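(* Let $\epsilon>0$ be a sufficiently small constant and run the Dynamic Agreement algorithm (described in the context) with parameter $\epsilon$ on a dynamic node stream with adversarial node insertions and uniformly random node deletions. Let $W_t$ be the number of operations (queries and elementary computations) performed by the algorithm at time $t$. Then for every time $t$, $\mathbb E[W_t]=O(\mathrm{polylog}\, n)$, i.e. the expected amortized update time is $O(\mathrm{polylog}\, n)$.
   Context: Setting. An undirected unsigned graph evolves over times $t=1,2,\dots$: at each time either an adversary inserts a new node (which reveals all its edges to the nodes currently present), or a node chosen uniformly at random among the currently present nodes is deleted together with all its edges. $G_t$ denotes the graph after the $t$-th update and $n$ the total number of nodes that ever appear. Access to the graph is only through degree queries, adjacency queries and uniformly-random-neighbor queries, each costing $O(\log n)$. $N(u)$ is the current neighborhood of $u$, $d(u)=|N(u)|$, $l_u=\lfloor\log d(u)\rfloor$. Tests. ProbabilisticAgreement$(u,v,\epsilon)$: with $k=300\log n/\epsilon$, draw independent uniformly random neighbors $r_1,\dots,r_k$ of $u$ and $s_1,\dots,s_k$ of $v$; output YES iff the fraction of $r_i\in N(u)\setminus N(v)$ and the fraction of $s_i\in N(v)\setminus N(u)$ are both $<0.4\epsilon$. Heavy$(u,\epsilon)$: draw $k'=1200\log n/\epsilon$ random neighbors $v_i$ of $u$, output YES iff the fraction of $i$ with ProbabilisticAgreement$(u,v_i,\epsilon)=$ NO is $<1.2\epsilon$. "In agreement"/"heavy" in the algorithm mean these tests return YES. Notify. Let $s=10^{10}\log n/\epsilon$. Each node $u$ stores sets $I^i_u,B^i_u$, $i=0,\dots,\log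 n$. Resample$(w)$: remove $w$ from $B^{l_w}_v$ for $v\in I^{l_w}_w$, replace $I^{l_w}_w$ by $s$ random neighbors of $w$, add $w$ to $B^{l_w}_v$ for $v$ in the new set. On arrival of $u$: $I^{l_u}_u\leftarrow s$ random neighbors, add $u$ to $B^{l_u}_v$ for those $v$, and send a Type$_0$ notification to each of them. On deletion of $u$: send a Type$_0$ notification to all $v\in\bigcup_iB^i_u$. Then for $i=0,1,2$ every node $w$ that received a Type$_i$ notification performs Resample$(w)$ and, if $i\le1$, sends a Type$_{i+1}$ notification to each node of its new $I^{l_w}_w$. $\mathcal I_t$ = nodes arriving at time $t$ or receiving a Type$_0$ or Type$_1$ notification at time $t$. Dynamic Agreement algorithm. Maintains an anchor set $\Phi$ and a subgraph $\tilde G$ of the current graph (deleted nodes are removed from both); $\Phi_u$ = nodes of $\Phi$ adjacent to $u$ in $\tilde G$. At time $t$, after Notify, for each $u\in\mathcal I_t$: Clean$(u)$: for each $w\in\Phi_u$, delete $(w,u)$ from $\tilde G$ if $w$ is not in agreement with $u$ or not heavy; if $w$ lost more than an $\epsilon$ fraction of its $\tilde G$-edges since entering $\Phi$, remove $w$ from $\Phi$ and delete its $\tilde G$-edges. Anchor$(u)$: sample $X_u\sim\mathrm{Bernoulli}(\min\{10^7\log n/(\epsilon d(u)),1\})$; if $u\in\Phi$, delete its $\tilde G$-edges to nodes outside $\Phi$; if $u$ is heavy and $X_u=1$, add $(u,v)$ to $\tilde G$ for every neighbor $v$ in agreement with $u$; at the end of the iteration put $u$ in $\Phi$ if $X_u=1$,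 and remove it from $\Phi$ if $X_u=0$. Connect$(u)$: sample $10^5\log n/\epsilon$ random neighbors $w$ of $u$; for each such $w$ and each $r\in\Phi_w$ that is heavy and in agreement with $u$, add $(r,u)$ to $\tilde G$.
   Formalization: Read literally, E[W_t] = O(polylog n) fails at single times when an anchor loses all its edges at once; proved instead: for every t the bound with each edge removal charged to that edge's addition, and a total expected work over times 1..t of at most t·polylog n. *)

theory Defs
  imports "HOL-Probability.Probability"
begin

section \<open>Dynamic node streams\<close>

text \<open>Edges are two-element sets of nodes.\<close>

type_synonym node = nat

record graph =
  verts :: "node set"
  edges :: "node set set"

definition nbrs :: "node set set \<Rightarrow> node \<Rightarrow> node set" where
  "nbrs E u = {v. {u, v} \<in> E}"

abbreviation N :: "graph \<Rightarrow> node \<Rightarrow> node set" where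
  "N G u \<equiv> nbrs (edges G) u"

abbreviation deg :: "graph \<Rightarrow> node \<Rightarrow> nat" where
  "deg G u \<equiv> card (N G u)"

definition empty_graph :: graph where
  "empty_graph = \<lparr>verts = {}, edges = {}\<rparr>"

definition insert_node :: "node \<Rightarrow> node set \<Rightarrow> graph \<Rightarrow> graph" where
  "insert_node u S G = \<lparr>verts = insert u (verts G), edges = edges G \<union> (\<lambda>v. {u, v}) ` S\<rparr>"

definition delete_node :: "node \<Rightarrow> graph \<Rightarrow> graph" where
  "delete_node u G = \<lparr>verts = verts G - {u}, edges = {e \<in> edges G. u \<notin> e}\<rparr>"

datatype request = Insert "node set" | Delete

text \<open>
  The adversary sees the sequence of graphs so far (latest first, so the list
  \<open>[G\<^sub>t, \<dots>, G\<^sub>0]\<close> has length \<open>t + 1\<close>), hence also which nodes were deleted, but not the random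
  choices of the algorithm. \<open>Insert S\<close> inserts a node whose neighbours are the nodes of \<open>S\<close>;
  \<open>Delete\<close> requests the deletion of a uniformly random node. The node that arrives at time \<open>t\<close>
  is called \<open>t\<close>. Nothing is lost by letting the adversary be deterministic: a bound that is
  uniform in it extends to randomized adversaries by averaging.
\<close>

type_synonym adversary = "graph list \<Rightarrow> request"

inductive history :: "adversary \<Rightarrow> graph list \<Rightarrow> bool" for adv :: adversary where
  start: "history adv [empty_graph]"
| ins: "history adv h \<Longrightarrow> adv h = Insert S \<Longrightarrow>
    history adv (insert_node (length h) S (hd h) # h)"
| del: "history adv h \<Longrightarrow> adv h = Delete \<Longrightarrow> u \<in> verts (hd h) \<Longrightarrow>
    history adv (delete_node u (hd h) # h)"

text \<open>A stream of \<open>T\<close> updates in which \<open>n\<close> nodes appear in total.\<close>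

definition node_stream :: "adversary \<Rightarrow> nat \<Rightarrow> nat \<Rightarrow> bool" where
  "node_stream adv n T \<longleftrightarrow>
    (\<forall>h. history adv h \<longrightarrow> length h \<le> T \<longrightarrow>
      (case adv h of Insert S \<Rightarrow> S \<subseteq> verts (hd h) | Delete \<Rightarrow> verts (hd h) \<noteq> {})) \<and>
    (\<forall>h. history adv h \<longrightarrow> length h = Suc T \<longrightarrow> card (\<Union>G\<in>set h. verts G) = n)"


section \<open>The Dynamic Agreement algorithm\<close>

primrec fold_pmf :: "('a \<Rightarrow> 's \<Rightarrow> 's pmf) \<Rightarrow> 'a list \<Rightarrow> 's \<Rightarrow> 's pmf" where
  "fold_pmf f [] s = return_pmf s"
| "fold_pmf f (x # xs) s = f x s \<bind> fold_pmf f xs"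

text \<open>
  \<open>sol_graph\<close> is (the edge set of) the maintained subgraph, and \<open>entry_nbrs w\<close> the set of
  \<open>sol_graph\<close>-neighbours of \<open>w\<close> when \<open>w\<close> last entered \<open>anchors\<close>.

  The work of the current update is split into the number \<open>adds\<close> of edge additions to
  \<open>sol_graph\<close>, the number \<open>dels\<close> of edge removals from it, and the cost \<open>ops\<close> of everything else.
\<close>

record state =
  cur_graph :: graph
  I_sets :: "node \<Rightarrow> nat \<Rightarrow> node set"
  B_sets :: "node \<Rightarrow> nat \<Rightarrow> node set"
  anchors :: "node set"
  sol_graph :: "node set set"
  entry_nbrs :: "node \<Rightarrow> node set"
  ops :: real
  adds :: nat
  dels :: nat

definition init_state :: state where
  "init_state = \<lparr>cur_graph = empty_graph, I_sets = (\<lambda>_ _. {}), B_sets = (\<lambda>_ _. {}),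
     anchors = {}, sol_graph = {}, entry_nbrs = (\<lambda>_. {}), ops = 0, adds = 0, dels = 0\<rparr>"

definition tick :: "real \<Rightarrow> state \<Rightarrow> state" where
  "tick c st = st\<lparr>ops := ops st + c\<rparr>"

definition add_edge :: "node \<Rightarrow> node \<Rightarrow> state \<Rightarrow> state" where
  "add_edge u v st = st\<lparr>sol_graph := insert {u, v} (sol_graph st), adds := adds st + 1\<rparr>"

definition remove_edges :: "node set set \<Rightarrow> state \<Rightarrow> state" where
  "remove_edges F st =
     st\<lparr>sol_graph := sol_graph st - F, dels := dels st + card (F \<inter> sol_graph st)\<rparr>"

definition anchor_nbrs :: "state \<Rightarrow> node \<Rightarrow> node set" where
  "anchor_nbrs st u = anchors st \<inter> nbrs (sol_graph st) u"

text \<open>An isolated node has level 0, as \<open>log 2 0 = 0\<close>.\<close>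

definition level :: "graph \<Rightarrow> node \<Rightarrow> nat" where
  "level G u = nat \<lfloor>log 2 (real (deg G u))\<rfloor>"

definition random_nbrs :: "graph \<Rightarrow> node \<Rightarrow> nat \<Rightarrow> node list pmf" where
  "random_nbrs G u k =
     (if N G u = {} then return_pmf [] else replicate_pmf k (pmf_of_set (N G u)))"

text \<open>
  \<open>n\<close> is the total number of nodes, \<open>qcost\<close> the cost of a query to the graph (elementary
  operations cost 1), and \<open>enum\<close> fixes the order in which loops over sets are executed.
\<close>

locale dynamic_agreement =
  fixes n :: nat and eps :: real and qcost :: real and enum :: "node set \<Rightarrow> node list"
begin

definition samples :: "real \<Rightarrow> nat" where
  "samples c = nat \<lceil>c * log 2 (real n) / eps\<rceil>"

definition top_level :: nat where
  "top_level = nat \<lfloor>log 2 (real n)\<rfloor>"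

subsection \<open>Tests\<close>

definition agreement :: "graph \<Rightarrow> node \<Rightarrow> node \<Rightarrow> bool pmf" where
  "agreement G u v = (let k = samples 300 in do {
     rs \<leftarrow> random_nbrs G u k;
     ss \<leftarrow> random_nbrs G v k;
     return_pmf
       (real (length (filter (\<lambda>r. r \<in> N G u - N G v) rs)) / real k < 0.4 * eps \<and>
        real (length (filter (\<lambda>r. r \<in> N G v - N G u) ss)) / real k < 0.4 * eps)
   })"

definition agreement_cost :: real where
  "agreement_cost = 2 * real (samples 300) * (2 * qcost + 1) + 1"

definition heavy :: "graph \<Rightarrow> node \<Rightarrow> bool pmf" where
  "heavy G u = (let k = samples 1200 in do {
     vs \<leftarrow> random_nbrs G u k;
     no \<leftarrow> fold_pmf (\<lambda>v c. map_pmf (\<lambda>yes. if yes then c else Suc c) (agreement G u v)) vs 0;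
     return_pmf (real no / real k < 1.2 * eps)
   })"

definition heavy_cost :: real where
  "heavy_cost = real (samples 1200) * (qcost + agreement_cost + 1) + 1"

subsection \<open>Notify\<close>

definition resample :: "node \<Rightarrow> state \<Rightarrow> state pmf" where
  "resample w st =
     (let l = level (cur_graph st) w; old = I_sets st w l; s = samples (10^10) in do {
       rs \<leftarrow> random_nbrs (cur_graph st) w s;
       let new = set rs;
       let B1 = (\<lambda>v i. if i = l \<and> v \<in> old then B_sets st v i - {w} else B_sets st v i);
       let B2 = (\<lambda>v i. if i = l \<and> v \<in> new then insert w (B1 v i) else B1 v i);
       return_pmf (tick (qcost * (1 + real s) + real (card old) + real (card new) + 1)
         (st\<lparr>I_sets := (I_sets st)(w := (I_sets st w)(l := new)), B_sets := B2\<rparr>))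
     })"

definition targets :: "state \<Rightarrow> node \<Rightarrow> node set" where
  "targets st w = I_sets st w (level (cur_graph st) w)"

text \<open>
  \<open>notify R0\<close> runs the three rounds of notifications when \<open>R0\<close> are the nodes with a
  \<open>Type\<^sub>0\<close> notification; it also returns the nodes that receive a \<open>Type\<^sub>0\<close> or \<open>Type\<^sub>1\<close> notification.
\<close>

definition notify :: "node set \<Rightarrow> state \<Rightarrow> (node set \<times> state) pmf" where
  "notify R0 st = do {
     st1 \<leftarrow> fold_pmf resample (enum R0) st;
     let R1 = (\<Union>w\<in>R0. targets st1 w);
     st2 \<leftarrow> fold_pmf resample (enum R1) (tick (\<Sum>w\<in>R0. real (card (targets st1 w))) st1);
     let R2 = (\<Union>w\<in>R1. targets st2 w);
     st3 \<leftarrow> fold_pmf resample (enum R2) (tick (\<Sum>w\<in>R1. real (card (targets st2 w))) st2);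
     return_pmf (R0 \<union> R1, st3)
   }"

text \<open>\<open>arrive\<close> and \<open>depart\<close> also return the set of nodes to be processed.\<close>

definition arrive :: "node \<Rightarrow> node set \<Rightarrow> state \<Rightarrow> (node set \<times> state) pmf" where
  "arrive u S st = do {
     st1 \<leftarrow> resample u (st\<lparr>cur_graph := insert_node u S (cur_graph st)\<rparr>);
     let R0 = targets st1 u;
     (R, st2) \<leftarrow> notify R0 (tick (real (card R0) + 1) st1);
     return_pmf (insert u R, st2)
   }"

text \<open>
  A deleted node also disappears from the sets \<open>B\<^sub>v\<^sup>i\<close>, so that only present nodes are notified.
\<close>

definition depart :: "node \<Rightarrow> state \<Rightarrow> (node set \<times> state) pmf" where
  "depart u st =
     (let R0 = (\<Union>i\<le>top_level. B_sets st u i) - {u};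
          c = (\<Sum>i\<le>top_level. real (card (B_sets st u i)) + real (card (I_sets st u i)) + 1);
          st1 = remove_edges {e. u \<in> e} (st\<lparr>
            cur_graph := delete_node u (cur_graph st),
            I_sets := (I_sets st)(u := (\<lambda>_. {})),
            B_sets := (\<lambda>v i. if v = u then {} else B_sets st v i - {u}),
            anchors := anchors st - {u}\<rparr>)
      in notify R0 (tick c st1))"

subsection \<open>Clean, Anchor and Connect\<close>

definition lost_many :: "state \<Rightarrow> node \<Rightarrow> bool" where
  "lost_many st w \<longleftrightarrow>
     real (card (entry_nbrs st w - nbrs (sol_graph st) w)) > eps * real (card (entry_nbrs st w))"

definition clean :: "node \<Rightarrow> state \<Rightarrow> state pmf" where
  "clean u st = fold_pmf (\<lambda>w st. do {
       a \<leftarrow> agreement (cur_graph st) w u;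
       hv \<leftarrow> heavy (cur_graph st) w;
       let st1 = tick (agreement_cost + heavy_cost + 1) st;
       let st2 = (if a \<and> hv then st1 else remove_edges {{w, u}} st1);
       return_pmf
         (if lost_many st2 w
          then remove_edges {e. w \<in> e} (st2\<lparr>anchors := anchors st2 - {w}\<rparr>)
          else st2)
     }) (enum (anchor_nbrs st u)) st"

text \<open>The probability is 1 for an isolated node (where HOL has \<open>x / 0 = 0\<close>).\<close>

definition anchor_prob :: "graph \<Rightarrow> node \<Rightarrow> real" where
  "anchor_prob G u =
     (if deg G u = 0 then 1 else min (10^7 * log 2 (real n) / (eps * real (deg G u))) 1)"

text \<open>
  There is no query that lists the neighbours of \<open>u\<close>, so they are collected with random-neighbour
  queries: as long as \<open>j\<close> of the \<open>d\<close> neighbours are missing, a query returns a new one with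
  probability \<open>j / d\<close>. (\<open>geometric_pmf\<close> counts the failures before the first success.)
\<close>

definition listing_cost :: "nat \<Rightarrow> real pmf" where
  "listing_cost d =
     fold_pmf (\<lambda>j c. map_pmf (\<lambda>g. c + (real g + 1) * qcost) (geometric_pmf (real j / real d)))
       [1..<Suc d] 0"

definition anchor :: "node \<Rightarrow> state \<Rightarrow> (bool \<times> state) pmf" where
  "anchor u st = (let G = cur_graph st in do {
     X \<leftarrow> bernoulli_pmf (anchor_prob G u);
     let st1 = (if u \<in> anchors st
       then remove_edges {{u, v} |v. v \<notin> anchors st} (tick (real (card (anchor_nbrs st u))) st)
       else st);
     hv \<leftarrow> heavy G u;
     let st2 = tick (qcost + heavy_cost + 1) st1;
     if hv \<and> X then do {
       c \<leftarrow> listing_cost (deg G u);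
       st3 \<leftarrow> fold_pmf (\<lambda>v st. map_pmf (\<lambda>a. (if a then add_edge u v else id)
                 (tick (agreement_cost + 1) st)) (agreement G u v))
               (enum (N G u)) (tick c st2);
       return_pmf (X, st3)
     } else return_pmf (X, st2)
   })"

text \<open>
  Only edges of the current graph are added, so that \<open>sol_graph\<close> is a subgraph of it; in
  particular \<open>r = u\<close> never leads to a loop.
\<close>

definition connect :: "node \<Rightarrow> state \<Rightarrow> state pmf" where
  "connect u st = (let G = cur_graph st; k = samples (10^5) in do {
     ws \<leftarrow> random_nbrs G u k;
     fold_pmf (\<lambda>w st. fold_pmf (\<lambda>r st. do {
         hv \<leftarrow> heavy G r;
         a \<leftarrow> agreement G r u;
         let st1 = tick (heavy_cost + agreement_cost + qcost + 1) st;
         return_pmf (if hv \<and> a \<and> r \<in> N G u then add_edge r u st1 else st1)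
       }) (enum (anchor_nbrs st w)) (tick 1 st)) ws (tick (real k * qcost + 1) st)
   })"

definition process :: "node \<Rightarrow> state \<Rightarrow> state pmf" where
  "process u st = do {
     st1 \<leftarrow> clean u (tick 1 st);
     (X, st2) \<leftarrow> anchor u st1;
     st3 \<leftarrow> connect u st2;
     return_pmf
       (if X then
          let E = nbrs (sol_graph st3) u in
          tick (real (card E) + 1)
            (st3\<lparr>anchors := insert u (anchors st3), entry_nbrs := (entry_nbrs st3)(u := E)\<rparr>)
        else tick 1 (st3\<lparr>anchors := anchors st3 - {u}\<rparr>))
   }"

subsection \<open>The run of the algorithm on a stream\<close>

definition step :: "adversary \<Rightarrow> graph list \<Rightarrow> state \<Rightarrow> state pmf" where
  "step adv h st = (let st0 = st\<lparr>ops := 0, adds := 0, dels := 0\<rparr> in do {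
     (R, st1) \<leftarrow> (case adv h of
         Insert S \<Rightarrow> arrive (length h) S st0
       | Delete \<Rightarrow> pmf_of_set (verts (cur_graph st0)) \<bind> (\<lambda>u. depart u st0));
     fold_pmf process (enum R) st1
   })"

primrec run :: "adversary \<Rightarrow> nat \<Rightarrow> (graph list \<times> state) pmf" where
  "run adv 0 = return_pmf ([empty_graph], init_state)"
| "run adv (Suc t) = do {
     (h, st) \<leftarrow> run adv t;
     st' \<leftarrow> step adv h st;
     return_pmf (cur_graph st' # h, st')
   }"

text \<open>
  Expectations are taken as Lebesgue integrals with values in \<open>[0, \<infinity>]\<close>, so no integrability has to
  be assumed. \<open>expected_work adv t\<close> is the expected number of operations executed at time \<open>t\<close>.
  In \<open>expected_amortized_work adv t\<close> the removal of an edge from \<open>sol_graph\<close> is charged to the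
  time at which the edge was added (so an addition costs 2, and a removal nothing); up to any
  time, the total amortized work is at least the total work.
\<close>

definition expected_work :: "adversary \<Rightarrow> nat \<Rightarrow> ennreal" where
  "expected_work adv t =
     (\<integral>\<^sup>+ (h, st). ennreal (ops st + real (adds st) + real (dels st)) \<partial>measure_pmf (run adv t))"

definition expected_amortized_work :: "adversary \<Rightarrow> nat \<Rightarrow> ennreal" where
  "expected_amortized_work adv t =
     (\<integral>\<^sup>+ (h, st). ennreal (ops st + 2 * real (adds st)) \<partial>measure_pmf (run adv t))"

end

definition enumerates :: "(node set \<Rightarrow> node list) \<Rightarrow> bool" where
  "enumerates enum \<longleftrightarrow> (\<forall>A. finite A \<longrightarrow> set (enum A) = A \<and> distinct (enum A))"

end

theory Submission
  imports Defs
begin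

text \<open>
  The updates are independent of the random choices of the algorithm, and the notifications are
  independent of the tests and of the anchor sampling. So fix the updates first. A deletion triggers
  few notifications on average, since a uniformly random node is contained in few samples. Given the
  updates and the notifications, the algorithm processes a fixed sequence of nodes, and \<open>w\<close> is an
  anchor with probability about \<open>log n / d\<close>, where \<open>d\<close> is the degree of \<open>w\<close> when it was last processed.

  An edge \<open>uw\<close> of the maintained subgraph was tested when \<open>u\<close> or \<open>w\<close> was last processed. At that time
  their degrees were about equal and most neighbours of \<open>w\<close> had degree at most about that of \<open>w\<close>. If
  the degree of \<open>w\<close> had grown by a large factor since \<open>w\<close> was last processed, then many neighbours of
  \<open>w\<close> would have arrived with a small degree, or have lost most of their neighbours since their
  arrival. Each of them would have notified a small random set of neighbours, and with high
  probability one of these sets would have contained \<open>w\<close>. Hence the degree of \<open>w\<close> has not grown much,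
  and the expected number of anchors adjacent to \<open>u\<close> in the subgraph is polylogarithmic. The work for a
  processed node is, up to polylogarithmic factors, the number of anchors adjacent to the node and to
  random neighbours of it.
\<close>

section \<open>Probability mass functions\<close>

text \<open>Two dependencies shape the proof. Which nodes send notifications depends on earlier
  samples, so the chances to hit a growing node \<open>w\<close> are not a fixed number of
  independent trials. An exponential potential in the number of neighbours that missed
  \<open>w\<close>, multiplied by the indicator that \<open>w\<close> is still unnotified, replaces
  the product bound. Secondly, whether a loss of neighbours is felt depends on samples drawn long
  before. A sample is therefore compared with the neighbourhood in one later graph, which is a
  constant because the updates are fixed before any sample is drawn. The uniform choice of a deleted
  node is used for the last update only, against samples that are already fixed.

  Every rare event is bounded by a polynomial over \<open>n ^ 20\<close>. The exponent has to beat
  the union bounds and the polynomial worst-case work with which failures are charged. The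
  thresholds of the analysis are absolute constants such as 1/8 instead of multiples of \<epsilon>,
  since degrees are compared up to constant factors; what is used of the tests is that they rarely
  accept a clearly bad pair.\<close>

lemma nn_integral_pmf_mono:
  assumes "\<And>x. x \<in> set_pmf p \<Longrightarrow> f x \<le> g x"
  shows "(\<integral>\<^sup>+x. f x \<partial>measure_pmf p) \<le> (\<integral>\<^sup>+x. g x \<partial>measure_pmf p)"
  by (rule nn_integral_mono_AE) (simp add: AE_measure_pmf_iff assms)

lemma nn_integral_pmf_cong:
  assumes "\<And>x. x \<in> set_pmf p \<Longrightarrow> f x = g x"
  shows "(\<integral>\<^sup>+x. f x \<partial>measure_pmf p) = (\<integral>\<^sup>+x. g x \<partial>measure_pmf p)"
  by (rule nn_integral_cong_AE) (simp add: AE_measure_pmf_iff assms)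

lemma nn_integral_pmf_const [simp]: "(\<integral>\<^sup>+x. (c::ennreal) \<partial>measure_pmf p) = c"
  by simp

lemma nn_integral_pmf_le_const:
  assumes "\<And>x. x \<in> set_pmf p \<Longrightarrow> f x \<le> c"
  shows "(\<integral>\<^sup>+x. f x \<partial>measure_pmf p) \<le> c"
  using nn_integral_pmf_mono[OF assms, of p] by simp

lemma nn_integral_pmf_add:
  fixes f g :: "'a \<Rightarrow> ennreal"
  shows "(\<integral>\<^sup>+x. f x + g x \<partial>measure_pmf p) = (\<integral>\<^sup>+x. f x \<partial>measure_pmf p) + (\<integral>\<^sup>+x. g x \<partial>measure_pmf p)"
  by (rule nn_integral_add) auto

lemma nn_integral_pmf_cmult:
  fixes f :: "'a \<Rightarrow> ennreal"
  shows "(\<integral>\<^sup>+x. c * f x \<partial>measure_pmf p) = c * (\<integral>\<^sup>+x. f x \<partial>measure_pmf p)"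
  by (rule nn_integral_cmult) auto

lemma nn_integral_pmf_sum:
  fixes f :: "'i \<Rightarrow> 'a \<Rightarrow> ennreal"
  shows "(\<integral>\<^sup>+x. (\<Sum>i\<in>I. f i x) \<partial>measure_pmf p) = (\<Sum>i\<in>I. \<integral>\<^sup>+x. f i x \<partial>measure_pmf p)"
  by (rule nn_integral_sum) auto

text \<open>An extended nonnegative integral of an indicator, so that failure probabilities combine
  directly with expected costs, without integrability conditions.\<close>

definition fail_prob :: "'a pmf \<Rightarrow> ('a \<Rightarrow> bool) \<Rightarrow> ennreal" where
  "fail_prob p P = (\<integral>\<^sup>+x. of_bool (\<not> P x) \<partial>measure_pmf p)"

lemma fail_prob_le_1: "fail_prob p P \<le> 1"
  unfolding fail_prob_def by (rule nn_integral_pmf_le_const) simp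

lemma fail_prob_eq_0: "(\<And>x. x \<in> set_pmf p \<Longrightarrow> P x) \<Longrightarrow> fail_prob p P = 0"
  unfolding fail_prob_def by (subst nn_integral_pmf_cong[where g = "\<lambda>_. 0"]) auto

lemma fail_prob_return [simp]: "fail_prob (return_pmf x) P = of_bool (\<not> P x)"
  by (simp add: fail_prob_def)

lemma fail_prob_map [simp]: "fail_prob (map_pmf f p) P = fail_prob p (\<lambda>x. P (f x))"
  by (simp add: fail_prob_def)

lemma fail_prob_mono:
  "(\<And>x. x \<in> set_pmf p \<Longrightarrow> Q x \<Longrightarrow> P x) \<Longrightarrow> fail_prob p P \<le> fail_prob p Q"
  unfolding fail_prob_def by (rule nn_integral_pmf_mono) auto

text \<open>Union bound for a two-stage experiment: either the first stage misses \<open>P\<close>,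
  or it succeeds and the second stage misses \<open>Q\<close>.\<close>

lemma fail_prob_bind:
  assumes "fail_prob p P \<le> d1" "\<And>x. x \<in> set_pmf p \<Longrightarrow> P x \<Longrightarrow> fail_prob (f x) Q \<le> d2"
  shows "fail_prob (p \<bind> f) Q \<le> d1 + d2"
proof -
  have "fail_prob (p \<bind> f) Q = (\<integral>\<^sup>+x. fail_prob (f x) Q \<partial>measure_pmf p)"
    by (simp add: fail_prob_def)
  also have "\<dots> \<le> (\<integral>\<^sup>+x. of_bool (\<not> P x) + d2 \<partial>measure_pmf p)"
  proof (rule nn_integral_pmf_mono)
    fix x assume "x \<in> set_pmf p"
    then show "fail_prob (f x) Q \<le> of_bool (\<not> P x) + d2"
      using assms(2)[of x] fail_prob_le_1[of "f x" Q]
      by (cases "P x") (auto intro: order_trans)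
  qed
  also have "\<dots> = fail_prob p P + d2"
    by (simp add: nn_integral_pmf_add fail_prob_def)
  finally show ?thesis using assms(1) by (meson add_right_mono order_trans)
qed

lemma fail_prob_bind_sure:
  assumes "\<And>x. x \<in> set_pmf p \<Longrightarrow> fail_prob (f x) Q \<le> d"
  shows "fail_prob (p \<bind> f) Q \<le> d"
  using fail_prob_bind[of p "\<lambda>_. True" 0 f Q d] assms by (simp add: fail_prob_eq_0)

lemma fail_prob_conj: "fail_prob p (\<lambda>x. P x \<and> Q x) \<le> fail_prob p P + fail_prob p Q"
  unfolding fail_prob_def nn_integral_pmf_add[symmetric]
  by (rule nn_integral_pmf_mono) auto

lemma fail_prob_ball:
  assumes "finite I" "\<And>i. i \<in> I \<Longrightarrow> fail_prob p (P i) \<le> d"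
  shows "fail_prob p (\<lambda>x. \<forall>i\<in>I. P i x) \<le> of_nat (card I) * d"
  using assms
proof (induction I rule: finite_induct)
  case empty then show ?case by (simp add: fail_prob_eq_0)
next
  case (insert i I)
  have "fail_prob p (\<lambda>x. \<forall>j\<in>insert i I. P j x) \<le> fail_prob p (P i) + fail_prob p (\<lambda>x. \<forall>j\<in>I. P j x)"
    using fail_prob_conj[of p "P i" "\<lambda>x. \<forall>j\<in>I. P j x"] by simp
  also have "\<dots> \<le> d + of_nat (card I) * d" using insert by (intro add_mono) auto
  finally show ?case using insert by (simp add: distrib_right)
qed

section \<open>Random loops: invariants and simulation\<close>

lemma fold_pmf_Nil: "fold_pmf f [] = return_pmf"
  by (rule ext) simp

lemma fold_pmf_single [simp]: "fold_pmf f [x] = f x"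
  by (rule ext) (simp add: fold_pmf_Nil bind_return_pmf')

lemma fold_pmf_append: "fold_pmf f (xs @ ys) s = fold_pmf f xs s \<bind> fold_pmf f ys"
proof (induction xs arbitrary: s)
  case (Cons x xs)
  then have "fold_pmf f (xs @ ys) = (\<lambda>s. fold_pmf f xs s \<bind> fold_pmf f ys)" by blast
  then show ?case by (simp add: bind_assoc_pmf)
qed (simp add: bind_return_pmf)

lemma fold_pmf_invariant:
  assumes "s' \<in> set_pmf (fold_pmf f xs s)" "P s"
    and "\<And>x s s'. x \<in> set xs \<Longrightarrow> P s \<Longrightarrow> s' \<in> set_pmf (f x s) \<Longrightarrow> P s'"
  shows "P s'"
  using assms
proof (induction xs arbitrary: s)
  case (Cons x xs)
  from Cons.prems(1) obtain s1 where s1: "s1 \<in> set_pmf (f x s)" "s' \<in> set_pmf (fold_pmf f xs s1)"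
    by auto
  have "P s1" using Cons.prems(3)[OF _ Cons.prems(2) s1(1)] by simp
  then show ?case
    by (rule Cons.IH[OF s1(2)]) (rule Cons.prems(3), simp_all)
qed simp

lemma fail_prob_fold:
  assumes "P s" "\<And>x s. x \<in> set xs \<Longrightarrow> P s \<Longrightarrow> fail_prob (f x s) P \<le> d"
  shows "fail_prob (fold_pmf f xs s) P \<le> of_nat (length xs) * d"
  using assms
proof (induction xs arbitrary: s)
  case Nil then show ?case by simp
next
  case (Cons x xs)
  have "fail_prob (f x s \<bind> fold_pmf f xs) P \<le> d + of_nat (length xs) * d"
    using Cons by (intro fail_prob_bind[where P = P]) auto
  then show ?case by (simp add: distrib_right)
qed

text \<open>A simulation rule: if \<open>g\<close> commutes with every step from states that satisfy
  an invariant \<open>P\<close> of the simulated run, it commutes with the loop. The absence of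
  interference between notifications and processing is reduced to this.\<close>

lemma fold_pmf_map_pmf:
  assumes "P s" "\<And>x s. P s \<Longrightarrow> x \<in> set xs \<Longrightarrow> f x (g s) = map_pmf g (f' x s)"
    "\<And>x s s'. P s \<Longrightarrow> x \<in> set xs \<Longrightarrow> s' \<in> set_pmf (f' x s) \<Longrightarrow> P s'"
  shows "fold_pmf f xs (g s) = map_pmf g (fold_pmf f' xs s)"
  using assms
proof (induction xs arbitrary: s)
  case (Cons x xs)
  have "fold_pmf f (x # xs) (g s) = f' x s \<bind> (\<lambda>s'. fold_pmf f xs (g s'))"
    using Cons.prems by (simp add: bind_map_pmf)
  also have "\<dots> = f' x s \<bind> (\<lambda>s'. map_pmf g (fold_pmf f' xs s'))"
  proof (intro bind_pmf_cong[OF refl] Cons.IH)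
    fix s' assume "s' \<in> set_pmf (f' x s)"
    then show "P s'" using Cons.prems(3)[OF Cons.prems(1), of x s'] by simp
  next
    fix x' s assume "P s" "x' \<in> set xs"
    then show "f x' (g s) = map_pmf g (f' x' s)" using Cons.prems(2)[of s x'] by simp
  next
    fix x' s s' assume "P s" "x' \<in> set xs" "s' \<in> set_pmf (f' x' s)"
    then show "P s'" using Cons.prems(3)[of s x' s'] by simp
  qed
  finally show ?case by (simp add: map_bind_pmf)
qed simp

lemma fold_pmf_map_pmf':
  assumes "\<And>x s. f x (g s) = map_pmf g (f' x s)"
  shows "fold_pmf f xs (g s) = map_pmf g (fold_pmf f' xs s)"
  by (rule fold_pmf_map_pmf[where P = "\<lambda>_. True"]) (simp_all add: assms)

section \<open>Update sequences\<close>

text \<open>Sequences of updates and of events have the latest one first. The node that arrives with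
  the \<open>k\<close>-th update is \<open>k\<close>.\<close>

datatype update = Ins "node set" | Del node

fun apply_update :: "nat \<Rightarrow> update \<Rightarrow> graph \<Rightarrow> graph" where
  "apply_update k (Ins S) G = insert_node k S G"
| "apply_update k (Del u) G = delete_node u G"

primrec graph_of :: "update list \<Rightarrow> graph" where
  "graph_of [] = empty_graph"
| "graph_of (x # us) = apply_update (Suc (length us)) x (graph_of us)"

primrec graphs_of :: "update list \<Rightarrow> graph list" where
  "graphs_of [] = [empty_graph]"
| "graphs_of (x # us) = graph_of (x # us) # graphs_of us"

fun valid :: "update list \<Rightarrow> bool" where
  "valid [] = True"
| "valid (Ins S # us) \<longleftrightarrow> valid us \<and> S \<subseteq> verts (graph_of us)"
| "valid (Del u # us) \<longleftrightarrow> valid us \<and> u \<in> verts (graph_of us)"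

lemma valid_tl: "valid (x # us) \<Longrightarrow> valid us"
  by (cases x) auto

lemma valid_appendD: "valid (us' @ us) \<Longrightarrow> valid us"
  by (induction us') (auto dest: valid_tl)

lemma length_graphs_of [simp]: "length (graphs_of us) = Suc (length us)"
  by (induction us) auto

lemma hd_graphs_of [simp]: "hd (graphs_of us) = graph_of us"
  by (cases us) auto

lemma graph_props:
  assumes "valid us"
  shows "finite (verts (graph_of us)) \<and> verts (graph_of us) \<subseteq> {1..length us} \<and>
    (\<forall>e\<in>edges (graph_of us). \<exists>a b. a \<noteq> b \<and> e = {a, b} \<and> a \<in> verts (graph_of us) \<and> b \<in> verts (graph_of us))"
    (is "?F us \<and> ?V us \<and> ?E us")
  using assms
proof (induction us)
  case Nil
  then show ?case by (simp add: empty_graph_def)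
next
  case (Cons x us)
  have F: "?F us" and V: "?V us" and E: "?E us" using Cons.IH[OF valid_tl[OF Cons.prems]] by blast+
  show ?case
  proof (cases x)
    case (Ins S)
    then have S: "S \<subseteq> verts (graph_of us)" using Cons.prems by simp
    have k: "Suc (length us) \<notin> verts (graph_of us)" using V by auto
    have "?E (x # us)"
    proof
      fix e assume "e \<in> edges (graph_of (x # us))"
      then consider "e \<in> edges (graph_of us)" | v where "v \<in> S" "e = {Suc (length us), v}"
        by (auto simp: Ins insert_node_def)
      then show "\<exists>a b. a \<noteq> b \<and> e = {a, b} \<and> a \<in> verts (graph_of (x # us)) \<and> b \<in> verts (graph_of (x # us))"
      proof cases
        case 1
        then obtain a b where "a \<noteq> b" "e = {a, b}" "a \<in> verts (graph_of us)" "b \<in> verts (graph_of us)"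
          using E by blast
        then show ?thesis by (intro exI[of _ a] exI[of _ b]) (simp add: Ins insert_node_def)
      next
        case 2
        then show ?thesis using S k
          by (intro exI[of _ "Suc (length us)"] exI[of _ v]) (auto simp: Ins insert_node_def)
      qed
    qed
    moreover have "?F (x # us)" "?V (x # us)" using F V by (auto simp: Ins insert_node_def)
    ultimately show ?thesis by blast
  next
    case (Del u)
    have "?E (x # us)"
    proof
      fix e assume e: "e \<in> edges (graph_of (x # us))"
      then have "e \<in> edges (graph_of us)" "u \<notin> e" by (auto simp: Del delete_node_def)
      then obtain a b where "a \<noteq> b" "e = {a, b}" "a \<in> verts (graph_of us)" "b \<in> verts (graph_of us)" "u \<noteq> a" "u \<noteq> b"
        using E by blast
      then show "\<exists>a b. a \<noteq> b \<and> e = {a, b} \<and> a \<in> verts (graph_of (x # us)) \<and> b \<in> verts (graph_of (x # us))"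
        by (intro exI[of _ a] exI[of _ b]) (auto simp: Del delete_node_def)
    qed
    moreover have "?F (x # us)" "?V (x # us)" using F V by (auto simp: Del delete_node_def)
    ultimately show ?thesis by blast
  qed
qed

lemma finite_verts [simp]: "valid us \<Longrightarrow> finite (verts (graph_of us))"
  using graph_props[of us] by blast

lemma verts_le: "valid us \<Longrightarrow> v \<in> verts (graph_of us) \<Longrightarrow> v \<le> length us"
  using graph_props[of us] by auto

lemma edgeE:
  assumes "valid us" "e \<in> edges (graph_of us)"
  obtains a b where "a \<noteq> b" "e = {a, b}" "a \<in> verts (graph_of us)" "b \<in> verts (graph_of us)"
  using graph_props[OF assms(1)] assms(2) that by blast

lemma N_sym: "v \<in> N G u \<longleftrightarrow> u \<in> N G v"
  by (simp add: nbrs_def insert_commute)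

lemma N_verts:
  assumes "valid us" "v \<in> N (graph_of us) u"
  shows "v \<in> verts (graph_of us)" "u \<in> verts (graph_of us)" "u \<noteq> v"
  using assms edgeE[of us "{u, v}"] by (auto simp: nbrs_def doubleton_eq_iff)

lemma N_subset_verts: "valid us \<Longrightarrow> N (graph_of us) u \<subseteq> verts (graph_of us)"
  using N_verts by blast

lemma finite_N [simp]: "valid us \<Longrightarrow> finite (N (graph_of us) u)"
  by (rule finite_subset[OF N_subset_verts]) auto

lemma deg_le_verts: "valid us \<Longrightarrow> deg (graph_of us) u \<le> card (verts (graph_of us))"
  by (intro card_mono N_subset_verts) auto

lemma N_delete: "N (delete_node y G) u = (if u = y then {} else N G u - {y})"
  by (auto simp: nbrs_def delete_node_def)

lemma N_insert: "N (insert_node k S G) u = N G u \<union> (if u = k then S else {}) \<union> (if u \<in> S then {k} else {})"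
  by (auto simp: nbrs_def insert_node_def doubleton_eq_iff image_iff)

section \<open>Separating updates, notifications and processing\<close>

lemma state_eqI:
  fixes a b :: state
  assumes "cur_graph a = cur_graph b" "I_sets a = I_sets b" "B_sets a = B_sets b"
    "anchors a = anchors b" "sol_graph a = sol_graph b" "entry_nbrs a = entry_nbrs b"
    "ops a = ops b" "adds a = adds b" "dels a = dels b"
  shows "a = b"
  using assms by (cases a, cases b) simp

text \<open>Notifications and the processing of nodes touch disjoint parts of the state, except for the
  current graph, on which \<open>a\<close> and \<open>b\<close> will agree, and for \<open>ops\<close>, which is additive.\<close>

definition merge :: "state \<Rightarrow> state \<Rightarrow> state" where
  "merge a b = b\<lparr>I_sets := I_sets a, B_sets := B_sets a, ops := ops a + ops b\<rparr>"

lemma merge_simps [simp]: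
  "cur_graph (merge a b) = cur_graph b" "I_sets (merge a b) = I_sets a"
  "B_sets (merge a b) = B_sets a" "anchors (merge a b) = anchors b"
  "sol_graph (merge a b) = sol_graph b" "entry_nbrs (merge a b) = entry_nbrs b"
  "ops (merge a b) = ops a + ops b" "adds (merge a b) = adds b" "dels (merge a b) = dels b"
  by (simp_all add: merge_def)

lemma merge_tick [simp]: "tick c (merge a b) = merge a (tick c b)"
  by (simp add: merge_def tick_def)

lemma merge_tick_left: "tick c (merge a b) = merge (tick c a) b"
  by (simp add: merge_def tick_def)

lemma merge_remove_edges [simp]: "remove_edges F (merge a b) = merge a (remove_edges F b)"
  by (simp add: merge_def remove_edges_def)

lemma merge_add_edge [simp]: "add_edge u v (merge a b) = merge a (add_edge u v b)"
  by (simp add: merge_def add_edge_def)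

lemma merge_anchor_nbrs [simp]: "anchor_nbrs (merge a b) u = anchor_nbrs b u"
  by (simp add: anchor_nbrs_def)

lemma merge_lost_many [simp]:
  "dynamic_agreement.lost_many eps (merge a b) u = dynamic_agreement.lost_many eps b u"
  by (simp add: dynamic_agreement.lost_many_def)

lemma merge_anchors_update [simp]: "(merge a b)\<lparr>anchors := A\<rparr> = merge a (b\<lparr>anchors := A\<rparr>)"
  by (simp add: merge_def)

lemma merge_entry_update [simp]: "(merge a b)\<lparr>entry_nbrs := E\<rparr> = merge a (b\<lparr>entry_nbrs := E\<rparr>)"
  by (simp add: merge_def)

definition reset_work :: "state \<Rightarrow> state" where
  "reset_work st = st\<lparr>ops := 0, adds := 0, dels := 0\<rparr>"

text \<open>The effect of an update on the fields that processing reads. \<open>I_sets\<close> and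
  \<open>B_sets\<close> are left as they are, because \<open>merge\<close> takes them from the
  notification state.\<close>

fun start_update :: "nat \<Rightarrow> update \<Rightarrow> state \<Rightarrow> state" where
  "start_update k (Ins S) b = (reset_work b)\<lparr>cur_graph := insert_node k S (cur_graph b)\<rparr>"
| "start_update k (Del u) b = remove_edges {e. u \<in> e} ((reset_work b)\<lparr>
      cur_graph := delete_node u (cur_graph b), anchors := anchors b - {u}\<rparr>)"

lemma cur_graph_simps [simp]:
  "cur_graph (tick c st) = cur_graph st" "cur_graph (add_edge u v st) = cur_graph st"
  "cur_graph (remove_edges F st) = cur_graph st"
  by (simp_all add: tick_def add_edge_def remove_edges_def)

lemma cur_graph_start_update [simp]:
  "cur_graph (start_update k x b) = apply_update k x (cur_graph b)"
  by (cases x) (auto simp: reset_work_def)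

text \<open>One flat sequence of updates and processed nodes lets inductions advance by a single
  processed node. \<open>Upd\<close> carries the name of an arriving node, which is not its position
  in this list.\<close>

datatype event = Upd nat update | Proc node

primrec graph_at :: "event list \<Rightarrow> graph" where
  "graph_at [] = empty_graph"
| "graph_at (e # es) = (case e of Upd k x \<Rightarrow> apply_update k x (graph_at es) | Proc u \<Rightarrow> graph_at es)"

text \<open>Nodes are processed in list order after their update, and the latest event comes first,
  hence the reversal.\<close>

fun events :: "update list \<Rightarrow> node list list \<Rightarrow> event list" where
  "events (x # us) (R # Rs) = rev (map Proc R) @ Upd (Suc (length us)) x # events us Rs"
| "events _ _ = []"

lemma graph_at_Procs [simp]: "graph_at (map Proc R @ es) = graph_at es"
  by (induction R) auto

lemma graph_at_events: "length us = length Rs \<Longrightarrow> graph_at (events us Rs) = graph_of us"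
  by (induction us Rs rule: list_induct2) (auto simp: rev_map)

definition choose_update :: "adversary \<Rightarrow> graph list \<Rightarrow> update pmf" where
  "choose_update adv h = (case adv h of Insert S \<Rightarrow> return_pmf (Ins S)
     | Delete \<Rightarrow> map_pmf Del (pmf_of_set (verts (hd h))))"

text \<open>The adversary sees only graphs, so the updates form a random process of their own and
  can be drawn before any choice of the algorithm.\<close>

primrec updates :: "adversary \<Rightarrow> nat \<Rightarrow> update list pmf" where
  "updates adv 0 = return_pmf []"
| "updates adv (Suc t) = updates adv t \<bind> (\<lambda>us. map_pmf (\<lambda>x. x # us) (choose_update adv (graphs_of us)))"

lemma length_updates: "us \<in> set_pmf (updates adv t) \<Longrightarrow> length us = t"
  by (induction t arbitrary: us) auto

context dynamic_agreement
begin

definition start_notify :: "nat \<Rightarrow> update \<Rightarrow> state \<Rightarrow> (node set \<times> state) pmf" where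
  "start_notify k x st = (case x of Ins S \<Rightarrow> arrive k S (reset_work st) | Del u \<Rightarrow> depart u (reset_work st))"

primrec fixed_run :: "update list \<Rightarrow> state pmf" where
  "fixed_run [] = return_pmf init_state"
| "fixed_run (x # us) = fixed_run us \<bind> (\<lambda>st. start_notify (Suc (length us)) x st \<bind>
     (\<lambda>(R, st1). fold_pmf process (enum R) st1))"

text \<open>The notification half alone. It records the nodes to be processed, in the order of
  \<open>enum\<close>, so that the processing half can be run afterwards on a known
  sequence.\<close>

primrec notify_run :: "update list \<Rightarrow> (node list list \<times> state) pmf" where
  "notify_run [] = return_pmf ([], init_state)"
| "notify_run (x # us) = notify_run us \<bind> (\<lambda>(Rs, a). map_pmf (\<lambda>(R, a'). (enum R # Rs, a'))
     (start_notify (Suc (length us)) x a))"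

primrec process_run :: "event list \<Rightarrow> state pmf" where
  "process_run [] = return_pmf init_state"
| "process_run (e # es) = process_run es \<bind>
     (case e of Upd k x \<Rightarrow> (\<lambda>b. return_pmf (start_update k x b)) | Proc u \<Rightarrow> process u)"

lemma process_run_Procs: "process_run (rev (map Proc R) @ es) = process_run es \<bind> fold_pmf process R"
proof (induction R rule: rev_induct)
  case Nil
  then show ?case by (simp add: fold_pmf_Nil bind_return_pmf')
next
  case (snoc u R)
  show ?case
    by (simp add: snoc fold_pmf_append[abs_def] bind_assoc_pmf del: fold_pmf.simps)
qed

lemma resample_cur_graph: "st' \<in> set_pmf (resample w st) \<Longrightarrow> cur_graph st' = cur_graph st"
  by (auto simp: resample_def Let_def)

lemma resample_merge:
  assumes "cur_graph b = cur_graph a"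
  shows "resample w (merge a b) = map_pmf (\<lambda>a'. merge a' b) (resample w a)"
  using assms
  by (auto simp: resample_def Let_def map_bind_pmf tick_def fun_eq_iff intro!: bind_pmf_cong state_eqI)

lemma fold_resample_cur_graph:
  "st' \<in> set_pmf (fold_pmf resample ws st) \<Longrightarrow> cur_graph st' = cur_graph st"
  by (rule fold_pmf_invariant[where P = "\<lambda>s. cur_graph s = cur_graph st"]) (auto dest: resample_cur_graph)

lemma fold_resample_merge:
  assumes "cur_graph b = cur_graph a"
  shows "fold_pmf resample ws (merge a b) = map_pmf (\<lambda>a'. merge a' b) (fold_pmf resample ws a)"
  using assms
  by (intro fold_pmf_map_pmf[where P = "\<lambda>a. cur_graph b = cur_graph a"])
    (auto simp: resample_merge dest: resample_cur_graph)

lemma targets_merge: "cur_graph b = cur_graph a \<Longrightarrow> targets (merge a b) w = targets a w"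
  by (simp add: targets_def)

lemma notify_merge:
  assumes "cur_graph b = cur_graph a"
  shows "notify R0 (merge a b) = map_pmf (\<lambda>(R, a'). (R, merge a' b)) (notify R0 a)"
  unfolding notify_def map_bind_pmf fold_resample_merge[OF assms] bind_map_pmf Let_def
proof (rule bind_pmf_cong[OF refl], goal_cases)
  case (1 a1)
  then have a1: "cur_graph b = cur_graph a1" using assms by (auto dest: fold_resample_cur_graph)
  then have a1': "cur_graph b = cur_graph (tick c a1)" for c by simp
  show ?case
    unfolding targets_merge[OF a1] merge_tick_left fold_resample_merge[OF a1'] bind_map_pmf map_bind_pmf
  proof (rule bind_pmf_cong[OF refl], goal_cases)
    case (1 a2)
    then have a2: "cur_graph b = cur_graph a2" using a1 by (auto dest: fold_resample_cur_graph)
    then have a2': "cur_graph b = cur_graph (tick c a2)" for c by simp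
    show ?case
      unfolding targets_merge[OF a2] merge_tick_left fold_resample_merge[OF a2'] bind_map_pmf map_bind_pmf
      by simp
  qed
qed

lemma notify_cur_graph: "(R, st') \<in> set_pmf (notify R0 st) \<Longrightarrow> cur_graph st' = cur_graph st"
  by (auto simp: notify_def Let_def dest!: fold_resample_cur_graph)

lemma start_notify_cur_graph:
  "(R, st') \<in> set_pmf (start_notify k x st) \<Longrightarrow> cur_graph st' = apply_update k x (cur_graph st)"
  by (auto simp: start_notify_def arrive_def depart_def Let_def reset_work_def split: update.splits
      dest!: notify_cur_graph resample_cur_graph)

lemma start_notify_merge:
  assumes "cur_graph b = cur_graph a"
  shows "start_notify k x (merge a b) =
    map_pmf (\<lambda>(R, a'). (R, merge a' (start_update k x b))) (start_notify k x a)"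
proof (cases x)
  case (Ins S)
  define a0 where "a0 = (reset_work a)\<lparr>cur_graph := insert_node k S (cur_graph a)\<rparr>"
  define b0 where "b0 = start_update k x b"
  have ab: "(reset_work (merge a b))\<lparr>cur_graph := insert_node k S (cur_graph b)\<rparr> = merge a0 b0"
    by (simp add: a0_def b0_def Ins merge_def reset_work_def)
  have c0: "cur_graph b0 = cur_graph a0" using assms by (simp add: a0_def b0_def Ins)
  have "arrive k S (reset_work (merge a b)) =
    map_pmf (\<lambda>(R, a'). (R, merge a' b0)) (arrive k S (reset_work a))"
  proof -
    have "arrive k S (reset_work (merge a b)) = resample k (merge a0 b0) \<bind> (\<lambda>st1.
      notify (targets st1 k) (tick (real (card (targets st1 k)) + 1) st1) \<bind>
      (\<lambda>(R, st2). return_pmf (insert k R, st2)))"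
      unfolding arrive_def ab[symmetric] Let_def by (simp add: reset_work_def)
    also have "\<dots> = resample k a0 \<bind> (\<lambda>a1.
      notify (targets a1 k) (tick (real (card (targets a1 k)) + 1) a1) \<bind>
      (\<lambda>(R, a2). return_pmf (insert k R, merge a2 b0)))"
      unfolding resample_merge[OF c0] bind_map_pmf
    proof (rule bind_pmf_cong[OF refl], goal_cases)
      case (1 a1)
      then have a1: "cur_graph b0 = cur_graph a1" using c0 by (auto dest: resample_cur_graph)
      then have a1': "cur_graph b0 = cur_graph (tick c a1)" for c by simp
      show ?case
        unfolding targets_merge[OF a1] merge_tick_left notify_merge[OF a1'] bind_map_pmf
        by (rule bind_pmf_cong[OF refl]) auto
    qed
    also have "\<dots> = map_pmf (\<lambda>(R, a'). (R, merge a' b0)) (arrive k S (reset_work a))"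
      by (simp add: arrive_def map_bind_pmf Let_def a0_def reset_work_def)
        (auto intro!: bind_pmf_cong)
    finally show ?thesis .
  qed
  then show ?thesis by (simp add: start_notify_def Ins b0_def)
next
  case (Del u)
  define upd :: "state \<Rightarrow> state" where "upd a = remove_edges {e. u \<in> e} ((reset_work a)\<lparr>
            cur_graph := delete_node u (cur_graph a),
            I_sets := (I_sets a)(u := (\<lambda>_. {})),
            B_sets := (\<lambda>v i. if v = u then {} else B_sets a v i - {u}),
            anchors := anchors a - {u}\<rparr>)" for a
  have ab: "upd (merge a b) = merge (upd a) (start_update k x b)"
    by (rule state_eqI) (simp_all add: upd_def Del reset_work_def remove_edges_def fun_eq_iff)
  have c0: "cur_graph (start_update k x b) = cur_graph (tick c (upd a))" for c
    using assms by (simp add: upd_def Del)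
  have dep: "depart u (reset_work a) = notify ((\<Union>i\<le>top_level. B_sets a u i) - {u})
     (tick (\<Sum>i\<le>top_level. real (card (B_sets a u i)) + real (card (I_sets a u i)) + 1) (upd a))" for a
    by (simp add: depart_def Let_def upd_def reset_work_def cong: if_cong)
  show ?thesis
    by (simp add: start_notify_def Del dep ab del: merge_tick start_update.simps)
      (simp add: merge_tick_left notify_merge[OF c0[unfolded Del]] del: merge_tick start_update.simps)
qed

lemma clean_merge: "clean u (merge a b) = map_pmf (merge a) (clean u b)"
  unfolding clean_def merge_anchor_nbrs
  by (rule fold_pmf_map_pmf') (auto simp: Let_def map_bind_pmf intro!: bind_pmf_cong)

lemma anchor_merge: "anchor u (merge a b) = map_pmf (\<lambda>(X, b'). (X, merge a b')) (anchor u b)"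
proof -
  have f: "fold_pmf (\<lambda>v st. map_pmf (\<lambda>x. (if x then add_edge u v else id)
      (tick (agreement_cost + 1) st)) (agreement G u v)) xs (merge a b) =
    map_pmf (merge a) (fold_pmf (\<lambda>v st. map_pmf (\<lambda>x. (if x then add_edge u v else id)
      (tick (agreement_cost + 1) st)) (agreement G u v)) xs b)" for G xs b
    by (rule fold_pmf_map_pmf') (auto simp: map_pmf_comp intro!: map_pmf_cong)
  show ?thesis
    unfolding anchor_def Let_def map_bind_pmf merge_simps merge_anchor_nbrs
    by (intro bind_pmf_cong[OF refl])
      (auto simp: map_bind_pmf f bind_map_pmf intro!: bind_pmf_cong)
qed

lemma connect_merge: "connect u (merge a b) = map_pmf (merge a) (connect u b)"
  unfolding connect_def Let_def map_bind_pmf merge_simps merge_tick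
  by (intro bind_pmf_cong[OF refl] fold_pmf_map_pmf')
    (unfold merge_anchor_nbrs merge_tick, intro fold_pmf_map_pmf',
      auto simp: Let_def map_bind_pmf intro!: bind_pmf_cong)

lemma process_merge: "process u (merge a b) = map_pmf (merge a) (process u b)"
  unfolding process_def merge_tick clean_merge bind_map_pmf anchor_merge map_bind_pmf
  by (intro bind_pmf_cong[OF refl])
    (auto simp: connect_merge bind_map_pmf map_bind_pmf Let_def intro!: bind_pmf_cong)

lemma fold_cur_graph:
  assumes "\<And>x s s'. s' \<in> set_pmf (f x s) \<Longrightarrow> cur_graph s' = cur_graph s"
    "s' \<in> set_pmf (fold_pmf f xs s)"
  shows "cur_graph s' = cur_graph s"
  using assms(2) by (rule fold_pmf_invariant[where P = "\<lambda>x. cur_graph x = cur_graph s"]) (auto dest: assms(1))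

lemma clean_cur_graph: "st' \<in> set_pmf (clean u st) \<Longrightarrow> cur_graph st' = cur_graph st"
  unfolding clean_def by (erule fold_cur_graph[rotated]) (auto simp: Let_def)

lemma anchor_cur_graph: "(X, st') \<in> set_pmf (anchor u st) \<Longrightarrow> cur_graph st' = cur_graph st"
  unfolding anchor_def Let_def
  by (auto split: if_splits dest!: fold_cur_graph[rotated])

lemma connect_cur_graph: "st' \<in> set_pmf (connect u st) \<Longrightarrow> cur_graph st' = cur_graph st"
proof -
  assume "st' \<in> set_pmf (connect u st)"
  then show ?thesis
    unfolding connect_def Let_def
    apply (simp only: set_bind_pmf UN_iff)
    apply (erule bexE)
    apply (drule fold_cur_graph[rotated])
     apply (drule fold_cur_graph[rotated])
      apply auto
    done
qed

lemma process_cur_graph: "st' \<in> set_pmf (process u st) \<Longrightarrow> cur_graph st' = cur_graph st"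
  by (auto simp: process_def Let_def split: if_splits
      dest!: clean_cur_graph anchor_cur_graph connect_cur_graph)

lemma process_run_cur_graph: "b \<in> set_pmf (process_run es) \<Longrightarrow> cur_graph b = graph_at es"
  by (induction es arbitrary: b) (auto simp: init_state_def split: event.splits dest!: process_cur_graph)

lemma fold_process_merge: "fold_pmf process R (merge a b) = map_pmf (merge a) (fold_pmf process R b)"
  by (rule fold_pmf_map_pmf') (rule process_merge)

lemma notify_run_props:
  "(Rs, a) \<in> set_pmf (notify_run us) \<Longrightarrow> length Rs = length us \<and> cur_graph a = graph_of us"
proof (induction us arbitrary: Rs a)
  case Nil
  then show ?case by (simp add: init_state_def)
next
  case (Cons x us)
  then show ?case by (auto dest!: start_notify_cur_graph)
qed

text \<open>Notifications never read anchors or \<open>sol_graph\<close>, and processing never reads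
  the samples. They share only the graph, which the updates determine. Hence all notifications can
  be drawn first, and processing then follows a fixed event sequence.\<close>

lemma fixed_run_eq:
  "fixed_run us = notify_run us \<bind> (\<lambda>(Rs, a). map_pmf (merge a) (process_run (events us Rs)))"
proof (induction us)
  case Nil
  then show ?case by (simp add: bind_return_pmf merge_def init_state_def)
next
  case (Cons x us)
  let ?k = "Suc (length us)"
  have "fixed_run (x # us) = notify_run us \<bind> (\<lambda>(Rs, a). process_run (events us Rs) \<bind>
     (\<lambda>b. start_notify ?k x (merge a b) \<bind> (\<lambda>(R, st1). fold_pmf process (enum R) st1)))"
    by (simp add: Cons bind_assoc_pmf bind_map_pmf split_def)
  also have "\<dots> = notify_run us \<bind> (\<lambda>(Rs, a). process_run (events us Rs) \<bind>
     (\<lambda>b. start_notify ?k x a \<bind> (\<lambda>(R, a').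
        map_pmf (merge a') (fold_pmf process (enum R) (start_update ?k x b)))))"
  proof (intro bind_pmf_cong[OF refl], clarify, intro bind_pmf_cong[OF refl], goal_cases)
    case (1 Rs a b)
    have "cur_graph b = cur_graph a"
      using process_run_cur_graph[OF 1(2)] notify_run_props[OF 1(1)]
      by (simp add: graph_at_events)
    then show ?case
      by (simp add: start_notify_merge bind_map_pmf split_def fold_process_merge)
  qed
  \<comment> \<open>The new notifications are drawn from \<open>a\<close> alone, so they can be
    exchanged with the processing of all earlier updates.\<close>
  also have "\<dots> = notify_run us \<bind> (\<lambda>(Rs, a). start_notify ?k x a \<bind> (\<lambda>(R, a').
      process_run (events us Rs) \<bind>
     (\<lambda>b. map_pmf (merge a') (fold_pmf process (enum R) (start_update ?k x b)))))"
    by (intro bind_pmf_cong[OF refl], clarify) (subst bind_commute_pmf, simp add: split_def)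
  also have "\<dots> = notify_run (x # us) \<bind> (\<lambda>(Rs, a). map_pmf (merge a) (process_run (events (x # us) Rs)))"
    by (simp add: bind_assoc_pmf bind_map_pmf split_def process_run_Procs map_bind_pmf bind_return_pmf)
  finally show ?case .
qed

lemma fixed_run_cur_graph: "st \<in> set_pmf (fixed_run us) \<Longrightarrow> cur_graph st = graph_of us"
  by (auto simp: fixed_run_eq dest!: process_run_cur_graph notify_run_props simp: graph_at_events)

text \<open>The current graph is a function of the updates, so the next update does not depend on
  the random choices of the algorithm and can be drawn before them.\<close>

lemma run_eq: "run adv t = updates adv t \<bind> (\<lambda>us. map_pmf (Pair (graphs_of us)) (fixed_run us))"
proof (induction t)
  case 0
  then show ?case by (simp add: bind_return_pmf)
next
  case (Suc t)
  have step: "step adv h st = choose_update adv h \<bind> (\<lambda>x. start_notify (length h) x st \<bind>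
     (\<lambda>(R, st1). fold_pmf process (enum R) st1))" if "cur_graph st = hd h" for h st
    using that
    by (auto simp: step_def Let_def choose_update_def start_notify_def reset_work_def bind_return_pmf
        bind_map_pmf bind_assoc_pmf split_def split: request.splits)
  have "run adv (Suc t) = updates adv t \<bind> (\<lambda>us. fixed_run us \<bind> (\<lambda>st.
      step adv (graphs_of us) st \<bind> (\<lambda>st'. return_pmf (cur_graph st' # graphs_of us, st'))))"
    by (simp add: Suc bind_assoc_pmf bind_map_pmf)
  also have "\<dots> = updates adv t \<bind> (\<lambda>us. fixed_run us \<bind> (\<lambda>st.
      choose_update adv (graphs_of us) \<bind> (\<lambda>x. start_notify (Suc (length us)) x st \<bind>
     (\<lambda>(R, st1). fold_pmf process (enum R) st1) \<bind>
       (\<lambda>st'. return_pmf (cur_graph st' # graphs_of us, st')))))"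
    by (intro bind_pmf_cong[OF refl]) (simp add: step fixed_run_cur_graph bind_assoc_pmf)
  also have "\<dots> = updates adv t \<bind> (\<lambda>us. choose_update adv (graphs_of us) \<bind> (\<lambda>x.
     fixed_run (x # us) \<bind> (\<lambda>st'. return_pmf (cur_graph st' # graphs_of us, st'))))"
    by (intro bind_pmf_cong[OF refl], subst bind_commute_pmf) (simp add: bind_assoc_pmf)
  also have "\<dots> = updates adv t \<bind> (\<lambda>us. choose_update adv (graphs_of us) \<bind> (\<lambda>x.
     map_pmf (Pair (graphs_of (x # us))) (fixed_run (x # us))))"
    unfolding map_pmf_def
    by (intro bind_pmf_cong[OF refl]) (simp add: fixed_run_cur_graph del: fixed_run.simps)
  also have "\<dots> = updates adv (Suc t) \<bind> (\<lambda>us. map_pmf (Pair (graphs_of us)) (fixed_run us))"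
    by (simp add: bind_assoc_pmf bind_map_pmf del: fixed_run.simps graphs_of.simps)
  finally show ?case .
qed

end

section \<open>Soundness of the tests\<close>

lemma nn_integral_replicate_pmf_prod:
  fixes g :: "'a \<Rightarrow> ennreal"
  shows "(\<integral>\<^sup>+xs. prod_list (map g xs) \<partial>measure_pmf (replicate_pmf k p)) = (\<integral>\<^sup>+x. g x \<partial>measure_pmf p) ^ k"
  by (induction k) (simp_all add: nn_integral_pmf_cmult nn_integral_multc)

lemma nn_integral_replicate_pmf_sum:
  fixes g :: "'a \<Rightarrow> ennreal"
  shows "(\<integral>\<^sup>+xs. sum_list (map g xs) \<partial>measure_pmf (replicate_pmf k p)) = of_nat k * (\<integral>\<^sup>+x. g x \<partial>measure_pmf p)"
  by (induction k) (simp_all add: nn_integral_pmf_add distrib_right)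

text \<open>Generating function of the number of NO answers. Once the sampled neighbours are fixed,
  the answers are independent, hence the product.\<close>

lemma nn_integral_fold_count:
  fixes z :: ennreal
  shows "(\<integral>\<^sup>+c'. z ^ c' \<partial>measure_pmf (fold_pmf (\<lambda>v c. map_pmf (\<lambda>yes. if yes then c else Suc c) (A v)) vs c))
    = z ^ c * prod_list (map (\<lambda>v. \<integral>\<^sup>+yes. (if yes then 1 else z) \<partial>measure_pmf (A v)) vs)"
proof (induction vs arbitrary: c)
  case (Cons v vs)
  let ?P = "prod_list (map (\<lambda>v. \<integral>\<^sup>+yes. (if yes then 1 else z) \<partial>measure_pmf (A v)) vs)"
  have eq: "z ^ (if x then c else Suc c) * ?P = (z ^ c * ?P) * (if x then 1 else z)" for x
    by (auto simp: mult_ac)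
  show ?case by (simp add: Cons.IH eq nn_integral_pmf_cmult nn_integral_multc mult_ac)
qed simp

lemma prod_list_filter:
  fixes z :: ennreal
  shows "z ^ length (filter P xs) = prod_list (map (\<lambda>x. if P x then z else 1) xs)"
  by (induction xs) auto

text \<open>Markov's inequality for the moment \<open>4\<^sup>-\<^sup>c\<close> of the count \<open>c\<close>.\<close>

lemma of_bool_count_le:
  fixes c k :: nat and \<theta> :: real
  assumes "0 < k"
  shows "(of_bool (real c / real k < \<theta>) :: ennreal) \<le> ennreal (4 powr (\<theta> * k)) * ennreal (1/4) ^ c"
proof (cases "real c / real k < \<theta>")
  case True
  then have "real c \<le> \<theta> * k" using assms by (simp add: field_simps)
  then have "(4::real) powr real c \<le> 4 powr (\<theta> * k)" by (intro powr_mono) auto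
  then have "(4::real) ^ c \<le> 4 powr (\<theta> * k)" by (simp add: powr_realpow)
  then have "1 \<le> 4 powr (\<theta> * k) * (1/4::real) ^ c" by (simp add: power_one_over field_simps)
  then have "ennreal 1 \<le> ennreal (4 powr (\<theta> * k) * (1/4::real) ^ c)" by (rule ennreal_leI)
  then show ?thesis using True by (simp add: ennreal_mult ennreal_power)
qed simp

lemma two_powr_log:
  assumes "2 \<le> n"
  shows "2 powr (- (20 * log 2 (real n))) = 1 / real n ^ 20"
proof -
  have "2 powr (log 2 (real n) * 20) = real n ^ 20"
    using assms by (simp add: powr_powr[symmetric])
  then show ?thesis by (simp add: powr_minus_divide mult.commute)
qed

text \<open>The common numerical core of both tests: \<open>\<theta>\<close> stands for the
  threshold \<open>0.4 * eps\<close> or \<open>1.2 * eps\<close>, both at most 1/80 when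
  \<open>eps < 1/100\<close>, and \<open>\<rho>\<close> for the mean factor contributed by one
  sample.\<close>

lemma tail_numeric:
  fixes k n :: nat and \<theta> \<rho> :: real
  assumes n: "2 \<le> n" and k: "1000 * log 2 (real n) \<le> real k"
    and th: "\<theta> \<le> 1/80" and rho: "0 \<le> \<rho>" "\<rho> \<le> 61/64"
  shows "4 powr (\<theta> * k) * \<rho> ^ k \<le> 1 / real n ^ 20"
proof -
  have root: "(x ^ m) powr (1 / real m) = x" if "0 < x" "0 < m" for x :: real and m :: nat
    using that by (simp add: powr_realpow[symmetric] powr_powr)
  \<comment> \<open>The aim is 1.02 * 61/64 < 0.98 < 2 powr (-1/50); then
    \<open>1000 * log 2 n\<close> samples give 2 powr (-20 log n).\<close>
  have 1: "4 powr (1/80) \<le> (1.02::real)"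
  proof -
    have "(4::real) \<le> 1.02 ^ 80" by (simp add: power_divide)
    then have "(4::real) powr (1/80) \<le> (1.02 ^ 80) powr (1/80)" by (intro powr_mono2) auto
    also have "\<dots> = 1.02" using root[of "1.02" 80] by simp
    finally show ?thesis .
  qed
  have 2: "(0.98::real) \<le> 2 powr (-1/50)"
  proof -
    have "(0.98::real) ^ 50 \<le> 1/2" by (simp add: power_divide)
    then have "(0.98 ^ 50) powr (1/50) \<le> (1/2::real) powr (1/50)" by (intro powr_mono2) auto
    also have "(0.98 ^ 50) powr (1/50) = (0.98::real)"
      using root[of "0.98" 50] by simp
    also have "(1/2::real) powr (1/50) = 2 powr (-1/50)" by (simp add: powr_minus_divide powr_divide)
    finally show ?thesis .
  qed
  have "4 powr (\<theta> * k) \<le> (4::real) powr ((1/80) * k)"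
    using th by (intro powr_mono mult_right_mono) auto
  also have "\<dots> = (4 powr (1/80)) ^ k"
    by (simp add: powr_powr powr_realpow[symmetric])
  also have "\<dots> \<le> (1.02::real) ^ k" using 1 by (intro power_mono) auto
  finally have "4 powr (\<theta> * k) * \<rho> ^ k \<le> 1.02 ^ k * (61/64) ^ k"
    using rho by (intro mult_mono power_mono) auto
  also have "\<dots> = (1.02 * (61/64)) ^ k" by (rule power_mult_distrib[symmetric])
  also have "\<dots> \<le> 0.98 ^ k" by (intro power_mono) auto
  also have "\<dots> \<le> (2 powr (-1/50)) ^ k" using 2 by (intro power_mono) auto
  also have "\<dots> = 2 powr (- (real k / 50))" by (simp add: powr_powr powr_realpow[symmetric])
  also have "\<dots> \<le> 2 powr (- (20 * log 2 n))"
  proof (intro powr_mono)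
    have "0 \<le> log 2 n" using n by simp
    then show "- (real k / 50) \<le> - (20 * log 2 n)" using k by simp
  qed auto
  also have "\<dots> = 1 / real n ^ 20" by (rule two_powr_log[OF n])
  finally show ?thesis .
qed

text \<open>What a YES of the agreement test is taken to mean. The fraction 1/8 is much weaker than
  the tested \<open>0.4 * eps\<close>; it already fixes the degrees up to a factor 8/7, and the wide
  gap makes a wrong YES very unlikely.\<close>

definition agrees :: "graph \<Rightarrow> node \<Rightarrow> node \<Rightarrow> bool" where
  "agrees G u v \<longleftrightarrow> 8 * card (N G u - N G v) \<le> deg G u \<and> 8 * card (N G v - N G u) \<le> deg G v"

definition mostly_agreeing :: "graph \<Rightarrow> node \<Rightarrow> bool" where
  "mostly_agreeing G u \<longleftrightarrow> 8 * card {v \<in> N G u. \<not> agrees G u v} \<le> deg G u"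

text \<open>It mentions only a graph and a node, so the analysis of the notifications can start from
  it without referring to any test.\<close>

definition degree_typical :: "graph \<Rightarrow> node \<Rightarrow> bool" where
  "degree_typical G w \<longleftrightarrow> 2 * card {v \<in> N G w. deg G v > 2 * deg G w} \<le> deg G w"

definition good_edge :: "graph \<Rightarrow> node \<Rightarrow> node \<Rightarrow> bool" where
  "good_edge G u w \<longleftrightarrow> w \<in> N G u \<and> deg G u \<le> 2 * deg G w \<and> deg G w \<le> 2 * deg G u \<and>
     degree_typical G u \<and> degree_typical G w"

lemma good_edge_sym: "good_edge G u w \<longleftrightarrow> good_edge G w u"
  by (auto simp: good_edge_def N_sym)

lemma card_Diff_Int: "finite A \<Longrightarrow> card A = card (A - B) + card (A \<inter> B)"
  by (metis Diff_Int_distrib2 add.commute card_Int_Diff)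

lemma agrees_deg:
  assumes "agrees G u v" "finite (N G u)" "finite (N G v)"
  shows "7 * deg G u \<le> 8 * deg G v" "7 * deg G v \<le> 8 * deg G u"
proof -
  have "card (N G u \<inter> N G v) \<le> deg G v" "card (N G u \<inter> N G v) \<le> deg G u"
    using assms by (auto intro!: card_mono)
  moreover have "deg G u = card (N G u - N G v) + card (N G u \<inter> N G v)"
    "deg G v = card (N G v - N G u) + card (N G u \<inter> N G v)"
    using card_Diff_Int[OF assms(2), of "N G v"] card_Diff_Int[OF assms(3), of "N G u"]
    by (simp_all add: Int_commute)
  ultimately show "7 * deg G u \<le> 8 * deg G v" "7 * deg G v \<le> 8 * deg G u"
    using assms(1) unfolding agrees_def by linarith+
qed

text \<open>Heaviness is assumed for \<open>u\<close> only; \<open>w\<close> inherits typicality. A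
  neighbour of \<open>w\<close> of degree above \<open>2 * deg G w\<close> either lies outside
  \<open>N G u\<close>, which holds for at most 1/8 of the neighbours of \<open>w\<close>, or it is
  a neighbour of \<open>u\<close> that disagrees with \<open>u\<close>. The latter are at most 1/8
  of \<open>deg G u\<close>, hence at most 1/7 of \<open>deg G w\<close>.\<close>

lemma good_edgeI:
  assumes w: "w \<in> N G u" and a: "agrees G u w" and h: "mostly_agreeing G u" and fin: "\<And>v. finite (N G v)"
  shows "good_edge G u w"
proof -
  note d = agrees_deg[OF a fin fin]
  let ?B = "{v \<in> N G u. \<not> agrees G u v}"
  have nb: "\<not> agrees G u v" if "7 * deg G v > 8 * deg G u" for v
    using agrees_deg(2)[of G u v] fin that by auto
  have "card {v \<in> N G u. deg G v > 2 * deg G u} \<le> card ?B"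
    using fin nb by (intro card_mono) auto
  then have 1: "degree_typical G u" using h unfolding mostly_agreeing_def degree_typical_def by linarith
  have "card {v \<in> N G w. deg G v > 2 * deg G w} \<le> card ((N G w - N G u) \<union> ?B)"
    using fin nb d by (intro card_mono) auto
  also have "\<dots> \<le> card (N G w - N G u) + card ?B" by (rule card_Un_le)
  finally have 2: "degree_typical G w"
    using h a d unfolding mostly_agreeing_def degree_typical_def agrees_def by linarith
  show ?thesis unfolding good_edge_def using w 1 2 d by auto
qed

locale dynamic_agreement_params = dynamic_agreement n eps qcost enum
  for n :: nat and eps :: real and qcost :: real and enum :: "node set \<Rightarrow> node list" +
  assumes n2: "2 \<le> n" and eps_pos: "0 < eps" and eps_small: "eps < 1/100"
    and qcost_nonneg: "0 \<le> qcost" and enum: "enumerates enum"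
begin

lemma set_enum [simp]: "finite A \<Longrightarrow> set (enum A) = A"
  and distinct_enum [simp]: "finite A \<Longrightarrow> distinct (enum A)"
  using enum by (auto simp: enumerates_def)

lemma length_enum [simp]: "finite A \<Longrightarrow> length (enum A) = card A"
  by (metis distinct_card set_enum distinct_enum)

lemma log_n: "1 \<le> log 2 (real n)"
  using n2 by simp

lemma ln_le_log2: "ln (real n) \<le> log 2 (real n)"
proof -
  have "ln (2::real) \<le> 1" using ln_le_minus_one[of 2] by simp
  moreover have "0 \<le> ln (real n)" using n2 by simp
  ultimately show ?thesis by (simp add: log_def field_simps mult_left_le)
qed

lemma samples_ge: "c * log 2 n / eps \<le> real (samples c)"
  unfolding samples_def by linarith

lemma samples_large:
  assumes "10 \<le> c" shows "100 * c * log 2 n \<le> real (samples c)" "0 < samples c"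
proof -
  have "100 * c * log 2 n * eps \<le> 100 * c * log 2 n * (1/100)"
    using assms log_n eps_small by (intro mult_left_mono) auto
  also have "\<dots> = c * log 2 n" by simp
  finally have "100 * c * log 2 n \<le> c * log 2 n / eps"
    using eps_pos by (simp add: field_simps)
  then show *: "100 * c * log 2 n \<le> real (samples c)" using samples_ge[of c] by linarith
  have "0 < 100 * c * log 2 n" using assms log_n by (intro mult_pos_pos) auto
  then show "0 < samples c" using * by linarith
qed

lemma agreement_cost_nonneg: "0 \<le> agreement_cost"
  using qcost_nonneg by (simp add: agreement_cost_def)

lemma heavy_cost_nonneg: "0 \<le> heavy_cost"
  using qcost_nonneg agreement_cost_nonneg by (simp add: heavy_cost_def)

text \<open>The exponent 20 is chosen generously: it absorbs the union bounds over all tests and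
  resamplings and the polynomial work charged to a failure.\<close>

definition test_error :: ennreal where
  "test_error = ennreal (1 / real n ^ 20)"

lemma test_error_le_half: "test_error \<le> ennreal (1/2)"
proof -
  have "(2::real) \<le> 2 ^ 20" by simp
  also have "\<dots> \<le> real n ^ 20" using n2 by (intro power_mono) auto
  finally show ?thesis unfolding test_error_def using n2 by (intro ennreal_leI) (simp add: field_simps)
qed

text \<open>More than 1/8 of the values are bad and each of these contributes at most 5/8, so the
  mean is at most 1 - 3/8 * 1/8 = 61/64. The value 5/8 instead of 1/4 serves the heaviness test,
  whose inner tests may err.\<close>

lemma sample_prob_le:
  assumes X: "finite X" "X \<noteq> {}" and b: "card X < 8 * card (X \<inter> {x. bad x})"
    and g: "\<And>x. x \<in> X \<Longrightarrow> g x \<le> (if bad x then ennreal (5/8) else 1)"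
  shows "(\<integral>\<^sup>+x. g x \<partial>measure_pmf (pmf_of_set X)) \<le> ennreal (61/64)"
proof -
  let ?B = "X \<inter> {x. bad x}"
  have "(\<integral>\<^sup>+x. g x \<partial>measure_pmf (pmf_of_set X)) \<le>
    (\<integral>\<^sup>+x. (if bad x then ennreal (5/8) else 1) \<partial>measure_pmf (pmf_of_set X))"
    using g X by (intro nn_integral_pmf_mono) auto
  also have "\<dots> = (\<Sum>x\<in>X. if bad x then ennreal (5/8) else 1) / card X"
    using X by (simp add: nn_integral_pmf_of_set)
  also have "(\<Sum>x\<in>X. if bad x then ennreal (5/8) else 1) = ennreal (\<Sum>x\<in>X. if bad x then 5/8 else 1)"
    by (subst sum_ennreal[symmetric], simp) (intro sum.cong, simp_all)
  also have "(\<Sum>x\<in>X. if bad x then 5/8 else 1) = 5/8 * real (card ?B) + real (card (X - {x. bad x}))"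
    using X(1) by (simp add: sum.If_cases Diff_eq)
  also have "\<dots> = real (card X) - 3/8 * real (card ?B)"
    using card_Diff_Int[OF X(1), of "{x. bad x}"] by simp
  also have "ennreal (real (card X) - 3/8 * real (card ?B)) / card X
     = ennreal ((real (card X) - 3/8 * real (card ?B)) / real (card X))"
  proof -
    have "card ?B \<le> card X" using X by (intro card_mono) auto
    then show ?thesis using X
      by (simp add: divide_ennreal ennreal_of_nat_eq_real_of_nat card_gt_0_iff)
  qed
  also have "\<dots> \<le> ennreal (61/64)"
  proof (rule ennreal_leI)
    have "0 < real (card X)" using X by (simp add: card_gt_0_iff)
    moreover have "real (card X) \<le> 8 * real (card ?B)" using b by linarith
    ultimately show "(real (card X) - 3/8 * real (card ?B)) / real (card X) \<le> 61/64"
      by (simp add: field_simps)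
  qed
  finally show ?thesis .
qed

lemma replicate_count_le:
  assumes X: "finite X" "X \<noteq> {}" and b: "card X < 8 * card (X \<inter> {x. bad x})"
    and c: "10 \<le> c" and th: "\<theta> \<le> 1/80"
  shows "(\<integral>\<^sup>+xs. of_bool (real (length (filter bad xs)) / real (samples c) < \<theta>)
     \<partial>measure_pmf (replicate_pmf (samples c) (pmf_of_set X))) \<le> test_error"
proof -
  let ?k = "samples c" let ?C = "ennreal (4 powr (\<theta> * ?k))"
  have "(\<integral>\<^sup>+xs. of_bool (real (length (filter bad xs)) / real ?k < \<theta>)
     \<partial>measure_pmf (replicate_pmf ?k (pmf_of_set X))) \<le>
     (\<integral>\<^sup>+xs. ?C * prod_list (map (\<lambda>x. if bad x then ennreal (1/4) else 1) xs)
     \<partial>measure_pmf (replicate_pmf ?k (pmf_of_set X)))"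
    unfolding prod_list_filter[symmetric]
    by (intro nn_integral_pmf_mono of_bool_count_le[OF samples_large(2)[OF c]])
  also have "\<dots> = ?C * (\<integral>\<^sup>+x. (if bad x then ennreal (1/4) else 1) \<partial>measure_pmf (pmf_of_set X)) ^ ?k"
    by (simp add: nn_integral_pmf_cmult nn_integral_replicate_pmf_prod)
  also have "\<dots> \<le> ?C * ennreal (61/64) ^ ?k"
    by (intro mult_left_mono power_mono sample_prob_le[OF X b]) auto
  also have "\<dots> = ennreal (4 powr (\<theta> * ?k) * (61/64) ^ ?k)"
    by (simp add: ennreal_mult ennreal_power)
  also have "\<dots> \<le> test_error" unfolding test_error_def
  proof (intro ennreal_leI tail_numeric n2 th)
    have "1000 * log 2 n \<le> 100 * c * log 2 n" using c log_n by (intro mult_right_mono) auto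
    then show "1000 * log 2 n \<le> real ?k" using samples_large(1)[OF c] by linarith
  qed auto
  finally show ?thesis .
qed

text \<open>The two samples are independent, so the probability of YES is a product, and one of its
  factors is small.\<close>

lemma agreement_sound:
  assumes fin: "finite (N G u)" "finite (N G v)" and ne: "N G u \<noteq> {}" "N G v \<noteq> {}" and na: "\<not> agrees G u v"
  shows "(\<integral>\<^sup>+yes. of_bool yes \<partial>measure_pmf (agreement G u v)) \<le> test_error"
proof -
  let ?k = "samples 300"
  let ?f = "\<lambda>rs. of_bool (real (length (filter (\<lambda>r. r \<in> N G u - N G v) rs)) / real ?k < 0.4 * eps) :: ennreal"
  let ?g = "\<lambda>rs. of_bool (real (length (filter (\<lambda>r. r \<in> N G v - N G u) rs)) / real ?k < 0.4 * eps) :: ennreal"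
  let ?U = "replicate_pmf ?k (pmf_of_set (N G u))" let ?V = "replicate_pmf ?k (pmf_of_set (N G v))"
  have eq: "(\<integral>\<^sup>+yes. of_bool yes \<partial>measure_pmf (agreement G u v)) = (\<integral>\<^sup>+rs. ?f rs \<partial>?U) * (\<integral>\<^sup>+ss. ?g ss \<partial>?V)"
    using ne by (simp add: agreement_def Let_def random_nbrs_def nn_integral_pmf_cmult nn_integral_multc
        of_bool_conj)
  have 1: "(\<integral>\<^sup>+rs. ?f rs \<partial>?U) \<le> 1" "(\<integral>\<^sup>+ss. ?g ss \<partial>?V) \<le> 1"
    by (intro nn_integral_pmf_le_const; simp)+
  have th: "0.4 * eps \<le> 1/80" using eps_small by simp
  consider "deg G u < 8 * card (N G u - N G v)" | "deg G v < 8 * card (N G v - N G u)"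
    using na by (auto simp: agrees_def)
  then show ?thesis
  proof cases
    case 1
    have "N G u \<inter> {r. r \<in> N G u - N G v} = N G u - N G v" by auto
    then have "(\<integral>\<^sup>+rs. ?f rs \<partial>?U) \<le> test_error"
      using 1 by (intro replicate_count_le fin ne th) auto
    then show ?thesis unfolding eq using \<open>(\<integral>\<^sup>+ss. ?g ss \<partial>?V) \<le> 1\<close>
      by (metis mult.right_neutral mult_mono zero_le)
  next
    case 2
    have "N G v \<inter> {r. r \<in> N G v - N G u} = N G v - N G u" by auto
    then have "(\<integral>\<^sup>+rs. ?g rs \<partial>?V) \<le> test_error"
      using 2 by (intro replicate_count_le fin ne th) auto
    then show ?thesis unfolding eq using \<open>(\<integral>\<^sup>+ss. ?f ss \<partial>?U) \<le> 1\<close>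
      by (metis mult.left_neutral mult_mono zero_le)
  qed
qed

text \<open>Sampling and inner test are averaged together: a disagreeing neighbour passes its test
  with probability at most 1/2, so it contributes at most 1/4 + 3/4 * 1/2 = 5/8 to the generating
  function at 1/4.\<close>

lemma heavy_sound:
  assumes fin: "\<And>v. finite (N G v)" and ne: "N G u \<noteq> {}" and nh: "\<not> mostly_agreeing G u"
  shows "(\<integral>\<^sup>+yes. of_bool yes \<partial>measure_pmf (heavy G u)) \<le> test_error"
proof -
  let ?k = "samples 1200" let ?C = "ennreal (4 powr (1.2 * eps * ?k))"
  let ?F = "\<lambda>vs. fold_pmf (\<lambda>v c. map_pmf (\<lambda>yes. if yes then c else Suc c) (agreement G u v)) vs 0"
  let ?g = "\<lambda>v. \<integral>\<^sup>+yes. (if yes then 1 else ennreal (1/4)) \<partial>measure_pmf (agreement G u v)"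
  let ?R = "replicate_pmf ?k (pmf_of_set (N G u))"
  have k: "0 < ?k" by (rule samples_large) simp
  have "(\<integral>\<^sup>+yes. of_bool yes \<partial>measure_pmf (heavy G u)) =
    (\<integral>\<^sup>+vs. \<integral>\<^sup>+c. of_bool (real c / real ?k < 1.2 * eps) \<partial>measure_pmf (?F vs) \<partial>?R)"
    using ne by (simp add: heavy_def Let_def random_nbrs_def)
  also have "\<dots> \<le> (\<integral>\<^sup>+vs. \<integral>\<^sup>+c. ?C * ennreal (1/4) ^ c \<partial>measure_pmf (?F vs) \<partial>?R)"
    by (intro nn_integral_mono) (rule of_bool_count_le[OF k])
  also have "\<dots> = ?C * (\<integral>\<^sup>+v. ?g v \<partial>measure_pmf (pmf_of_set (N G u))) ^ ?k"
    by (simp add: nn_integral_pmf_cmult nn_integral_fold_count nn_integral_replicate_pmf_prod)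
  also have "\<dots> \<le> ?C * ennreal (61/64) ^ ?k"
  proof (intro mult_left_mono power_mono sample_prob_le[where bad = "\<lambda>v. \<not> agrees G u v"])
    show "deg G u < 8 * card (N G u \<inter> {v. \<not> agrees G u v})"
      using nh by (simp add: mostly_agreeing_def Collect_conj_eq)
    fix v assume v: "v \<in> N G u"
    show "?g v \<le> (if \<not> agrees G u v then ennreal (5/8) else 1)"
    proof (cases "agrees G u v")
      case True
      have "?g v \<le> 1" by (rule nn_integral_pmf_le_const) (auto simp: ennreal_le_1)
      then show ?thesis using True by simp
    next
      case False
      have ne': "N G v \<noteq> {}" using v N_sym by blast
      have "?g v \<le> (\<integral>\<^sup>+yes. ennreal (1/4) + ennreal (3/4) * of_bool yes \<partial>measure_pmf (agreement G u v))"
        by (intro nn_integral_pmf_mono) (auto simp: ennreal_plus[symmetric] simp del: ennreal_plus)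
      also have "\<dots> = ennreal (1/4) + ennreal (3/4) * (\<integral>\<^sup>+yes. of_bool yes \<partial>measure_pmf (agreement G u v))"
        by (simp add: nn_integral_pmf_add nn_integral_pmf_cmult)
      also have "\<dots> \<le> ennreal (1/4) + ennreal (3/4) * ennreal (1/2)"
        using agreement_sound[OF fin fin ne ne' False] test_error_le_half
        by (intro add_left_mono mult_left_mono) auto
      also have "\<dots> = ennreal (1/4 + 3/4 * (1/2))"
        by (subst ennreal_plus, simp, simp, subst ennreal_mult) simp_all
      also have "\<dots> = ennreal (5/8)" by simp
      finally show ?thesis using False by simp
    qed
  qed (use fin ne in auto)
  also have "\<dots> = ennreal (4 powr (1.2 * eps * ?k) * (61/64) ^ ?k)"
    by (simp add: ennreal_mult ennreal_power)
  also have "\<dots> \<le> test_error" unfolding test_error_def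
  proof (intro ennreal_leI tail_numeric n2)
    show "1000 * log 2 n \<le> real ?k" using samples_large(1)[of 1200] log_n by simp
  qed (use eps_small in auto)
  finally show ?thesis .
qed

text \<open>The continuation \<open>f\<close> is arbitrary because Clean and Connect react
  differently to a double YES, the only outcome after which \<open>P\<close> may fail. On a bad edge
  at least one of the two tests says YES with probability at most \<open>test_error\<close>.\<close>

lemma both_tests_sound:
  assumes fin: "\<And>v. finite (N G v)" and v: "v \<in> N G u" and ng: "\<not> good_edge G u v"
    and P: "\<And>a hv x. \<not> (a \<and> hv) \<Longrightarrow> x \<in> set_pmf (f a hv) \<Longrightarrow> P x"
  shows "fail_prob (agreement G u v \<bind> (\<lambda>a. heavy G u \<bind> (\<lambda>hv. f a hv))) P \<le> test_error"
proof -
  have ne: "N G u \<noteq> {}" "N G v \<noteq> {}" using v N_sym by blast+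
  consider "\<not> agrees G u v" | "\<not> mostly_agreeing G u"
    using good_edgeI[OF v _ _ fin] ng by blast
  then show ?thesis
  proof cases
    case 1
    have "fail_prob (agreement G u v) (\<lambda>a. \<not> a) \<le> test_error"
      using agreement_sound[OF fin fin ne 1] by (simp add: fail_prob_def)
    then have "fail_prob (agreement G u v \<bind> (\<lambda>a. heavy G u \<bind> (\<lambda>hv. f a hv))) P \<le> test_error + 0"
    proof (rule fail_prob_bind)
      fix a assume "\<not> a"
      have "fail_prob (heavy G u \<bind> (\<lambda>hv. f a hv)) P = 0"
      proof (rule fail_prob_eq_0)
        fix x assume "x \<in> set_pmf (heavy G u \<bind> (\<lambda>hv. f a hv))"
        then obtain hv where "x \<in> set_pmf (f a hv)" by auto
        then show "P x" using P[of a hv x] \<open>\<not> a\<close> by simp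
      qed
      then show "fail_prob (heavy G u \<bind> (\<lambda>hv. f a hv)) P \<le> 0" by simp
    qed
    then show ?thesis by simp
  next
    case 2
    have *: "fail_prob (heavy G u) (\<lambda>hv. \<not> hv) \<le> test_error"
      using heavy_sound[OF fin ne(1) 2] by (simp add: fail_prob_def)
    have "fail_prob (heavy G u \<bind> (\<lambda>hv. f a hv)) P \<le> test_error + 0" for a
    proof (rule fail_prob_bind[OF *])
      fix hv assume "\<not> hv"
      have "fail_prob (f a hv) P = 0"
        by (rule fail_prob_eq_0) (use P[of a hv] \<open>\<not> hv\<close> in simp)
      then show "fail_prob (f a hv) P \<le> 0" by simp
    qed
    then show ?thesis by (intro fail_prob_bind_sure[of "agreement G u v" "\<lambda>a. heavy G u \<bind> f a"]) simp
  qed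
qed

end

section \<open>Processing a node\<close>

text \<open>The invariant may mention the elements still to come. This expresses prepaid costs, and
  claims restricted to the elements already visited.\<close>

lemma fold_pmf_invariant_list:
  assumes "s' \<in> set_pmf (fold_pmf f xs s)" "P xs s"
    and "\<And>x xs s s'. P (x # xs) s \<Longrightarrow> s' \<in> set_pmf (f x s) \<Longrightarrow> P xs s'"
  shows "P [] s'"
  using assms(1,2)
proof (induction xs arbitrary: s)
  case (Cons x xs)
  from Cons.prems(1) obtain s1 where s1: "s1 \<in> set_pmf (f x s)" "s' \<in> set_pmf (fold_pmf f xs s1)"
    by auto
  show ?case by (rule Cons.IH[OF s1(2) assms(3)[OF Cons.prems(2) s1(1)]])
qed simp

lemma fail_prob_fold_list:
  assumes "P xs s" "\<And>x xs s. P (x # xs) s \<Longrightarrow> fail_prob (f x s) (P xs) \<le> d"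
  shows "fail_prob (fold_pmf f xs s) (P []) \<le> of_nat (length xs) * d"
  using assms(1)
proof (induction xs arbitrary: s)
  case Nil then show ?case by simp
next
  case (Cons x xs)
  have "fail_prob (f x s \<bind> fold_pmf f xs) (P []) \<le> d + of_nat (length xs) * d"
    by (rule fail_prob_bind[OF assms(2)[OF Cons.prems] Cons.IH])
  then show ?case by (simp add: distrib_right)
qed

definition work :: "state \<Rightarrow> real" where
  "work st = ops st + 2 * real (adds st)"

lemma work_simps [simp]:
  "work (tick c st) = work st + c" "work (add_edge u v st) = work st + 2"
  "work (remove_edges F st) = work st" "work (st\<lparr>anchors := A\<rparr>) = work st"
  "work (st\<lparr>entry_nbrs := E\<rparr>) = work st"
  by (simp_all add: work_def tick_def add_edge_def remove_edges_def)

lemma anchors_simps [simp]: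
  "anchors (tick c st) = anchors st" "anchors (add_edge u v st) = anchors st"
  "anchors (remove_edges F st) = anchors st"
  by (simp_all add: tick_def add_edge_def remove_edges_def)

lemma sol_graph_simps [simp]:
  "sol_graph (tick c st) = sol_graph st" "sol_graph (add_edge u v st) = insert {u, v} (sol_graph st)"
  "sol_graph (remove_edges F st) = sol_graph st - F"
  by (simp_all add: tick_def add_edge_def remove_edges_def)

text \<open>The last clause makes Clean exhaustive. An edge at \<open>u\<close> either leads to an
  anchor, which Clean inspects, or \<open>u\<close> is an anchor itself and Anchor deletes the
  edge.\<close>

definition proper :: "graph \<Rightarrow> state \<Rightarrow> bool" where
  "proper G b \<longleftrightarrow> cur_graph b = G \<and> sol_graph b \<subseteq> edges G \<and> anchors b \<subseteq> verts G \<and>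
     (\<forall>e\<in>sol_graph b. e \<inter> anchors b \<noteq> {})"

definition good_at :: "graph \<Rightarrow> node \<Rightarrow> state \<Rightarrow> bool" where
  "good_at G u b \<longleftrightarrow> (\<forall>v. {u, v} \<in> sol_graph b \<longrightarrow> good_edge G u v)"

locale graph_params = dynamic_agreement_params n eps qcost enum
  for n :: nat and eps :: real and qcost :: real and enum :: "node set \<Rightarrow> node list" +
  fixes us :: "update list" and G :: graph
  assumes valid: "valid us" and G: "G = graph_of us" and card_verts: "card (verts G) \<le> n"
begin

lemma fin_verts [simp]: "finite (verts G)" and fin_N [simp]: "finite (N G u)"
  using valid G by auto

lemma N_in_verts: "v \<in> N G u \<Longrightarrow> v \<in> verts G" and N_neq: "v \<in> N G u \<Longrightarrow> u \<noteq> v"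
  using N_verts[OF valid, of v u] G by auto

lemma deg_le_n: "deg G u \<le> n"
  using deg_le_verts[OF valid, of u] G card_verts by simp

lemma edge_at:
  assumes "e \<in> edges G" "u \<in> e" obtains v where "e = {u, v}" "v \<in> N G u" "v \<noteq> u"
  using assms edgeE[OF valid, of e] G unfolding nbrs_def
  by (metis insertE insert_commute mem_Collect_eq singletonD)

lemma finite_anchor_nbrs [simp]: "proper G b \<Longrightarrow> finite (anchor_nbrs b u)"
  by (auto simp: proper_def anchor_nbrs_def intro: finite_subset[OF _ fin_verts])

lemma card_anchor_nbrs_le: "proper G b \<Longrightarrow> card (anchor_nbrs b u) \<le> n"
proof -
  assume "proper G b"
  then have "anchor_nbrs b u \<subseteq> verts G" by (auto simp: proper_def anchor_nbrs_def)
  then show ?thesis using card_mono[OF fin_verts] card_verts order_trans by blast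
qed

section \<open>Clean: retesting the edges to adjacent anchors\<close>

abbreviation clean_cost :: real where
  "clean_cost \<equiv> agreement_cost + heavy_cost + 1"

definition check_anchor :: "node \<Rightarrow> node \<Rightarrow> state \<Rightarrow> state pmf" where
  "check_anchor u w st = agreement (cur_graph st) w u \<bind> (\<lambda>a.
       heavy (cur_graph st) w \<bind> (\<lambda>hv.
       let st1 = tick (agreement_cost + heavy_cost + 1) st;
       st2 = (if a \<and> hv then st1 else remove_edges {{w, u}} st1)
       in return_pmf
         (if lost_many st2 w
          then remove_edges {e. w \<in> e} (st2\<lparr>anchors := anchors st2 - {w}\<rparr>)
          else st2)))"

lemma clean_eq: "clean u st = fold_pmf (check_anchor u) (enum (anchor_nbrs st u)) st"
  by (simp add: clean_def check_anchor_def[abs_def] Let_def)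

lemma check_anchor_sure:
  assumes "proper G st" "s' \<in> set_pmf (check_anchor u w st)"
  shows "proper G s' \<and> sol_graph s' \<subseteq> sol_graph st \<and> anchors s' \<subseteq> anchors st \<and>
    work s' = work st + clean_cost"
proof -
  from assms(2) obtain a hv where s': "s' = (let st1 = tick (agreement_cost + heavy_cost + 1) st;
       st2 = (if a \<and> hv then st1 else remove_edges {{w, u}} st1)
       in if lost_many st2 w
          then remove_edges {e. w \<in> e} (st2\<lparr>anchors := anchors st2 - {w}\<rparr>)
          else st2)"
    by (auto simp only: check_anchor_def set_bind_pmf set_return_pmf Let_def)
  define st2 where "st2 = (if a \<and> hv then tick clean_cost st else remove_edges {{w, u}} (tick clean_cost st))"
  have 2: "proper G st2" "sol_graph st2 \<subseteq> sol_graph st" "anchors st2 \<subseteq> anchors st" "work st2 = work st + clean_cost"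
    using assms(1) by (auto simp: st2_def proper_def)
  have 3: "proper G (remove_edges {e. w \<in> e} (st2\<lparr>anchors := anchors st2 - {w}\<rparr>))"
    using 2(1) unfolding proper_def by (simp add: remove_edges_def) blast
  have "s' = (if lost_many st2 w then remove_edges {e. w \<in> e} (st2\<lparr>anchors := anchors st2 - {w}\<rparr>) else st2)"
    unfolding s' st2_def Let_def by (rule refl)
  moreover have "sol_graph (remove_edges {e. w \<in> e} (st2\<lparr>anchors := anchors st2 - {w}\<rparr>)) \<subseteq> sol_graph st2"
    "anchors (remove_edges {e. w \<in> e} (st2\<lparr>anchors := anchors st2 - {w}\<rparr>)) \<subseteq> anchors st2"
    by auto
  ultimately show ?thesis using 2 3 by (cases "lost_many st2 w") auto
qed

lemma clean_sure:
  assumes b: "proper G b" and st: "st \<in> set_pmf (clean u b)"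
  shows "proper G st" "sol_graph st \<subseteq> sol_graph b" "anchors st \<subseteq> anchors b"
    "work st = work b + real (card (anchor_nbrs b u)) * clean_cost"
proof -
  define P where "P xs s \<longleftrightarrow> proper G s \<and> sol_graph s \<subseteq> sol_graph b \<and> anchors s \<subseteq> anchors b \<and>
    work s + real (length xs) * clean_cost = work b + real (card (anchor_nbrs b u)) * clean_cost"
    for s and xs :: "node list"
  have "P [] st"
    using st[unfolded clean_eq]
  proof (rule fold_pmf_invariant_list[where P = P], goal_cases)
    case 1 then show ?case using b by (simp add: P_def)
  next
    case (2 x xs s s')
    then show ?case using check_anchor_sure[of s s' u x] unfolding P_def by (auto simp: algebra_simps)
  qed
  then show "proper G st" "sol_graph st \<subseteq> sol_graph b" "anchors st \<subseteq> anchors b"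
    "work st = work b + real (card (anchor_nbrs b u)) * clean_cost"
    by (auto simp: P_def)
qed

text \<open>A bad edge survives its check with probability at most \<open>test_error\<close>, and at
  most \<open>n\<close> anchors are checked. Later checks only delete edges and anchors, so they
  cannot spoil an earlier one.\<close>

lemma clean_sound:
  assumes b: "proper G b"
  shows "fail_prob (clean u b) (\<lambda>st. \<forall>v\<in>anchors st. {u, v} \<in> sol_graph st \<longrightarrow> good_edge G u v)
    \<le> of_nat n * test_error"
proof -
  define P where "P xs s \<longleftrightarrow> proper G s \<and>
    (\<forall>v\<in>anchors s. {u, v} \<in> sol_graph s \<longrightarrow> v \<notin> set xs \<longrightarrow> good_edge G u v)"
    for s and xs :: "node list"
  have "fail_prob (clean u b) (P []) \<le> of_nat (length (enum (anchor_nbrs b u))) * test_error"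
    unfolding clean_eq
  proof (rule fail_prob_fold_list, goal_cases)
    case 1
    have "set (enum (anchor_nbrs b u)) = anchor_nbrs b u" using b by simp
    then show ?case using b unfolding P_def by (simp add: anchor_nbrs_def nbrs_def)
  next
    case (2 w xs s)
    then have s: "proper G s" and old: "\<And>v. v \<in> anchors s \<Longrightarrow> {u, v} \<in> sol_graph s \<Longrightarrow> v \<notin> set xs \<Longrightarrow> v \<noteq> w \<Longrightarrow> good_edge G u v"
      by (auto simp: P_def)
    have c: "cur_graph s = G" using s by (simp add: proper_def)
    consider "{u, w} \<in> sol_graph s" "\<not> good_edge G w u" | "{u, w} \<notin> sol_graph s \<or> good_edge G w u" by blast
    then show ?case
    proof cases
      case 1
      then have "u \<in> N G w" using s by (auto simp: proper_def nbrs_def insert_commute)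
      then show ?thesis unfolding check_anchor_def c
      proof (rule both_tests_sound[OF fin_N _ 1(2)], goal_cases)
        case (1 a hv x)
        have "proper G x \<and> sol_graph x \<subseteq> sol_graph s - {{w, u}} \<and> anchors x \<subseteq> anchors s"
          using 1 s by (auto simp: Let_def proper_def split: if_splits)
        then show ?case using old unfolding P_def by (auto simp: insert_commute)
      qed
    next
      case 2
      have "fail_prob (check_anchor u w s) (P xs) = 0"
      proof (rule fail_prob_eq_0, goal_cases)
        case (1 x)
        from check_anchor_sure[OF s this] show ?case using old 2 good_edge_sym unfolding P_def by blast
      qed
      then show ?thesis by simp
    qed
  qed
  also have "\<dots> \<le> of_nat n * test_error"
    using card_anchor_nbrs_le[OF b] b by (intro mult_right_mono) auto
  finally show ?thesis by (rule order_trans[rotated]) (intro fail_prob_mono, simp add: P_def)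
qed

section \<open>Anchor: sampling an anchor and adding its edges\<close>

definition add_loop :: "node \<Rightarrow> node list \<Rightarrow> state \<Rightarrow> state pmf" where
  "add_loop u = fold_pmf (\<lambda>v st. map_pmf (\<lambda>a. (if a then add_edge u v else id)
                 (tick (agreement_cost + 1) st)) (agreement G u v))"

lemma add_loop_sure:
  assumes "st' \<in> set_pmf (add_loop u vs st)"
  shows "anchors st' = anchors st" "cur_graph st' = cur_graph st"
    "sol_graph st \<subseteq> sol_graph st'" "sol_graph st' \<subseteq> sol_graph st \<union> (\<lambda>v. {u, v}) ` set vs"
    "work st' \<le> work st + real (length vs) * (agreement_cost + 3)"
proof -
  define P where "P xs s \<longleftrightarrow> set xs \<subseteq> set vs \<and> anchors s = anchors st \<and> cur_graph s = cur_graph st \<and> sol_graph st \<subseteq> sol_graph s \<and>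
    sol_graph s \<subseteq> sol_graph st \<union> (\<lambda>v. {u, v}) ` set vs \<and>
    work s + real (length xs) * (agreement_cost + 3) \<le> work st + real (length vs) * (agreement_cost + 3)"
    for s and xs :: "node list"
  have "P [] st'"
    using assms[unfolded add_loop_def]
  proof (rule fold_pmf_invariant_list[where P = P], goal_cases)
    case 1 then show ?case by (simp add: P_def)
  next
    case (2 x xs s s')
    then show ?case unfolding P_def by (auto simp: algebra_simps split: if_splits)
  qed
  then show "anchors st' = anchors st" "cur_graph st' = cur_graph st"
    "sol_graph st \<subseteq> sol_graph st'" "sol_graph st' \<subseteq> sol_graph st \<union> (\<lambda>v. {u, v}) ` set vs"
    "work st' \<le> work st + real (length vs) * (agreement_cost + 3)"
    by (auto simp: P_def)
qed

lemma add_loop_sound: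
  assumes st: "good_at G u st" and vs: "set vs \<subseteq> N G u" and h: "mostly_agreeing G u"
  shows "fail_prob (add_loop u vs st) (good_at G u) \<le> of_nat (length vs) * test_error"
  unfolding add_loop_def
proof (rule fail_prob_fold[where P = "good_at G u", OF st])
  fix v s assume v: "v \<in> set vs" and s: "good_at G u s"
  have vN: "v \<in> N G u" using v vs by blast
  have eq: "good_at G u ((if a then add_edge u v else id) (tick (agreement_cost + 1) s)) \<longleftrightarrow> (a \<longrightarrow> good_edge G u v)" for a
    using s by (auto simp: good_at_def doubleton_eq_iff)
  show "fail_prob (map_pmf (\<lambda>a. (if a then add_edge u v else id) (tick (agreement_cost + 1) s)) (agreement G u v)) (good_at G u) \<le> test_error"
  proof (cases "good_edge G u v")
    case True
    then show ?thesis unfolding fail_prob_map eq by (subst fail_prob_eq_0) auto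
  next
    case False
    then have "\<not> agrees G u v" using good_edgeI[OF vN _ h] by auto
    moreover have "N G u \<noteq> {}" "N G v \<noteq> {}" using vN N_sym by blast+
    ultimately show ?thesis
      using agreement_sound[of G u v] False unfolding fail_prob_map eq by (simp add: fail_prob_def)
  qed
qed

definition anchor_start :: "node \<Rightarrow> state \<Rightarrow> state" where
  "anchor_start u st = tick (qcost + heavy_cost + 1) (if u \<in> anchors st
       then remove_edges {{u, v} |v. v \<notin> anchors st} (tick (real (card (anchor_nbrs st u))) st)
       else st)"

lemma anchor_eq:
  assumes "cur_graph st = G"
  shows "anchor u st = bernoulli_pmf (anchor_prob G u) \<bind> (\<lambda>X. heavy G u \<bind> (\<lambda>hv.
     if hv \<and> X then listing_cost (deg G u) \<bind> (\<lambda>c. add_loop u (enum (N G u)) (tick c (anchor_start u st)) \<bind>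
       (\<lambda>st3. return_pmf (X, st3))) else return_pmf (X, anchor_start u st)))"
  using assms by (simp add: anchor_def Let_def anchor_start_def add_loop_def cong: if_cong)

lemma anchor_start_simps [simp]:
  "anchors (anchor_start u st) = anchors st" "cur_graph (anchor_start u st) = cur_graph st"
  by (auto simp: anchor_start_def)

lemma anchor_start_subset: "sol_graph (anchor_start u st) \<subseteq> sol_graph st"
  by (auto simp: anchor_start_def)

lemma work_anchor_start:
  "work (anchor_start u st) \<le> work st + real (card (anchor_nbrs st u)) + qcost + heavy_cost + 1"
  by (auto simp: anchor_start_def)

text \<open>If \<open>u\<close> is an anchor, its edges to other nodes than anchors have just been
  removed; if it is not, \<open>proper\<close> puts an anchor at the other end. So every surviving
  edge at \<open>u\<close> is of the kind that Clean has checked.\<close>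

lemma anchor_start_other_end:
  assumes st: "proper G st" and e: "{u, v} \<in> sol_graph (anchor_start u st)"
  shows "v \<in> anchors st"
proof -
  have "{u, v} \<in> sol_graph st" using e anchor_start_subset by blast
  then have "{u, v} \<inter> anchors st \<noteq> {}" using st by (auto simp: proper_def)
  then show ?thesis using e by (cases "u \<in> anchors st") (auto simp: anchor_start_def)
qed

lemma anchor_casesE:
  assumes "proper G st" and "(X, st') \<in> set_pmf (anchor u st)"
  obtains "st' = anchor_start u st"
  | c where "X" "st' \<in> set_pmf (add_loop u (enum (N G u)) (tick c (anchor_start u st)))"
proof -
  have c: "cur_graph st = G" using assms(1) by (simp add: proper_def)
  show thesis using assms(2) that unfolding anchor_eq[OF c] by (auto split: if_splits)
qed

lemma anchor_sol_graph:
  assumes st: "proper G st" and r: "(X, st') \<in> set_pmf (anchor u st)"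
  shows "anchors st' = anchors st" "cur_graph st' = G"
    "sol_graph st' \<subseteq> sol_graph (anchor_start u st) \<union> (if X then (\<lambda>v. {u, v}) ` N G u else {})"
proof -
  have c: "cur_graph st = G" using st by (simp add: proper_def)
  from st r have "anchors st' = anchors st \<and> cur_graph st' = cur_graph st \<and>
    sol_graph st' \<subseteq> sol_graph (anchor_start u st) \<union> (if X then (\<lambda>v. {u, v}) ` N G u else {})"
  proof (cases rule: anchor_casesE)
    case 1
    then show ?thesis by auto
  next
    case (2 c')
    from add_loop_sure[OF 2(2)] 2(1) show ?thesis by auto
  qed
  then show "anchors st' = anchors st" "cur_graph st' = G"
    "sol_graph st' \<subseteq> sol_graph (anchor_start u st) \<union> (if X then (\<lambda>v. {u, v}) ` N G u else {})"
    using c by auto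
qed

lemma anchor_sure:
  assumes st: "proper G st" and r: "(X, st') \<in> set_pmf (anchor u st)"
  shows "anchors st' = anchors st" "cur_graph st' = G" "sol_graph st' \<subseteq> edges G"
    "\<And>e. e \<in> sol_graph st' \<Longrightarrow> u \<notin> e \<Longrightarrow> e \<in> sol_graph st"
    "\<And>e. e \<in> sol_graph st' \<Longrightarrow> e \<inter> anchors st \<noteq> {} \<or> X \<and> u \<in> e"
    "\<And>v. {u, v} \<in> sol_graph st' \<Longrightarrow> v \<in> anchors st \<or> X"
proof -
  have c: "cur_graph st = G" and sol: "sol_graph st \<subseteq> edges G" using st by (auto simp: proper_def)
  show "anchors st' = anchors st" "cur_graph st' = G" by (fact anchor_sol_graph[OF st r])+
  have s: "e \<in> sol_graph (anchor_start u st) \<or> X \<and> (\<exists>v\<in>N G u. e = {u, v})" if "e \<in> sol_graph st'" for e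
    using subsetD[OF anchor_sol_graph(3)[OF st r] that] by (cases X) auto
  have s1: "e \<in> sol_graph st \<or> X \<and> (\<exists>v\<in>N G u. e = {u, v})" if "e \<in> sol_graph st'" for e
    using s[OF that] anchor_start_subset[of u st] by blast
  show "sol_graph st' \<subseteq> edges G" using s1 sol by (auto simp: nbrs_def)
  fix e assume e: "e \<in> sol_graph st'"
  show "e \<in> sol_graph st" if "u \<notin> e" using s1[OF e] that by auto
  show "e \<inter> anchors st \<noteq> {} \<or> X \<and> u \<in> e"
    using s1[OF e] st unfolding proper_def by blast
next
  fix v assume e: "{u, v} \<in> sol_graph st'"
  have "{u, v} \<in> sol_graph (anchor_start u st) \<or> X"
    using subsetD[OF anchor_sol_graph(3)[OF st r] e] by (cases X) auto
  then show "v \<in> anchors st \<or> X" using anchor_start_other_end[OF st, of u v] by blast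
qed

text \<open>The heaviness of \<open>u\<close> is tested once for all new edges, and each new edge
  has an agreement test of its own; this is the count \<open>Suc n\<close>.\<close>

lemma anchor_sound:
  assumes st: "proper G st" and g: "\<forall>v\<in>anchors st. {u, v} \<in> sol_graph st \<longrightarrow> good_edge G u v"
  shows "fail_prob (anchor u st) (\<lambda>(X, st'). good_at G u st') \<le> of_nat (Suc n) * test_error"
proof -
  have c: "cur_graph st = G" using st by (auto simp: proper_def)
  have start: "good_at G u (tick x (anchor_start u st))" "good_at G u (anchor_start u st)" for x
    using anchor_start_other_end[OF st, of u] g anchor_start_subset[of u st]
    unfolding good_at_def sol_graph_simps by blast+
  \<comment> \<open>An isolated node draws no sample and always passes the heaviness test. It is
    exempted here and gets no edges.\<close>
  have "fail_prob (heavy G u) (\<lambda>hv. hv \<longrightarrow> mostly_agreeing G u \<or> N G u = {}) \<le> test_error"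
    using heavy_sound[of G u] by (cases "mostly_agreeing G u \<or> N G u = {}") (auto simp: fail_prob_def)
  note hv = this
  have "fail_prob (anchor u st) (\<lambda>(X, st'). good_at G u st') \<le> test_error + of_nat n * test_error"
    unfolding anchor_eq[OF c]
  proof (intro fail_prob_bind_sure[where p = "bernoulli_pmf _"] fail_prob_bind[OF hv], goal_cases)
    case (1 X hv)
    show ?case
    proof (cases "hv \<and> X")
      case True
      have "fail_prob (add_loop u (enum (N G u)) (tick c' (anchor_start u st))) (good_at G u) \<le> of_nat (deg G u) * test_error" for c'
      proof (cases "N G u = {}")
        case True
        have "enum {} = []" using set_enum[of "{}"] by (metis finite.emptyI set_empty)
        then show ?thesis using start True by (simp add: add_loop_def)
      next
        case False
        then show ?thesis using add_loop_sound[OF start(1), of "enum (N G u)" c'] 1 True by auto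
      qed
      also have "of_nat (deg G u) * test_error \<le> of_nat n * test_error"
        using deg_le_n[of u] by (intro mult_right_mono) auto
      finally have "fail_prob (listing_cost (deg G u) \<bind> (\<lambda>c. add_loop u (enum (N G u)) (tick c (anchor_start u st)) \<bind>
       (\<lambda>st3. return_pmf (X, st3)))) (\<lambda>(X, st'). good_at G u st') \<le> of_nat n * test_error"
        by (intro fail_prob_bind_sure[where p = "listing_cost _"]) (simp add: map_pmf_def[symmetric])
      then show ?thesis using True by simp
    next
      case False
      then show ?thesis using start by auto
    qed
  qed
  then show ?thesis by (simp add: distrib_right)
qed

section \<open>Connect: attaching a node to anchors near its neighbours\<close>

abbreviation connect_cost :: real where
  "connect_cost \<equiv> heavy_cost + agreement_cost + qcost + 1"

definition check_candidate :: "node \<Rightarrow> node \<Rightarrow> state \<Rightarrow> state pmf" where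
  "check_candidate u r st = do {
     hv \<leftarrow> heavy G r;
     a \<leftarrow> agreement G r u;
     let st1 = tick (heavy_cost + agreement_cost + qcost + 1) st;
     return_pmf (if hv \<and> a \<and> r \<in> N G u then add_edge r u st1 else st1)
   }"

definition connect_loop :: "node \<Rightarrow> node list \<Rightarrow> state \<Rightarrow> state pmf" where
  "connect_loop u = fold_pmf (\<lambda>w st. fold_pmf (check_candidate u) (enum (anchor_nbrs st w)) (tick 1 st))"

lemma connect_eq:
  assumes "cur_graph st = G"
  shows "connect u st = random_nbrs G u (samples (10^5)) \<bind>
    (\<lambda>ws. connect_loop u ws (tick (real (samples (10^5)) * qcost + 1) st))"
  using assms by (simp add: connect_def Let_def connect_loop_def check_candidate_def[abs_def])

definition connecting :: "node \<Rightarrow> state \<Rightarrow> state \<Rightarrow> bool" where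
  "connecting u b st \<longleftrightarrow> cur_graph st = G \<and> anchors st = anchors b \<and> sol_graph b \<subseteq> sol_graph st \<and>
     sol_graph st \<subseteq> sol_graph b \<union> {{r, u} |r. r \<in> anchors b \<inter> N G u}"

text \<open>Connect adds edges at \<open>u\<close> only. For a sampled \<open>w\<close> other than
  \<open>u\<close> these enlarge the set of adjacent anchors at most by \<open>u\<close>, so the
  cost of every sample is governed by the sets before the loop.\<close>

lemma connecting_anchor_nbrs:
  assumes "connecting u b st" "w \<noteq> u"
  shows "anchor_nbrs st w \<subseteq> insert u (anchor_nbrs b w)"
proof
  fix x assume "x \<in> anchor_nbrs st w"
  then have "x \<in> anchors b" "{w, x} \<in> sol_graph st"
    using assms by (auto simp: anchor_nbrs_def nbrs_def connecting_def)
  then consider "{w, x} \<in> sol_graph b" | r where "{w, x} = {r, u}" using assms by (auto simp: connecting_def)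
  then show "x \<in> insert u (anchor_nbrs b w)"
    using \<open>x \<in> anchors b\<close> assms(2) by cases (auto simp: anchor_nbrs_def nbrs_def doubleton_eq_iff)
qed

lemma connect_inner_sure:
  assumes b: "connecting u b st" and rs: "set rs \<subseteq> anchors b"
    and st': "st' \<in> set_pmf (fold_pmf (check_candidate u) rs st)"
  shows "connecting u b st' \<and> work st' \<le> work st + real (length rs) * (connect_cost + 2)"
proof -
  define P where "P xs s \<longleftrightarrow> set xs \<subseteq> anchors b \<and> connecting u b s \<and>
    work s + real (length xs) * (connect_cost + 2) \<le> work st + real (length rs) * (connect_cost + 2)"
    for s and xs :: "node list"
  have "P [] st'"
    using st'
  proof (rule fold_pmf_invariant_list[where P = P], goal_cases)
    case 1 then show ?case using b rs by (simp add: P_def)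
  next
    case (2 x xs s s')
    then have xs: "x \<in> anchors b" "set xs \<subseteq> anchors b" and s: "connecting u b s"
      and w: "work s + real (length (x # xs)) * (connect_cost + 2) \<le> work st + real (length rs) * (connect_cost + 2)"
      by (auto simp: P_def)
    from 2(2) obtain hv a where "s' = (if hv \<and> a \<and> x \<in> N G u then add_edge x u (tick connect_cost s) else tick connect_cost s)"
      by (auto simp: check_candidate_def Let_def)
    then have "connecting u b s' \<and> work s' \<le> work s + (connect_cost + 2)"
      using s xs by (auto simp: connecting_def)
    then show ?case using xs w unfolding P_def by (auto simp: algebra_simps)
  qed
  then show ?thesis by (auto simp: P_def)
qed

lemma connect_loop_sure:
  assumes b: "connecting u b st" "finite (anchors b)" and ws: "set ws \<subseteq> N G u"
    and st': "st' \<in> set_pmf (connect_loop u ws st)"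
  shows "connecting u b st'"
    "work st' \<le> work st + (\<Sum>w\<leftarrow>ws. 1 + (1 + real (card (anchor_nbrs b w))) * (connect_cost + 2))"
proof -
  let ?c = "connect_cost + 2"
  have c: "0 \<le> ?c" using qcost_nonneg heavy_cost_nonneg agreement_cost_nonneg by simp
  define \<phi> where "\<phi> w = 1 + (1 + real (card (anchor_nbrs b w))) * ?c" for w
  define P where "P xs s \<longleftrightarrow> set xs \<subseteq> N G u \<and> connecting u b s \<and>
    work s + sum_list (map \<phi> xs) \<le> work st + sum_list (map \<phi> ws)"
    for s and xs :: "node list"
  have "P [] st'"
    using st'[unfolded connect_loop_def]
  proof (rule fold_pmf_invariant_list[where P = P], goal_cases)
    case 1 then show ?case using b ws by (simp add: P_def)
  next
    case (2 w xs s s')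
    then have s: "connecting u b s" and w: "w \<in> N G u" by (auto simp: P_def)
    have fin: "finite (anchor_nbrs b w)" "finite (anchor_nbrs s w)"
      using b s by (auto simp: anchor_nbrs_def connecting_def)
    have "card (anchor_nbrs s w) \<le> card (insert u (anchor_nbrs b w))"
      using connecting_anchor_nbrs[OF s] N_neq[OF w] fin by (intro card_mono) auto
    also have "\<dots> \<le> Suc (card (anchor_nbrs b w))" by (rule card_insert_le_m1) auto
    finally have k: "real (card (anchor_nbrs s w)) * ?c \<le> (1 + real (card (anchor_nbrs b w))) * ?c"
      using c by (intro mult_right_mono) auto
    have t: "connecting u b (tick 1 s)" using s by (simp add: connecting_def)
    have "set (enum (anchor_nbrs s w)) \<subseteq> anchors b"
      using s fin by (auto simp: anchor_nbrs_def connecting_def)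
    from connect_inner_sure[OF t this 2(2)] have "connecting u b s' \<and> work s' \<le> work s + \<phi> w"
      using k fin by (auto simp: \<phi>_def)
    then show ?case using 2(1) unfolding P_def by auto
  qed
  moreover have "\<phi> = (\<lambda>w. 1 + (1 + real (card (anchor_nbrs b w))) * ?c)"
    by (simp add: \<phi>_def fun_eq_iff)
  ultimately show "connecting u b st'"
    "work st' \<le> work st + (\<Sum>w\<leftarrow>ws. 1 + (1 + real (card (anchor_nbrs b w))) * ?c)"
    unfolding P_def by simp_all
qed

lemma connect_loop_sound:
  assumes g: "good_at G u st" and b: "connecting u b st" "finite (anchors b)" "card (anchors b) \<le> n"
  shows "fail_prob (connect_loop u ws st) (good_at G u) \<le> of_nat (length ws) * (of_nat n * test_error)"
proof -
  define P where "P s \<longleftrightarrow> good_at G u s \<and> connecting u b s" for s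
  have "fail_prob (connect_loop u ws st) P \<le> of_nat (length ws) * (of_nat n * test_error)"
    unfolding connect_loop_def
  proof (rule fail_prob_fold, goal_cases)
    case 1 then show ?case using g b by (simp add: P_def)
  next
    case (2 w s)
    let ?rs = "enum (anchor_nbrs s w)"
    have sub: "anchor_nbrs s w \<subseteq> anchors b" using 2 by (auto simp: P_def anchor_nbrs_def connecting_def)
    have fin: "finite (anchor_nbrs s w)" using sub b(2) finite_subset by blast
    have len: "length ?rs \<le> n" using card_mono[OF b(2) sub] b(3) fin by simp
    define Q where "Q = (\<lambda>s. good_at G u s \<and> connecting u b s)"
    have PQ: "P = Q" by (simp add: fun_eq_iff P_def Q_def)
    have "fail_prob (fold_pmf (check_candidate u) ?rs (tick 1 s)) Q \<le> of_nat (length ?rs) * test_error"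
    proof (rule fail_prob_fold, goal_cases)
      case 1
      then show ?case using 2 by (simp add: PQ Q_def good_at_def connecting_def)
    next
      case (2 r s1)
      let ?f = "\<lambda>a hv. return_pmf (if hv \<and> a \<and> r \<in> N G u
           then add_edge r u (tick (heavy_cost + agreement_cost + qcost + 1) s1)
           else tick (heavy_cost + agreement_cost + qcost + 1) s1)"
      have r: "r \<in> anchors b" using 2 sub fin by auto
      have same: "Q (tick c s1)" for c using 2 by (simp add: Q_def good_at_def connecting_def)
      have new: "Q (add_edge r u (tick c s1))" if "r \<in> N G u" "good_edge G r u" for c
        using 2 that r good_edge_sym
        by (auto simp: Q_def good_at_def connecting_def doubleton_eq_iff insert_commute)
      \<comment> \<open>Connect draws the heaviness test first, \<open>both_tests_sound\<close> the
        agreement test; the two draws are independent.\<close>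
      have comm: "heavy G r \<bind> (\<lambda>hv. agreement G r u \<bind> (\<lambda>a. ?f a hv)) =
         agreement G r u \<bind> (\<lambda>a. heavy G r \<bind> (\<lambda>hv. ?f a hv))"
        by (rule bind_commute_pmf)
      show ?case
      proof (cases "r \<in> N G u \<and> \<not> good_edge G r u")
        case True
        then have "u \<in> N G r" using N_sym by blast
        then have "fail_prob (agreement G r u \<bind> (\<lambda>a. heavy G r \<bind> (\<lambda>hv. ?f a hv))) Q \<le> test_error"
          by (rule both_tests_sound[OF fin_N]) (use True same in auto)
        then show ?thesis unfolding check_candidate_def Let_def comm .
      next
        case False
        have "fail_prob (heavy G r \<bind> (\<lambda>hv. agreement G r u \<bind> (\<lambda>a. ?f a hv))) Q = 0"
          by (rule fail_prob_eq_0) (use False same new in auto)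
        then show ?thesis by (simp add: check_candidate_def Let_def)
      qed
    qed
    also have "\<dots> \<le> of_nat n * test_error" using len by (intro mult_right_mono) auto
    finally show ?case by (simp only: PQ)
  qed
  then show ?thesis by (rule order_trans[rotated]) (intro fail_prob_mono, simp add: P_def)
qed

lemma random_nbrs_sure:
  assumes "ws \<in> set_pmf (random_nbrs G u k)"
  shows "set ws \<subseteq> N G u" "length ws \<le> k"
  using assms by (auto simp: random_nbrs_def set_replicate_pmf split: if_splits)

section \<open>Composition of Clean, Anchor and Connect\<close>

definition finish :: "node \<Rightarrow> bool \<Rightarrow> state \<Rightarrow> state" where
  "finish u X st = (if X then tick (real (card (nbrs (sol_graph st) u)) + 1)
            (st\<lparr>anchors := insert u (anchors st), entry_nbrs := (entry_nbrs st)(u := nbrs (sol_graph st) u)\<rparr>)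
        else tick 1 (st\<lparr>anchors := anchors st - {u}\<rparr>))"

lemma finish_simps [simp]:
  "sol_graph (finish u X st) = sol_graph st" "cur_graph (finish u X st) = cur_graph st"
  "anchors (finish u X st) = (if X then insert u (anchors st) else anchors st - {u})"
  "work (finish u X st) = work st + (if X then real (card (nbrs (sol_graph st) u)) + 1 else 1)"
  by (simp_all add: finish_def)

lemma process_eq:
  "process u b = clean u (tick 1 b) \<bind> (\<lambda>st1. anchor u st1 \<bind> (\<lambda>(X, st2).
     map_pmf (finish u X) (connect u st2)))"
  unfolding process_def map_pmf_def Let_def finish_def by (intro bind_pmf_cong[OF refl]) (auto intro!: bind_pmf_cong)

lemma connecting_refl: "cur_graph b = G \<Longrightarrow> connecting u b (tick c b)"
  by (auto simp: connecting_def)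

lemma proper_tick [simp]: "proper G (tick c b) \<longleftrightarrow> proper G b"
  by (simp add: proper_def)

text \<open>The second claim is the locality on which the analysis of edges rests: processing
  \<open>u\<close> creates no edge away from \<open>u\<close>, so every edge was last tested when
  one of its ends was last processed.\<close>

lemma process_sure:
  assumes b: "proper G b" and u: "u \<in> verts G" and st: "st \<in> set_pmf (process u b)"
  shows "proper G st" "\<And>e. e \<in> sol_graph st \<Longrightarrow> u \<notin> e \<Longrightarrow> e \<in> sol_graph b"
    "anchors st \<subseteq> insert u (anchors b)"
proof -
  obtain st1 X st2 ws st3 where 1: "st1 \<in> set_pmf (clean u (tick 1 b))"
    and 2: "(X, st2) \<in> set_pmf (anchor u st1)"
    and 30: "st3 \<in> set_pmf (connect u st2)"
    and 4: "st = finish u X st3"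
    using st unfolding process_eq by auto
  have bt: "proper G (tick 1 b)" using b by simp
  note s1 = clean_sure[OF bt 1] and s2 = anchor_sure[OF clean_sure(1)[OF bt 1] 2]
  obtain ws where ws: "ws \<in> set_pmf (random_nbrs G u (samples (10^5)))"
    and 3: "st3 \<in> set_pmf (connect_loop u ws (tick (real (samples (10^5)) * qcost + 1) st2))"
    using 30 unfolding connect_eq[OF s2(2)] by auto
  have fin: "finite (anchors st2)" using s1(1) s2(1) unfolding proper_def by (metis fin_verts finite_subset)
  have s3: "connecting u st2 st3"
    by (rule connect_loop_sure(1)[OF connecting_refl[OF s2(2)] fin random_nbrs_sure(1)[OF ws] 3])
  have a3: "anchors st3 = anchors st1" and sol3: "sol_graph st3 \<subseteq> sol_graph st2 \<union> {{r, u} |r. r \<in> anchors st1 \<inter> N G u}"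
    using s3 s2(1) by (auto simp: connecting_def)
  have edges3: "sol_graph st3 \<subseteq> edges G"
    using sol3 s2(3) by (auto simp: nbrs_def insert_commute)
  have other: "e \<inter> anchors st1 \<noteq> {} \<or> X \<and> u \<in> e" if "e \<in> sol_graph st3" for e
    using that sol3 s2(5)[of e] by auto
  \<comment> \<open>When \<open>u\<close> ceases to be an anchor, its edges must still have one at
    the other end: those left by Anchor because \<open>X\<close> is false, the new ones because
    Connect attaches \<open>u\<close> to anchors.\<close>
  have nu: "e \<inter> (anchors st1 - {u}) \<noteq> {}" if "e \<in> sol_graph st3" "\<not> X" for e
  proof (cases "u \<in> e")
    case True
    from that sol3 consider "e \<in> sol_graph st2" | r where "e = {r, u}" "r \<in> anchors st1 \<inter> N G u" by auto
    then show ?thesis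
    proof cases
      case 1
      then obtain v where "e = {u, v}" "v \<noteq> u" using edge_at[OF _ True] s2(3) by blast
      then show ?thesis using s2(6)[of v] 1 that by auto
    next
      case 2
      then show ?thesis using N_neq[of r u] by auto
    qed
  next
    case False
    then show ?thesis using other[OF that(1)] that(2) by auto
  qed
  show "proper G st"
    using 4 edges3 a3 s1(1) s3 other nu u unfolding proper_def connecting_def by (cases X) auto
  show "anchors st \<subseteq> insert u (anchors b)" using 4 a3 s1(3) by (auto split: if_splits)
  show "e \<in> sol_graph b" if "e \<in> sol_graph st" "u \<notin> e" for e
    using 4 that sol3 s2(4)[of e] s1(2) by (auto split: if_splits)
qed

text \<open>Terms of a union bound: \<open>n\<close> for Clean, \<open>n + 1\<close> for Anchor, and
  \<open>n\<close> for each of the \<open>samples (10^5)\<close> neighbours visited by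
  Connect.\<close>

definition process_error :: ennreal where
  "process_error = of_nat (2 * n + 1 + samples (10^5) * n) * test_error"

lemma connect_sound:
  assumes st1: "proper G st1" and r: "(X, st2) \<in> set_pmf (anchor u st1)" and g: "good_at G u st2"
  shows "fail_prob (connect u st2) (good_at G u) \<le> of_nat (samples (10^5)) * (of_nat n * test_error)"
proof -
  note s2 = anchor_sure[OF st1 r]
  have sub: "anchors st2 \<subseteq> verts G" using st1 s2(1) by (simp add: proper_def)
  have fin: "finite (anchors st2)" "card (anchors st2) \<le> n"
    using card_verts card_mono[OF fin_verts sub] finite_subset[OF sub fin_verts] by auto
  show ?thesis
    unfolding connect_eq[OF s2(2)]
  proof (rule fail_prob_bind_sure)
    fix ws assume ws: "ws \<in> set_pmf (random_nbrs G u (samples (10^5)))"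
    let ?st = "tick (real (samples (10 ^ 5)) * qcost + 1) st2"
    have "fail_prob (connect_loop u ws ?st) (good_at G u) \<le> of_nat (length ws) * (of_nat n * test_error)"
      by (rule connect_loop_sound[OF _ connecting_refl[OF s2(2)] fin]) (use g in \<open>simp add: good_at_def\<close>)
    also have "\<dots> \<le> of_nat (samples (10^5)) * (of_nat n * test_error)"
      using random_nbrs_sure(2)[OF ws] by (intro mult_right_mono) auto
    finally show "fail_prob (connect_loop u ws ?st) (good_at G u)
        \<le> of_nat (samples (10^5)) * (of_nat n * test_error)" .
  qed
qed

lemma process_sound:
  assumes b: "proper G b"
  shows "fail_prob (process u b) (good_at G u) \<le> process_error"
proof -
  let ?k = "samples (10^5)"
  have bt: "proper G (tick 1 b)" using b by simp
  have 1: "fail_prob (map_pmf (finish u X) (connect u st2)) (good_at G u) \<le> of_nat ?k * (of_nat n * test_error)"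
    if "proper G st1" "(X, st2) \<in> set_pmf (anchor u st1)" "good_at G u st2" for st1 st2 X
    using connect_sound[OF that] by (simp add: good_at_def[abs_def])
  have 2: "fail_prob (anchor u st1 \<bind> (\<lambda>(X, st2). map_pmf (finish u X) (connect u st2))) (good_at G u)
    \<le> of_nat (Suc n) * test_error + of_nat ?k * (of_nat n * test_error)"
    if "proper G st1" "\<forall>v\<in>anchors st1. {u, v} \<in> sol_graph st1 \<longrightarrow> good_edge G u v" for st1
    by (rule fail_prob_bind[OF anchor_sound[OF that]]) (use 1[OF that(1)] in auto)
  have "fail_prob (process u b) (good_at G u) \<le>
    of_nat n * test_error + (of_nat (Suc n) * test_error + of_nat ?k * (of_nat n * test_error))"
    unfolding process_eq
    by (rule fail_prob_bind[OF clean_sound[OF bt]]) (rule 2, auto intro: clean_sure(1)[OF bt])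
  also have "\<dots> = process_error"
    by (simp add: process_error_def algebra_simps flip: mult_2)
  finally show ?thesis .
qed

end

section \<open>Listing a neighbourhood by random queries\<close>

lemma ennreal_add_le: "ennreal (a + c) \<le> ennreal a + ennreal c"
  by (cases "0 \<le> a"; cases "0 \<le> c") (auto simp: ennreal_neg intro: ennreal_leI)

lemma nn_integral_geometric_pmf:
  assumes "0 < p" "p \<le> 1"
  shows "(\<integral>\<^sup>+g. ennreal (real g) \<partial>measure_pmf (geometric_pmf p)) = ennreal ((1 - p) / p)"
proof -
  have "(\<integral>\<^sup>+g. of_nat g \<partial>measure_pmf (geometric_pmf p)) = ennreal ((1 - p) / p)"
    using nn_integral_neg_binomial_pmf_real[of p 1] assms by simp
  then show ?thesis by (simp only: ennreal_of_nat_eq_real_of_nat)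
qed

lemma sum_inverse_le_log: "1 \<le> d \<Longrightarrow> (\<Sum>j=1..d. 1 / real j) \<le> 1 + ln (real d)"
proof (induction d rule: nat_induct_at_least)
  case (Suc d)
  have "ln (real d / real (Suc d)) \<le> real d / real (Suc d) - 1" using Suc by (intro ln_le_minus_one) auto
  also have "\<dots> = - (1 / real (Suc d))" by (simp add: field_simps)
  finally have "1 / real (Suc d) \<le> ln (real (Suc d)) - ln (real d)" using Suc by (simp add: ln_div)
  then show ?case using Suc by simp
qed simp

context dynamic_agreement_params
begin

text \<open>Coupon collection: with \<open>j\<close> of \<open>d\<close> neighbours missing, the
  next new one takes \<open>1 + (1 - p) / p\<close> queries on average for \<open>p = j / d\<close>,
  which is \<open>d / j\<close>.\<close>

lemma listing_fold:
  assumes "set js \<subseteq> {1..d}" "0 \<le> c"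
  shows "(\<integral>\<^sup>+c'. ennreal c' \<partial>measure_pmf (fold_pmf (\<lambda>j c. map_pmf (\<lambda>g. c + (real g + 1) * qcost)
      (geometric_pmf (real j / real d))) js c)) \<le> ennreal (c + (\<Sum>j\<leftarrow>js. qcost * (real d / real j)))"
  using assms
proof (induction js arbitrary: c)
  case (Cons j js)
  let ?p = "real j / real d" let ?S = "\<Sum>j\<leftarrow>js. qcost * (real d / real j)"
  have S: "0 \<le> ?S" using qcost_nonneg by (intro sum_list_nonneg) auto
  have p: "0 < ?p" "?p \<le> 1" using Cons.prems by auto
  have "(\<integral>\<^sup>+c'. ennreal c' \<partial>measure_pmf (fold_pmf (\<lambda>j c. map_pmf (\<lambda>g. c + (real g + 1) * qcost)
      (geometric_pmf (real j / real d))) (j # js) c)) \<le>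
      (\<integral>\<^sup>+g. ennreal ((c + (real g + 1) * qcost) + ?S) \<partial>measure_pmf (geometric_pmf ?p))"
    unfolding fold_pmf.simps nn_integral_bind_pmf nn_integral_map_pmf
    using Cons.prems qcost_nonneg by (intro nn_integral_mono Cons.IH) auto
  also have "\<dots> = (\<integral>\<^sup>+g. ennreal (c + qcost + ?S) + ennreal qcost * ennreal (real g) \<partial>measure_pmf (geometric_pmf ?p))"
    using Cons.prems qcost_nonneg S
    by (intro nn_integral_cong) (simp add: ennreal_mult[symmetric] ennreal_plus[symmetric] algebra_simps del: ennreal_plus)
  also have "\<dots> = ennreal (c + qcost + ?S) + ennreal qcost * ennreal ((1 - ?p) / ?p)"
    using nn_integral_geometric_pmf[OF p] by (simp add: nn_integral_pmf_add nn_integral_pmf_cmult)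
  also have "\<dots> = ennreal (c + qcost + ?S + qcost * ((1 - ?p) / ?p))"
    using Cons.prems qcost_nonneg S p
    by (subst ennreal_mult[symmetric]) (auto simp: ennreal_plus[symmetric] simp del: ennreal_plus)
  also have "c + qcost + ?S + qcost * ((1 - ?p) / ?p) = c + (\<Sum>j\<leftarrow>j # js. qcost * (real d / real j))"
  proof -
    have "0 < real j" "0 < real d" using Cons.prems(1) by auto
    then show ?thesis by (simp add: field_simps)
  qed
  finally show ?case .
qed simp

lemma listing_cost_le:
  assumes "d \<le> n"
  shows "(\<integral>\<^sup>+c. ennreal c \<partial>measure_pmf (listing_cost d)) \<le> ennreal (real d * (2 * qcost * log 2 (real n)))"
proof (cases "d = 0")
  case True
  then show ?thesis by (simp add: listing_cost_def)
next
  case False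
  have "(\<integral>\<^sup>+c. ennreal c \<partial>measure_pmf (listing_cost d)) \<le> ennreal (0 + (\<Sum>j\<leftarrow>[1..<Suc d]. qcost * (real d / real j)))"
    unfolding listing_cost_def by (rule listing_fold) auto
  also have "(\<Sum>j\<leftarrow>[1..<Suc d]. qcost * (real d / real j)) = qcost * real d * (\<Sum>j=1..d. 1 / real j)"
  proof -
    have "(\<Sum>j\<leftarrow>[1..<Suc d]. qcost * (real d / real j)) = (\<Sum>j\<in>{1..<Suc d}. qcost * (real d / real j))"
      by (simp only: interv_sum_list_conv_sum_set_nat set_upt)
    also have "{1..<Suc d} = {1..d}" by auto
    finally show ?thesis by (simp add: sum_distrib_left)
  qed
  also have "ennreal (0 + qcost * real d * (\<Sum>j=1..d. 1 / real j)) \<le> ennreal (qcost * real d * (2 * log 2 (real n)))"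
  proof -
    have "(\<Sum>j=1..d. 1 / real j) \<le> 1 + ln (real d)" using False by (intro sum_inverse_le_log) auto
    also have "ln (real d) \<le> ln (real n)" using False assms by simp
    also have "ln (real n) \<le> log 2 (real n)" by (rule ln_le_log2)
    finally have "(\<Sum>j=1..d. 1 / real j) \<le> 2 * log 2 (real n)" using log_n by simp
    then show ?thesis using qcost_nonneg by (intro ennreal_leI) (simp add: mult_left_mono)
  qed
  finally show ?thesis by (simp add: mult_ac)
qed

text \<open>A bound for degree times sampling probability. It is the reason why listing and adding
  all edges of a new anchor is affordable on average.\<close>

definition anchor_rate :: real where
  "anchor_rate = 10^7 * log 2 (real n) / eps"

lemma anchor_rate_ge_1: "1 \<le> anchor_rate"
proof -
  have "eps \<le> 10^7 * log 2 (real n)" using eps_small log_n by simp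
  then show ?thesis using eps_pos by (simp add: anchor_rate_def)
qed

lemma anchor_prob_bounds: "0 \<le> anchor_prob G u" "anchor_prob G u \<le> 1"
  "anchor_prob G u * real (deg G u) \<le> anchor_rate"
proof -
  have L: "0 \<le> anchor_rate" using anchor_rate_ge_1 by simp
  have eq: "anchor_prob G u = (if deg G u = 0 then 1 else min (anchor_rate / real (deg G u)) 1)"
    by (simp add: anchor_prob_def anchor_rate_def)
  show "0 \<le> anchor_prob G u" "anchor_prob G u \<le> 1" using L by (auto simp: eq)
  show "anchor_prob G u * real (deg G u) \<le> anchor_rate"
  proof (cases "deg G u = 0")
    case False
    have "min (anchor_rate / real (deg G u)) 1 * real (deg G u) \<le> (anchor_rate / real (deg G u)) * real (deg G u)"
      by (intro mult_right_mono) auto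
    then show ?thesis using False by (simp add: eq)
  qed (use L in simp)
qed

text \<open>Collected constants: \<open>process_const\<close> is paid for every processed node,
  \<open>process_factor\<close> for each anchor adjacent to the node and, on average, for each
  anchor adjacent to a neighbour of it.\<close>

definition process_const :: real where
  "process_const = 4 + (2 + real (samples (10^5))) * qcost + heavy_cost + anchor_rate * (2 * qcost * log 2 (real n) + agreement_cost + 4)
     + real (samples (10^5)) * (1 + 2 * (heavy_cost + agreement_cost + qcost + 3))"

definition process_factor :: real where
  "process_factor = agreement_cost + heavy_cost + 2 + real (samples (10^5)) * (heavy_cost + agreement_cost + qcost + 3)"

end

section \<open>Expected work of processing a node\<close>

context graph_params
begin

text \<open>The extra term reserves \<open>deg G u\<close> when \<open>u\<close> is chosen, to pay
  for copying its neighbours at the end of \<open>process\<close>. All terms proportional to the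
  degree are charged whenever \<open>X\<close> holds, whatever the heaviness test says, and hence
  occur multiplied by \<open>anchor_prob\<close>.\<close>

lemma anchor_work:
  assumes st: "proper G st"
  shows "(\<integral>\<^sup>+(X, st'). ennreal (work st') + ennreal (if X then real (deg G u) else 0) \<partial>measure_pmf (anchor u st))
    \<le> ennreal (work st) + ennreal (real (card (anchor_nbrs st u)) + qcost + heavy_cost + 1 +
         anchor_rate * (2 * qcost * log 2 (real n) + agreement_cost + 4))"
proof -
  let ?d = "real (deg G u)" let ?e = "2 * qcost * log 2 (real n) + agreement_cost + 4"
  let ?b = "real (card (anchor_nbrs st u)) + qcost + heavy_cost + 1"
  let ?s = "anchor_start u st" let ?p = "anchor_prob G u"
  have c: "cur_graph st = G" using st by (simp add: proper_def)
  have e: "0 \<le> ?e" using qcost_nonneg agreement_cost_nonneg log_n by simp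
  have b: "0 \<le> ?b" using qcost_nonneg heavy_cost_nonneg by simp
  have s: "work ?s \<le> work st + ?b" using work_anchor_start[of u st] by simp
  define f where "f X = ?b + (if X then ?d * ?e else 0)" for X
  have inner: "(\<integral>\<^sup>+(X, st'). ennreal (work st') + ennreal (if X then ?d else 0) \<partial>measure_pmf
    (if hv \<and> X then listing_cost (deg G u) \<bind> (\<lambda>c. add_loop u (enum (N G u)) (tick c ?s) \<bind>
       (\<lambda>st3. return_pmf (X, st3))) else return_pmf (X, ?s))) \<le> ennreal (work st) + ennreal (f X)" for hv X
  proof (cases "hv \<and> X")
    case True
    have "(\<integral>\<^sup>+(X, st'). ennreal (work st') + ennreal (if X then ?d else 0) \<partial>measure_pmf
      (listing_cost (deg G u) \<bind> (\<lambda>c. add_loop u (enum (N G u)) (tick c ?s) \<bind> (\<lambda>st3. return_pmf (X, st3)))))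
      = (\<integral>\<^sup>+c. \<integral>\<^sup>+st'. ennreal (work st') + ennreal ?d \<partial>measure_pmf (add_loop u (enum (N G u)) (tick c ?s)) \<partial>measure_pmf (listing_cost (deg G u)))"
      using True by simp
    also have "\<dots> \<le> (\<integral>\<^sup>+c. (ennreal (work st) + ennreal (?b + ?d * (agreement_cost + 3)) + ennreal ?d) + ennreal c \<partial>measure_pmf (listing_cost (deg G u)))"
    proof (intro nn_integral_mono nn_integral_pmf_le_const)
      fix c st' assume "st' \<in> set_pmf (add_loop u (enum (N G u)) (tick c ?s))"
      from add_loop_sure(5)[OF this] have "work st' \<le> (work st + (?b + ?d * (agreement_cost + 3))) + c"
        using s by simp
      then have "ennreal (work st') \<le> ennreal ((work st + (?b + ?d * (agreement_cost + 3))) + c)" by (rule ennreal_leI)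
      also have "\<dots> \<le> ennreal (work st + (?b + ?d * (agreement_cost + 3))) + ennreal c"
        by (rule ennreal_add_le)
      also have "\<dots> \<le> (ennreal (work st) + ennreal (?b + ?d * (agreement_cost + 3))) + ennreal c"
        by (intro add_right_mono ennreal_add_le)
      finally have "ennreal (work st') + ennreal ?d \<le> ((ennreal (work st) + ennreal (?b + ?d * (agreement_cost + 3))) + ennreal c) + ennreal ?d"
        by (rule add_right_mono)
      then show "ennreal (work st') + ennreal ?d \<le> (ennreal (work st) + ennreal (?b + ?d * (agreement_cost + 3)) + ennreal ?d) + ennreal c"
        by (simp only: add_ac)
    qed
    also have "\<dots> \<le> (ennreal (work st) + ennreal (?b + ?d * (agreement_cost + 3)) + ennreal ?d) + ennreal (?d * (2 * qcost * log 2 (real n)))"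
      using listing_cost_le[OF deg_le_n[of u]]
      by (simp only: nn_integral_pmf_add nn_integral_pmf_const add_left_mono)
    also have "\<dots> = ennreal (work st) + ennreal (f X)"
    proof -
      have "ennreal (?b + ?d * (agreement_cost + 3)) + ennreal ?d = ennreal (?b + ?d * (agreement_cost + 3) + ?d)"
        using b agreement_cost_nonneg by (intro ennreal_plus[symmetric]) auto
      moreover have "\<dots> + ennreal (?d * (2 * qcost * log 2 (real n))) = ennreal (?b + ?d * (agreement_cost + 3) + ?d + ?d * (2 * qcost * log 2 (real n)))"
        using b agreement_cost_nonneg qcost_nonneg log_n by (intro ennreal_plus[symmetric]) auto
      moreover have "?b + ?d * (agreement_cost + 3) + ?d + ?d * (2 * qcost * log 2 (real n)) = f X"
        using True by (simp add: f_def algebra_simps)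
      ultimately show ?thesis by (simp only: add.assoc)
    qed
    finally show ?thesis using True by simp
  next
    case False
    have "ennreal (work ?s) + ennreal (if X then ?d else 0) \<le> (ennreal (work st) + ennreal ?b) + ennreal (if X then ?d * ?e else 0)"
    proof (intro add_mono order_trans[OF ennreal_leI[OF s] ennreal_add_le] ennreal_leI)
      have "?d * 1 \<le> ?d * ?e" using qcost_nonneg agreement_cost_nonneg log_n by (intro mult_left_mono) auto
      then show "(if X then ?d else 0) \<le> (if X then ?d * ?e else 0)" by simp
    qed
    also have "\<dots> = ennreal (work st) + ennreal (f X)"
    proof -
      have "ennreal (f X) = ennreal ?b + ennreal (if X then ?d * ?e else 0)"
        unfolding f_def using b e by (intro ennreal_plus) auto
      then show ?thesis by (simp only: add.assoc)
    qed
    finally show ?thesis unfolding if_not_P[OF False] by simp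
  qed
  have "(\<integral>\<^sup>+(X, st'). ennreal (work st') + ennreal (if X then ?d else 0) \<partial>measure_pmf (anchor u st))
    \<le> (\<integral>\<^sup>+X. ennreal (work st) + ennreal (f X) \<partial>measure_pmf (bernoulli_pmf ?p))"
    unfolding anchor_eq[OF c] nn_integral_bind_pmf
    by (intro nn_integral_mono nn_integral_pmf_le_const inner)
  also have "\<dots> = ennreal (work st) + (\<integral>\<^sup>+X. ennreal (f X) \<partial>measure_pmf (bernoulli_pmf ?p))"
    by (simp only: nn_integral_pmf_add nn_integral_pmf_const)
  also have "(\<integral>\<^sup>+X. ennreal (f X) \<partial>measure_pmf (bernoulli_pmf ?p)) = ennreal (f True * ?p + f False * (1 - ?p))"
    using anchor_prob_bounds[of G u] b e
    by (simp add: f_def ennreal_mult[symmetric] ennreal_plus[symmetric] del: ennreal_plus)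
  also have "\<dots> \<le> ennreal (?b + anchor_rate * ?e)"
  proof (rule ennreal_leI)
    have "f True * ?p + f False * (1 - ?p) = ?b + (?p * ?d) * ?e" by (simp add: f_def algebra_simps)
    also have "\<dots> \<le> ?b + anchor_rate * ?e"
      using anchor_prob_bounds(3)[of G u] e by (intro add_left_mono mult_right_mono) auto
    finally show "f True * ?p + f False * (1 - ?p) \<le> ?b + anchor_rate * ?e" .
  qed
  finally show ?thesis by (simp add: add_left_mono)
qed

text \<open>The mean number of candidates that Connect examines per sampled neighbour; it is 0 for
  an isolated node.\<close>

definition avg_anchors :: "state \<Rightarrow> node \<Rightarrow> real" where
  "avg_anchors b u = (\<Sum>w\<in>N G u. real (card (anchor_nbrs b w))) / real (deg G u)"

lemma avg_anchors_nonneg: "0 \<le> avg_anchors b u"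
  by (auto simp: avg_anchors_def intro!: divide_nonneg_nonneg sum_nonneg)

lemma random_nbrs_sum:
  assumes "\<And>w. w \<in> N G u \<Longrightarrow> 0 \<le> \<phi> w"
  shows "(\<integral>\<^sup>+ws. ennreal (\<Sum>w\<leftarrow>ws. \<phi> w) \<partial>measure_pmf (random_nbrs G u k))
    = ennreal (real k * ((\<Sum>w\<in>N G u. \<phi> w) / real (deg G u)))"
proof (cases "N G u = {}")
  case False
  have "(\<integral>\<^sup>+ws. ennreal (\<Sum>w\<leftarrow>ws. \<phi> w) \<partial>measure_pmf (random_nbrs G u k))
    = (\<integral>\<^sup>+ws. (\<Sum>w\<leftarrow>ws. ennreal (\<phi> w)) \<partial>measure_pmf (random_nbrs G u k))"
  proof (rule nn_integral_pmf_cong)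
    fix ws assume "ws \<in> set_pmf (random_nbrs G u k)"
    then have "set ws \<subseteq> N G u" by (rule random_nbrs_sure)
    then show "ennreal (\<Sum>w\<leftarrow>ws. \<phi> w) = (\<Sum>w\<leftarrow>ws. ennreal (\<phi> w))"
    proof (induction ws)
      case (Cons a ws)
      have "0 \<le> sum_list (map \<phi> ws)" using Cons.prems assms by (intro sum_list_nonneg) auto
      then show ?case using Cons assms by (simp add: ennreal_plus)
    qed simp
  qed
  also have "\<dots> = of_nat k * ((\<Sum>w\<in>N G u. ennreal (\<phi> w)) / ennreal (real (deg G u)))"
    using False
    by (simp add: random_nbrs_def nn_integral_replicate_pmf_sum nn_integral_pmf_of_set ennreal_of_nat_eq_real_of_nat)
  also have "\<dots> = ennreal (real k * ((\<Sum>w\<in>N G u. \<phi> w) / real (deg G u)))"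
    using False assms
    by (subst ennreal_mult) (auto simp: sum_ennreal divide_ennreal sum_nonneg card_gt_0_iff
        ennreal_of_nat_eq_real_of_nat intro!: divide_nonneg_nonneg)
  finally show ?thesis .
qed (simp add: random_nbrs_def)

text \<open>\<open>st\<close> is the state in which Connect starts and \<open>b\<close> the one
  before processing. The summand 2 in \<open>2 + avg_anchors b u\<close> allows \<open>u\<close>
  itself to become a further candidate, once through the step from \<open>b\<close> to
  \<open>st\<close> and once during the loop.\<close>

lemma connect_work:
  assumes c: "cur_graph st = G" and fin: "finite (anchors st)"
    and sub: "\<And>w. w \<in> N G u \<Longrightarrow> anchor_nbrs st w \<subseteq> insert u (anchor_nbrs b w)" and b: "proper G b"
  shows "(\<integral>\<^sup>+st'. ennreal (work st') \<partial>measure_pmf (connect u st)) \<le>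
    ennreal (work st) + ennreal (real (samples (10^5)) * qcost + 1 + real (samples (10^5)) * (1 + (2 + avg_anchors b u) * (connect_cost + 2)))"
proof -
  let ?k = "samples (10^5)" let ?c = "connect_cost + 2" let ?st = "tick (real ?k * qcost + 1) st"
  have c0: "0 \<le> ?c" using qcost_nonneg heavy_cost_nonneg agreement_cost_nonneg by simp
  define \<phi> where "\<phi> w = 1 + (2 + real (card (anchor_nbrs b w))) * ?c" for w
  have \<phi>: "0 \<le> \<phi> w" for w using c0 by (simp add: \<phi>_def)
  have "(\<integral>\<^sup>+st'. ennreal (work st') \<partial>measure_pmf (connect u st)) \<le>
    (\<integral>\<^sup>+ws. ennreal (work ?st) + ennreal (\<Sum>w\<leftarrow>ws. \<phi> w) \<partial>measure_pmf (random_nbrs G u ?k))"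
    unfolding connect_eq[OF c] nn_integral_bind_pmf
  proof (intro nn_integral_pmf_mono nn_integral_pmf_le_const)
    fix ws st' assume ws: "ws \<in> set_pmf (random_nbrs G u ?k)" and st': "st' \<in> set_pmf (connect_loop u ws ?st)"
    have N: "set ws \<subseteq> N G u" by (rule random_nbrs_sure(1)[OF ws])
    have "work st' \<le> work ?st + (\<Sum>w\<leftarrow>ws. 1 + (1 + real (card (anchor_nbrs st w))) * ?c)"
      by (rule connect_loop_sure(2)[OF connecting_refl[OF c] fin N st'])
    also have "(\<Sum>w\<leftarrow>ws. 1 + (1 + real (card (anchor_nbrs st w))) * ?c) \<le> (\<Sum>w\<leftarrow>ws. \<phi> w)"
    proof (rule sum_list_mono)
      fix w assume "w \<in> set ws"
      then have "card (anchor_nbrs st w) \<le> card (insert u (anchor_nbrs b w))"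
        using sub N b by (intro card_mono) auto
      also have "\<dots> \<le> Suc (card (anchor_nbrs b w))" by (rule card_insert_le_m1) auto
      finally show "1 + (1 + real (card (anchor_nbrs st w))) * ?c \<le> \<phi> w"
        using c0 unfolding \<phi>_def by (intro add_left_mono mult_right_mono) auto
    qed
    finally show "ennreal (work st') \<le> ennreal (work ?st) + ennreal (\<Sum>w\<leftarrow>ws. \<phi> w)"
      by (intro order_trans[OF ennreal_leI ennreal_add_le]) auto
  qed
  also have "\<dots> = ennreal (work ?st) + ennreal (real ?k * ((\<Sum>w\<in>N G u. \<phi> w) / real (deg G u)))"
    by (simp only: nn_integral_pmf_add nn_integral_pmf_const random_nbrs_sum[OF \<phi>])
  also have "\<dots> \<le> (ennreal (work st) + ennreal (real ?k * qcost + 1)) + ennreal (real ?k * (1 + (2 + avg_anchors b u) * ?c))"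
  proof (intro add_mono ennreal_leI mult_left_mono)
    show "ennreal (work ?st) \<le> ennreal (work st) + ennreal (real ?k * qcost + 1)"
      unfolding work_simps by (rule ennreal_add_le)
    show "(\<Sum>w\<in>N G u. \<phi> w) / real (deg G u) \<le> 1 + (2 + avg_anchors b u) * ?c"
    proof (cases "N G u = {}")
      case True
      then show ?thesis using c0 avg_anchors_nonneg[of b u] by simp
    next
      case False
      then have "0 < real (deg G u)" by (simp add: card_gt_0_iff)
      moreover have "(\<Sum>w\<in>N G u. \<phi> w) = real (deg G u) * (1 + 2 * ?c) + (\<Sum>w\<in>N G u. real (card (anchor_nbrs b w))) * ?c"
        unfolding \<phi>_def by (simp only: distrib_right sum.distrib sum_constant sum_distrib_right) (simp add: algebra_simps)
      ultimately show ?thesis unfolding avg_anchors_def by (simp add: field_simps)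
    qed
  qed auto
  also have "\<dots> = ennreal (work st) + ennreal (real ?k * qcost + 1 + real ?k * (1 + (2 + avg_anchors b u) * ?c))"
  proof -
    have "0 \<le> real ?k * qcost + 1" "0 \<le> real ?k * (1 + (2 + avg_anchors b u) * ?c)"
      using c0 qcost_nonneg avg_anchors_nonneg[of b u] by auto
    from ennreal_plus[OF this] show ?thesis by (simp only: add.assoc)
  qed
  finally show ?thesis .
qed

text \<open>The bound is expressed in the state \<open>b\<close> before processing, because that is
  where the expected numbers of adjacent anchors are controlled.\<close>

lemma process_work:
  assumes b: "proper G b"
  shows "(\<integral>\<^sup>+st. ennreal (work st) \<partial>measure_pmf (process u b)) \<le>
    ennreal (work b) + ennreal (process_const + process_factor * (real (card (anchor_nbrs b u)) + avg_anchors b u))"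
proof -
  let ?k = "real (samples (10^5))" let ?d = "real (deg G u)" let ?c = "connect_cost + 2"
  let ?A = "real (card (anchor_nbrs b u))"
  let ?e = "qcost + heavy_cost + 1 + anchor_rate * (2 * qcost * log 2 (real n) + agreement_cost + 4)"
  let ?g = "?k * qcost + 1 + ?k * (1 + (2 + avg_anchors b u) * ?c)"
  have bt: "proper G (tick 1 b)" using b by simp
  have nn: "0 \<le> agreement_cost" "0 \<le> heavy_cost" "0 \<le> qcost"
    using agreement_cost_nonneg heavy_cost_nonneg qcost_nonneg by auto
  have g: "0 \<le> ?g" using nn avg_anchors_nonneg[of b u] by simp
  have e: "0 \<le> ?e" using nn anchor_rate_ge_1 log_n by simp
  have 1: "(\<integral>\<^sup>+st. ennreal (work (finish u X st)) \<partial>measure_pmf (connect u st2)) \<le>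
      (ennreal (work st2) + ennreal (if X then ?d else 0)) + ennreal (?g + 1)"
    if st1: "st1 \<in> set_pmf (clean u (tick 1 b))" and st2: "(X, st2) \<in> set_pmf (anchor u st1)" for st1 X st2
  proof -
    note s1 = clean_sure[OF bt st1] and s2 = anchor_sure[OF clean_sure(1)[OF bt st1] st2]
    have fin: "finite (anchors st2)"
      using s1(1) s2(1) finite_subset[OF _ fin_verts] unfolding proper_def by auto
    have sub: "anchor_nbrs st2 w \<subseteq> insert u (anchor_nbrs b w)" if w: "w \<in> N G u" for w
    proof
      fix x assume "x \<in> anchor_nbrs st2 w"
      then have x: "x \<in> anchors b" "{w, x} \<in> sol_graph st2" using s1(3) s2(1) by (auto simp: anchor_nbrs_def nbrs_def)
      show "x \<in> insert u (anchor_nbrs b w)"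
      proof (cases "x = u")
        case False
        then have "u \<notin> {w, x}" using N_neq[OF w] by auto
        then have "{w, x} \<in> sol_graph b" using s2(4)[OF x(2)] s1(2) by auto
        then show ?thesis using x by (simp add: anchor_nbrs_def nbrs_def)
      qed simp
    qed
    have fin_le: "work (finish u X st3) \<le> work st3 + ((if X then ?d else 0) + 1)"
      if st3: "st3 \<in> set_pmf (connect u st2)" for st3
    proof -
      obtain ws where ws: "ws \<in> set_pmf (random_nbrs G u (samples (10^5)))"
        and 3: "st3 \<in> set_pmf (connect_loop u ws (tick (real (samples (10^5)) * qcost + 1) st2))"
        using st3 unfolding connect_eq[OF s2(2)] by auto
      have "connecting u st2 st3"
        by (rule connect_loop_sure(1)[OF connecting_refl[OF s2(2)] fin random_nbrs_sure(1)[OF ws] 3])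
      then have "sol_graph st3 \<subseteq> sol_graph st2 \<union> {{r, u} |r. r \<in> anchors st2 \<inter> N G u}"
        by (simp add: connecting_def)
      then have "sol_graph st3 \<subseteq> edges G"
        using s2(3) by (auto simp: nbrs_def insert_commute)
      then have "nbrs (sol_graph st3) u \<subseteq> N G u" by (auto simp: nbrs_def)
      then have "card (nbrs (sol_graph st3) u) \<le> deg G u" by (intro card_mono) auto
      then show ?thesis by simp
    qed
    have "(\<integral>\<^sup>+st. ennreal (work (finish u X st)) \<partial>measure_pmf (connect u st2)) \<le>
      (\<integral>\<^sup>+st. ennreal (work st) + (ennreal (if X then ?d else 0) + ennreal 1) \<partial>measure_pmf (connect u st2))"
    proof (rule nn_integral_pmf_mono)
      fix st3 assume "st3 \<in> set_pmf (connect u st2)"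
      from ennreal_leI[OF fin_le[OF this]] show "ennreal (work (finish u X st3)) \<le> ennreal (work st3) + (ennreal (if X then ?d else 0) + ennreal 1)"
        by (rule order_trans) (intro order_trans[OF ennreal_add_le] add_left_mono ennreal_add_le)
    qed
    also have "\<dots> \<le> (ennreal (work st2) + ennreal ?g) + (ennreal (if X then ?d else 0) + ennreal 1)"
      unfolding nn_integral_pmf_add nn_integral_pmf_const
      by (intro add_right_mono connect_work s2(2) fin sub b)
    also have "\<dots> = (ennreal (work st2) + ennreal (if X then ?d else 0)) + (ennreal ?g + ennreal 1)"
      by (simp only: add_ac)
    also have "ennreal ?g + ennreal 1 = ennreal (?g + 1)" using g by (intro ennreal_plus[symmetric]) auto
    finally show ?thesis .
  qed
  have 2: "(\<integral>\<^sup>+(X, st2). (\<integral>\<^sup>+st. ennreal (work (finish u X st)) \<partial>measure_pmf (connect u st2)) \<partial>measure_pmf (anchor u st1))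
    \<le> ennreal (work b) + ennreal (1 + ?A * clean_cost + ?A + ?e + (?g + 1))"
    if st1: "st1 \<in> set_pmf (clean u (tick 1 b))" for st1
  proof -
    note s1 = clean_sure[OF bt st1]
    have w1: "work st1 = work b + (1 + ?A * clean_cost)" using s1(4) by (simp add: anchor_nbrs_def)
    have "anchor_nbrs st1 u \<subseteq> anchor_nbrs b u" using s1(2,3) by (auto simp: anchor_nbrs_def nbrs_def)
    then have A: "real (card (anchor_nbrs st1 u)) \<le> ?A" using card_mono[OF finite_anchor_nbrs[OF b]] by simp
    have nnA: "0 \<le> 1 + ?A * clean_cost" "0 \<le> ?A + ?e" "0 \<le> ?g + 1" using nn e g by auto
    have "(\<integral>\<^sup>+(X, st2). (\<integral>\<^sup>+st. ennreal (work (finish u X st)) \<partial>measure_pmf (connect u st2)) \<partial>measure_pmf (anchor u st1))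
      \<le> (\<integral>\<^sup>+p. (case p of (X, st2) \<Rightarrow> ennreal (work st2) + ennreal (if X then ?d else 0)) + ennreal (?g + 1) \<partial>measure_pmf (anchor u st1))"
      by (rule nn_integral_pmf_mono) (use 1[OF st1] in auto)
    also have "\<dots> \<le> (ennreal (work st1) + ennreal (real (card (anchor_nbrs st1 u)) + ?e)) + ennreal (?g + 1)"
      using anchor_work[OF s1(1), of u] unfolding nn_integral_pmf_add nn_integral_pmf_const
      by (intro add_right_mono) (simp add: add_ac)
    also have "\<dots> \<le> ((ennreal (work b) + ennreal (1 + ?A * clean_cost)) + ennreal (?A + ?e)) + ennreal (?g + 1)"
      unfolding w1 using A by (intro add_mono order_refl ennreal_add_le ennreal_leI) auto
    also have "\<dots> = ennreal (work b) + ennreal ((1 + ?A * clean_cost) + (?A + ?e) + (?g + 1))"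
      unfolding ennreal_plus[OF add_nonneg_nonneg[OF nnA(1,2)] nnA(3)] ennreal_plus[OF nnA(1,2)]
      by (simp only: add.assoc)
    finally show ?thesis by (simp only: add.assoc)
  qed
  have "(\<integral>\<^sup>+st. ennreal (work st) \<partial>measure_pmf (process u b)) =
    (\<integral>\<^sup>+st1. (\<integral>\<^sup>+(X, st2). (\<integral>\<^sup>+st. ennreal (work (finish u X st)) \<partial>measure_pmf (connect u st2)) \<partial>measure_pmf (anchor u st1)) \<partial>measure_pmf (clean u (tick 1 b)))"
    unfolding process_eq nn_integral_bind_pmf by (intro nn_integral_cong) (auto split: prod.splits)
  also have "\<dots> \<le> ennreal (work b) + ennreal (1 + ?A * clean_cost + ?A + ?e + (?g + 1))"
    by (rule nn_integral_pmf_le_const) (rule 2)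
  also have "\<dots> \<le> ennreal (work b) + ennreal (process_const + process_factor * (?A + avg_anchors b u))"
  proof (intro add_left_mono ennreal_leI)
    have "0 \<le> clean_cost * avg_anchors b u" "0 \<le> avg_anchors b u" "0 \<le> ?k * ?c * ?A"
      using nn avg_anchors_nonneg[of b u] by auto
    with nn(3) show "1 + ?A * clean_cost + ?A + ?e + (?g + 1) \<le> process_const + process_factor * (?A + avg_anchors b u)"
      unfolding process_const_def process_factor_def by (simp add: algebra_simps)
  qed
  finally show ?thesis .
qed

end

section \<open>Processing along a sequence of events\<close>

primrec updates_of :: "event list \<Rightarrow> update list" where
  "updates_of [] = []"
| "updates_of (e # es) = (case e of Upd k x \<Rightarrow> x # updates_of es | Proc u \<Rightarrow> updates_of es)"

text \<open>For \<open>A = {u, w}\<close> this is the graph in which an edge \<open>{u, w}\<close>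
  was last tested.\<close>

primrec last_graph :: "node set \<Rightarrow> event list \<Rightarrow> graph" where
  "last_graph A [] = empty_graph"
| "last_graph A (e # es) = (case e of Upd k x \<Rightarrow> last_graph A es
     | Proc u \<Rightarrow> if u \<in> A then graph_at es else last_graph A es)"

definition good_pair :: "graph \<Rightarrow> node set \<Rightarrow> bool" where
  "good_pair G e \<longleftrightarrow> (\<exists>u v. e = {u, v} \<and> good_edge G u v)"

lemma good_pair_iff: "good_pair G {u, v} \<longleftrightarrow> good_edge G u v"
  unfolding good_pair_def by (auto simp: doubleton_eq_iff good_edge_sym)

lemma sum_UN_le:
  fixes f :: "'a \<Rightarrow> real"
  assumes "finite J" "\<And>j. j \<in> J \<Longrightarrow> finite (A j)" "\<And>x. 0 \<le> f x"
  shows "sum f (\<Union>j\<in>J. A j) \<le> (\<Sum>j\<in>J. sum f (A j))"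
  using assms(1,2)
proof (induction J rule: finite_induct)
  case (insert j J)
  have "sum f (A j \<union> (\<Union>j\<in>J. A j)) + sum f (A j \<inter> (\<Union>j\<in>J. A j)) = sum f (A j) + sum f (\<Union>j\<in>J. A j)"
    using insert by (intro sum.union_inter) auto
  moreover have "0 \<le> sum f (A j \<inter> (\<Union>j\<in>J. A j))" by (intro sum_nonneg assms)
  ultimately show ?case using insert by simp
qed simp

context dynamic_agreement_params
begin

fun ok_events :: "event list \<Rightarrow> bool" where
  "ok_events [] \<longleftrightarrow> True"
| "ok_events (Upd k x # es) \<longleftrightarrow> ok_events es \<and> valid (x # updates_of es) \<and> k = Suc (length (updates_of es)) \<and>
     card (verts (graph_of (x # updates_of es))) \<le> n"
| "ok_events (Proc u # es) \<longleftrightarrow> ok_events es \<and> u \<in> verts (graph_at es)"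

lemma ok_events_tl: "ok_events (e # es) \<Longrightarrow> ok_events es"
  by (cases e) auto

lemma ok_events_graph:
  "ok_events es \<Longrightarrow> valid (updates_of es) \<and> graph_at es = graph_of (updates_of es) \<and> card (verts (graph_at es)) \<le> n"
proof (induction es rule: ok_events.induct)
  case 1
  then show ?case by (simp add: empty_graph_def)
next
  case (2 k x es)
  then show ?case by (simp del: valid.simps)
next
  case (3 u es)
  then show ?case by (metis graph_at.simps(2) event.simps(6) ok_events.simps(3) updates_of.simps(2))
qed

lemma ok_events_params:
  "ok_events es \<Longrightarrow> graph_params n eps qcost enum (updates_of es) (graph_at es)"
  using ok_events_graph[of es] by unfold_locales auto

lemma proper_run: "ok_events es \<Longrightarrow> b \<in> set_pmf (process_run es) \<Longrightarrow> proper (graph_at es) b"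
proof (induction es arbitrary: b)
  case Nil
  then show ?case by (simp add: proper_def init_state_def)
next
  case (Cons e es)
  have ok: "ok_events es" by (rule ok_events_tl[OF Cons.prems(1)])
  interpret graph_params n eps qcost enum "updates_of es" "graph_at es" by (rule ok_events_params[OF ok])
  show ?case
  proof (cases e)
    case (Upd k x)
    then obtain b0 where b0: "b0 \<in> set_pmf (process_run es)" and b: "b = start_update k x b0"
      using Cons.prems(2) by auto
    have p: "proper (graph_at es) b0" by (rule Cons.IH[OF ok b0])
    show ?thesis
    proof (cases x)
      case (Ins S)
      show ?thesis using p unfolding Upd b Ins
        by (auto simp: proper_def insert_node_def reset_work_def)
    next
      case (Del u)
      show ?thesis using p unfolding Upd b Del
        by (auto simp: proper_def delete_node_def reset_work_def)
    qed
  next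
    case (Proc u)
    then obtain b0 where b0: "b0 \<in> set_pmf (process_run es)" and b: "b \<in> set_pmf (process u b0)"
      using Cons.prems(2) by auto
    have "u \<in> verts (graph_at es)" using Cons.prems(1) Proc by simp
    from process_sure(1)[OF Cons.IH[OF ok b0] this b] show ?thesis using Proc by simp
  qed
qed

text \<open>The parameter of the coin tossed when \<open>w\<close> was last processed; given the
  events it is deterministic.\<close>

primrec anchor_bound :: "node \<Rightarrow> event list \<Rightarrow> real" where
  "anchor_bound w [] = 0"
| "anchor_bound w (e # es) = (case e of Upd k x \<Rightarrow> anchor_bound w es
     | Proc u \<Rightarrow> if u = w then anchor_prob (graph_at es) w else anchor_bound w es)"

lemma anchor_bound_nonneg: "0 \<le> anchor_bound w es"
  by (induction es) (auto split: event.splits simp: anchor_prob_bounds)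

lemma process_anchor_prob:
  assumes "graph_params n eps qcost enum us G" "proper G b"
  shows "(\<integral>\<^sup>+st. of_bool (u \<in> anchors st) \<partial>measure_pmf (process u b)) \<le> ennreal (anchor_prob G u)"
proof -
  interpret graph_params n eps qcost enum us G by (rule assms(1))
  have bt: "proper G (tick 1 b)" using assms(2) by simp
  have "(\<integral>\<^sup>+st. of_bool (u \<in> anchors st) \<partial>measure_pmf (process u b)) \<le>
    (\<integral>\<^sup>+st1. (\<integral>\<^sup>+(X, st2). of_bool X \<partial>measure_pmf (anchor u st1)) \<partial>measure_pmf (clean u (tick 1 b)))"
    unfolding process_eq nn_integral_bind_pmf
    by (intro nn_integral_mono) (auto intro!: nn_integral_pmf_le_const split: prod.splits)
  also have "\<dots> \<le> ennreal (anchor_prob G u)"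
  proof (rule nn_integral_pmf_le_const)
    fix st1 assume "st1 \<in> set_pmf (clean u (tick 1 b))"
    then have c: "cur_graph st1 = G" using clean_sure(1)[OF bt] by (simp add: proper_def)
    have "(\<integral>\<^sup>+(X, st2). of_bool X \<partial>measure_pmf (anchor u st1)) \<le>
      (\<integral>\<^sup>+X. of_bool X \<partial>measure_pmf (bernoulli_pmf (anchor_prob G u)))"
      unfolding anchor_eq[OF c] nn_integral_bind_pmf
      by (intro nn_integral_mono nn_integral_pmf_le_const) auto
    also have "\<dots> = ennreal (anchor_prob G u)" using anchor_prob_bounds[of G u] by simp
    finally show "(\<integral>\<^sup>+(X, st2). of_bool X \<partial>measure_pmf (anchor u st1)) \<le> ennreal (anchor_prob G u)" .
  qed
  finally show ?thesis .
qed

text \<open>Only the processing of \<open>w\<close> can make \<open>w\<close> an anchor, and it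
  replaces the earlier choice by a fresh coin. All other events can only remove
  \<open>w\<close>.\<close>

lemma run_anchor_prob:
  "ok_events es \<Longrightarrow> (\<integral>\<^sup>+b. of_bool (w \<in> anchors b) \<partial>measure_pmf (process_run es)) \<le> ennreal (anchor_bound w es)"
proof (induction es)
  case Nil
  then show ?case by (simp add: init_state_def)
next
  case (Cons e es)
  have ok: "ok_events es" by (rule ok_events_tl[OF Cons.prems])
  note gp = ok_events_params[OF ok]
  show ?case
  proof (cases e)
    case (Upd k x)
    have "(\<integral>\<^sup>+b. of_bool (w \<in> anchors b) \<partial>measure_pmf (process_run (e # es))) \<le>
      (\<integral>\<^sup>+b. of_bool (w \<in> anchors b) \<partial>measure_pmf (process_run es))"
      unfolding Upd by (cases x) (auto intro!: nn_integral_mono simp: reset_work_def)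
    then show ?thesis using Cons.IH[OF ok] Upd by (auto intro: order_trans)
  next
    case (Proc u)
    have u: "u \<in> verts (graph_at es)" using Cons.prems Proc by simp
    have eq: "(\<integral>\<^sup>+b. of_bool (w \<in> anchors b) \<partial>measure_pmf (process_run (e # es))) =
      (\<integral>\<^sup>+b. (\<integral>\<^sup>+st. of_bool (w \<in> anchors st) \<partial>measure_pmf (process u b)) \<partial>measure_pmf (process_run es))"
      by (simp add: Proc)
    show ?thesis
    proof (cases "u = w")
      case True
      have "(\<integral>\<^sup>+b. (\<integral>\<^sup>+st. of_bool (w \<in> anchors st) \<partial>measure_pmf (process u b)) \<partial>measure_pmf (process_run es))
        \<le> ennreal (anchor_prob (graph_at es) w)"
        unfolding True by (rule nn_integral_pmf_le_const) (rule process_anchor_prob[OF gp proper_run[OF ok]])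
      then show ?thesis using True eq Proc by simp
    next
      case False
      have "(\<integral>\<^sup>+b. (\<integral>\<^sup>+st. of_bool (w \<in> anchors st) \<partial>measure_pmf (process u b)) \<partial>measure_pmf (process_run es))
        \<le> (\<integral>\<^sup>+b. of_bool (w \<in> anchors b) \<partial>measure_pmf (process_run es))"
      proof (intro nn_integral_pmf_mono nn_integral_pmf_le_const)
        fix b st assume b: "b \<in> set_pmf (process_run es)" and st: "st \<in> set_pmf (process u b)"
        have "anchors st \<subseteq> insert u (anchors b)"
          by (rule graph_params.process_sure(3)[OF gp proper_run[OF ok b] u st])
        then show "(of_bool (w \<in> anchors st) :: ennreal) \<le> of_bool (w \<in> anchors b)" using False by auto
      qed
      then show ?thesis using False eq Proc Cons.IH[OF ok] by (auto intro: order_trans)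
    qed
  qed
qed

definition sound_state :: "event list \<Rightarrow> state \<Rightarrow> bool" where
  "sound_state es b \<longleftrightarrow> (\<forall>e\<in>sol_graph b. good_pair (last_graph e es) e)"

text \<open>Edges at a processed node are retested at this event, other edges are inherited, and
  updates never add an edge to \<open>sol_graph\<close>.\<close>

lemma run_sound:
  "ok_events es \<Longrightarrow> fail_prob (process_run es) (sound_state es) \<le> of_nat (length es) * graph_params.process_error n eps"
proof (induction es)
  case Nil
  then show ?case by (simp add: init_state_def sound_state_def)
next
  case (Cons e es)
  have ok: "ok_events es" by (rule ok_events_tl[OF Cons.prems])
  interpret graph_params n eps qcost enum "updates_of es" "graph_at es" by (rule ok_events_params[OF ok])
  let ?d = "of_nat (length es) * process_error"
  have "fail_prob (process_run (e # es)) (sound_state (e # es)) \<le> ?d + process_error"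
    unfolding process_run.simps
  proof (rule fail_prob_bind[OF Cons.IH[OF ok]])
    fix b assume b: "b \<in> set_pmf (process_run es)" and s: "sound_state es b"
    show "fail_prob ((case e of Upd k x \<Rightarrow> (\<lambda>b. return_pmf (start_update k x b)) | Proc u \<Rightarrow> process u) b)
      (sound_state (e # es)) \<le> process_error"
    proof (cases e)
      case (Upd k x)
      have "sound_state (e # es) (start_update k x b)"
        using s unfolding Upd by (cases x) (auto simp: sound_state_def reset_work_def)
      then show ?thesis unfolding Upd by simp
    next
      case (Proc u)
      have u: "u \<in> verts (graph_at es)" using Cons.prems Proc by simp
      have "fail_prob (process u b) (sound_state (e # es)) \<le> fail_prob (process u b) (good_at (graph_at es) u)"
      proof (rule fail_prob_mono)
        fix st assume st: "st \<in> set_pmf (process u b)" and g: "good_at (graph_at es) u st"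
        note p = process_sure[OF proper_run[OF ok b] u st]
        show "sound_state (e # es) st"
          unfolding sound_state_def
        proof
          fix f assume f: "f \<in> sol_graph st"
          show "good_pair (last_graph f (e # es)) f"
          proof (cases "u \<in> f")
            case True
            have "f \<in> edges (graph_at es)" using f p(1) by (auto simp: proper_def)
            then obtain v where v: "f = {u, v}" using edge_at True by blast
            then have "good_edge (graph_at es) u v" using g f by (simp add: good_at_def)
            then show ?thesis using Proc True v by (simp add: good_pair_iff)
          next
            case False
            then show ?thesis using p(2)[OF f False] s Proc by (simp add: sound_state_def)
          qed
        qed
      qed
      also have "\<dots> \<le> process_error" by (rule process_sound[OF proper_run[OF ok b]])
      finally show ?thesis using Proc by simp
    qed
  qed
  then show ?case by (simp add: distrib_right add.commute)
qed

lemma last_graph_props: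
  "ok_events es \<Longrightarrow> verts (last_graph A es) \<subseteq> {..length (updates_of es)} \<and> finite (verts (last_graph A es)) \<and>
    (\<forall>u v. v \<in> N (last_graph A es) u \<longrightarrow> v \<in> verts (last_graph A es)) \<and> card (verts (last_graph A es)) \<le> n"
proof (induction es)
  case Nil
  then show ?case by (simp add: empty_graph_def nbrs_def)
next
  case (Cons e es)
  have ok: "ok_events es" by (rule ok_events_tl[OF Cons.prems])
  have g: "verts (graph_at es) \<subseteq> {..length (updates_of es)}" "finite (verts (graph_at es))"
     "\<And>u v. v \<in> N (graph_at es) u \<Longrightarrow> v \<in> verts (graph_at es)" "card (verts (graph_at es)) \<le> n"
    using ok_events_graph[OF ok] verts_le N_verts(1) by auto
  show ?case
  proof (cases e)
    case (Upd k x)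
    show ?thesis using Cons.IH[OF ok] unfolding Upd by (auto dest!: subsetD)
  next
    case (Proc u)
    show ?thesis using Cons.IH[OF ok] g unfolding Proc by auto
  qed
qed

text \<open>Consider the latest processing event at which \<open>u\<close> has degree below
  \<open>M\<close>. The last test of such an edge happened then or earlier, and an edge that was
  present at its last test and is present now was present throughout. So all these \<open>w\<close>
  were neighbours of \<open>u\<close> at this event, when \<open>u\<close> had fewer than
  \<open>M\<close> of them.\<close>

lemma card_candidates:
  "ok_events es \<Longrightarrow>
   card {w \<in> N (graph_at es) u. w \<in> N (last_graph {u, w} es) u \<and> deg (last_graph {u, w} es) u < M} \<le> M"
proof (induction es)
  case Nil
  then show ?case by (simp add: empty_graph_def nbrs_def)
next
  case (Cons e es)
  have ok: "ok_events es" by (rule ok_events_tl[OF Cons.prems])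
  interpret graph_params n eps qcost enum "updates_of es" "graph_at es" by (rule ok_events_params[OF ok])
  let ?W = "\<lambda>es. {w \<in> N (graph_at es) u. w \<in> N (last_graph {u, w} es) u \<and> deg (last_graph {u, w} es) u < M}"
  have fin: "finite (?W es)" by (rule finite_subset[OF _ fin_N[of u]]) auto
  have ?case if sub: "?W (e # es) \<subseteq> ?W es"
    using card_mono[OF fin sub] Cons.IH[OF ok] by simp
  moreover have ?case if "?W (e # es) \<subseteq> N (graph_at es) u" "deg (graph_at es) u < M"
    using card_mono[OF fin_N that(1)] that(2) by simp
  moreover have "?W (e # es) \<subseteq> ?W es \<or> ?W (e # es) \<subseteq> N (graph_at es) u \<and> deg (graph_at es) u < M"
  proof (cases e)
    case (Upd k x)
    \<comment> \<open>An arriving node occurs in no earlier graph, so an edge that existed at its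
      last test is not one of the new edges.\<close>
    have "?W (e # es) \<subseteq> ?W es"
    proof
      fix w assume w: "w \<in> ?W (e # es)"
      then have 1: "w \<in> N (last_graph {u, w} es) u" "deg (last_graph {u, w} es) u < M"
        and 2: "w \<in> N (apply_update k x (graph_at es)) u" unfolding Upd by auto
      have k: "k = Suc (length (updates_of es))" using Cons.prems Upd by simp
      note lp = last_graph_props[OF ok, of "{u, w}"]
      have "w \<in> verts (last_graph {u, w} es)" using lp 1(1) by blast
      then have "w \<noteq> k" using lp k by auto
      have "u \<in> N (last_graph {u, w} es) w" using 1(1) N_sym by blast
      then have "u \<in> verts (last_graph {u, w} es)" using lp by blast
      then have "u \<noteq> k" using lp k by auto
      have "w \<in> N (graph_at es) u"
        using 2 \<open>w \<noteq> k\<close> \<open>u \<noteq> k\<close> by (cases x) (auto simp: N_insert N_delete split: if_splits)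
      then show "w \<in> ?W es" using 1 by simp
    qed
    then show ?thesis ..
  next
    case (Proc v)
    show ?thesis
    proof (cases "deg (graph_at es) u < M")
      case True
      then show ?thesis unfolding Proc by auto
    next
      case False
      have "?W (e # es) \<subseteq> ?W es" using False unfolding Proc by (auto split: if_splits)
      then show ?thesis ..
    qed
  qed
  ultimately show ?case by blast
qed

text \<open>Typical nodes were sampled as anchors with a probability of the right order: at most \<open>c\<close> over
  their current degree.\<close>

fun settled :: "real \<Rightarrow> event list \<Rightarrow> bool" where
  "settled c [] \<longleftrightarrow> True"
| "settled c (Upd k x # es) \<longleftrightarrow> settled c es"
| "settled c (Proc v # es) \<longleftrightarrow> settled c es \<and>
     (\<forall>w. degree_typical (graph_at es) w \<longrightarrow> anchor_bound w es * real (deg (graph_at es) w) \<le> c)"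

text \<open>If the edge was last tested while processing \<open>w\<close>, the coin was tossed with
  the degree in that very graph. If it was while processing \<open>u\<close>, then \<open>w\<close>
  was not processed since, and \<open>settled\<close> at this event gives the bound.\<close>

lemma settled_bound:
  assumes "settled c es" "anchor_rate \<le> c" "good_edge (last_graph {u, w} es) u w"
  shows "anchor_bound w es * real (deg (last_graph {u, w} es) w) \<le> c"
  using assms(1,3)
proof (induction es)
  case Nil
  then show ?case using assms(2) anchor_rate_ge_1 by simp
next
  case (Cons e es)
  show ?case
  proof (cases e)
    case (Upd k x)
    then show ?thesis using Cons by simp
  next
    case (Proc v)
    show ?thesis
    proof (cases "v = w")
      case True
      then show ?thesis using Proc anchor_prob_bounds(3)[of "graph_at es" w] assms(2) by simp
    next
      case False
      then show ?thesis using Cons Proc by (cases "v = u") (auto simp: good_edge_def)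
    qed
  qed
qed

lemma top_level_bound: "n < 2 ^ Suc top_level"
proof -
  have "log 2 (real n) < real (Suc top_level)"
    unfolding top_level_def using log_n by linarith
  then have "real n < 2 powr real (Suc top_level)" using n2 by (simp add: log_less_iff)
  then have "real n < 2 ^ Suc top_level" by (subst (asm) powr_realpow) auto
  then show ?thesis by (metis of_nat_less_iff of_nat_numeral of_nat_power)
qed

lemma dyadic_index:
  assumes "1 \<le> d" "d \<le> n"
  shows "\<exists>j\<le>top_level. 2 ^ j \<le> d \<and> d < 2 ^ Suc j"
proof -
  obtain j where j: "2 ^ j \<le> d" "d < 2 ^ (j + 1)"
    using ex_power_ivl1[of 2 d] assms by auto
  have "(2::nat) ^ j < 2 ^ Suc top_level" using j(1) assms(2) top_level_bound by linarith
  then have "j < Suc top_level" by (rule power_less_imp_less_exp[rotated]) simp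
  then show ?thesis using j by (intro exI[of _ j]) auto
qed

lemma sum_anchor_bound:
  fixes u :: node
  assumes ok: "ok_events es" and s: "settled c es" and c: "anchor_rate \<le> c"
  defines "W \<equiv> {w \<in> N (graph_at es) u. good_edge (last_graph {u, w} es) u w}"
  shows "(\<Sum>w\<in>W. anchor_bound w es) \<le> 4 * c * real (Suc top_level)"
proof -
  interpret graph_params n eps qcost enum "updates_of es" "graph_at es" by (rule ok_events_params[OF ok])
  have c0: "0 \<le> c" using c anchor_rate_ge_1 by simp
  \<comment> \<open>Candidates are sorted by the degree that \<open>u\<close> had when the edge was last tested: for a degree
    about \<open>2 ^ j\<close> there are at most \<open>2 ^ (j + 1)\<close> of them, each an anchor with probability at most
    \<open>2 * c / 2 ^ j\<close>.\<close>
  define D where "D w = deg (last_graph {u, w} es) u" for w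
  define Wj where "Wj j = {w \<in> W. 2 ^ j \<le> D w \<and> D w < 2 ^ Suc j}" for j
  have fW: "finite W" by (rule finite_subset[OF _ fin_N[of u]]) (auto simp: W_def)
  have "W \<subseteq> (\<Union>j\<in>{..top_level}. Wj j)"
  proof
    fix w assume w: "w \<in> W"
    note lp = last_graph_props[OF ok, of "{u, w}"]
    let ?N = "N (last_graph {u, w} es) u"
    have sub: "?N \<subseteq> verts (last_graph {u, w} es)" using lp by blast
    then have "card ?N \<le> n" using lp card_mono[OF _ sub] by linarith
    moreover have "w \<in> ?N" using w by (simp add: W_def good_edge_def)
    then have "1 \<le> card ?N" using finite_subset[OF sub] lp by (simp add: Suc_le_eq card_gt_0_iff) blast
    ultimately obtain j where "j \<le> top_level" "2 ^ j \<le> D w" "D w < 2 ^ Suc j"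
      using dyadic_index unfolding D_def by blast
    then show "w \<in> (\<Union>j\<in>{..top_level}. Wj j)" using w by (auto simp: Wj_def)
  qed
  then have "(\<Sum>w\<in>W. anchor_bound w es) \<le> (\<Sum>w\<in>(\<Union>j\<in>{..top_level}. Wj j). anchor_bound w es)"
    using fW anchor_bound_nonneg by (intro sum_mono2) (auto simp: Wj_def)
  also have "\<dots> \<le> (\<Sum>j\<in>{..top_level}. \<Sum>w\<in>Wj j. anchor_bound w es)"
    using fW anchor_bound_nonneg by (intro sum_UN_le) (auto simp: Wj_def)
  also have "\<dots> \<le> (\<Sum>j\<in>{..top_level}. 4 * c)"
  proof (rule sum_mono)
    fix j
    have "(\<Sum>w\<in>Wj j. anchor_bound w es) \<le> of_nat (card (Wj j)) * (2 * c / 2 ^ j)"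
    proof (rule sum_bounded_above)
      fix w assume w: "w \<in> Wj j"
      then have g: "good_edge (last_graph {u, w} es) u w" by (simp add: Wj_def W_def)
      have "D w \<le> 2 * deg (last_graph {u, w} es) w" using g by (simp add: good_edge_def D_def)
      moreover have "2 ^ j \<le> D w" using w by (simp add: Wj_def)
      ultimately have "2 ^ j \<le> 2 * deg (last_graph {u, w} es) w" by linarith
      then have "real (2 ^ j) \<le> real (2 * deg (last_graph {u, w} es) w)" by (simp only: of_nat_le_iff)
      then have le: "2 ^ j / 2 \<le> real (deg (last_graph {u, w} es) w)" by simp
      have "anchor_bound w es * (2 ^ j / 2) \<le> anchor_bound w es * real (deg (last_graph {u, w} es) w)"
        by (rule mult_left_mono[OF le anchor_bound_nonneg])
      also have "\<dots> \<le> c" by (rule settled_bound[OF s c g])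
      finally show "anchor_bound w es \<le> 2 * c / 2 ^ j" by (simp add: field_simps)
    qed
    also have "\<dots> \<le> real (2 ^ Suc j) * (2 * c / 2 ^ j)"
    proof (intro mult_right_mono)
      have "Wj j \<subseteq> {w \<in> N (graph_at es) u. w \<in> N (last_graph {u, w} es) u \<and> deg (last_graph {u, w} es) u < 2 ^ Suc j}"
        by (auto simp: Wj_def W_def D_def good_edge_def)
      then have "card (Wj j) \<le> card {w \<in> N (graph_at es) u. w \<in> N (last_graph {u, w} es) u \<and> deg (last_graph {u, w} es) u < 2 ^ Suc j}"
        by (intro card_mono finite_subset[OF _ fin_N[of u]]) auto
      also have "\<dots> \<le> 2 ^ Suc j" by (rule card_candidates[OF ok])
      finally show "of_nat (card (Wj j)) \<le> real (2 ^ Suc j)" by (simp only: of_nat_le_iff)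
    qed (use c0 in auto)
    also have "\<dots> = 4 * c" by simp
    finally show "(\<Sum>w\<in>Wj j. anchor_bound w es) \<le> 4 * c" .
  qed
  also have "\<dots> = 4 * c * real (Suc top_level)" by simp
  finally show ?thesis .
qed

text \<open>\<open>W\<close> is determined by the events, so the expectation can be summed over its
  members. States in which a test has erred are charged the trivial count \<open>n\<close>.\<close>

lemma expected_anchor_nbrs:
  assumes ok: "ok_events es" and s: "settled c es" and c: "anchor_rate \<le> c"
  shows "(\<integral>\<^sup>+b. ennreal (real (card (anchor_nbrs b u))) \<partial>measure_pmf (process_run es)) \<le>
    ennreal (4 * c * real (Suc top_level)) + of_nat n * (of_nat (length es) * graph_params.process_error n eps)"
proof -
  interpret graph_params n eps qcost enum "updates_of es" "graph_at es" by (rule ok_events_params[OF ok])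
  define W where "W = {w \<in> N (graph_at es) u. good_edge (last_graph {u, w} es) u w}"
  have fW: "finite W" by (rule finite_subset[OF _ fin_N[of u]]) (auto simp: W_def)
  have "(\<integral>\<^sup>+b. ennreal (real (card (anchor_nbrs b u))) \<partial>measure_pmf (process_run es)) \<le>
    (\<integral>\<^sup>+b. (\<Sum>w\<in>W. of_bool (w \<in> anchors b)) + of_nat n * of_bool (\<not> sound_state es b) \<partial>measure_pmf (process_run es))"
  proof (rule nn_integral_pmf_mono)
    fix b assume b: "b \<in> set_pmf (process_run es)"
    note p = proper_run[OF ok b]
    have "(\<Sum>w\<in>W. of_bool (w \<in> anchors b)) = (of_nat (card {w \<in> W. w \<in> anchors b}) :: ennreal)"
      using fW by (simp add: Collect_conj_eq)
    moreover have "card (anchor_nbrs b u) \<le> card {w \<in> W. w \<in> anchors b}" if "sound_state es b"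
    proof (rule card_mono)
      show "anchor_nbrs b u \<subseteq> {w \<in> W. w \<in> anchors b}"
      proof
        fix w assume w: "w \<in> anchor_nbrs b u"
        then have e: "{u, w} \<in> sol_graph b" by (simp add: anchor_nbrs_def nbrs_def)
        then have "w \<in> N (graph_at es) u" using p by (auto simp: proper_def nbrs_def)
        moreover have "good_edge (last_graph {u, w} es) u w"
          using that e by (auto simp: sound_state_def good_pair_iff)
        ultimately show "w \<in> {w \<in> W. w \<in> anchors b}" using w by (simp add: W_def anchor_nbrs_def)
      qed
    qed (use fW in auto)
    ultimately show "ennreal (real (card (anchor_nbrs b u))) \<le>
      (\<Sum>w\<in>W. of_bool (w \<in> anchors b)) + of_nat n * of_bool (\<not> sound_state es b)"
      using card_anchor_nbrs_le[OF p, of u]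
      by (cases "sound_state es b") (auto simp: ennreal_of_nat_eq_real_of_nat[symmetric] intro: add_increasing)
  qed
  also have "\<dots> = (\<Sum>w\<in>W. \<integral>\<^sup>+b. of_bool (w \<in> anchors b) \<partial>measure_pmf (process_run es)) +
    of_nat n * fail_prob (process_run es) (sound_state es)"
    by (simp only: nn_integral_pmf_add nn_integral_pmf_sum nn_integral_pmf_cmult fail_prob_def)
  also have "\<dots> \<le> (\<Sum>w\<in>W. ennreal (anchor_bound w es)) + of_nat n * (of_nat (length es) * process_error)"
    by (intro add_mono sum_mono mult_left_mono run_anchor_prob[OF ok] run_sound[OF ok]) auto
  also have "(\<Sum>w\<in>W. ennreal (anchor_bound w es)) = ennreal (\<Sum>w\<in>W. anchor_bound w es)"
    by (intro sum_ennreal anchor_bound_nonneg)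
  also have "\<dots> \<le> ennreal (4 * c * real (Suc top_level))"
    unfolding W_def by (intro ennreal_leI sum_anchor_bound[OF ok s c])
  finally show ?thesis by (simp add: add_right_mono)
qed

section \<open>Notifications\<close>


abbreviation s_size :: nat where
  "s_size \<equiv> samples (10 ^ 10)"

lemma s_size_pos: "0 < s_size"
  by (rule samples_large) simp

text \<open>\<open>B_sets\<close> inverts \<open>I_sets\<close> at present nodes only: after a
  deletion, samples of other nodes may still contain the deleted node. The bounds by
  \<open>length us\<close> ensure that the next arriving node, \<open>Suc (length us)\<close>,
  occurs in no sample and starts with empty \<open>B_sets\<close>.\<close>

definition consistent :: "update list \<Rightarrow> state \<Rightarrow> bool" where
  "consistent us a \<longleftrightarrow> cur_graph a = graph_of us \<and>
     (\<forall>w i. card (I_sets a w i) \<le> s_size \<and> I_sets a w i \<subseteq> {..length us}) \<and>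
     (\<forall>w i. w \<notin> verts (graph_of us) \<longrightarrow> I_sets a w i = {}) \<and>
     (\<forall>u\<in>verts (graph_of us). \<forall>i. B_sets a u i = {w. u \<in> I_sets a w i}) \<and>
     (\<forall>u>length us. \<forall>i. B_sets a u i = {})"

lemma consistent_tick [simp]: "consistent us (tick c a) \<longleftrightarrow> consistent us a"
  by (simp add: consistent_def tick_def)

lemma I_sets_tick [simp]: "I_sets (tick c a) = I_sets a" "B_sets (tick c a) = B_sets a"
  and ops_tick [simp]: "ops (tick c a) = ops a + c"
  by (simp_all add: tick_def)

lemma consistent_graph: "consistent us a \<Longrightarrow> cur_graph a = graph_of us"
  by (simp add: consistent_def)

lemma consistent_card: "consistent us a \<Longrightarrow> card (I_sets a w i) \<le> s_size"
  by (simp add: consistent_def)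

lemma consistent_finite: "consistent us a \<Longrightarrow> finite (I_sets a w i)"
  unfolding consistent_def by (meson finite_atMost finite_subset)

lemma random_nbrs_props:
  assumes "rs \<in> set_pmf (random_nbrs G w k)" "finite (N G w)"
  shows "set rs \<subseteq> N G w" "card (set rs) \<le> k" "N G w \<noteq> {} \<Longrightarrow> 0 < k \<Longrightarrow> set rs \<noteq> {}"
proof -
  show "set rs \<subseteq> N G w" using assms by (auto simp: random_nbrs_def set_replicate_pmf split: if_splits)
  have "length rs \<le> k" using assms by (auto simp: random_nbrs_def set_replicate_pmf split: if_splits)
  then show "card (set rs) \<le> k" using card_length order_trans by blast
  show "set rs \<noteq> {}" if "N G w \<noteq> {}" "0 < k"
    using assms that by (auto simp: random_nbrs_def set_replicate_pmf split: if_splits)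
qed

definition resample_cost :: real where
  "resample_cost = qcost * (1 + real s_size) + 2 * real s_size + 1"

lemma resample_sure:
  assumes v: "valid us" and c: "consistent us a" and w: "w \<in> verts (graph_of us)" and a': "a' \<in> set_pmf (resample w a)"
  obtains new where "I_sets a' = (I_sets a)(w := (I_sets a w)(level (graph_of us) w := new))"
    "new \<subseteq> N (graph_of us) w" "N (graph_of us) w \<noteq> {} \<Longrightarrow> new \<noteq> {}" "consistent us a'"
    "ops a' \<le> ops a + resample_cost"
proof -
  let ?G = "graph_of us" let ?l = "level ?G w"
  have g: "cur_graph a = ?G" by (rule consistent_graph[OF c])
  have cd: "\<And>w i. card (I_sets a w i) \<le> s_size" "\<And>w i. I_sets a w i \<subseteq> {..length us}"
    "\<And>w i. w \<notin> verts ?G \<Longrightarrow> I_sets a w i = {}"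
    "\<And>u i. u \<in> verts ?G \<Longrightarrow> B_sets a u i = {w. u \<in> I_sets a w i}"
    "\<And>u i. u > length us \<Longrightarrow> B_sets a u i = {}"
    using c by (auto simp: consistent_def)
  obtain rs where rs: "rs \<in> set_pmf (random_nbrs ?G w s_size)"
    and I': "I_sets a' = (I_sets a)(w := (I_sets a w)(?l := set rs))"
    and B': "B_sets a' = (\<lambda>v i. if i = ?l \<and> v \<in> set rs
       then insert w (if i = ?l \<and> v \<in> I_sets a w ?l then B_sets a v i - {w} else B_sets a v i)
       else (if i = ?l \<and> v \<in> I_sets a w ?l then B_sets a v i - {w} else B_sets a v i))"
    and g': "cur_graph a' = ?G"
    and o': "ops a' = ops a + (qcost * (1 + real s_size) + real (card (I_sets a w ?l)) + real (card (set rs)) + 1)"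
    using a' g by (auto simp: resample_def Let_def tick_def)
  note new = random_nbrs_props[OF rs finite_N[OF v]]
  have newV: "set rs \<subseteq> verts ?G" using new(1) N_subset_verts[OF v] by blast
  have lenV: "verts ?G \<subseteq> {..length us}" using verts_le[OF v] by auto
  have "consistent us a'"
    unfolding consistent_def
  proof (intro conjI allI ballI impI)
    show "cur_graph a' = ?G" by (rule g')
    fix w' i
    show "card (I_sets a' w' i) \<le> s_size" using cd(1) new(2) by (simp add: I')
    show "I_sets a' w' i \<subseteq> {..length us}" using cd(2) newV lenV by (auto simp: I')
    show "I_sets a' w' i = {}" if "w' \<notin> verts ?G" using that w cd(3) by (auto simp: I')
  next
    fix u i assume u: "u \<in> verts ?G"
    show "B_sets a' u i = {w'. u \<in> I_sets a' w' i}"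
      unfolding B' I' cd(4)[OF u] by auto
  next
    fix u i assume u: "length us < u"
    have "u \<notin> set rs" "u \<notin> I_sets a w ?l" using u newV lenV cd(2)[of w ?l] by auto
    then show "B_sets a' u i = {}" using cd(5)[OF u] by (simp add: B')
  qed
  moreover have "ops a' \<le> ops a + resample_cost"
    using o' new(2) cd(1)[of w ?l] by (simp add: resample_cost_def)
  ultimately show thesis using that[of "set rs"] I' new s_size_pos by blast
qed

lemma level_le_top:
  assumes "valid us" "card (verts (graph_of us)) \<le> n"
  shows "level (graph_of us) w \<le> top_level"
proof (cases "deg (graph_of us) w = 0")
  case True
  then show ?thesis by (simp add: level_def log_def)
next
  case False
  have "deg (graph_of us) w \<le> n" using deg_le_verts[OF assms(1)] assms(2) order_trans by blast
  then have "log 2 (real (deg (graph_of us) w)) \<le> log 2 (real n)" using False by simp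
  then show ?thesis unfolding level_def top_level_def by (intro nat_mono floor_mono)
qed

lemma level_bounds:
  assumes "deg G w \<noteq> 0"
  shows "2 ^ level G w \<le> deg G w" "2 ^ j \<le> deg G w \<Longrightarrow> j \<le> level G w"
proof -
  let ?x = "log 2 (real (deg G w))"
  have x: "0 \<le> ?x" using assms by simp
  have "real (level G w) \<le> ?x" unfolding level_def using x by linarith
  then have "2 powr real (level G w) \<le> real (deg G w)" using assms by (simp add: le_log_iff)
  then have "2 ^ level G w \<le> real (deg G w)" by (simp add: powr_realpow)
  then show "2 ^ level G w \<le> deg G w" by (metis of_nat_le_iff of_nat_numeral of_nat_power)
  show "j \<le> level G w" if "2 ^ j \<le> deg G w"
  proof -
    have "real (2 ^ j) \<le> real (deg G w)" using that by (simp only: of_nat_le_iff)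
    then have "2 powr real j \<le> real (deg G w)" by (simp add: powr_realpow)
    then have "real j \<le> ?x" using assms by (simp add: le_log_iff)
    then show ?thesis unfolding level_def by linarith
  qed
qed

lemma fold_resample_sure:
  assumes v: "valid us" and c: "consistent us a" and ws: "set ws \<subseteq> verts (graph_of us)"
    and a': "a' \<in> set_pmf (fold_pmf resample ws a)"
  shows "consistent us a'" "ops a' \<le> ops a + real (length ws) * resample_cost"
    "\<And>w. w \<in> set ws \<Longrightarrow> targets a' w \<subseteq> N (graph_of us) w"
    "\<And>w. w \<notin> set ws \<Longrightarrow> I_sets a' w = I_sets a w"
proof -
  define P where "P xs s \<longleftrightarrow> set xs \<subseteq> verts (graph_of us) \<and> consistent us s \<and>
     ops s + real (length xs) * resample_cost \<le> ops a + real (length ws) * resample_cost \<and>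
     (\<forall>w\<in>set ws. w \<in> set xs \<or> targets s w \<subseteq> N (graph_of us) w) \<and>
     (\<forall>w. w \<notin> set ws \<longrightarrow> I_sets s w = I_sets a w) \<and> set xs \<subseteq> set ws" for xs s
  have "P [] a'"
    using a'
  proof (rule fold_pmf_invariant_list[where P = P], goal_cases)
    case 1 then show ?case using c ws by (simp add: P_def)
  next
    case (2 x xs s s')
    then have p: "consistent us s" "x \<in> verts (graph_of us)" "set xs \<subseteq> verts (graph_of us)" "x \<in> set ws" "set xs \<subseteq> set ws"
      "ops s + real (Suc (length xs)) * resample_cost \<le> ops a + real (length ws) * resample_cost"
      "\<And>w. w \<in> set ws \<Longrightarrow> w \<noteq> x \<Longrightarrow> w \<notin> set xs \<Longrightarrow> targets s w \<subseteq> N (graph_of us) w"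
      "\<And>w. w \<notin> set ws \<Longrightarrow> I_sets s w = I_sets a w" by (auto simp: P_def)
    obtain new where new: "I_sets s' = (I_sets s)(x := (I_sets s x)(level (graph_of us) x := new))"
      "new \<subseteq> N (graph_of us) x" "consistent us s'" "ops s' \<le> ops s + resample_cost"
      using resample_sure[OF v p(1,2) 2(2)] by metis
    have t: "targets s' w = (if w = x then new else targets s w)" for w
      using consistent_graph[OF new(3)] consistent_graph[OF p(1)] by (simp add: targets_def new(1))
    have I: "I_sets s' w = I_sets s w" if "w \<notin> set ws" for w using that p(4) new(1) by auto
    have "ops s' + real (length xs) * resample_cost \<le> ops a + real (length ws) * resample_cost"
      using p(6) new(4) by (simp add: distrib_right)
    then show ?case unfolding P_def t using p new(2,3) I by auto
  qed
  then show "consistent us a'" "ops a' \<le> ops a + real (length ws) * resample_cost"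
    "\<And>w. w \<in> set ws \<Longrightarrow> targets a' w \<subseteq> N (graph_of us) w"
    "\<And>w. w \<notin> set ws \<Longrightarrow> I_sets a' w = I_sets a w"
    by (auto simp: P_def)
qed

text \<open>The work caused by one notification of the first round: itself, at most
  \<open>s_size\<close> recipients in the second and \<open>s_size ^ 2\<close> in the third round,
  all of which resample, and the messages sent.\<close>

definition notify_factor :: real where
  "notify_factor = (1 + real s_size + real s_size ^ 2) * resample_cost + real s_size + real s_size ^ 2"

lemma resample_cost_nonneg: "0 \<le> resample_cost"
  using qcost_nonneg by (simp add: resample_cost_def)

lemma card_targets_UN:
  assumes c: "consistent us a" and R: "finite R"
  shows "card (\<Union>w\<in>R. targets a w) \<le> card R * s_size" "(\<Sum>w\<in>R. real (card (targets a w))) \<le> real (card R) * real s_size"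
proof -
  have *: "card (targets a w) \<le> s_size" for w using consistent_card[OF c] by (simp add: targets_def)
  have "card (\<Union>w\<in>R. targets a w) \<le> (\<Sum>w\<in>R. card (targets a w))" by (rule card_UN_le[OF R])
  also have "\<dots> \<le> card R * s_size" using * by (intro order_trans[OF sum_bounded_above]) auto
  finally show "card (\<Union>w\<in>R. targets a w) \<le> card R * s_size" .
  show "(\<Sum>w\<in>R. real (card (targets a w))) \<le> real (card R) * real s_size"
    using * by (intro order_trans[OF sum_bounded_above]) auto
qed

lemma notify_sure:
  assumes v: "valid us" and c: "consistent us a" and R0: "R0 \<subseteq> verts (graph_of us)"
    and r: "(R, a') \<in> set_pmf (notify R0 a)"
  obtains a1 where "a1 \<in> set_pmf (fold_pmf resample (enum R0) a)" "consistent us a1" "R = R0 \<union> (\<Union>w\<in>R0. targets a1 w)"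
    "R \<subseteq> verts (graph_of us)" "card R \<le> card R0 * (1 + s_size)" "consistent us a'"
    "ops a' \<le> ops a + real (card R0) * notify_factor"
proof -
  let ?V = "verts (graph_of us)"
  have fV: "finite ?V" using v by simp
  have f0: "finite R0" using R0 fV finite_subset by blast
  define c1 where "c1 a1 = (\<Sum>w\<in>R0. real (card (targets a1 w)))" for a1
  obtain a1 a2 R1 R2 where a1: "a1 \<in> set_pmf (fold_pmf resample (enum R0) a)"
    and R1: "R1 = (\<Union>w\<in>R0. targets a1 w)"
    and a2: "a2 \<in> set_pmf (fold_pmf resample (enum R1) (tick (\<Sum>w\<in>R0. real (card (targets a1 w))) a1))"
    and R2: "R2 = (\<Union>w\<in>R1. targets a2 w)"
    and a3: "a' \<in> set_pmf (fold_pmf resample (enum R2) (tick (\<Sum>w\<in>R1. real (card (targets a2 w))) a2))"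
    and R: "R = R0 \<union> R1"
    using r unfolding notify_def Let_def by auto
  have e0: "set (enum R0) \<subseteq> ?V" using R0 f0 by simp
  note s1 = fold_resample_sure[OF v c e0 a1]
  have R1V: "R1 \<subseteq> ?V" unfolding R1 using s1(3) f0 N_subset_verts[OF v] by fastforce
  have f1: "finite R1" using R1V fV finite_subset by blast
  have e1: "set (enum R1) \<subseteq> ?V" using R1V f1 by simp
  have c1: "consistent us (tick (\<Sum>w\<in>R0. real (card (targets a1 w))) a1)" using s1(1) by simp
  note s2 = fold_resample_sure[OF v c1 e1 a2]
  have R2V: "R2 \<subseteq> ?V" unfolding R2 using s2(3) f1 N_subset_verts[OF v] by fastforce
  have f2: "finite R2" using R2V fV finite_subset by blast
  have e2: "set (enum R2) \<subseteq> ?V" using R2V f2 by simp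
  have c2: "consistent us (tick (\<Sum>w\<in>R1. real (card (targets a2 w))) a2)" using s2(1) by simp
  note s3 = fold_resample_sure[OF v c2 e2 a3]
  note k1 = card_targets_UN[OF s1(1) f0] and k2 = card_targets_UN[OF s2(1) f1]
  have n1: "real (card R1) \<le> real (card R0) * real s_size"
    using k1(1) unfolding R1 by (metis of_nat_le_iff of_nat_mult)
  have n2': "real (card R2) \<le> real (card R1) * real s_size"
    using k2(1) unfolding R2 by (metis of_nat_le_iff of_nat_mult)
  have n12: "real (card R1) * real s_size \<le> real (card R0) * real s_size ^ 2"
    using mult_right_mono[OF n1, of "real s_size"] by (simp add: power2_eq_square mult.assoc)
  have "card R \<le> card R0 + card R1" unfolding R by (rule card_Un_le)
  also have "\<dots> \<le> card R0 * (1 + s_size)" using k1(1) R1 by simp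
  finally have cR: "card R \<le> card R0 * (1 + s_size)" .
  have o: "ops a' \<le> ops a + (real (card R0) + real (card R1) + real (card R2)) * resample_cost
     + (\<Sum>w\<in>R0. real (card (targets a1 w))) + (\<Sum>w\<in>R1. real (card (targets a2 w)))"
    using s1(2) s2(2) s3(2) f0 f1 f2 by (simp add: algebra_simps)
  also have "\<dots> \<le> ops a + (real (card R0) + real (card R0) * real s_size + real (card R0) * real s_size ^ 2) * resample_cost
     + real (card R0) * real s_size + real (card R0) * real s_size ^ 2"
    using k1(2) k2(2) n1 n2' n12 resample_cost_nonneg
    by (intro add_mono mult_right_mono order_refl) linarith+
  also have "\<dots> = ops a + real (card R0) * notify_factor" by (simp add: notify_factor_def algebra_simps)
  finally have "ops a' \<le> ops a + real (card R0) * notify_factor" .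
  then show thesis using that[OF a1 s1(1) R[unfolded R1] _ cR s3(1)] R R0 R1V by simp
qed

lemma reset_work_fields [simp]:
  "I_sets (reset_work a) = I_sets a" "B_sets (reset_work a) = B_sets a"
  "cur_graph (reset_work a) = cur_graph a" "ops (reset_work a) = 0"
  by (simp_all add: reset_work_def)

text \<open>The states \<open>prepare_insert\<close> and \<open>prepare_delete\<close> lie between
  an update and its notifications; in terms of them \<open>start_notify\<close> consists of
  \<open>resample\<close> and \<open>notify\<close> only.\<close>

definition prepare_insert :: "nat \<Rightarrow> node set \<Rightarrow> state \<Rightarrow> state" where
  "prepare_insert k S a = (reset_work a)\<lparr>cur_graph := insert_node k S (cur_graph a)\<rparr>"

definition departures :: "node \<Rightarrow> state \<Rightarrow> node set" where
  "departures u a = (\<Union>i\<le>top_level. B_sets a u i) - {u}"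

definition prepare_delete :: "node \<Rightarrow> state \<Rightarrow> state" where
  "prepare_delete u a = tick (\<Sum>i\<le>top_level. real (card (B_sets a u i)) + real (card (I_sets a u i)) + 1)
     (remove_edges {e. u \<in> e} ((reset_work a)\<lparr>cur_graph := delete_node u (cur_graph a),
            I_sets := (I_sets a)(u := (\<lambda>_. {})),
            B_sets := (\<lambda>v i. if v = u then {} else B_sets a v i - {u}),
            anchors := anchors a - {u}\<rparr>))"

lemma start_notify_Ins: "start_notify k (Ins S) a = resample k (prepare_insert k S a) \<bind> (\<lambda>a1.
    notify (targets a1 k) (tick (real (card (targets a1 k)) + 1) a1) \<bind> (\<lambda>(R, a2). return_pmf (insert k R, a2)))"
  by (simp add: start_notify_def arrive_def Let_def prepare_insert_def)

lemma start_notify_Del: "start_notify k (Del u) a = notify (departures u a) (prepare_delete u a)"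
  by (simp add: start_notify_def depart_def Let_def prepare_delete_def departures_def cong: if_cong)
    (simp add: reset_work_def)

lemma prepare_insert_fields [simp]:
  "I_sets (prepare_insert k S a) = I_sets a" "B_sets (prepare_insert k S a) = B_sets a" "ops (prepare_insert k S a) = 0"
  by (simp_all add: prepare_insert_def)

lemma prepare_delete_fields [simp]:
  "I_sets (prepare_delete u a) = (I_sets a)(u := (\<lambda>_. {}))"
  "B_sets (prepare_delete u a) = (\<lambda>v i. if v = u then {} else B_sets a v i - {u})"
  "cur_graph (prepare_delete u a) = delete_node u (cur_graph a)"
  "ops (prepare_delete u a) = (\<Sum>i\<le>top_level. real (card (B_sets a u i)) + real (card (I_sets a u i)) + 1)"
  by (simp_all add: prepare_delete_def remove_edges_def)

lemma consistent_prepare_insert: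
  assumes v: "valid (Ins S # us)" and c: "consistent us a"
  shows "consistent (Ins S # us) (prepare_insert (Suc (length us)) S a)"
proof -
  have V: "verts (graph_of (Ins S # us)) = insert (Suc (length us)) (verts (graph_of us))"
    by (simp add: insert_node_def)
  have "Suc (length us) \<notin> I_sets a w i" for w i using c unfolding consistent_def by (meson atMost_iff lessI not_le subsetD)
  then show ?thesis using c unfolding consistent_def V by (auto simp: prepare_insert_def) (meson atMost_iff le_SucI subsetD)
qed

lemma consistent_prepare_delete:
  assumes v: "valid (Del u # us)" and c: "consistent us a"
  shows "consistent (Del u # us) (prepare_delete u a)"
proof -
  have V: "verts (graph_of (Del u # us)) = verts (graph_of us) - {u}" by (simp add: delete_node_def)
  have "I_sets a w i \<subseteq> {..Suc (length us)}" for w i using c unfolding consistent_def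
    by (meson atMost_iff le_SucI subsetD subsetI)
  then show ?thesis using c unfolding consistent_def V by auto
qed

lemma departures_verts:
  assumes v: "valid (Del u # us)" and c: "consistent us a"
  shows "departures u a \<subseteq> verts (graph_of (Del u # us))"
proof
  fix w assume "w \<in> departures u a"
  then obtain i where "w \<in> B_sets a u i" "w \<noteq> u" by (auto simp: departures_def)
  moreover have "u \<in> verts (graph_of us)" using v by simp
  ultimately have "u \<in> I_sets a w i" using c by (auto simp: consistent_def)
  then have "w \<in> verts (graph_of us)" using c by (auto simp: consistent_def)
  then show "w \<in> verts (graph_of (Del u # us))" using \<open>w \<noteq> u\<close> by (simp add: delete_node_def)
qed

lemma start_notify_sure:
  assumes v: "valid (x # us)" and c: "consistent us a"
    and r: "(R, a') \<in> set_pmf (start_notify (Suc (length us)) x a)"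
  shows "R \<subseteq> verts (graph_of (x # us))" "consistent (x # us) a'"
proof -
  have "R \<subseteq> verts (graph_of (x # us)) \<and> consistent (x # us) a'"
  proof (cases x)
    case (Ins S)
    let ?k = "Suc (length us)"
    have k: "?k \<in> verts (graph_of (x # us))" by (simp add: Ins insert_node_def)
    obtain a1 R' where a1: "a1 \<in> set_pmf (resample ?k (prepare_insert ?k S a))"
      and R': "(R', a') \<in> set_pmf (notify (targets a1 ?k) (tick (real (card (targets a1 ?k)) + 1) a1))" "R = insert ?k R'"
      using r unfolding Ins start_notify_Ins by auto
    have c0: "consistent (x # us) (prepare_insert ?k S a)"
      using consistent_prepare_insert[of S us a] v c Ins by simp
    obtain new where new: "I_sets a1 = (I_sets (prepare_insert ?k S a))(?k := (I_sets (prepare_insert ?k S a) ?k)(level (graph_of (x # us)) ?k := new))"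
      "new \<subseteq> N (graph_of (x # us)) ?k" and c1: "consistent (x # us) a1"
      using resample_sure[OF v c0 k a1] by metis
    have "targets a1 ?k \<subseteq> verts (graph_of (x # us))"
      using new N_subset_verts[OF v] consistent_graph[OF c1] by (auto simp: targets_def)
    from notify_sure[OF v _ this R'(1)] c1 show ?thesis using k R'(2) by (metis consistent_tick insert_subset)
  next
    case (Del u)
    have "consistent (x # us) (prepare_delete u a)" "departures u a \<subseteq> verts (graph_of (x # us))"
      using consistent_prepare_delete departures_verts v c Del by blast+
    from notify_sure[OF v this r[unfolded Del start_notify_Del]] show ?thesis by metis
  qed
  then show "R \<subseteq> verts (graph_of (x # us))" "consistent (x # us) a'" by auto
qed

lemma notify_run_sure:
  "valid us \<Longrightarrow> (Rs, a) \<in> set_pmf (notify_run us) \<Longrightarrow> consistent us a"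
proof (induction us arbitrary: Rs a)
  case Nil
  then show ?case by (simp add: consistent_def init_state_def empty_graph_def)
next
  case (Cons x us)
  then obtain R Rs0 a0 where 0: "(Rs0, a0) \<in> set_pmf (notify_run us)"
    and r: "(R, a) \<in> set_pmf (start_notify (Suc (length us)) x a0)" by auto
  show ?case by (rule start_notify_sure(2)[OF Cons.prems(1) Cons.IH[OF valid_tl[OF Cons.prems(1)] 0] r])
qed

section \<open>Notification costs of an insertion and of a deletion\<close>

text \<open>A bound for the notifications sent when \<open>u\<close> is deleted, counted with
  multiplicity over the levels. For a single node it can be large; only its mean over all present
  nodes is controlled.\<close>

definition load :: "state \<Rightarrow> node \<Rightarrow> nat" where
  "load a u = (\<Sum>i\<le>top_level. card (B_sets a u i))"

lemma insert_cost:
  assumes v: "valid (Ins S # us)" and c: "consistent us a"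
    and r: "(R, a') \<in> set_pmf (start_notify (Suc (length us)) (Ins S) a)"
  shows "real (card R) \<le> 1 + real s_size * (1 + real s_size)"
    "ops a' \<le> resample_cost + real s_size + 1 + real s_size * notify_factor"
proof -
  let ?k = "Suc (length us)"
  have k: "?k \<in> verts (graph_of (Ins S # us))" by (simp add: insert_node_def)
  obtain a1 R' where a1: "a1 \<in> set_pmf (resample ?k (prepare_insert ?k S a))"
    and R': "(R', a') \<in> set_pmf (notify (targets a1 ?k) (tick (real (card (targets a1 ?k)) + 1) a1))" "R = insert ?k R'"
    using r unfolding start_notify_Ins by auto
  note c0 = consistent_prepare_insert[OF v c]
  obtain new where new: "I_sets a1 = (I_sets (prepare_insert ?k S a))(?k := (I_sets (prepare_insert ?k S a) ?k)(level (graph_of (Ins S # us)) ?k := new))"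
    "new \<subseteq> N (graph_of (Ins S # us)) ?k" and c1: "consistent (Ins S # us) a1"
    and o1: "ops a1 \<le> ops (prepare_insert ?k S a) + resample_cost"
    using resample_sure[OF v c0 k a1] by metis
  have T: "targets a1 ?k \<subseteq> verts (graph_of (Ins S # us))"
    using new N_subset_verts[OF v] consistent_graph[OF c1] by (auto simp: targets_def)
  have cT: "card (targets a1 ?k) \<le> s_size" using consistent_card[OF c1] by (simp add: targets_def)
  have nf: "0 \<le> notify_factor" using resample_cost_nonneg by (simp add: notify_factor_def)
  have "card R' \<le> card (targets a1 ?k) * (1 + s_size)"
    and o2: "ops a' \<le> ops (tick (real (card (targets a1 ?k)) + 1) a1) + real (card (targets a1 ?k)) * notify_factor"
    using notify_sure[OF v _ T R'(1)] c1 by (metis consistent_tick)+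
  then have "card R' \<le> s_size * (1 + s_size)" using cT by (meson mult_le_mono1 order_trans)
  then have "card R \<le> 1 + s_size * (1 + s_size)" unfolding R'(2) using card_insert_le_m1[of "Suc (card R')" R' ?k] by simp
  then have "real (card R) \<le> real (1 + s_size * (1 + s_size))" by (simp only: of_nat_le_iff)
  then show "real (card R) \<le> 1 + real s_size * (1 + real s_size)" by (simp add: distrib_left)
  have "real (card (targets a1 ?k)) * notify_factor \<le> real s_size * notify_factor"
    using cT nf by (intro mult_right_mono) auto
  then show "ops a' \<le> resample_cost + real s_size + 1 + real s_size * notify_factor"
    using o1 o2 cT by simp
qed

lemma delete_cost:
  assumes v: "valid (Del u # us)" and c: "consistent us a"
    and r: "(R, a') \<in> set_pmf (start_notify (Suc (length us)) (Del u) a)"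
  shows "real (card R) \<le> real (load a u) * (1 + real s_size)"
    "ops a' \<le> real (load a u) * (1 + notify_factor) + real (Suc top_level) * (1 + real s_size)"
proof -
  note c0 = consistent_prepare_delete[OF v c] and d = departures_verts[OF v c]
  have "finite (verts (graph_of (Del u # us)))" using v by (rule finite_verts)
  have nf: "0 \<le> notify_factor" using resample_cost_nonneg by (simp add: notify_factor_def)
  have "card (departures u a) \<le> card (\<Union>i\<le>top_level. B_sets a u i)" 
  proof (intro card_mono finite_UN_I)
    fix i
    have "u \<in> verts (graph_of us)" using v by simp
    then have "B_sets a u i = {w. u \<in> I_sets a w i}" using c by (auto simp: consistent_def)
    also have "\<dots> \<subseteq> verts (graph_of us)" using c by (auto simp: consistent_def)
    finally show "finite (B_sets a u i)" using finite_subset valid_tl[OF v] finite_verts by blast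
  qed (auto simp: departures_def)
  also have "\<dots> \<le> load a u" unfolding load_def by (intro card_UN_le) simp
  finally have cd: "card (departures u a) \<le> load a u" .
  have "card R \<le> card (departures u a) * (1 + s_size)"
    and o: "ops a' \<le> ops (prepare_delete u a) + real (card (departures u a)) * notify_factor"
    using notify_sure[OF v c0 d r[unfolded start_notify_Del]] by metis+
  then have "card R \<le> load a u * (1 + s_size)" using cd by (meson mult_le_mono1 order_trans)
  then have "real (card R) \<le> real (load a u * (1 + s_size))" by (simp only: of_nat_le_iff)
  then show "real (card R) \<le> real (load a u) * (1 + real s_size)" by (simp add: distrib_left)
  have "ops (prepare_delete u a) = real (load a u) + (\<Sum>i\<le>top_level. real (card (I_sets a u i)) + 1)"
    by (simp add: load_def sum.distrib)
  also have "(\<Sum>i\<le>top_level. real (card (I_sets a u i)) + 1) \<le> (\<Sum>i\<le>top_level. 1 + real s_size)"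
    using consistent_card[OF c] by (intro sum_mono) simp
  finally have "ops (prepare_delete u a) \<le> real (load a u) + real (Suc top_level) * (1 + real s_size)" by simp
  moreover have "real (card (departures u a)) * notify_factor \<le> real (load a u) * notify_factor"
    using cd nf by (intro mult_right_mono) auto
  ultimately show "ops a' \<le> real (load a u) * (1 + notify_factor) + real (Suc top_level) * (1 + real s_size)"
    using o by (simp add: algebra_simps)
qed

text \<open>Double counting: this is where the deleted node has to be uniformly random.\<close>

lemma sum_load:
  assumes v: "valid us" and c: "consistent us a"
  shows "(\<Sum>u\<in>verts (graph_of us). load a u) \<le> card (verts (graph_of us)) * (Suc top_level * s_size)"
proof -
  let ?V = "verts (graph_of us)"
  have fV: "finite ?V" using v by simp
  have "(\<Sum>u\<in>?V. card (B_sets a u i)) \<le> card ?V * s_size" for i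
  proof -
    have "(\<Sum>u\<in>?V. card (B_sets a u i)) = (\<Sum>u\<in>?V. card {w \<in> ?V. u \<in> I_sets a w i})"
      using c by (intro sum.cong arg_cong[where f = card]) (auto simp: consistent_def)
    also have "\<dots> = (\<Sum>w\<in>?V. card {u \<in> ?V. u \<in> I_sets a w i})"
      using sum.swap_restrict[OF fV fV, of "\<lambda>_ _. 1::nat" "\<lambda>u w. u \<in> I_sets a w i"] by simp
    also have "\<dots> \<le> (\<Sum>w\<in>?V. s_size)"
    proof (rule sum_mono)
      fix w
      have "card {u \<in> ?V. u \<in> I_sets a w i} \<le> card (I_sets a w i)"
        by (intro card_mono consistent_finite[OF c]) auto
      also have "\<dots> \<le> s_size" by (rule consistent_card[OF c])
      finally show "card {u \<in> ?V. u \<in> I_sets a w i} \<le> s_size" .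
    qed
    finally show ?thesis by simp
  qed
  then have "(\<Sum>i\<le>top_level. \<Sum>u\<in>?V. card (B_sets a u i)) \<le> (\<Sum>i\<le>top_level. card ?V * s_size)"
    by (rule sum_mono)
  then show ?thesis unfolding load_def by (subst sum.swap) (simp add: algebra_simps)
qed

section \<open>Growing nodes are notified\<close>

text \<open>A node with an intact sample of a level \<open>\<ge> j\<close> is shielded. While its degree is below \<open>2 ^ j\<close>, that
  sample is not overwritten, and the shield is lost only with the deletion of a sampled node. The node
  then notifies a fresh sample of fewer than \<open>2 ^ j\<close> neighbours.\<close>


definition shielded :: "nat \<Rightarrow> graph \<Rightarrow> state \<Rightarrow> node \<Rightarrow> bool" where
  "shielded j G a v \<longleftrightarrow> (\<exists>l\<le>top_level. j \<le> l \<and> I_sets a v l \<noteq> {} \<and> I_sets a v l \<subseteq> N G v)"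

lemma shielded_tick [simp]: "shielded j G (tick c a) v \<longleftrightarrow> shielded j G a v"
  by (simp add: shielded_def)

text \<open>A resampling overwrites the sample of the current level only. If this is the shielding
  sample, the level is at least \<open>j\<close>, and the fresh sample, nonempty and made of current
  neighbours, takes over. A node of degree at least \<open>2 ^ j\<close> gains a shield in the same
  way.\<close>

lemma shielded_resample:
  assumes v: "valid us" "card (verts (graph_of us)) \<le> n" and c: "consistent us a" and w: "w \<in> verts (graph_of us)"
    and a': "a' \<in> set_pmf (resample w a)" and ne: "N (graph_of us) u \<noteq> {}"
    and sh: "shielded j (graph_of us) a u \<or> w = u \<and> 2 ^ j \<le> deg (graph_of us) u"
  shows "shielded j (graph_of us) a' u"
proof -
  let ?l = "level (graph_of us) w"
  obtain new where new: "I_sets a' = (I_sets a)(w := (I_sets a w)(?l := new))"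
    "new \<subseteq> N (graph_of us) w" "N (graph_of us) w \<noteq> {} \<Longrightarrow> new \<noteq> {}"
    using resample_sure[OF v(1) c w a'] by metis
  consider l where "l \<le> top_level" "j \<le> l" "I_sets a u l \<noteq> {}" "I_sets a u l \<subseteq> N (graph_of us) u" "\<not> (w = u \<and> l = ?l)"
    | "w = u" "j \<le> ?l"
  proof -
    have "deg (graph_of us) u \<noteq> 0" using ne v(1) by simp
    then show thesis using sh level_bounds(2)[of "graph_of us" u j] that unfolding shielded_def by blast
  qed
  then show ?thesis
  proof cases
    case 1
    then show ?thesis unfolding shielded_def new(1) by (intro exI[of _ l]) auto
  next
    case 2
    then show ?thesis using new ne level_le_top[OF v] unfolding shielded_def new(1) by (intro exI[of _ ?l]) auto
  qed
qed

lemma shielded_fold: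
  assumes v: "valid us" "card (verts (graph_of us)) \<le> n" and c: "consistent us a" and ws: "set ws \<subseteq> verts (graph_of us)"
    and a': "a' \<in> set_pmf (fold_pmf resample ws a)" and ne: "N (graph_of us) u \<noteq> {}"
    and sh: "shielded j (graph_of us) a u \<or> u \<in> set ws \<and> 2 ^ j \<le> deg (graph_of us) u"
  shows "shielded j (graph_of us) a' u"
proof -
  define P where "P xs s \<longleftrightarrow> set xs \<subseteq> verts (graph_of us) \<and> consistent us s \<and>
    (shielded j (graph_of us) s u \<or> u \<in> set xs \<and> 2 ^ j \<le> deg (graph_of us) u)" for xs s
  have "P [] a'"
    using a'
  proof (rule fold_pmf_invariant_list[where P = P], goal_cases)
    case 1 then show ?case using c ws sh by (simp add: P_def)
  next
    case (2 x xs s s')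
    then have p: "consistent us s" "x \<in> verts (graph_of us)" "set xs \<subseteq> verts (graph_of us)"
      "shielded j (graph_of us) s u \<or> (u = x \<or> u \<in> set xs) \<and> 2 ^ j \<le> deg (graph_of us) u"
      by (auto simp: P_def)
    have "consistent us s'" using resample_sure[OF v(1) p(1,2) 2(2)] by metis
    then show ?case using shielded_resample[OF v p(1,2) 2(2) ne] p(3,4) unfolding P_def by blast
  qed
  then show ?thesis by (simp add: P_def)
qed

text \<open>The first round is split off because the samples drawn in it decide whether
  \<open>w\<close> is hit; in the potential argument the later rounds have to preserve the
  shields.\<close>

definition later_rounds :: "node set \<Rightarrow> state \<Rightarrow> (node set \<times> state) pmf" where
  "later_rounds R0 st1 = (    let R1 = (\<Union>w\<in>R0. targets st1 w) in
    fold_pmf resample (enum R1) (tick (\<Sum>w\<in>R0. real (card (targets st1 w))) st1) \<bind> (\<lambda>st2.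
    let R2 = (\<Union>w\<in>R1. targets st2 w) in
    fold_pmf resample (enum R2) (tick (\<Sum>w\<in>R1. real (card (targets st2 w))) st2) \<bind> (\<lambda>st3.
    return_pmf (R0 \<union> R1, st3))))"

lemma notify_eq: "notify R0 a = fold_pmf resample (enum R0) a \<bind> later_rounds R0"
  by (simp add: notify_def later_rounds_def[abs_def])

lemma later_rounds_sure:
  assumes v: "valid us" "card (verts (graph_of us)) \<le> n" and c: "consistent us a" and R0: "R0 \<subseteq> verts (graph_of us)"
    and a1: "a1 \<in> set_pmf (fold_pmf resample (enum R0) a)" and Ra': "(R, a') \<in> set_pmf (later_rounds R0 a1)"
  shows "R0 \<subseteq> R" "(\<Union>w\<in>R0. targets a1 w) \<subseteq> R"
    "N (graph_of us) u \<noteq> {} \<Longrightarrow> shielded j (graph_of us) a u \<or> u \<in> R0 \<and> 2 ^ j \<le> deg (graph_of us) u \<Longrightarrow>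
       shielded j (graph_of us) a' u"
proof -
    from Ra' obtain R1 a2 R2 where R1: "R1 = (\<Union>w\<in>R0. targets a1 w)"
      and a2: "a2 \<in> set_pmf (fold_pmf resample (enum R1) (tick (\<Sum>w\<in>R0. real (card (targets a1 w))) a1))"
      and R2: "R2 = (\<Union>w\<in>R1. targets a2 w)"
      and a3: "a' \<in> set_pmf (fold_pmf resample (enum R2) (tick (\<Sum>w\<in>R1. real (card (targets a2 w))) a2))"
      and R: "R = R0 \<union> R1"
      unfolding later_rounds_def Let_def by auto
    let ?V = "verts (graph_of us)"
    have fV: "finite ?V" using v by simp
    have f0: "finite R0" using R0 fV finite_subset by blast
    have e0: "set (enum R0) \<subseteq> ?V" using R0 f0 by simp
    note s1 = fold_resample_sure[OF v(1) c e0 a1]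
    have R1V: "R1 \<subseteq> ?V" unfolding R1 using s1(3) f0 N_subset_verts[OF v(1)] by fastforce
    have f1: "finite R1" using R1V fV finite_subset by blast
    have e1: "set (enum R1) \<subseteq> ?V" using R1V f1 by simp
    have c1: "consistent us (tick x a1)" for x using s1(1) by simp
    note s2 = fold_resample_sure[OF v(1) c1 e1 a2]
    have R2V: "R2 \<subseteq> ?V" unfolding R2 using s2(3) f1 N_subset_verts[OF v(1)] by fastforce
    have f2: "finite R2" using R2V fV finite_subset by blast
    have e2: "set (enum R2) \<subseteq> ?V" using R2V f2 by simp
    have c2: "consistent us (tick x a2)" for x using s2(1) by simp
    have "shielded j (graph_of us) a' u" if ne: "N (graph_of us) u \<noteq> {}"
      and sh: "shielded j (graph_of us) a u \<or> u \<in> R0 \<and> 2 ^ j \<le> deg (graph_of us) u"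
    proof -
      have "shielded j (graph_of us) a1 u" using shielded_fold[OF v c e0 a1 ne] sh f0 by simp
      then have "shielded j (graph_of us) a2 u" using shielded_fold[OF v c1 e1 a2 ne] by simp
      then show ?thesis using shielded_fold[OF v c2 e2 a3 ne] by simp
    qed
    then show "N (graph_of us) u \<noteq> {} \<Longrightarrow> shielded j (graph_of us) a u \<or> u \<in> R0 \<and> 2 ^ j \<le> deg (graph_of us) u \<Longrightarrow>
       shielded j (graph_of us) a' u" by blast
    show "R0 \<subseteq> R" "(\<Union>w\<in>R0. targets a1 w) \<subseteq> R" using R R1 by blast+
qed

text \<open>The probability that \<open>s_size\<close> uniform draws from \<open>2 ^ j\<close>
  elements all miss a given one.\<close>

definition miss_prob :: "nat \<Rightarrow> real" where
  "miss_prob j = (1 - 1 / 2 ^ j) ^ s_size"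

lemma nn_integral_replicate_all:
  assumes "finite X" "X \<noteq> {}"
  shows "(\<integral>\<^sup>+rs. of_bool (set rs \<subseteq> A) \<partial>measure_pmf (replicate_pmf k (pmf_of_set X))) =
    ennreal ((real (card (A \<inter> X)) / real (card X)) ^ k)"
proof -
  have "(of_bool (set rs \<subseteq> A) :: ennreal) = prod_list (map (\<lambda>x. of_bool (x \<in> A)) rs)" for rs
  proof (induction rs)
    case (Cons a rs)
    have "(of_bool (set (a # rs) \<subseteq> A) :: ennreal) = of_bool (a \<in> A) * of_bool (set rs \<subseteq> A)"
      by (simp add: of_bool_conj)
    then show ?case by (simp add: Cons)
  qed simp
  then have "(\<integral>\<^sup>+rs. of_bool (set rs \<subseteq> A) \<partial>measure_pmf (replicate_pmf k (pmf_of_set X))) =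
    (\<integral>\<^sup>+x. of_bool (x \<in> A) \<partial>measure_pmf (pmf_of_set X)) ^ k"
    by (simp add: nn_integral_replicate_pmf_prod)
  also have "(\<integral>\<^sup>+x. of_bool (x \<in> A) \<partial>measure_pmf (pmf_of_set X)) = ennreal (real (card (A \<inter> X)) / real (card X))"
    using assms
    by (simp add: nn_integral_pmf_of_set divide_ennreal ennreal_of_nat_eq_real_of_nat card_gt_0_iff Int_def conj_commute)
  finally show ?thesis by (simp add: ennreal_power)
qed

lemma resample_miss:
  assumes v: "valid us" and c: "consistent us a"
    and w: "w \<in> N (graph_of us) u" and d: "deg (graph_of us) u \<le> 2 ^ j"
  shows "(\<integral>\<^sup>+a'. of_bool (w \<notin> targets a' u) \<partial>measure_pmf (resample u a)) \<le> ennreal (miss_prob j)"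
proof -
  let ?G = "graph_of us" let ?X = "N ?G u"
  have g: "cur_graph a = ?G" by (rule consistent_graph[OF c])
  have X: "finite ?X" "?X \<noteq> {}" using v w by auto
  have "(\<integral>\<^sup>+a'. of_bool (w \<notin> targets a' u) \<partial>measure_pmf (resample u a)) =
    (\<integral>\<^sup>+rs. of_bool (set rs \<subseteq> - {w}) \<partial>measure_pmf (replicate_pmf s_size (pmf_of_set ?X)))"
    using X g by (simp add: resample_def Let_def targets_def tick_def random_nbrs_def subset_Compl_singleton)
  also have "\<dots> = ennreal ((real (card (- {w} \<inter> ?X)) / real (card ?X)) ^ s_size)"
    by (rule nn_integral_replicate_all[OF X])
  also have "\<dots> \<le> ennreal (miss_prob j)"
    unfolding miss_prob_def
  proof (intro ennreal_leI power_mono)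
    have p: "0 < real (card ?X)" using X by (simp add: card_gt_0_iff)
    have "- {w} \<inter> ?X = ?X - {w}" by auto
    then have "real (card (- {w} \<inter> ?X)) = real (card ?X) - 1"
      using X w by (simp add: card_Diff_singleton card_gt_0_iff Suc_leI of_nat_diff)
    then have "real (card (- {w} \<inter> ?X)) / real (card ?X) = 1 - 1 / real (card ?X)" using p by (simp add: field_simps)
    moreover have "real (card ?X) \<le> 2 ^ j" using d by (metis of_nat_le_iff of_nat_numeral of_nat_power)
    then have "1 / 2 ^ j \<le> 1 / real (card ?X)" using p by (intro divide_left_mono) auto
    ultimately show "real (card (- {w} \<inter> ?X)) / real (card ?X) \<le> 1 - 1 / 2 ^ j" by simp
  qed simp
  finally show ?thesis .
qed

lemma miss_prob_nonneg: "0 \<le> miss_prob j"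
  unfolding miss_prob_def by (intro zero_le_power) (simp add: one_le_power)

text \<open>Each sample of the round is drawn with fresh randomness. As \<open>ws\<close> is
  distinct, no sample is overwritten before the targets are read in the final state, so the miss
  probabilities multiply.\<close>

lemma fold_miss:
  assumes v: "valid us" and c: "consistent us a" and ws: "set ws \<subseteq> verts (graph_of us)" "distinct ws"
    and T: "\<And>u. u \<in> T \<Longrightarrow> w \<in> N (graph_of us) u \<and> deg (graph_of us) u \<le> 2 ^ j"
  shows "(\<integral>\<^sup>+a'. of_bool (\<forall>u\<in>T \<inter> set ws. w \<notin> targets a' u) \<partial>measure_pmf (fold_pmf resample ws a))
    \<le> ennreal (miss_prob j ^ card (T \<inter> set ws))"
  using c ws
proof (induction ws arbitrary: a)
  case Nil
  then show ?case by simp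
next
  case (Cons x ws)
  let ?q = "miss_prob j" let ?m = "card (T \<inter> set ws)"
  have sub: "set ws \<subseteq> verts (graph_of us)" "distinct ws" "x \<in> verts (graph_of us)" "x \<notin> set ws" using Cons.prems by auto
  have "(\<integral>\<^sup>+a'. of_bool (\<forall>u\<in>T \<inter> set (x # ws). w \<notin> targets a' u) \<partial>measure_pmf (fold_pmf resample (x # ws) a))
    \<le> (\<integral>\<^sup>+a1. of_bool (x \<in> T \<longrightarrow> w \<notin> targets a1 x) * ennreal (?q ^ ?m) \<partial>measure_pmf (resample x a))"
    unfolding fold_pmf.simps nn_integral_bind_pmf
  proof (rule nn_integral_pmf_mono)
    fix a1 assume a1: "a1 \<in> set_pmf (resample x a)"
    have c1: "consistent us a1" using resample_sure[OF v Cons.prems(1) sub(3) a1] by metis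
    have "(\<integral>\<^sup>+a'. of_bool (\<forall>u\<in>T \<inter> set (x # ws). w \<notin> targets a' u) \<partial>measure_pmf (fold_pmf resample ws a1))
      \<le> (\<integral>\<^sup>+a'. of_bool (x \<in> T \<longrightarrow> w \<notin> targets a1 x) * of_bool (\<forall>u\<in>T \<inter> set ws. w \<notin> targets a' u) \<partial>measure_pmf (fold_pmf resample ws a1))"
    proof (rule nn_integral_pmf_mono)
      fix a' assume a': "a' \<in> set_pmf (fold_pmf resample ws a1)"
      note s = fold_resample_sure[OF v c1 sub(1) a']
      have "targets a' x = targets a1 x"
        using s(4)[OF sub(4)] consistent_graph[OF s(1)] consistent_graph[OF c1] by (simp add: targets_def)
      then show "(of_bool (\<forall>u\<in>T \<inter> set (x # ws). w \<notin> targets a' u) :: ennreal)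
        \<le> of_bool (x \<in> T \<longrightarrow> w \<notin> targets a1 x) * of_bool (\<forall>u\<in>T \<inter> set ws. w \<notin> targets a' u)"
        by auto
    qed
    also have "\<dots> = of_bool (x \<in> T \<longrightarrow> w \<notin> targets a1 x) * (\<integral>\<^sup>+a'. of_bool (\<forall>u\<in>T \<inter> set ws. w \<notin> targets a' u) \<partial>measure_pmf (fold_pmf resample ws a1))"
      by (rule nn_integral_pmf_cmult)
    also have "\<dots> \<le> of_bool (x \<in> T \<longrightarrow> w \<notin> targets a1 x) * ennreal (?q ^ ?m)"
      by (intro mult_left_mono Cons.IH c1 sub) auto
    finally show "(\<integral>\<^sup>+a'. of_bool (\<forall>u\<in>T \<inter> set (x # ws). w \<notin> targets a' u) \<partial>measure_pmf (fold_pmf resample ws a1))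
      \<le> of_bool (x \<in> T \<longrightarrow> w \<notin> targets a1 x) * ennreal (?q ^ ?m)" .
  qed
  also have "\<dots> = (\<integral>\<^sup>+a1. of_bool (x \<in> T \<longrightarrow> w \<notin> targets a1 x) \<partial>measure_pmf (resample x a)) * ennreal (?q ^ ?m)"
    by (rule nn_integral_multc) auto
  also have "\<dots> \<le> ennreal (?q ^ card (T \<inter> set (x # ws)))"
  proof (cases "x \<in> T")
    case True
    have "(\<integral>\<^sup>+a1. of_bool (x \<in> T \<longrightarrow> w \<notin> targets a1 x) \<partial>measure_pmf (resample x a)) \<le> ennreal ?q"
      using resample_miss[OF v Cons.prems(1)] T[OF True] True by simp
    then have "(\<integral>\<^sup>+a1. of_bool (x \<in> T \<longrightarrow> w \<notin> targets a1 x) \<partial>measure_pmf (resample x a)) * ennreal (?q ^ ?m) \<le> ennreal ?q * ennreal (?q ^ ?m)"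
      by (rule mult_right_mono) simp
    also have "\<dots> = ennreal (?q ^ Suc ?m)" using miss_prob_nonneg by (simp add: ennreal_mult)
    also have "Suc ?m = card (T \<inter> set (x # ws))" using True sub(4) by simp
    finally show ?thesis .
  qed simp
  finally show ?case .
qed

text \<open>\<open>m\<close> will be the time when \<open>w\<close> was last processed. An exposed
  neighbour arrived later and has no high-level sample left, so it has drawn a small-degree sample
  that could have contained \<open>w\<close>.\<close>

definition exposed :: "nat \<Rightarrow> nat \<Rightarrow> node \<Rightarrow> graph \<Rightarrow> state \<Rightarrow> node set" where
  "exposed j m w G a = {v \<in> N G w. m < v \<and> \<not> shielded j G a v}"

lemma exposed_finite: "valid us \<Longrightarrow> finite (exposed j m w (graph_of us) a)"
  unfolding exposed_def by (rule finite_subset[OF _ finite_N]) auto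

lemma shielded_prepare_insert:
  assumes v: "valid (Ins S # us)" and sh: "shielded j (graph_of us) a u"
  shows "shielded j (graph_of (Ins S # us)) (prepare_insert k S a) u"
  using sh unfolding shielded_def by (auto simp: N_insert)

text \<open>If a sample contains the deleted \<open>y\<close>, its owner is a member of
  \<open>departures y a\<close>. All other shielding samples stay inside the neighbourhood.\<close>

lemma shielded_prepare_delete:
  assumes v: "valid (Del y # us)" and c: "consistent us a" and sh: "shielded j (graph_of us) a u" and u: "u \<noteq> y"
    and nd: "u \<notin> departures y a"
  shows "shielded j (graph_of (Del y # us)) (prepare_delete y a) u"
proof -
  obtain l where l: "l \<le> top_level" "j \<le> l" "I_sets a u l \<noteq> {}" "I_sets a u l \<subseteq> N (graph_of us) u"
    using sh by (auto simp: shielded_def)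
  have "y \<in> verts (graph_of us)" using v by simp
  then have "B_sets a y l = {w. y \<in> I_sets a w l}" using c by (simp add: consistent_def)
  then have "y \<notin> I_sets a u l" using nd l(1) u by (auto simp: departures_def)
  then show ?thesis using l u unfolding shielded_def by (intro exI[of _ l]) (auto simp: N_delete)
qed

text \<open>\<open>m\<close> additional exposed nodes raise the potential by exactly the factor by
  which missing \<open>w\<close> in \<open>m\<close> samples lowers the probability.\<close>

lemma miss_potential:
  fixes r :: real
  assumes r: "r * miss_prob j = 1" "1 \<le> r"
  shows "ennreal (r ^ (c + m)) * ennreal (miss_prob j ^ m) = ennreal (r ^ c)"
proof -
  have "r ^ (c + m) * miss_prob j ^ m = r ^ c * (r * miss_prob j) ^ m"
    by (simp add: power_add power_mult_distrib)
  then show ?thesis using r miss_prob_nonneg[of j] by (subst ennreal_mult[symmetric]) auto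
qed

text \<open>With \<open>r = 1 / miss_prob j\<close>, the power \<open>r ^ card exposed\<close>, set to 0 as soon as \<open>w\<close> is notified, is a
  supermartingale: every newly exposed node has just missed \<open>w\<close>, with probability at most \<open>1 / r\<close>.\<close>

lemma notify_potential:
  fixes r :: real
  assumes v: "valid us" "card (verts (graph_of us)) \<le> n" and c: "consistent us a" and R0: "R0 \<subseteq> verts (graph_of us)"
    and r: "r * miss_prob j = 1" "1 \<le> r"
    and E: "finite E" "\<And>u. u \<in> N (graph_of us) w \<Longrightarrow> m < u \<Longrightarrow> u \<notin> E \<Longrightarrow> u \<notin> R0 \<Longrightarrow> shielded j (graph_of us) a u"
  shows "(\<integral>\<^sup>+(R, a'). of_bool (w \<notin> R) * ennreal (r ^ card (exposed j m w (graph_of us) a')) \<partial>measure_pmf (notify R0 a))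
    \<le> ennreal (r ^ card E)"
proof -
  let ?G = "graph_of us"
  \<comment> \<open>The nodes that may become exposed now: they draw from at most
    \<open>2 ^ j\<close> neighbours, one of which is \<open>w\<close>.\<close>
  define T where "T = {u \<in> R0. w \<in> N ?G u \<and> deg ?G u \<le> 2 ^ j}"
  have f0: "finite R0" using R0 v(1) finite_subset finite_verts by blast
  have fT: "finite T" using f0 by (simp add: T_def)
  have T0: "T \<inter> set (enum R0) = T" using f0 by (auto simp: T_def)
  have r1: "1 \<le> r" by (rule r)
  have "(\<integral>\<^sup>+(R, a'). of_bool (w \<notin> R) * ennreal (r ^ card (exposed j m w ?G a')) \<partial>measure_pmf (notify R0 a))
    \<le> (\<integral>\<^sup>+a1. ennreal (r ^ (card E + card T)) * of_bool (\<forall>u\<in>T \<inter> set (enum R0). w \<notin> targets a1 u) \<partial>measure_pmf (fold_pmf resample (enum R0) a))"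
    unfolding notify_eq nn_integral_bind_pmf
  proof (intro nn_integral_pmf_mono nn_integral_pmf_le_const)
    fix a1 p assume a1: "a1 \<in> set_pmf (fold_pmf resample (enum R0) a)" and p: "p \<in> set_pmf (later_rounds R0 a1)"
    obtain R a' where Ra: "p = (R, a')" by fastforce
    note q = later_rounds_sure[OF v c R0 a1 p[unfolded Ra]]
    have "exposed j m w ?G a' \<subseteq> E \<union> T"
    proof
      fix u assume u: "u \<in> exposed j m w ?G a'"
      then have uN: "u \<in> N ?G w" "m < u" "\<not> shielded j ?G a' u" by (auto simp: exposed_def)
      have wN: "w \<in> N ?G u" using uN(1) N_sym by blast
      then have ne: "N ?G u \<noteq> {}" by blast
      show "u \<in> E \<union> T"
      proof (rule ccontr)
        assume "u \<notin> E \<union> T"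
        then have "u \<notin> E" "u \<notin> T" by auto
        show False
        proof (cases "u \<in> R0")
          case True
          then have "2 ^ j \<le> deg ?G u" using \<open>u \<notin> T\<close> wN by (auto simp: T_def)
          then show False using q(3)[OF ne, of j] True uN(3) by blast
        next
          case False
          then show False using E(2)[OF uN(1,2) \<open>u \<notin> E\<close>] q(3)[OF ne, of j] uN(3) by blast
        qed
      qed
    qed
    then have "card (exposed j m w ?G a') \<le> card (E \<union> T)" using E(1) fT by (intro card_mono) auto
    also have "\<dots> \<le> card E + card T" by (rule card_Un_le)
    finally have "r ^ card (exposed j m w ?G a') \<le> r ^ (card E + card T)" using r1 by (rule power_increasing)
    moreover have "\<forall>u\<in>T \<inter> set (enum R0). w \<notin> targets a1 u" if "w \<notin> R"
      using that q(2) by (auto simp: T_def)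
    ultimately show "(case p of (R, a') \<Rightarrow> of_bool (w \<notin> R) * ennreal (r ^ card (exposed j m w ?G a')))
      \<le> ennreal (r ^ (card E + card T)) * of_bool (\<forall>u\<in>T \<inter> set (enum R0). w \<notin> targets a1 u)"
      unfolding Ra by (cases "w \<in> R") (auto intro: ennreal_leI)
  qed
  also have "\<dots> = ennreal (r ^ (card E + card T)) *
     (\<integral>\<^sup>+a1. of_bool (\<forall>u\<in>T \<inter> set (enum R0). w \<notin> targets a1 u) \<partial>measure_pmf (fold_pmf resample (enum R0) a))"
    by (rule nn_integral_pmf_cmult)
  also have "\<dots> \<le> ennreal (r ^ (card E + card T)) * ennreal (miss_prob j ^ card T)"
    using fold_miss[OF v(1) c, of "enum R0" T w j] R0 f0 unfolding T0
    by (intro mult_left_mono) (auto simp: T_def)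
  also have "\<dots> = ennreal (r ^ card E)" by (rule miss_potential[OF r])
  finally show ?thesis .
qed

text \<open>At a deletion the newly exposed nodes are among the \<open>departures\<close>. At an
  insertion the new node resamples before the rounds start and may itself be exposed, so it is
  treated as one more sender; if it is \<open>w\<close>, then \<open>w\<close> is processed and the
  potential vanishes.\<close>

lemma start_notify_potential:
  fixes r :: real
  assumes v: "valid (x # us)" "card (verts (graph_of (x # us))) \<le> n" and c: "consistent us a"
    and r: "r * miss_prob j = 1" "1 \<le> r"
  shows "(\<integral>\<^sup>+(R, a'). of_bool (w \<notin> R) * ennreal (r ^ card (exposed j m w (graph_of (x # us)) a'))
      \<partial>measure_pmf (start_notify (Suc (length us)) x a))
    \<le> ennreal (r ^ card (exposed j m w (graph_of us) a))"
proof (cases x)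
  case (Del y)
  let ?G' = "graph_of (x # us)"
  let ?a = "prepare_delete y a"
  have v': "valid (Del y # us)" using v(1) Del by simp
  have fin: "finite (exposed j m w (graph_of us) a)" by (rule exposed_finite[OF valid_tl[OF v(1)]])
  have "consistent (x # us) ?a" "departures y a \<subseteq> verts ?G'"
    using consistent_prepare_delete[OF v' c] departures_verts[OF v' c] Del by simp_all
  moreover have "shielded j ?G' ?a u"
    if u: "u \<in> N ?G' w" "m < u" "u \<notin> exposed j m w (graph_of us) a" "u \<notin> departures y a" for u
  proof -
    have "u \<noteq> y" "u \<in> N (graph_of us) w" using u(1) by (auto simp: Del N_delete split: if_splits)
    moreover from this u have "shielded j (graph_of us) a u" by (auto simp: exposed_def)
    ultimately show ?thesis using shielded_prepare_delete[OF v' c] u(4) Del by simp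
  qed
  ultimately have "(\<integral>\<^sup>+(R, a'). of_bool (w \<notin> R) * ennreal (r ^ card (exposed j m w ?G' a')) \<partial>measure_pmf (notify (departures y a) ?a))
    \<le> ennreal (r ^ card (exposed j m w (graph_of us) a))"
    by (intro notify_potential[OF v _ _ r fin]) auto
  then show ?thesis unfolding Del start_notify_Del .
next
  case (Ins S)
  let ?k = "Suc (length us)" let ?G' = "graph_of (x # us)"
  let ?a = "prepare_insert ?k S a" let ?E0 = "exposed j m w (graph_of us) a"
  have v': "valid (Ins S # us)" using v(1) Ins by simp
  have fin: "finite ?E0" by (rule exposed_finite[OF valid_tl[OF v(1)]])
  have c0: "consistent (x # us) ?a" using consistent_prepare_insert[OF v' c] Ins by simp
  have k: "?k \<in> verts ?G'" by (simp add: Ins insert_node_def)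
  have sh: "shielded j ?G' ?a u" if "u \<in> N ?G' w" "m < u" "u \<notin> ?E0" "u \<noteq> ?k" "w \<noteq> ?k" for u
  proof -
    have "u \<in> N (graph_of us) w" using that(1,4,5) by (auto simp: Ins N_insert split: if_splits)
    then have "shielded j (graph_of us) a u" using that by (auto simp: exposed_def)
    then show ?thesis using shielded_prepare_insert[OF v'] Ins by simp
  qed
  show ?thesis
  proof (cases "w = ?k")
    case True
    have "(\<integral>\<^sup>+(R, a'). of_bool (w \<notin> R) * ennreal (r ^ card (exposed j m w ?G' a'))
      \<partial>measure_pmf (start_notify ?k x a)) = (\<integral>\<^sup>+p. 0 \<partial>measure_pmf (start_notify ?k x a))"
      by (rule nn_integral_pmf_cong) (use True in \<open>auto simp: Ins start_notify_Ins\<close>)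
    then show ?thesis by simp
  next
    case False
    define T where "T = (if w \<in> N ?G' ?k \<and> deg ?G' ?k \<le> 2 ^ j then {?k} else {})"
    have "(\<integral>\<^sup>+(R, a'). of_bool (w \<notin> R) * ennreal (r ^ card (exposed j m w ?G' a')) \<partial>measure_pmf (start_notify ?k x a))
      \<le> (\<integral>\<^sup>+a1. ennreal (r ^ (card ?E0 + card T)) * of_bool (\<forall>u\<in>T. w \<notin> targets a1 u) \<partial>measure_pmf (resample ?k ?a))"
      unfolding Ins start_notify_Ins nn_integral_bind_pmf
    proof (rule nn_integral_pmf_mono)
      fix a1 assume a1: "a1 \<in> set_pmf (resample ?k ?a)"
      have c1: "consistent (x # us) a1" using resample_sure[OF v(1) c0 k a1] by metis
      obtain new where new: "I_sets a1 = (I_sets ?a)(?k := (I_sets ?a ?k)(level ?G' ?k := new))" "new \<subseteq> N ?G' ?k"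
        using resample_sure[OF v(1) c0 k a1] by metis
      have T0: "targets a1 ?k \<subseteq> verts ?G'"
        using new N_subset_verts[OF v(1)] consistent_graph[OF c1] by (auto simp: targets_def)
      let ?t = "tick (real (card (targets a1 ?k)) + 1) a1"
      have ct: "consistent (x # us) ?t" using c1 by simp
      have fET: "finite (?E0 \<union> T)" using fin by (simp add: T_def)
      have shE: "shielded j ?G' ?t u" if u: "u \<in> N ?G' w" "m < u" "u \<notin> ?E0 \<union> T" for u
      proof -
        have wN: "w \<in> N ?G' u" using u(1) N_sym by blast
        then have ne: "N ?G' u \<noteq> {}" by blast
        have "shielded j ?G' ?a u \<or> ?k = u \<and> 2 ^ j \<le> deg ?G' u"
        proof (cases "u = ?k")
          case True
          then show ?thesis using u(3) wN by (auto simp: T_def split: if_splits)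
        next
          case False
          then show ?thesis using sh[of u] u \<open>w \<noteq> ?k\<close> by blast
        qed
        from shielded_resample[OF v c0 k a1 ne this] show ?thesis by simp
      qed
      have pot: "(\<integral>\<^sup>+(R, a'). of_bool (w \<notin> R) * ennreal (r ^ card (exposed j m w ?G' a')) \<partial>measure_pmf (notify (targets a1 ?k) ?t))
        \<le> ennreal (r ^ card (?E0 \<union> T))"
        by (rule notify_potential[OF v ct T0 r fET]) (use shE in auto)
      also have "\<dots> \<le> ennreal (r ^ (card ?E0 + card T))"
        by (intro ennreal_leI power_increasing card_Un_le r)
      finally have pot: "(\<integral>\<^sup>+(R, a'). of_bool (w \<notin> R) * ennreal (r ^ card (exposed j m w ?G' a')) \<partial>measure_pmf (notify (targets a1 ?k) ?t))
        \<le> ennreal (r ^ (card ?E0 + card T))" .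
      have R0R: "targets a1 ?k \<subseteq> R" if "(R, a') \<in> set_pmf (notify (targets a1 ?k) ?t)" for R a'
        using notify_sure[OF v(1) ct T0 that] by (metis Un_upper1)
      have "(\<integral>\<^sup>+p. (\<integral>\<^sup>+q. (case q of (R, a') \<Rightarrow> of_bool (w \<notin> R) * ennreal (r ^ card (exposed j m w ?G' a')))
          \<partial>measure_pmf (case p of (R, a2) \<Rightarrow> return_pmf (insert ?k R, a2))) \<partial>measure_pmf (notify (targets a1 ?k) ?t))
        = (\<integral>\<^sup>+(R, a'). of_bool (w \<notin> R) * ennreal (r ^ card (exposed j m w ?G' a')) \<partial>measure_pmf (notify (targets a1 ?k) ?t))"
        using False by (intro nn_integral_cong) auto
      also have "\<dots> \<le> ennreal (r ^ (card ?E0 + card T)) * of_bool (\<forall>u\<in>T. w \<notin> targets a1 u)"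
      proof (cases "\<forall>u\<in>T. w \<notin> targets a1 u")
        case True
        then show ?thesis using pot by simp
      next
        case False
        then have "w \<in> targets a1 ?k" by (auto simp: T_def split: if_splits)
        then have "(\<integral>\<^sup>+(R, a'). of_bool (w \<notin> R) * ennreal (r ^ card (exposed j m w ?G' a')) \<partial>measure_pmf (notify (targets a1 ?k) ?t))
          = (\<integral>\<^sup>+p. 0 \<partial>measure_pmf (notify (targets a1 ?k) ?t))"
        proof (intro nn_integral_pmf_cong)
          fix p assume p: "p \<in> set_pmf (notify (targets a1 ?k) ?t)"
          obtain R a' where "p = (R, a')" by fastforce
          then show "(case p of (R, a') \<Rightarrow> of_bool (w \<notin> R) * ennreal (r ^ card (exposed j m w ?G' a'))) = 0"
            using R0R[of R a'] p \<open>w \<in> targets a1 ?k\<close> by auto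
        qed
        then show ?thesis by simp
      qed
      finally show "(\<integral>\<^sup>+p. (\<integral>\<^sup>+q. (case q of (R, a') \<Rightarrow> of_bool (w \<notin> R) * ennreal (r ^ card (exposed j m w (graph_of (Ins S # us)) a')))
          \<partial>measure_pmf (case p of (R, a2) \<Rightarrow> return_pmf (insert ?k R, a2))) \<partial>measure_pmf (notify (targets a1 ?k) ?t))
        \<le> ennreal (r ^ (card ?E0 + card T)) * of_bool (\<forall>u\<in>T. w \<notin> targets a1 u)" unfolding Ins .
    qed
    also have "\<dots> = ennreal (r ^ (card ?E0 + card T)) * (\<integral>\<^sup>+a1. of_bool (\<forall>u\<in>T. w \<notin> targets a1 u) \<partial>measure_pmf (resample ?k ?a))"
      by (rule nn_integral_pmf_cmult)
    also have "\<dots> \<le> ennreal (r ^ (card ?E0 + card T)) * ennreal (miss_prob j ^ card T)"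
    proof (rule mult_left_mono)
      show "(\<integral>\<^sup>+a1. of_bool (\<forall>u\<in>T. w \<notin> targets a1 u) \<partial>measure_pmf (resample ?k ?a)) \<le> ennreal (miss_prob j ^ card T)"
        using resample_miss[OF v(1) c0, of w ?k j] by (simp add: T_def)
    qed simp
    also have "\<dots> = ennreal (r ^ card ?E0)" by (rule miss_potential[OF r])
    finally show ?thesis .
  qed
qed

text \<open>The supermartingale iterated over the updates \<open>us1\<close>. It starts at 1,
  because every node present after \<open>us0\<close> is at most \<open>length us0\<close>, so no
  neighbour is exposed yet.\<close>

lemma run_potential:
  fixes r :: real
  assumes v: "valid (us1 @ us0)" and n: "\<And>us'. suffix us' (us1 @ us0) \<Longrightarrow> card (verts (graph_of us')) \<le> n"
    and r: "r * miss_prob j = 1" "1 \<le> r"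
  shows "(\<integral>\<^sup>+(Rs, a). of_bool (\<forall>R\<in>set (take (length us1) Rs). w \<notin> set R) *
      ennreal (r ^ card (exposed j (length us0) w (graph_of (us1 @ us0)) a)) \<partial>measure_pmf (notify_run (us1 @ us0))) \<le> 1"
  using v n
proof (induction us1)
  case Nil
  have "exposed j (length us0) w (graph_of us0) a = {}" for a
    using N_verts(1)[of us0] verts_le[of us0] Nil by (fastforce simp: exposed_def)
  then show ?case by (simp add: split_def)
next
  case (Cons x us1)
  let ?us = "us1 @ us0" let ?m = "length us0"
  have vx: "valid (x # ?us)" using Cons.prems(1) by simp
  have vu: "valid ?us" by (rule valid_tl[OF vx])
  have nx: "card (verts (graph_of (x # ?us))) \<le> n"
    using Cons.prems(2)[of "x # ?us"] Cons.prems(1) by (simp del: graph_of.simps)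
  have IH: "(\<integral>\<^sup>+(Rs, a). of_bool (\<forall>R\<in>set (take (length us1) Rs). w \<notin> set R) *
      ennreal (r ^ card (exposed j ?m w (graph_of ?us) a)) \<partial>measure_pmf (notify_run ?us)) \<le> 1"
    by (intro Cons.IH vu) (rule Cons.prems(2), simp add: suffix_ConsI)
  have "(\<integral>\<^sup>+(Rs, a). of_bool (\<forall>R\<in>set (take (length (x # us1)) Rs). w \<notin> set R) *
      ennreal (r ^ card (exposed j ?m w (graph_of ((x # us1) @ us0)) a)) \<partial>measure_pmf (notify_run ((x # us1) @ us0)))
    \<le> (\<integral>\<^sup>+(Rs, a). of_bool (\<forall>R\<in>set (take (length us1) Rs). w \<notin> set R) *
      ennreal (r ^ card (exposed j ?m w (graph_of ?us) a)) \<partial>measure_pmf (notify_run ?us))"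
    unfolding append_Cons notify_run.simps nn_integral_bind_pmf
  proof (rule nn_integral_pmf_mono)
    fix p assume p: "p \<in> set_pmf (notify_run ?us)"
    obtain Rs a where Ra: "p = (Rs, a)" by fastforce
    have c: "consistent ?us a" using notify_run_sure[OF vu] p Ra by blast
    let ?b = "of_bool (\<forall>R\<in>set (take (length us1) Rs). w \<notin> set R) :: ennreal"
    have fin: "finite R" if "(R, a') \<in> set_pmf (start_notify (Suc (length ?us)) x a)" for R a'
      by (rule finite_subset[OF start_notify_sure(1)[OF vx c that] finite_verts[OF vx]])
    have "(\<integral>\<^sup>+(Rs, a). of_bool (\<forall>R\<in>set (take (length (x # us1)) Rs). w \<notin> set R) * ennreal (r ^ card (exposed j ?m w (graph_of (x # ?us)) a))
        \<partial>measure_pmf (case p of (Rs, a) \<Rightarrow> map_pmf (\<lambda>(R, a'). (enum R # Rs, a')) (start_notify (Suc (length ?us)) x a)))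
      = (\<integral>\<^sup>+q. ?b * (case q of (R, a') \<Rightarrow> of_bool (w \<notin> R) * ennreal (r ^ card (exposed j ?m w (graph_of (x # ?us)) a')))
        \<partial>measure_pmf (start_notify (Suc (length ?us)) x a))"
      unfolding Ra prod.case nn_integral_map_pmf using fin by (intro nn_integral_pmf_cong) auto
    also have "\<dots> = ?b * (\<integral>\<^sup>+(R, a'). of_bool (w \<notin> R) * ennreal (r ^ card (exposed j ?m w (graph_of (x # ?us)) a'))
        \<partial>measure_pmf (start_notify (Suc (length ?us)) x a))"
      by (rule nn_integral_pmf_cmult)
    also have "\<dots> \<le> ?b * ennreal (r ^ card (exposed j ?m w (graph_of ?us) a))"
      using Cons.prems(1) by (intro mult_left_mono start_notify_potential nx c r) auto
    finally show "(\<integral>\<^sup>+(Rs, a). of_bool (\<forall>R\<in>set (take (length (x # us1)) Rs). w \<notin> set R) * ennreal (r ^ card (exposed j ?m w (graph_of (x # ?us)) a))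
        \<partial>measure_pmf (case p of (Rs, a) \<Rightarrow> map_pmf (\<lambda>(R, a'). (enum R # Rs, a')) (start_notify (Suc (length ?us)) x a)))
      \<le> (case p of (Rs, a) \<Rightarrow> of_bool (\<forall>R\<in>set (take (length us1) Rs). w \<notin> set R) * ennreal (r ^ card (exposed j ?m w (graph_of ?us) a)))"
      unfolding Ra by simp
  qed
  also note IH
  finally show ?case .
qed

end

section \<open>Growth of a typical node forces many exposed neighbours\<close>

text \<open>An edge appears only with the arrival of one of its ends, so an edge between two old
  nodes is old.\<close>

lemma N_past:
  assumes "v \<in> N (graph_of (us1 @ us0)) w" "v \<le> length us0" "w \<le> length us0"
  shows "v \<in> N (graph_of us0) w"
  using assms(1)
proof (induction us1)
  case (Cons x us1)
  then show ?case using assms(2,3) by (cases x) (auto simp: N_insert N_delete split: if_splits)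
qed simp

lemma deg_step:
  assumes v: "valid (x # us)" and u: "u \<in> verts (graph_of (x # us))" "u \<le> length us"
  shows "deg (graph_of us) u \<le> deg (graph_of (x # us)) u + 1"
proof (cases x)
  case (Ins S)
  have "N (graph_of us) u \<subseteq> N (graph_of (x # us)) u" by (auto simp: Ins N_insert)
  from card_mono[OF finite_N[OF v] this] show ?thesis by simp
next
  case (Del y)
  have "u \<noteq> y" using u Del by (simp add: delete_node_def)
  then have "N (graph_of us) u \<subseteq> insert y (N (graph_of (x # us)) u)" by (auto simp: Del N_delete)
  then have "deg (graph_of us) u \<le> card (insert y (N (graph_of (x # us)) u))"
    using finite_N[OF v] by (intro card_mono) auto
  also have "\<dots> \<le> deg (graph_of (x # us)) u + 1" by (simp add: card_insert_le_m1)
  finally show ?thesis .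
qed

lemma graph_at_rev_Procs [simp]: "graph_at (rev (map Proc R) @ es) = graph_at es"
  by (induction R rule: rev_induct) auto

context dynamic_agreement_params
begin

text \<open>Here \<open>F\<close> is a later graph. It does not depend on the samples, so that a fresh sample of level \<open>l\<close>
  lies in \<open>N F v\<close> with probability at most \<open>2\<close> to the \<open>- s\<close> if \<open>N F v\<close> is half as large as \<open>2 ^ l\<close>.\<close>

definition noticed :: "graph \<Rightarrow> state \<Rightarrow> bool" where
  "noticed F a \<longleftrightarrow> (\<forall>v l. I_sets a v l \<noteq> {} \<longrightarrow> 2 * deg F v \<le> 2 ^ l \<longrightarrow> \<not> I_sets a v l \<subseteq> N F v)"

lemma noticed_tick [simp]: "noticed F (tick c a) = noticed F a"
  by (simp add: noticed_def)

text \<open>Only the sample of the current level \<open>l\<close> is new. It is drawn from at least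
  \<open>2 ^ l\<close> neighbours, of which at most half lie in \<open>N F w\<close> in the case
  that matters.\<close>

lemma noticed_fail_resample:
  assumes v: "valid us" and c: "consistent us a" and n: "noticed F a" and F: "finite (N F w)"
  shows "fail_prob (resample w a) (noticed F) \<le> ennreal ((1/2) ^ s_size)"
proof -
  let ?G = "graph_of us" let ?X = "N ?G w" let ?l = "level ?G w"
  have g: "cur_graph a = ?G" by (rule consistent_graph[OF c])
  have nt: "noticed F a' \<longleftrightarrow> (new \<noteq> {} \<longrightarrow> 2 * deg F w \<le> 2 ^ ?l \<longrightarrow> \<not> new \<subseteq> N F w)"
    if "I_sets a' = (I_sets a)(w := (I_sets a w)(?l := new))" for a' new
    using n unfolding noticed_def that by auto
  have "fail_prob (resample w a) (noticed F) =
       (\<integral>\<^sup>+rs. of_bool (rs \<noteq> [] \<and> 2 * deg F w \<le> 2 ^ ?l \<and> set rs \<subseteq> N F w) \<partial>measure_pmf (random_nbrs ?G w s_size))"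
    by (simp add: resample_def Let_def g fail_prob_def nt)
  also have "\<dots> \<le> ennreal ((1/2) ^ s_size)"
  proof (cases "?X = {} \<or> \<not> 2 * deg F w \<le> 2 ^ ?l")
    case True
    then have "(\<integral>\<^sup>+rs. of_bool (rs \<noteq> [] \<and> 2 * deg F w \<le> 2 ^ ?l \<and> set rs \<subseteq> N F w) \<partial>measure_pmf (random_nbrs ?G w s_size))
      = (\<integral>\<^sup>+rs. 0 \<partial>measure_pmf (random_nbrs ?G w s_size))"
      by (intro nn_integral_cong_AE) (auto simp: AE_measure_pmf_iff random_nbrs_def split: if_splits)
    then show ?thesis by simp
  next
    case False
    have X: "finite ?X" "?X \<noteq> {}" using v False by auto
    have d: "2 ^ ?l \<le> deg ?G w" using X by (intro level_bounds) auto
    have "(\<integral>\<^sup>+rs. of_bool (rs \<noteq> [] \<and> 2 * deg F w \<le> 2 ^ ?l \<and> set rs \<subseteq> N F w) \<partial>measure_pmf (random_nbrs ?G w s_size))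
      \<le> (\<integral>\<^sup>+rs. of_bool (set rs \<subseteq> N F w) \<partial>measure_pmf (replicate_pmf s_size (pmf_of_set ?X)))"
      using X by (auto simp: random_nbrs_def intro!: nn_integral_mono)
    also have "\<dots> = ennreal ((real (card (N F w \<inter> ?X)) / real (card ?X)) ^ s_size)"
      by (rule nn_integral_replicate_all[OF X])
    also have "\<dots> \<le> ennreal ((1/2) ^ s_size)"
    proof (intro ennreal_leI power_mono)
      have "card (N F w \<inter> ?X) \<le> deg F w" using F by (intro card_mono) auto
      then have "2 * card (N F w \<inter> ?X) \<le> deg ?G w" using False d by linarith
      then show "real (card (N F w \<inter> ?X)) / real (card ?X) \<le> 1/2"
        using X by (simp add: field_simps card_gt_0_iff)
    qed simp
    finally show ?thesis .
  qed
  finally show ?thesis .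
qed

lemma half_power_le: "ennreal ((1/2) ^ s_size) \<le> test_error"
  and exp_s_size_le: "exp (- (real s_size / 32)) \<le> 1 / real n ^ 20"
proof -
  \<comment> \<open>640 = 32 * 20: the second bound loses a factor 32 and has to reach the exponent
    20.\<close>
  have s: "640 * log 2 (real n) \<le> real s_size" 
  proof -
    have "640 * log 2 (real n) \<le> 100 * 10 ^ 10 * log 2 (real n)" using log_n by (intro mult_right_mono) auto
    also have "100 * 10 ^ 10 * log 2 (real n) \<le> real s_size" by (rule samples_large(1)) simp
    finally show ?thesis .
  qed
  have l0: "0 \<le> log 2 (real n)" using log_n by simp
  have e: "exp (- (20 * ln (real n))) = 1 / real n ^ 20"
  proof -
    have "exp (20 * ln (real n)) = real n ^ 20" using n2 exp_of_nat_mult[of 20 "ln (real n)"] by simp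
    then show ?thesis by (simp add: exp_minus divide_inverse)
  qed
  show 1: "exp (- (real s_size / 32)) \<le> 1 / real n ^ 20"
  proof -
    have "20 * ln (real n) \<le> real s_size / 32" using s ln_le_log2 by linarith
    then show ?thesis unfolding e[symmetric] by simp
  qed
  have hp: "(1/2::real) ^ k = 2 powr (- real k)" for k :: nat
    by (simp add: powr_minus_divide powr_realpow power_one_over)
  have "(1/2::real) ^ s_size = 2 powr (- real s_size)" by (rule hp)
  also have "\<dots> \<le> 2 powr (- (20 * log 2 (real n)))" using s l0 by (intro powr_mono) auto
  also have "\<dots> = 1 / real n ^ 20" by (rule two_powr_log[OF n2])
  finally show "ennreal ((1/2) ^ s_size) \<le> test_error" unfolding test_error_def by (intro ennreal_leI)
qed

lemma noticed_fail_fold: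
  assumes v: "valid us" and c: "consistent us a" and n: "noticed F a" and F: "\<And>w. finite (N F w)"
    and ws: "set ws \<subseteq> verts (graph_of us)"
  shows "fail_prob (fold_pmf resample ws a) (noticed F) \<le> of_nat (length ws) * test_error"
proof -
  define P where "P xs s \<longleftrightarrow> set xs \<subseteq> verts (graph_of us) \<and> consistent us s \<and> noticed F s" for xs s
  have "fail_prob (fold_pmf resample ws a) (P []) \<le> of_nat (length ws) * test_error"
  proof (rule fail_prob_fold_list)
    show "P ws a" using c n ws by (simp add: P_def)
    fix x xs s assume p: "P (x # xs) s"
    then have "fail_prob (resample x s) (P xs) \<le> fail_prob (resample x s) (noticed F)"
      using resample_sure[OF v, of s x] by (intro fail_prob_mono) (auto simp: P_def)
    also have "\<dots> \<le> test_error"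
      using p noticed_fail_resample[OF v _ _ F, of s x] half_power_le by (auto simp: P_def intro: order_trans)
    finally show "fail_prob (resample x s) (P xs) \<le> test_error" .
  qed
  then show ?thesis by (rule order_trans[rotated]) (intro fail_prob_mono, simp add: P_def)
qed

text \<open>Each of the three rounds resamples at most \<open>n\<close> nodes.\<close>

lemma noticed_fail_notify:
  assumes v: "valid us" "card (verts (graph_of us)) \<le> n" and c: "consistent us a" and nt: "noticed F a"
    and F: "\<And>w. finite (N F w)" and R0: "R0 \<subseteq> verts (graph_of us)"
  shows "fail_prob (notify R0 a) (\<lambda>(R, a'). noticed F a') \<le> of_nat (3 * n) * test_error"
proof -
  let ?V = "verts (graph_of us)" let ?d = "of_nat n * test_error"
  have fV: "finite ?V" using v by simp
  have one: "fail_prob (fold_pmf resample (enum R) a) (noticed F) \<le> ?d" if "R \<subseteq> ?V" "consistent us a" "noticed F a" for R a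
  proof -
    have f: "finite R" using that(1) fV finite_subset by blast
    have "fail_prob (fold_pmf resample (enum R) a) (noticed F) \<le> of_nat (length (enum R)) * test_error"
      using that f by (intro noticed_fail_fold[OF v(1)] F) auto
    also have "\<dots> \<le> ?d"
    proof (rule mult_right_mono)
      have "length (enum R) \<le> n" using f card_mono[OF fV that(1)] v(2) by simp
      then show "(of_nat (length (enum R)) :: ennreal) \<le> of_nat n" by simp
    qed simp
    finally show ?thesis .
  qed
  have UN: "(\<Union>w\<in>R. targets a' w) \<subseteq> ?V" "consistent us a'"
    if "R \<subseteq> ?V" "consistent us a" "a' \<in> set_pmf (fold_pmf resample (enum R) a)" for R a a'
  proof -
    have f: "finite R" using that(1) fV finite_subset by blast
    have e: "set (enum R) \<subseteq> ?V" using that(1) f by simp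
    note s = fold_resample_sure[OF v(1) that(2) e that(3)]
    show "consistent us a'" by (rule s(1))
    show "(\<Union>w\<in>R. targets a' w) \<subseteq> ?V"
      using s(3) f N_subset_verts[OF v(1)] by fastforce
  qed
  have "fail_prob (notify R0 a) (\<lambda>(R, a'). noticed F a') \<le> ?d + (?d + ?d)"
    unfolding notify_def Let_def
  proof (rule fail_prob_bind[OF one[OF R0 c nt]])
    fix a1 assume a1: "a1 \<in> set_pmf (fold_pmf resample (enum R0) a)" "noticed F a1"
    let ?a1 = "tick (\<Sum>w\<in>R0. real (card (targets a1 w))) a1"
    note u1 = UN[OF R0 c a1(1)]
    have c1: "consistent us ?a1" "noticed F ?a1" using u1 a1 by simp_all
    show "fail_prob (fold_pmf resample (enum (\<Union>w\<in>R0. targets a1 w)) ?a1 \<bind> (\<lambda>st2.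
        fold_pmf resample (enum (\<Union>w\<in>(\<Union>w\<in>R0. targets a1 w). targets st2 w))
          (tick (\<Sum>w\<in>(\<Union>w\<in>R0. targets a1 w). real (card (targets st2 w))) st2) \<bind>
        (\<lambda>st3. return_pmf (R0 \<union> (\<Union>w\<in>R0. targets a1 w), st3)))) (\<lambda>(R, a'). noticed F a') \<le> ?d + ?d"
    proof (rule fail_prob_bind[OF one[OF u1(1) c1]])
      fix a2 assume a2: "a2 \<in> set_pmf (fold_pmf resample (enum (\<Union>w\<in>R0. targets a1 w)) ?a1)" "noticed F a2"
      note u2 = UN[OF u1(1) c1(1) a2(1)]
      have c2: "consistent us (tick x a2)" "noticed F (tick x a2)" for x using u2 a2 by simp_all
      show "fail_prob (fold_pmf resample (enum (\<Union>w\<in>(\<Union>w\<in>R0. targets a1 w). targets a2 w))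
          (tick (\<Sum>w\<in>(\<Union>w\<in>R0. targets a1 w). real (card (targets a2 w))) a2) \<bind>
        (\<lambda>st3. return_pmf (R0 \<union> (\<Union>w\<in>R0. targets a1 w), st3))) (\<lambda>(R, a'). noticed F a') \<le> ?d"
        using one[OF u2(1) c2] by (simp flip: map_pmf_def)
    qed
  qed
  also have "?d + (?d + ?d) = of_nat (3 * n) * test_error"
    by (simp add: distrib_right mult.assoc numeral_3_eq_3)
  finally show ?thesis .
qed

lemma noticed_fail_start:
  assumes v: "valid (x # us)" "card (verts (graph_of (x # us))) \<le> n" and c: "consistent us a" and nt: "noticed F a"
    and F: "\<And>w. finite (N F w)"
  shows "fail_prob (start_notify (Suc (length us)) x a) (\<lambda>(R, a'). noticed F a') \<le> of_nat (3 * n + 1) * test_error"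
proof (cases x)
  case (Del y)
  have v': "valid (Del y # us)" using v(1) Del by simp
  have 1: "consistent (x # us) (prepare_delete y a)" "departures y a \<subseteq> verts (graph_of (x # us))"
    using consistent_prepare_delete[OF v' c] departures_verts[OF v' c] Del by simp_all
  have 2: "noticed F (prepare_delete y a)" using nt by (simp add: noticed_def)
  have "fail_prob (start_notify (Suc (length us)) x a) (\<lambda>(R, a'). noticed F a') \<le> of_nat (3 * n) * test_error"
    unfolding Del start_notify_Del using noticed_fail_notify[OF v 1(1) 2 F 1(2)] by simp
  also have "\<dots> \<le> of_nat (3 * n + 1) * test_error" by (intro mult_right_mono) auto
  finally show ?thesis .
next
  case (Ins S)
  let ?k = "Suc (length us)"
  have v': "valid (Ins S # us)" using v(1) Ins by simp
  have c0: "consistent (x # us) (prepare_insert ?k S a)" using consistent_prepare_insert[OF v' c] Ins by simp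
  have k: "?k \<in> verts (graph_of (x # us))" by (simp add: Ins insert_node_def)
  have n0: "noticed F (prepare_insert ?k S a)" using nt by (simp add: noticed_def)
  have "fail_prob (start_notify ?k x a) (\<lambda>(R, a'). noticed F a') \<le> test_error + of_nat (3 * n) * test_error"
    unfolding Ins start_notify_Ins
  proof (rule fail_prob_bind)
    show "fail_prob (resample ?k (prepare_insert ?k S a)) (noticed F) \<le> test_error"
      using noticed_fail_resample[OF v(1) c0 n0 F] half_power_le by (rule order_trans)
    fix a1 assume a1: "a1 \<in> set_pmf (resample ?k (prepare_insert ?k S a))" "noticed F a1"
    obtain new where new: "I_sets a1 = (I_sets (prepare_insert ?k S a))(?k := (I_sets (prepare_insert ?k S a) ?k)(level (graph_of (x # us)) ?k := new))"
      "new \<subseteq> N (graph_of (x # us)) ?k" and c1: "consistent (x # us) a1"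
      using resample_sure[OF v(1) c0 k a1(1)] by metis
    have T: "targets a1 ?k \<subseteq> verts (graph_of (x # us))"
      using new N_subset_verts[OF v(1)] consistent_graph[OF c1] by (auto simp: targets_def)
    have "fail_prob (notify (targets a1 ?k) (tick (real (card (targets a1 ?k)) + 1) a1)) (\<lambda>(R, a'). noticed F a')
      \<le> of_nat (3 * n) * test_error"
      by (rule noticed_fail_notify[OF v _ _ F T]) (use c1 a1 in auto)
    moreover have "notify (targets a1 ?k) (tick (real (card (targets a1 ?k)) + 1) a1) \<bind> (\<lambda>(R, a2). return_pmf (insert ?k R, a2))
      = map_pmf (\<lambda>(R, a2). (insert ?k R, a2)) (notify (targets a1 ?k) (tick (real (card (targets a1 ?k)) + 1) a1))"
      by (simp add: map_pmf_def split_def)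
    ultimately show "fail_prob (notify (targets a1 ?k) (tick (real (card (targets a1 ?k)) + 1) a1) \<bind>
        (\<lambda>(R, a2). return_pmf (insert ?k R, a2))) (\<lambda>(R, a'). noticed F a') \<le> of_nat (3 * n) * test_error"
      by (simp add: split_def)
  qed
  also have "\<dots> = of_nat (3 * n + 1) * test_error" by (simp add: distrib_right add.commute)
  finally show ?thesis .
qed

definition all_small :: "update list \<Rightarrow> bool" where
  "all_small us \<longleftrightarrow> (\<forall>us'. suffix us' us \<longrightarrow> card (verts (graph_of us')) \<le> n)"

lemma all_small_tl: "all_small (x # us) \<Longrightarrow> all_small us"
  by (simp add: all_small_def suffix_ConsI)

lemma all_smallD: "all_small us \<Longrightarrow> card (verts (graph_of us)) \<le> n"
  by (simp add: all_small_def)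

lemma noticed_fail_run:
  assumes F: "\<And>w. finite (N F w)"
  shows "valid us \<Longrightarrow> all_small us \<Longrightarrow>
    fail_prob (notify_run us) (\<lambda>(Rs, a). noticed F a) \<le> of_nat (length us * (3 * n + 1)) * test_error"
proof (induction us)
  case Nil
  then show ?case by (simp add: noticed_def init_state_def)
next
  case (Cons x us)
  let ?d = "of_nat (3 * n + 1) * test_error"
  have IH: "fail_prob (notify_run us) (\<lambda>(Rs, a). noticed F a) \<le> of_nat (length us * (3 * n + 1)) * test_error"
    using Cons valid_tl all_small_tl by blast
  have "fail_prob (notify_run (x # us)) (\<lambda>(Rs, a). noticed F a) \<le> of_nat (length us * (3 * n + 1)) * test_error + ?d"
    unfolding notify_run.simps
  proof (rule fail_prob_bind[OF IH])
    fix p assume p: "p \<in> set_pmf (notify_run us)" "case p of (Rs, a) \<Rightarrow> noticed F a"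
    obtain Rs a where Ra: "p = (Rs, a)" by fastforce
    have c: "consistent us a" using notify_run_sure[OF valid_tl[OF Cons.prems(1)]] p(1) Ra by blast
    have "fail_prob (start_notify (Suc (length us)) x a) (\<lambda>(R, a'). noticed F a') \<le> ?d"
      using p(2) Ra by (intro noticed_fail_start Cons.prems(1) all_smallD[OF Cons.prems(2)] c F) simp
    then show "fail_prob (case p of (Rs, a) \<Rightarrow> map_pmf (\<lambda>(R, a'). (enum R # Rs, a')) (start_notify (Suc (length us)) x a))
        (\<lambda>(Rs, a). noticed F a) \<le> ?d"
      unfolding Ra by (simp add: split_def)
  qed
  also have "\<dots> = of_nat (length (x # us) * (3 * n + 1)) * test_error"
    by (simp add: distrib_right add_ac)
  finally show ?case .
qed

text \<open>At least half of the \<open>d\<close> neighbours have degree at most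
  \<open>2 * d\<close>. At most \<open>d / 8\<close> of these were neighbours already after
  \<open>us0\<close>, one may be the node arriving with \<open>x\<close>, and the others are
  exposed: a shield would be a sample of level at least \<open>i + 3\<close> inside a neighbourhood
  of at most \<open>2 * d + 1\<close> nodes, which \<open>noticed\<close> excludes.\<close>

lemma exposed_large:
  assumes v: "valid (x # us1 @ us0)" and w: "w \<le> length us0"
    and t: "degree_typical (graph_of (x # us1 @ us0)) w"
  defines "d \<equiv> deg (graph_of (x # us1 @ us0)) w"
  assumes d: "64 \<le> d" "8 * deg (graph_of us0) w \<le> d" "2 ^ i \<le> d" "d < 2 ^ Suc i"
    and nt: "noticed (graph_of (us1 @ us0)) a"
  shows "d \<le> 4 * card (exposed (i + 3) (length us0) w (graph_of (us1 @ us0)) a)"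
proof -
  let ?us = "us1 @ us0" let ?G = "graph_of ?us" let ?G' = "graph_of (x # ?us)" let ?k = "Suc (length ?us)"
  let ?E = "exposed (i + 3) (length us0) w ?G a"
  have vu: "valid ?us" by (rule valid_tl[OF v])
  have v0: "valid us0" by (rule valid_appendD[OF vu])
  define A where "A = {u \<in> N ?G' w. deg ?G' u \<le> 2 * d}"
  have fN: "finite (N ?G' w)" by (rule finite_N[OF v])
  have "d = card (A \<union> {u \<in> N ?G' w. deg ?G' u > 2 * d})"
    unfolding d_def A_def by (intro arg_cong[where f = card]) auto
  also have "\<dots> \<le> card A + card {u \<in> N ?G' w. deg ?G' u > 2 * d}" by (rule card_Un_le)
  finally have dA: "d \<le> 2 * card A" using t unfolding degree_typical_def d_def by linarith
  have "A \<subseteq> (?E \<union> N (graph_of us0) w) \<union> {?k}"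
  proof
    fix u assume u: "u \<in> A"
    then have uN: "u \<in> N ?G' w" and ud: "deg ?G' u \<le> 2 * d" by (auto simp: A_def)
    show "u \<in> (?E \<union> N (graph_of us0) w) \<union> {?k}"
    proof (cases "u = ?k \<or> u \<le> length us0")
      case True
      then show ?thesis using N_past[of u "x # us1" us0 w] uN w by auto
    next
      case False
      have uV: "u \<in> verts ?G'" by (rule N_verts(1)[OF v uN])
      have ul: "u \<le> length ?us" using verts_le[OF v uV] False by simp
      have "u \<in> N ?G w" using N_past[of u "[x]" ?us w] uN ul w by simp
      moreover have "\<not> shielded (i + 3) ?G a u"
      proof
        assume "shielded (i + 3) ?G a u"
        then obtain l where l: "i + 3 \<le> l" "I_sets a u l \<noteq> {}" "I_sets a u l \<subseteq> N ?G u" by (auto simp: shielded_def)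
        \<comment> \<open>Samples are compared with the graph before \<open>x\<close>, where a
          degree may be larger by one. \<open>d + 1 \<le> 2 ^ Suc i\<close> absorbs this, and the
          factor 4 turns \<open>2 ^ Suc i\<close> into \<open>2 ^ (i + 3)\<close>.\<close>
        have "deg ?G u \<le> 2 * d + 1" using deg_step[OF v uV ul] ud by linarith
        then have "2 * deg ?G u \<le> 4 * d + 2" by simp
        also have "\<dots> \<le> 4 * 2 ^ Suc i" using d(4) by simp
        also have "\<dots> = (2::nat) ^ (i + 3)" by (simp add: power_add)
        also have "\<dots> \<le> 2 ^ l" using l(1) by (intro power_increasing) auto
        finally show False using nt l unfolding noticed_def by blast
      qed
      ultimately show ?thesis using False by (simp add: exposed_def)
    qed
  qed
  then have "card A \<le> card ((?E \<union> N (graph_of us0) w) \<union> {?k})"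
    using exposed_finite[OF vu] finite_N[OF v0] by (intro card_mono) auto
  also have "\<dots> \<le> card (?E \<union> N (graph_of us0) w) + card {?k}" by (rule card_Un_le)
  also have "card (?E \<union> N (graph_of us0) w) \<le> card ?E + deg (graph_of us0) w" by (rule card_Un_le)
  finally have "card A \<le> card ?E + deg (graph_of us0) w + 1" by simp
  then show ?thesis using dA d(1,2) by linarith
qed

text \<open>There are \<open>m \<ge> 2 ^ i / 4\<close> nodes, and each misses with probability at
  most \<open>exp (- s_size / 2 ^ (i + 3))\<close>. The degree cancels, and the total exponent is at
  least \<open>s_size / 32\<close>.\<close>

lemma miss_prob_power_le:
  assumes d: "64 \<le> d" "2 ^ i \<le> d" "d \<le> 4 * m"
  shows "miss_prob (i + 3) ^ m \<le> 1 / real n ^ 20"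
proof -
  let ?p = "1 / (2::real) ^ (i + 3)"
  have le: "1 - ?p \<le> exp (- ?p)" using exp_ge_add_one_self[of "- ?p"] by simp
  have p1: "0 \<le> 1 - ?p" by simp
  have "miss_prob (i + 3) ^ m = (1 - ?p) ^ (s_size * m)"
    by (simp add: miss_prob_def power_mult)
  also have "\<dots> \<le> exp (- ?p) ^ (s_size * m)" using le p1 by (intro power_mono) auto
  also have "\<dots> = exp (- (real s_size * (real m * ?p)))" by (simp add: exp_of_nat_mult[symmetric])
  also have "\<dots> \<le> exp (- (real s_size / 32))"
  proof -
    have "real (2 ^ i) \<le> real (4 * m)" using d(2,3) by (simp only: of_nat_le_iff)
    then have "(2::real) ^ i \<le> 4 * real m" by simp
    then have "1 / 32 \<le> real m * ?p" by (simp add: power_add field_simps)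
    then have "real s_size * (1 / 32) \<le> real s_size * (real m * ?p)" by (intro mult_left_mono) auto
    then show ?thesis by simp
  qed
  also have "\<dots> \<le> 1 / real n ^ 20" by (rule exp_s_size_le)
  finally show ?thesis .
qed

definition hit_error :: ennreal where
  "hit_error = of_nat (1 + 2 * n * (3 * n + 1)) * test_error"

text \<open>Markov's inequality for the potential: if \<open>w\<close> is not hit although
  \<open>noticed\<close> holds, at least \<open>m\<close> neighbours are exposed, so the potential
  is at least \<open>r ^ m\<close>, while its expectation is at most 1. The degree is taken after
  \<open>x\<close> and the notifications before it, which is the situation when the first node of
  update \<open>x\<close> is processed.\<close>

lemma growth_hit:
  assumes v: "valid (x # us1 @ us0)" "all_small (us1 @ us0)" and w: "w \<le> length us0"
    and t: "degree_typical (graph_of (x # us1 @ us0)) w"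
    and d: "64 \<le> deg (graph_of (x # us1 @ us0)) w" "8 * deg (graph_of us0) w \<le> deg (graph_of (x # us1 @ us0)) w"
    and len: "length (us1 @ us0) \<le> 2 * n"
  shows "fail_prob (notify_run (us1 @ us0)) (\<lambda>(Rs, a). \<exists>R\<in>set (take (length us1) Rs). w \<in> set R) \<le> hit_error"
proof -
  let ?us = "us1 @ us0" let ?d = "deg (graph_of (x # ?us)) w"
  have vu: "valid ?us" by (rule valid_tl[OF v(1)])
  obtain i where i: "2 ^ i \<le> ?d" "?d < 2 ^ Suc i" using ex_power_ivl1[of 2 ?d] d(1) by auto
  define j where "j = i + 3"
  \<comment> \<open>A quarter of the degree, rounded up: then \<open>?d \<le> 4 * m\<close>, and
    still \<open>m \<le> card (?E a)\<close>.\<close>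
  define m where "m = (?d + 3) div 4"
  define r where "r = 1 / miss_prob j"
  let ?E = "\<lambda>a. exposed j (length us0) w (graph_of ?us) a"
  let ?hit = "\<lambda>Rs. \<exists>R\<in>set (take (length us1) Rs). w \<in> set R"
  have mp: "0 < miss_prob j" "miss_prob j \<le> 1"
  proof -
    have "(2::real) ^ 3 \<le> 2 ^ j" unfolding j_def by (intro power_increasing) auto
    then have "1 / (2::real) ^ j < 1" by simp
    then show "0 < miss_prob j" unfolding miss_prob_def by (intro zero_less_power) simp
    show "miss_prob j \<le> 1" unfolding miss_prob_def by (intro power_le_one) (simp_all add: one_le_power)
  qed
  have r: "r * miss_prob j = 1" "1 \<le> r" using mp by (auto simp: r_def)
  have dm: "?d \<le> 4 * m" unfolding m_def by linarith
  have "fail_prob (notify_run ?us) (\<lambda>(Rs, a). ?hit Rs) \<le>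
    (\<integral>\<^sup>+p. of_bool (\<not> (case p of (Rs, a) \<Rightarrow> noticed (graph_of ?us) a)) + ennreal (miss_prob j ^ m) *
      (case p of (Rs, a) \<Rightarrow> of_bool (\<forall>R\<in>set (take (length us1) Rs). w \<notin> set R) * ennreal (r ^ card (?E a))) \<partial>measure_pmf (notify_run ?us))"
    unfolding fail_prob_def
  proof (rule nn_integral_pmf_mono)
    fix p :: "node list list \<times> state"
    obtain Rs a where p: "p = (Rs, a)" by fastforce
    show "of_bool (\<not> (case p of (Rs, a) \<Rightarrow> ?hit Rs)) \<le> of_bool (\<not> (case p of (Rs, a) \<Rightarrow> noticed (graph_of ?us) a)) +
      ennreal (miss_prob j ^ m) * (case p of (Rs, a) \<Rightarrow> of_bool (\<forall>R\<in>set (take (length us1) Rs). w \<notin> set R) * ennreal (r ^ card (?E a)))"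
    proof (cases "\<not> ?hit Rs \<and> noticed (graph_of ?us) a")
      case True
      have "?d \<le> 4 * card (?E a)"
        unfolding j_def using exposed_large[OF v(1) w t d i] True by simp
      then have "m \<le> card (?E a)" unfolding m_def by linarith
      then have "r ^ m \<le> r ^ card (?E a)" using r(2) by (rule power_increasing)
      then have "miss_prob j ^ m * r ^ m \<le> miss_prob j ^ m * r ^ card (?E a)" using mp by (intro mult_left_mono) auto
      moreover have "miss_prob j ^ m * r ^ m = 1" using r(1) by (metis mult.commute power_mult_distrib power_one)
      ultimately have "ennreal 1 \<le> ennreal (miss_prob j ^ m * r ^ card (?E a))" by (intro ennreal_leI) simp
      then have "1 \<le> ennreal (miss_prob j ^ m) * ennreal (r ^ card (?E a))"
        using mp r(2) by (simp add: ennreal_mult)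
      then show ?thesis using True p by simp
    next
      case False
      then show ?thesis unfolding p by (cases "?hit Rs") auto
    qed
  qed
  also have "\<dots> = fail_prob (notify_run ?us) (\<lambda>(Rs, a). noticed (graph_of ?us) a) + ennreal (miss_prob j ^ m) *
      (\<integral>\<^sup>+(Rs, a). of_bool (\<forall>R\<in>set (take (length us1) Rs). w \<notin> set R) * ennreal (r ^ card (?E a)) \<partial>measure_pmf (notify_run ?us))"
    by (simp only: nn_integral_pmf_add nn_integral_pmf_cmult fail_prob_def)
  also have "\<dots> \<le> of_nat (length ?us * (3 * n + 1)) * test_error + test_error * 1"
  proof (intro add_mono mult_mono)
    show "fail_prob (notify_run ?us) (\<lambda>(Rs, a). noticed (graph_of ?us) a) \<le> of_nat (length ?us * (3 * n + 1)) * test_error"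
      using vu v(2) by (intro noticed_fail_run) auto
    show "ennreal (miss_prob j ^ m) \<le> test_error"
      unfolding test_error_def j_def by (intro ennreal_leI miss_prob_power_le[OF d(1) i(1) dm])
    show "(\<integral>\<^sup>+(Rs, a). of_bool (\<forall>R\<in>set (take (length us1) Rs). w \<notin> set R) * ennreal (r ^ card (?E a)) \<partial>measure_pmf (notify_run ?us)) \<le> 1"
      by (rule run_potential[OF vu _ r]) (use v(2) in \<open>auto simp: all_small_def\<close>)
  qed auto
  also have "\<dots> \<le> of_nat (2 * n * (3 * n + 1)) * test_error + test_error * 1"
  proof (intro add_right_mono mult_right_mono)
    have "length ?us * (3 * n + 1) \<le> 2 * n * (3 * n + 1)" using len by (intro mult_right_mono) auto
    then show "(of_nat (length ?us * (3 * n + 1)) :: ennreal) \<le> of_nat (2 * n * (3 * n + 1))" by (simp only: of_nat_le_iff)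
  qed auto
  also have "\<dots> = hit_error" unfolding hit_error_def by (simp only: of_nat_add of_nat_1 distrib_right) (simp add: add.commute)
  finally show ?thesis .
qed

section \<open>Event sequences are settled with high probability\<close>

lemma anchor_bound_Procs:
  "anchor_bound w (rev (map Proc R) @ es) = (if w \<in> set R then anchor_prob (graph_at es) w else anchor_bound w es)"
  by (induction R rule: rev_induct) auto

text \<open>The index \<open>i\<close> locates the last processing of \<open>w\<close>:
  \<open>drop i us\<close> are the updates up to and including that time, and
  \<open>take i Rs\<close> are the lists processed later.\<close>

lemma anchor_bound_split:
  "length us = length Rs \<Longrightarrow> anchor_bound w (events us Rs) = 0 \<or>
   (\<exists>i<length us. (\<forall>R\<in>set (take i Rs). w \<notin> set R) \<and> w \<in> set (Rs ! i) \<and>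
      anchor_bound w (events us Rs) = anchor_prob (graph_of (drop i us)) w)"
proof (induction us Rs rule: list_induct2)
  case (Cons x us R Rs)
  show ?case
  proof (cases "w \<in> set R")
    case True
    then show ?thesis using Cons.hyps
      by (intro disjI2 exI[of _ 0]) (simp add: anchor_bound_Procs graph_at_events)
  next
    case False
    then have eq: "anchor_bound w (events (x # us) (R # Rs)) = anchor_bound w (events us Rs)"
      by (simp add: anchor_bound_Procs)
    from Cons.IH show ?thesis
    proof (elim disjE exE conjE)
      fix i assume "i < length us" "\<forall>R\<in>set (take i Rs). w \<notin> set R" "w \<in> set (Rs ! i)"
        "anchor_bound w (events us Rs) = anchor_prob (graph_of (drop i us)) w"
      then show ?thesis using False unfolding eq by (intro disjI2 exI[of _ "Suc i"]) auto
    qed (unfold eq, rule disjI1)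
  qed
qed simp

text \<open>Within one update the graph is constant, and processing \<open>w\<close> resets its coin
  to the current degree. So it suffices to check the moment before the first node is
  processed.\<close>

lemma settled_Procs:
  assumes "settled c es" "anchor_rate \<le> c"
    "\<And>w. degree_typical (graph_at es) w \<Longrightarrow> anchor_bound w es * real (deg (graph_at es) w) \<le> c"
  shows "settled c (rev (map Proc R) @ es)"
proof (induction R rule: rev_induct)
  case (snoc v R)
  have "anchor_bound w (rev (map Proc R) @ es) * real (deg (graph_at es) w) \<le> c"
    if "degree_typical (graph_at es) w" for w
    using assms(2) assms(3)[OF that] anchor_prob_bounds(3)[of "graph_at es" w]
    by (auto simp: anchor_bound_Procs)
  then show ?case using snoc by simp
qed (simp add: assms)

lemma notify_run_verts:
  "valid us \<Longrightarrow> (Rs, a) \<in> set_pmf (notify_run us) \<Longrightarrow> i < length us \<Longrightarrow> set (Rs ! i) \<subseteq> verts (graph_of (drop i us))"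
proof (induction us arbitrary: Rs a i)
  case (Cons x us)
  obtain R Rs0 a0 where 0: "(Rs0, a0) \<in> set_pmf (notify_run us)"
    and r: "(R, a) \<in> set_pmf (start_notify (Suc (length us)) x a0)" and Rs: "Rs = enum R # Rs0"
    using Cons.prems(2) by auto
  note vu = valid_tl[OF Cons.prems(1)]
  have RV: "R \<subseteq> verts (graph_of (x # us))"
    by (rule start_notify_sure(1)[OF Cons.prems(1) notify_run_sure[OF vu 0] r])
  then have "finite R" using finite_verts[OF Cons.prems(1)] finite_subset by blast
  then show ?case using RV Cons.IH[OF vu 0] Cons.prems(3) unfolding Rs by (cases i) auto
qed simp

lemma updates_of_events [simp]: "length us = length Rs \<Longrightarrow> updates_of (events us Rs) = us"
proof (induction us Rs rule: list_induct2)
  case (Cons x us R Rs)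
  have "updates_of (rev (map Proc R) @ es) = updates_of es" for es by (induction R rule: rev_induct) auto
  then show ?case using Cons by simp
qed simp

lemma ok_events_Procs:
  "ok_events es \<Longrightarrow> set R \<subseteq> verts (graph_at es) \<Longrightarrow> ok_events (rev (map Proc R) @ es)"
  by (induction R rule: rev_induct) auto

lemma ok_events_run:
  "valid us \<Longrightarrow> all_small us \<Longrightarrow> (Rs, a) \<in> set_pmf (notify_run us) \<Longrightarrow> ok_events (events us Rs)"
proof (induction us arbitrary: Rs a)
  case Nil
  then show ?case by simp
next
  case (Cons x us)
  note V = notify_run_verts[OF Cons.prems(1,3), of 0]
  obtain R Rs0 a0 where 0: "(Rs0, a0) \<in> set_pmf (notify_run us)" and Rs: "Rs = enum R # Rs0"
    using Cons.prems(3) by auto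
  have len: "length us = length Rs0" using notify_run_props[OF 0] by simp
  have ok: "ok_events (events us Rs0)"
    by (rule Cons.IH[OF valid_tl[OF Cons.prems(1)] all_small_tl[OF Cons.prems(2)] 0])
  have "ok_events (Upd (Suc (length us)) x # events us Rs0)"
    using ok len Cons.prems(1) all_smallD[OF Cons.prems(2)] by (simp del: valid.simps)
  moreover have "set (enum R) \<subseteq> verts (graph_at (Upd (Suc (length us)) x # events us Rs0))"
    using V len Rs by (simp add: graph_at_events)
  ultimately show ?case unfolding Rs events.simps by (rule ok_events_Procs)
qed

definition growth_error :: ennreal where
  "growth_error = of_nat (n * (2 * n + 1)) * hit_error"

text \<open>A violation would mean that \<open>w\<close> has degree at least 64 and that this degree
  has grown at least eightfold since \<open>w\<close> was last processed; then, with high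
  probability, \<open>growth_hit\<close> has it processed in between. The time of the last
  processing is random, so the union bound runs over all pairs of a node and a time.\<close>

lemma settled_step:
  assumes v: "valid (x # us)" "all_small (x # us)" and len: "length us \<le> 2 * n"
  shows "fail_prob (notify_run us) (\<lambda>(Rs, a). \<forall>w. degree_typical (graph_of (x # us)) w \<longrightarrow>
      anchor_bound w (events us Rs) * real (deg (graph_of (x # us)) w) \<le> 64 * anchor_rate) \<le> growth_error"
proof -
  let ?G' = "graph_of (x # us)" let ?V = "verts ?G'"
  note vu = valid_tl[OF v(1)]
  define C where "C w i \<longleftrightarrow> degree_typical ?G' w \<and> 64 \<le> deg ?G' w \<and> 8 * deg (graph_of (drop i us)) w \<le> deg ?G' w \<and>
    w \<le> length (drop i us)" for w i
  define H where "H = (\<lambda>(w, i) (Rs, a :: state). C w i \<longrightarrow> (\<exists>R\<in>set (take i Rs). w \<in> set R))"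
  have fV: "finite ?V" by (rule finite_verts[OF v(1)])
  have "fail_prob (notify_run us) (\<lambda>p. \<forall>wi\<in>?V \<times> {..length us}. H wi p) \<le> of_nat (card (?V \<times> {..length us})) * hit_error"
  proof (rule fail_prob_ball)
    fix wi assume wi: "wi \<in> ?V \<times> {..length us}"
    obtain w i where [simp]: "wi = (w, i)" by fastforce
    have i: "i \<le> length us" using wi by simp
    show "fail_prob (notify_run us) (H wi) \<le> hit_error"
    proof (cases "C w i")
      case True
      have us: "take i us @ drop i us = us" by simp
      have "fail_prob (notify_run (take i us @ drop i us)) (\<lambda>(Rs, a). \<exists>R\<in>set (take (length (take i us)) Rs). w \<in> set R) \<le> hit_error"
        by (rule growth_hit[of x]) (use True v all_small_tl[OF v(2)] len in \<open>auto simp: C_def simp del: graph_of.simps valid.simps\<close>)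
      then show ?thesis using True i by (simp add: H_def min_absorb2)
    next
      case False
      then show ?thesis by (subst fail_prob_eq_0) (auto simp: H_def)
    qed
  qed (use fV in auto)
  also have "\<dots> \<le> growth_error"
    unfolding growth_error_def
  proof (rule mult_right_mono)
    have "card (?V \<times> {..length us}) \<le> n * (2 * n + 1)"
      unfolding card_cartesian_product using all_smallD[OF v(2)] len by (intro mult_le_mono) auto
    then show "(of_nat (card (?V \<times> {..length us})) :: ennreal) \<le> of_nat (n * (2 * n + 1))" by (simp only: of_nat_le_iff)
  qed simp
  finally have *: "fail_prob (notify_run us) (\<lambda>p. \<forall>wi\<in>?V \<times> {..length us}. H wi p) \<le> growth_error" .
  show ?thesis
  proof (rule order_trans[OF fail_prob_mono *], clarify)
    fix Rs a w
    assume Ra: "(Rs, a) \<in> set_pmf (notify_run us)" and h: "\<forall>wi\<in>?V \<times> {..length us}. H wi (Rs, a)"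
      and t: "degree_typical ?G' w"
    let ?d = "real (deg ?G' w)" let ?b = "anchor_bound w (events us Rs)"
    have L: "1 \<le> anchor_rate" by (rule anchor_rate_ge_1)
    have len: "length us = length Rs" using notify_run_props[OF Ra] by simp
    show "?b * ?d \<le> 64 * anchor_rate"
    proof (rule ccontr)
      assume neg: "\<not> ?b * ?d \<le> 64 * anchor_rate"
      then have "?b \<noteq> 0" using L by auto
      then obtain i where i: "i < length us" "\<forall>R\<in>set (take i Rs). w \<notin> set R" "w \<in> set (Rs ! i)"
        "?b = anchor_prob (graph_of (drop i us)) w"
        using anchor_bound_split[OF len, of w] by blast
      let ?G0 = "graph_of (drop i us)"
      have v0: "valid (drop i us)" using vu by (metis append_take_drop_id valid_appendD)
      have "w \<in> verts ?G0" using notify_run_verts[OF vu Ra i(1)] i(3) by blast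
      then have wl: "w \<le> length (drop i us)" by (rule verts_le[OF v0])
      have b1: "?b \<le> 1" "0 \<le> ?b" "?b * real (deg ?G0 w) \<le> anchor_rate" using i(4) anchor_prob_bounds by auto
      \<comment> \<open>As \<open>?b\<close> is a probability and
        \<open>anchor_rate \<ge> 1\<close>, the violated bound itself yields the minimal degree 64
        that \<open>growth_hit\<close> demands.\<close>
      have "?b * ?d \<le> 1 * ?d" using b1 by (intro mult_right_mono) auto
      then have d64: "64 \<le> deg ?G' w" using neg L by linarith
      have "8 * deg ?G0 w \<le> deg ?G' w"
      proof (rule ccontr)
        assume "\<not> ?thesis"
        then have "?d \<le> 8 * real (deg ?G0 w)" by linarith
        then have "?b * ?d \<le> ?b * (8 * real (deg ?G0 w))" using b1 by (intro mult_left_mono) auto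
        then show False using neg b1(3) L by simp
      qed
      then have C: "C w i" using t d64 wl by (simp add: C_def)
      have "w \<in> ?V"
      proof -
        have "deg ?G' w \<noteq> 0" using d64 by linarith
        then have "N ?G' w \<noteq> {}" by auto
        then show ?thesis using N_verts(2)[OF v(1)] by blast
      qed
      then have "H (w, i) (Rs, a)" using h i(1) by auto
      then show False using C i(2) by (simp add: H_def)
    qed
  qed
qed

lemma settled_run:
  "valid us \<Longrightarrow> all_small us \<Longrightarrow> length us \<le> 2 * n \<Longrightarrow>
    fail_prob (notify_run us) (\<lambda>(Rs, a). settled (64 * anchor_rate) (events us Rs)) \<le> of_nat (length us) * growth_error"
proof (induction us)
  case Nil
  then show ?case by simp
next
  case (Cons x us)
  let ?c = "64 * anchor_rate"
  note vu = valid_tl[OF Cons.prems(1)] and au = all_small_tl[OF Cons.prems(2)]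
  have c: "anchor_rate \<le> ?c" using anchor_rate_ge_1 by simp
  define Q where "Q = (\<lambda>(Rs, a :: state). \<forall>w. degree_typical (graph_of (x # us)) w \<longrightarrow>
      anchor_bound w (events us Rs) * real (deg (graph_of (x # us)) w) \<le> ?c)"
  have "fail_prob (notify_run us) (\<lambda>p. (\<lambda>(Rs, a). settled ?c (events us Rs)) p \<and> Q p)
    \<le> of_nat (length us) * growth_error + growth_error"
  proof (rule order_trans[OF fail_prob_conj], rule add_mono)
    show "fail_prob (notify_run us) (\<lambda>(Rs, a). settled ?c (events us Rs)) \<le> of_nat (length us) * growth_error"
      using Cons vu au by simp
    show "fail_prob (notify_run us) Q \<le> growth_error"
      unfolding Q_def using Cons.prems by (intro settled_step) auto
  qed
  then have "fail_prob (notify_run (x # us)) (\<lambda>(Rs, a). settled ?c (events (x # us) Rs))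
    \<le> (of_nat (length us) * growth_error + growth_error) + 0"
    unfolding notify_run.simps
  proof (rule fail_prob_bind)
    fix p assume p: "p \<in> set_pmf (notify_run us)" "(\<lambda>(Rs, a). settled ?c (events us Rs)) p \<and> Q p"
    obtain Rs a where Ra: "p = (Rs, a)" by fastforce
    have len: "length us = length Rs" using notify_run_props p(1) Ra by simp
    have "settled ?c (events (x # us) (R # Rs))" for R
      unfolding events.simps using p(2) Ra len
      by (intro settled_Procs c) (auto simp: Q_def graph_at_events)
    then show "fail_prob (case p of (Rs, a) \<Rightarrow> map_pmf (\<lambda>(R, a'). (enum R # Rs, a')) (start_notify (Suc (length us)) x a))
        (\<lambda>(Rs, a). settled ?c (events (x # us) Rs)) \<le> 0"
      unfolding Ra by (subst fail_prob_eq_0) auto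
  qed
  then show ?case by (simp add: distrib_right add.commute)
qed

end

section \<open>Node streams\<close>

text \<open>\<open>node_stream\<close> counts nodes only in histories of full length, so a shorter
  history is extended before its nodes are counted.\<close>

lemma history_extend:
  assumes "node_stream adv n T" "history adv h" "length h \<le> Suc T"
  shows "\<exists>h'. history adv h' \<and> length h' = Suc T \<and> set h \<subseteq> set h'"
  using assms(2,3)
proof (induction "Suc T - length h" arbitrary: h)
  case 0
  then show ?case by (intro exI[of _ h]) auto
next
  case (Suc k)
  then have len: "length h \<le> T" by simp
  have ok: "case adv h of Insert S \<Rightarrow> S \<subseteq> verts (hd h) | Delete \<Rightarrow> verts (hd h) \<noteq> {}"
    using assms(1) Suc.prems(1) len by (auto simp: node_stream_def)
  obtain G where G: "history adv (G # h)"
  proof (cases "adv h")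
    case (Insert S)
    then show thesis using that history.ins[OF Suc.prems(1)] by blast
  next
    case Delete
    then obtain u where "u \<in> verts (hd h)" using ok by auto
    then show thesis using that history.del[OF Suc.prems(1) Delete] by blast
  qed
  have "\<exists>h'. history adv h' \<and> length h' = Suc T \<and> set (G # h) \<subseteq> set h'"
    using Suc.hyps(2) len by (intro Suc.hyps(1) G) auto
  then show ?case by auto
qed

lemma updates_history:
  assumes ns: "node_stream adv n T" and us: "us \<in> set_pmf (updates adv t)" and t: "t \<le> T"
  shows "valid us \<and> history adv (graphs_of us)"
  using us t
proof (induction t arbitrary: us)
  case 0
  then show ?case by (simp add: history.start)
next
  case (Suc t)
  from Suc.prems(1) obtain us0 x where us0: "us0 \<in> set_pmf (updates adv t)"
    and x: "x \<in> set_pmf (choose_update adv (graphs_of us0))" and us: "us = x # us0" by auto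
  have IH: "valid us0" "history adv (graphs_of us0)" using Suc.IH[OF us0] Suc.prems(2) by auto
  have len: "length us0 = t" by (rule length_updates[OF us0])
  have ok: "case adv (graphs_of us0) of Insert S \<Rightarrow> S \<subseteq> verts (graph_of us0) | Delete \<Rightarrow> verts (graph_of us0) \<noteq> {}"
    using ns IH(2) len Suc.prems(2) unfolding node_stream_def by (metis hd_graphs_of length_graphs_of)
  show ?case
  proof (cases "adv (graphs_of us0)")
    case (Insert S)
    then have xS: "x = Ins S" using x by (simp add: choose_update_def)
    show ?thesis using history.ins[OF IH(2) Insert] ok Insert IH(1) by (simp add: us xS)
  next
    case Delete
    then have "verts (graph_of us0) \<noteq> {}" using ok by simp
    then obtain u where xu: "x = Del u" "u \<in> verts (graph_of us0)"
      using x Delete finite_verts[OF IH(1)] by (auto simp: choose_update_def)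
    show ?thesis using history.del[OF IH(2) Delete, of u] xu IH(1) by (simp add: us)
  qed
qed

lemma graphs_of_suffix: "suffix us' us \<Longrightarrow> graph_of us' \<in> set (graphs_of us)"
proof (induction us)
  case (Cons x us)
  then show ?case by (auto simp: suffix_Cons simp del: graph_of.simps)
qed simp

lemma verts_graphs_of: "valid us \<Longrightarrow> (\<Union>G\<in>set (graphs_of us). verts G) \<subseteq> {..length us}"
proof (induction us)
  case (Cons x us)
  have "verts (graph_of (x # us)) \<subseteq> {..length (x # us)}"
    using verts_le[OF Cons.prems] by auto
  then show ?case using Cons.IH[OF valid_tl[OF Cons.prems]] by (auto simp del: graph_of.simps)
qed (simp add: empty_graph_def)

text \<open>There are as many insertions as nodes that ever appeared, and as many deletions as such
  nodes that are absent now. This limits the number of updates to twice the number of nodes.\<close>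

lemma count_updates:
  "valid us \<Longrightarrow> length us + card (verts (graph_of us)) = 2 * card (\<Union>G\<in>set (graphs_of us). verts G)"
proof (induction us)
  case Nil
  then show ?case by (simp add: empty_graph_def)
next
  case (Cons x us)
  let ?U = "\<Union>G\<in>set (graphs_of us). verts G"
  have vu: "valid us" by (rule valid_tl[OF Cons.prems])
  have fin: "finite ?U" using verts_graphs_of[OF vu] finite_subset by blast
  have "graph_of us \<in> set (graphs_of us)" by (rule graphs_of_suffix) simp
  then have sub: "verts (graph_of us) \<subseteq> ?U" by blast
  have fV: "finite (verts (graph_of us))" using vu by simp
  note IH = Cons.IH[OF vu]
  show ?case
  proof (cases x)
    case (Ins S)
    have k: "Suc (length us) \<notin> ?U" using verts_graphs_of[OF vu] by fastforce
    have "(\<Union>G\<in>set (graphs_of (x # us)). verts G) = insert (Suc (length us)) ?U"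
      using sub by (auto simp: Ins insert_node_def)
    moreover have "Suc (length us) \<notin> verts (graph_of us)" using k sub by blast
    ultimately show ?thesis using IH k fin fV by (simp add: Ins insert_node_def)
  next
    case (Del u)
    then have u: "u \<in> verts (graph_of us)" using Cons.prems by simp
    have "(\<Union>G\<in>set (graphs_of (x # us)). verts G) = ?U"
      using sub by (auto simp: Del delete_node_def)
    moreover have "card (verts (graph_of us)) = Suc (card (verts (graph_of us) - {u}))"
      using u fV by (rule card.remove[rotated])
    ultimately show ?thesis using IH by (simp add: Del delete_node_def)
  qed
qed

text \<open>Fubini for two independent discrete distributions, read off from
  \<open>bind_commute_pmf\<close>.\<close>

lemma nn_integral_pmf_swap:
  "(\<integral>\<^sup>+x. (\<integral>\<^sup>+y. f x y \<partial>measure_pmf B) \<partial>measure_pmf A) = (\<integral>\<^sup>+y. (\<integral>\<^sup>+x. f x y \<partial>measure_pmf A) \<partial>measure_pmf B)"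
proof -
  have "(\<integral>\<^sup>+z. f (fst z) (snd z) \<partial>measure_pmf (A \<bind> (\<lambda>x. B \<bind> (\<lambda>y. return_pmf (x, y))))) =
    (\<integral>\<^sup>+z. f (fst z) (snd z) \<partial>measure_pmf (B \<bind> (\<lambda>y. A \<bind> (\<lambda>x. return_pmf (x, y)))))"
    by (subst bind_commute_pmf) (rule refl)
  then show ?thesis by simp
qed

context dynamic_agreement_params
begin

lemma updates_props:
  assumes ns: "node_stream adv n T" and us: "us \<in> set_pmf (updates adv t)" and t: "t \<le> T"
  shows "valid us" "all_small us" "length us \<le> 2 * n"
proof -
  have v: "valid us" and h: "history adv (graphs_of us)" using updates_history[OF ns us t] by auto
  show "valid us" by (rule v)
  have "length (graphs_of us) \<le> Suc T" using length_updates[OF us] t by simp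
  from history_extend[OF ns h this] obtain h' where h': "history adv h'" "length h' = Suc T" "set (graphs_of us) \<subseteq> set h'"
    by blast
  let ?U = "\<Union>G\<in>set (graphs_of us). verts G"
  have card': "card (\<Union>G\<in>set h'. verts G) = n" using ns h' by (auto simp: node_stream_def)
  have "finite (\<Union>G\<in>set h'. verts G)"
  proof (rule ccontr)
    assume "infinite (\<Union>G\<in>set h'. verts G)"
    then show False using card' n2 by simp
  qed
  moreover have "?U \<subseteq> (\<Union>G\<in>set h'. verts G)" using h'(3) by blast
  ultimately have cU: "card ?U \<le> n" using card_mono card' by metis
  have fU: "finite ?U" using verts_graphs_of[OF v] finite_subset by blast
  show "all_small us"
    unfolding all_small_def
  proof (intro allI impI)
    fix us' assume "suffix us' us"
    then have "verts (graph_of us') \<subseteq> ?U" using graphs_of_suffix by blast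
    then show "card (verts (graph_of us')) \<le> n" using card_mono[OF fU] cU order_trans by blast
  qed
  show "length us \<le> 2 * n" using count_updates[OF v] cU by linarith
qed

section \<open>The expected work of an update\<close>

lemma process_const_nonneg: "0 \<le> process_const" and process_factor_nonneg: "0 \<le> process_factor"
  unfolding process_const_def process_factor_def
  using agreement_cost_nonneg heavy_cost_nonneg qcost_nonneg log_n anchor_rate_ge_1
  by (auto intro!: add_nonneg_nonneg mult_nonneg_nonneg)

text \<open>\<open>\<Psi>\<close> bounds the expected number of adjacent anchors for every node. The
  neighbours of \<open>u\<close> are fixed by the events, so the same bound holds for the mean over
  them.\<close>

lemma work_process_step:
  assumes ok: "ok_events es" and psi: "\<And>u. (\<integral>\<^sup>+b. ennreal (real (card (anchor_nbrs b u))) \<partial>measure_pmf (process_run es)) \<le> \<Psi>"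
  shows "(\<integral>\<^sup>+b. (\<integral>\<^sup>+st. ennreal (work st) \<partial>measure_pmf (process u b)) \<partial>measure_pmf (process_run es)) \<le>
    (\<integral>\<^sup>+b. ennreal (work b) \<partial>measure_pmf (process_run es)) + (ennreal process_const + ennreal process_factor * (2 * \<Psi>))"
proof -
  interpret graph_params n eps qcost enum "updates_of es" "graph_at es" by (rule ok_events_params[OF ok])
  let ?G = "graph_at es" let ?M = "measure_pmf (process_run es)"
  let ?c = "\<lambda>b w. ennreal (real (card (anchor_nbrs b w)))"
  have avg: "(\<integral>\<^sup>+b. ennreal (avg_anchors b u) \<partial>?M) \<le> \<Psi>"
  proof (cases "N ?G u = {}")
    case True
    then show ?thesis by (simp add: avg_anchors_def)
  next
    case False
    have d: "0 < deg ?G u" using False by (simp add: card_gt_0_iff)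
    have "(\<integral>\<^sup>+b. ennreal (avg_anchors b u) \<partial>?M) = (\<integral>\<^sup>+b. (\<Sum>w\<in>N ?G u. ?c b w) / of_nat (deg ?G u) \<partial>?M)"
      using d by (intro nn_integral_cong)
        (simp add: avg_anchors_def divide_ennreal[symmetric] sum_nonneg ennreal_of_nat_eq_real_of_nat sum_ennreal)
    also have "\<dots> = (\<Sum>w\<in>N ?G u. (\<integral>\<^sup>+b. ?c b w \<partial>?M)) / of_nat (deg ?G u)"
      by (subst nn_integral_divide, simp, simp only: nn_integral_pmf_sum)
    also have "\<dots> \<le> (\<Sum>w\<in>N ?G u. \<Psi>) / of_nat (deg ?G u)"
      by (intro divide_right_mono_ennreal sum_mono psi)
    also have "\<dots> = \<Psi>"
    proof -
      have "(of_nat k * \<Psi>) / of_nat k = \<Psi>" if "0 < k" for k :: nat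
        using that by (subst mult.commute) (rule ennreal_mult_divide_eq, simp_all)
      then show ?thesis using d by simp
    qed
    finally show ?thesis .
  qed
  have "(\<integral>\<^sup>+b. (\<integral>\<^sup>+st. ennreal (work st) \<partial>measure_pmf (process u b)) \<partial>?M) \<le>
    (\<integral>\<^sup>+b. ennreal (work b) + (ennreal process_const + ennreal process_factor * (?c b u + ennreal (avg_anchors b u))) \<partial>?M)"
  proof (rule nn_integral_pmf_mono)
    fix b assume b: "b \<in> set_pmf (process_run es)"
    have "ennreal (process_const + process_factor * (real (card (anchor_nbrs b u)) + avg_anchors b u)) =
      ennreal process_const + ennreal process_factor * (?c b u + ennreal (avg_anchors b u))"
      using process_const_nonneg process_factor_nonneg avg_anchors_nonneg[of b u]
      by (simp add: ennreal_plus ennreal_mult)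
    then show "(\<integral>\<^sup>+st. ennreal (work st) \<partial>measure_pmf (process u b)) \<le>
      ennreal (work b) + (ennreal process_const + ennreal process_factor * (?c b u + ennreal (avg_anchors b u)))"
      using process_work[OF proper_run[OF ok b], of u] by simp
  qed
  also have "\<dots> = (\<integral>\<^sup>+b. ennreal (work b) \<partial>?M) + (ennreal process_const + ennreal process_factor *
      ((\<integral>\<^sup>+b. ?c b u \<partial>?M) + (\<integral>\<^sup>+b. ennreal (avg_anchors b u) \<partial>?M)))"
    by (simp only: nn_integral_pmf_add nn_integral_pmf_cmult nn_integral_pmf_const)
  also have "\<dots> \<le> (\<integral>\<^sup>+b. ennreal (work b) \<partial>?M) + (ennreal process_const + ennreal process_factor * (\<Psi> + \<Psi>))"
    by (intro add_left_mono mult_left_mono add_mono psi avg) auto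
  finally show ?thesis by (simp only: mult_2)
qed

lemma work_run_le:
  assumes ok: "ok_events (rev (map Proc R) @ Upd k x # es)"
    and psi: "\<And>R' u. prefix R' R \<Longrightarrow>
      (\<integral>\<^sup>+b. ennreal (real (card (anchor_nbrs b u))) \<partial>measure_pmf (process_run (rev (map Proc R') @ Upd k x # es))) \<le> \<Psi>"
  shows "(\<integral>\<^sup>+b. ennreal (work b) \<partial>measure_pmf (process_run (rev (map Proc R) @ Upd k x # es))) \<le>
    of_nat (length R) * (ennreal process_const + ennreal process_factor * (2 * \<Psi>))"
  using ok psi
proof (induction R rule: rev_induct)
  case Nil
  have "work (start_update k x b) = 0" for b by (cases x) (simp_all add: reset_work_def work_def remove_edges_def)
  then show ?case by simp
next
  case (snoc u R)
  let ?es = "rev (map Proc R) @ Upd k x # es"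
  let ?X = "ennreal process_const + ennreal process_factor * (2 * \<Psi>)"
  have ok: "ok_events ?es" using snoc.prems(1) by simp
  have psi: "(\<integral>\<^sup>+b. ennreal (real (card (anchor_nbrs b u))) \<partial>measure_pmf (process_run (rev (map Proc R') @ Upd k x # es))) \<le> \<Psi>"
    if "prefix R' R" for R' u using snoc.prems(2) that by (simp add: prefix_prefix)
  have "(\<integral>\<^sup>+b. ennreal (work b) \<partial>measure_pmf (process_run (rev (map Proc (R @ [u])) @ Upd k x # es))) =
    (\<integral>\<^sup>+b. (\<integral>\<^sup>+st. ennreal (work st) \<partial>measure_pmf (process u b)) \<partial>measure_pmf (process_run ?es))"
    by simp
  also have "\<dots> \<le> (\<integral>\<^sup>+b. ennreal (work b) \<partial>measure_pmf (process_run ?es)) + ?X"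
    by (rule work_process_step[OF ok psi]) simp
  also have "\<dots> \<le> of_nat (length R) * ?X + ?X"
    by (intro add_right_mono snoc.IH ok psi)
  also have "\<dots> = of_nat (length (R @ [u])) * ?X" by (simp add: distrib_right add.commute)
  finally show ?case .
qed

lemma length_events:
  "valid us \<Longrightarrow> all_small us \<Longrightarrow> (Rs, a) \<in> set_pmf (notify_run us) \<Longrightarrow> length (events us Rs) \<le> length us * (n + 1)"
proof (induction us arbitrary: Rs a)
  case Nil
  then show ?case by simp
next
  case (Cons x us)
  obtain R Rs0 a0 where 0: "(Rs0, a0) \<in> set_pmf (notify_run us)"
    and r: "(R, a) \<in> set_pmf (start_notify (Suc (length us)) x a0)" and Rs: "Rs = enum R # Rs0"
    using Cons.prems(3) by auto
  note vu = valid_tl[OF Cons.prems(1)]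
  have RV: "R \<subseteq> verts (graph_of (x # us))"
    by (rule start_notify_sure(1)[OF Cons.prems(1) notify_run_sure[OF vu 0] r])
  have fV: "finite (verts (graph_of (x # us)))" by (rule finite_verts[OF Cons.prems(1)])
  have "card R \<le> n" using card_mono[OF fV RV] all_smallD[OF Cons.prems(2)] by linarith
  moreover have "finite R" using RV fV finite_subset by blast
  ultimately show ?case
    using Cons.IH[OF vu all_small_tl[OF Cons.prems(2)] 0] unfolding Rs by simp
qed

section \<open>Assembling the cost of one update\<close>

text \<open>256 is the factor 4 of \<open>sum_anchor_bound\<close> times the constant 64 of
  \<open>settled_run\<close>; the other summands cover erring tests, see
  \<open>process_error_small\<close>.\<close>

definition anchor_degree :: real where
  "anchor_degree = 256 * anchor_rate * real (Suc top_level) + 3 + real (samples (10^5))"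

text \<open>The trivial count \<open>n\<close>, the number of events and the error of one event
  multiply to at most \<open>6 * n ^ 4 * (3 + samples (10^5))\<close>, which is set against
  \<open>n ^ 20\<close>.\<close>

lemma process_error_small:
  assumes "l \<le> (2 * n + 1) * (n + 1)"
  shows "of_nat n * (of_nat l * graph_params.process_error n eps) \<le> ennreal (3 + real (samples (10^5)))"
proof -
  let ?k = "samples (10^5)"
  have gp: "graph_params n eps qcost enum [] empty_graph"
    by unfold_locales (auto simp: empty_graph_def)
  have pe: "graph_params.process_error n eps = of_nat (2 * n + 1 + ?k * n) * test_error"
    by (rule graph_params.process_error_def[OF gp])
  have "of_nat n * (of_nat l * graph_params.process_error n eps) = of_nat (n * (l * (2 * n + 1 + ?k * n))) * test_error"
    unfolding pe by (simp only: of_nat_mult mult.assoc)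
  also have "\<dots> = ennreal (real (n * (l * (2 * n + 1 + ?k * n))) * (1 / real n ^ 20))"
    unfolding test_error_def by (subst ennreal_mult) (auto simp: ennreal_of_nat_eq_real_of_nat)
  also have "\<dots> \<le> ennreal (3 + real ?k)"
  proof (rule ennreal_leI)
    have "l \<le> (3 * n) * (2 * n)" using assms n2 by (intro order_trans[OF assms] mult_le_mono) auto
    moreover have "2 * n + 1 + ?k * n \<le> (3 + ?k) * n" using n2 by (simp add: algebra_simps)
    ultimately have "n * (l * (2 * n + 1 + ?k * n)) \<le> n * (((3 * n) * (2 * n)) * ((3 + ?k) * n))"
      by (intro mult_le_mono order_refl)
    also have "\<dots> = 6 * n ^ 4 * (3 + ?k)" by (simp add: power4_eq_xxxx)
    also have "6 * n ^ 4 \<le> n ^ 16 * n ^ 4"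
    proof (rule mult_le_mono)
      have "(6::nat) \<le> 2 ^ 16" by simp
      also have "\<dots> \<le> n ^ 16" using n2 by (rule power_mono) simp
      finally show "6 \<le> n ^ 16" .
    qed simp
    also have "n ^ 16 * n ^ 4 = n ^ 20" by (simp flip: power_add)
    finally have "n * (l * (2 * n + 1 + ?k * n)) \<le> n ^ 20 * (3 + ?k)" by simp
    then have "real (n * (l * (2 * n + 1 + ?k * n))) \<le> real (n ^ 20 * (3 + ?k))" by (simp only: of_nat_le_iff)
    then show "real (n * (l * (2 * n + 1 + ?k * n))) * (1 / real n ^ 20) \<le> 3 + real ?k"
      using n2 by (simp add: field_simps)
  qed
  finally show ?thesis .
qed

lemma settled_prefix: "settled c (es' @ es) \<Longrightarrow> settled c es"
proof (induction es')
  case (Cons e es')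
  then show ?case by (cases e) auto
qed simp

lemma ok_events_prefix: "ok_events (es' @ es) \<Longrightarrow> ok_events es"
  by (induction es') (auto dest: ok_events_tl)

text \<open>Two regimes: along a settled sequence the expected number of adjacent anchors is at most
  \<open>anchor_degree\<close>; along any other the trivial bound \<open>n\<close> is used, and the
  rarity of such sequences pays for it later.\<close>

lemma work_events_le:
  assumes v: "valid (x # us)" "all_small (x # us)" "length (x # us) \<le> 2 * n"
    and Rs: "(Rs, a) \<in> set_pmf (notify_run (x # us))"
  shows "(\<integral>\<^sup>+b. ennreal (work b) \<partial>measure_pmf (process_run (events (x # us) Rs))) \<le>
    of_nat (length (hd Rs)) * ennreal (process_const + 2 * process_factor * anchor_degree) +
    of_nat n * ennreal (process_const + 2 * process_factor * real n) *
      of_bool (\<not> settled (64 * anchor_rate) (events (x # us) Rs))"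
proof -
  let ?k = "Suc (length us)"
  obtain R Rs0 a0 where 0: "(Rs0, a0) \<in> set_pmf (notify_run us)"
    and r: "(R, a) \<in> set_pmf (start_notify ?k x a0)" and Rs': "Rs = enum R # Rs0"
    using Rs by auto
  have len: "length us = length Rs0" using notify_run_props[OF 0] by simp
  have ok: "ok_events (events (x # us) Rs)" by (rule ok_events_run[OF v(1,2) Rs])
  have ok': "ok_events (rev (map Proc (enum R)) @ Upd ?k x # events us Rs0)"
    using ok unfolding Rs' by simp
  have lR: "length (enum R) \<le> n"
  proof -
    note vu = valid_tl[OF v(1)]
    have RV: "R \<subseteq> verts (graph_of (x # us))"
      by (rule start_notify_sure(1)[OF v(1) notify_run_sure[OF vu 0] r])
    have fV: "finite (verts (graph_of (x # us)))" by (rule finite_verts[OF v(1)])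
    have "card R \<le> n" using card_mono[OF fV RV] all_smallD[OF v(2)] by linarith
    then show ?thesis using RV fV finite_subset by (metis length_enum)
  qed
  have pre: "\<exists>es'. rev (map Proc (enum R)) @ Upd ?k x # events us Rs0 = es' @ (rev (map Proc R') @ Upd ?k x # events us Rs0)"
    if pR: "prefix R' (enum R)" for R'
    using pR by (auto simp: prefix_def)
  have pn: "0 \<le> process_const" "0 \<le> process_factor" by (rule process_const_nonneg process_factor_nonneg)+
  have an: "0 \<le> anchor_degree" using anchor_rate_ge_1 by (simp add: anchor_degree_def)
  have conv: "ennreal process_const + ennreal process_factor * (2 * ennreal y) = ennreal (process_const + 2 * process_factor * y)"
    if "0 \<le> y" for y
  proof -
    have "2 * ennreal y = ennreal (2 * y)" using that by (simp add: ennreal_mult)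
    then show ?thesis using pn that by (simp add: ennreal_mult[symmetric] ennreal_plus[symmetric] mult_ac del: ennreal_plus)
  qed
  show ?thesis
  proof (cases "settled (64 * anchor_rate) (events (x # us) Rs)")
    case True
    have "(\<integral>\<^sup>+b. ennreal (work b) \<partial>measure_pmf (process_run (events (x # us) Rs))) \<le>
      of_nat (length (enum R)) * (ennreal process_const + ennreal process_factor * (2 * ennreal anchor_degree))"
      unfolding Rs' events.simps
    proof (rule work_run_le[OF ok'])
      fix R' u assume pR: "prefix R' (enum R)"
      let ?es = "rev (map Proc R') @ Upd ?k x # events us Rs0"
      obtain es' where es': "rev (map Proc (enum R)) @ Upd ?k x # events us Rs0 = es' @ ?es" using pre[OF pR] by blast
      have o: "ok_events ?es" using ok' unfolding es' by (rule ok_events_prefix)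
      have s: "settled (64 * anchor_rate) ?es" using True unfolding Rs' events.simps es' by (rule settled_prefix)
      have "length ?es \<le> length (es' @ ?es)" by simp
      also have "\<dots> = length (events (x # us) Rs)" unfolding Rs' events.simps es' ..
      also have "\<dots> \<le> length (x # us) * (n + 1)" by (rule length_events[OF v(1,2) Rs])
      also have "\<dots> \<le> (2 * n + 1) * (n + 1)" using v(3) by (intro mult_right_mono) auto
      finally have l: "length ?es \<le> (2 * n + 1) * (n + 1)" .
      have "(\<integral>\<^sup>+b. ennreal (real (card (anchor_nbrs b u))) \<partial>measure_pmf (process_run ?es)) \<le>
        ennreal (4 * (64 * anchor_rate) * real (Suc top_level)) + of_nat n * (of_nat (length ?es) * graph_params.process_error n eps)"
        using anchor_rate_ge_1 by (intro expected_anchor_nbrs o s) simp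
      also have "\<dots> \<le> ennreal (256 * anchor_rate * real (Suc top_level)) + ennreal (3 + real (samples (10^5)))"
        using process_error_small[OF l] by (intro add_mono ennreal_leI) auto
      also have "\<dots> = ennreal anchor_degree"
        unfolding anchor_degree_def using anchor_rate_ge_1 by (subst ennreal_plus[symmetric]) auto
      finally show "(\<integral>\<^sup>+b. ennreal (real (card (anchor_nbrs b u))) \<partial>measure_pmf (process_run ?es)) \<le> ennreal anchor_degree" .
    qed
    then show ?thesis using True unfolding conv[OF an] Rs' by simp
  next
    case False
    have "(\<integral>\<^sup>+b. ennreal (work b) \<partial>measure_pmf (process_run (events (x # us) Rs))) \<le>
      of_nat (length (enum R)) * (ennreal process_const + ennreal process_factor * (2 * ennreal (real n)))"
      unfolding Rs' events.simps
    proof (rule work_run_le[OF ok'])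
      fix R' u assume pR: "prefix R' (enum R)"
      let ?es = "rev (map Proc R') @ Upd ?k x # events us Rs0"
      obtain es' where es': "rev (map Proc (enum R)) @ Upd ?k x # events us Rs0 = es' @ ?es" using pre[OF pR] by blast
      have o: "ok_events ?es" using ok' unfolding es' by (rule ok_events_prefix)
      show "(\<integral>\<^sup>+b. ennreal (real (card (anchor_nbrs b u))) \<partial>measure_pmf (process_run ?es)) \<le> ennreal (real n)"
        using graph_params.card_anchor_nbrs_le[OF ok_events_params[OF o] proper_run[OF o]]
        by (intro nn_integral_pmf_le_const ennreal_leI) simp
    qed
    also have "\<dots> \<le> of_nat n * ennreal (process_const + 2 * process_factor * real n)"
      unfolding conv[OF of_nat_0_le_iff] using lR by (intro mult_right_mono) auto
    finally show ?thesis using False by (simp add: add_increasing)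
  qed
qed

text \<open>Worst-case work along an unsettled sequence times the probability of such a sequence: up
  to the factor \<open>?C\<close>, at most \<open>54 * n ^ 7\<close> over
  \<open>n ^ 20\<close>.\<close>

lemma growth_error_small:
  assumes "l \<le> 2 * n"
  shows "of_nat n * ennreal (process_const + 2 * process_factor * real n) * (of_nat l * growth_error)
    \<le> ennreal (process_const + 2 * process_factor)"
proof -
  let ?C = "process_const + 2 * process_factor"
  have pn: "0 \<le> process_const" "0 \<le> process_factor" by (rule process_const_nonneg process_factor_nonneg)+
  have n1: "1 \<le> real n" using n2 by simp
  have "process_const + 2 * process_factor * real n \<le> ?C * real n"
    using pn n1 mult_left_mono[OF n1 pn(1)] by (simp add: algebra_simps)
  then have "of_nat n * ennreal (process_const + 2 * process_factor * real n) * (of_nat l * growth_error)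
    \<le> of_nat n * ennreal (?C * real n) * (of_nat (2 * n) * growth_error)"
    using assms by (intro mult_mono ennreal_leI) (auto simp del: of_nat_mult)
  also have "\<dots> = ennreal (?C * (real (n * n * (2 * n) * (n * (2 * n + 1)) * (1 + 2 * n * (3 * n + 1))) * (1 / real n ^ 20)))"
  proof -
    have merge: "ennreal a * ennreal b * (ennreal c * (ennreal d * (ennreal e * ennreal f))) = ennreal (a * b * (c * (d * (e * f))))"
      if "0 \<le> a" "0 \<le> b" "0 \<le> c" "0 \<le> d" "0 \<le> e" "0 \<le> f" for a b c d e f
      using that by (simp add: ennreal_mult)
    have "of_nat n * ennreal (?C * real n) * (of_nat (2 * n) * growth_error) =
      ennreal (real n * (?C * real n) * (real (2 * n) * (real (n * (2 * n + 1)) * (real (1 + 2 * n * (3 * n + 1)) * (1 / real n ^ 20)))))"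
      unfolding growth_error_def hit_error_def test_error_def ennreal_of_nat_eq_real_of_nat
      by (rule merge) (use pn in simp_all)
    also have "real n * (?C * real n) * (real (2 * n) * (real (n * (2 * n + 1)) * (real (1 + 2 * n * (3 * n + 1)) * (1 / real n ^ 20))))
      = ?C * (real (n * n * (2 * n) * (n * (2 * n + 1)) * (1 + 2 * n * (3 * n + 1))) * (1 / real n ^ 20))"
    proof -
      have "a * (C * a) * (b * (c * (d * f))) = C * ((a * a * b * c * d) * f)" for a b c d f C :: real
        by (simp only: mult_ac)
      then show ?thesis by (simp only: of_nat_mult[of "_ * _" "1 + 2 * n * (3 * n + 1)"] of_nat_mult[of "_ * _" "n * (2 * n + 1)"]
            of_nat_mult[of "n * n" "2 * n"] of_nat_mult[of n n])
    qed
    finally show ?thesis .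
  qed
  also have "\<dots> \<le> ennreal (?C * 1)"
  proof (intro ennreal_leI mult_left_mono)
    have "2 * n + 1 \<le> 3 * n" "1 + 2 * n * (3 * n + 1) \<le> 9 * n * n"
    proof -
      show "2 * n + 1 \<le> 3 * n" using n2 by simp
      have "1 \<le> n * n" "2 * n \<le> n * n" using n2 by auto
      moreover have "1 + 2 * n * (3 * n + 1) = 1 + 2 * n + 6 * (n * n)" "9 * n * n = 9 * (n * n)"
        by (simp_all add: algebra_simps)
      ultimately show "1 + 2 * n * (3 * n + 1) \<le> 9 * n * n" by linarith
    qed
    then have "n * n * (2 * n) * (n * (2 * n + 1)) * (1 + 2 * n * (3 * n + 1)) \<le> n * n * (2 * n) * (n * (3 * n)) * (9 * n * n)"
      by (intro mult_le_mono order_refl)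
    also have "\<dots> = 54 * n ^ 7"
    proof -
      have "n ^ 7 = n ^ 3 * n ^ 4" by (simp flip: power_add)
      then show ?thesis by (simp add: power3_eq_cube power4_eq_xxxx)
    qed
    also have "\<dots> \<le> n ^ 13 * n ^ 7"
    proof (rule mult_le_mono)
      have "(54::nat) \<le> 2 ^ 13" by simp
      also have "\<dots> \<le> n ^ 13" using n2 by (rule power_mono) simp
      finally show "54 \<le> n ^ 13" .
    qed simp
    also have "\<dots> = n ^ 20" by (simp flip: power_add)
    finally have "real (n * n * (2 * n) * (n * (2 * n + 1)) * (1 + 2 * n * (3 * n + 1))) \<le> real (n ^ 20)" by (simp only: of_nat_le_iff)
    then show "real (n * n * (2 * n) * (n * (2 * n + 1)) * (1 + 2 * n * (3 * n + 1))) * (1 / real n ^ 20) \<le> 1"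
      using n2 by (simp del: of_nat_mult of_nat_add)
  qed (use pn in simp)
  finally show ?thesis by simp
qed

definition node_cost :: real where
  "node_cost = process_const + 2 * process_factor * anchor_degree"

text \<open>Every node to be processed is charged \<open>node_cost\<close> in advance, so the only
  randomness left is that of the notifications of this update.\<close>

definition update_cost :: "nat \<Rightarrow> update \<Rightarrow> state \<Rightarrow> ennreal" where
  "update_cost k x a = (\<integral>\<^sup>+(R, a'). ennreal (ops a') + of_nat (length (enum R)) * ennreal node_cost \<partial>measure_pmf (start_notify k x a))"

lemma fixed_run_work:
  assumes v: "valid (x # us)" "all_small (x # us)" "length (x # us) \<le> 2 * n"
  shows "(\<integral>\<^sup>+st. ennreal (work st) \<partial>measure_pmf (fixed_run (x # us))) \<le>
    (\<integral>\<^sup>+(Rs, a). update_cost (Suc (length us)) x a \<partial>measure_pmf (notify_run us)) + ennreal (process_const + 2 * process_factor)"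
proof -
  let ?c = "64 * anchor_rate" let ?Y = "of_nat n * ennreal (process_const + 2 * process_factor * real n)"
  let ?M = "measure_pmf (notify_run (x # us))"
  have wm: "work (merge a b) = ops a + work b" for a b by (simp add: work_def)
  have "(\<integral>\<^sup>+st. ennreal (work st) \<partial>measure_pmf (fixed_run (x # us))) =
    (\<integral>\<^sup>+p. (case p of (Rs, a) \<Rightarrow> \<integral>\<^sup>+b. ennreal (ops a + work b) \<partial>measure_pmf (process_run (events (x # us) Rs))) \<partial>?M)"
    unfolding fixed_run_eq[of "x # us"] nn_integral_bind_pmf
    by (intro nn_integral_cong) (auto simp: wm simp del: events.simps split: prod.splits)
  also have "\<dots> \<le> (\<integral>\<^sup>+p. (case p of (Rs, a) \<Rightarrow> ennreal (ops a) + of_nat (length (hd Rs)) * ennreal node_cost) +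
      ?Y * of_bool (\<not> (case p of (Rs, a) \<Rightarrow> settled ?c (events (x # us) Rs))) \<partial>?M)"
  proof (rule nn_integral_pmf_mono)
    fix p assume p: "p \<in> set_pmf (notify_run (x # us))"
    obtain Rs a where Ra: "p = (Rs, a)" by fastforce
    have "(\<integral>\<^sup>+b. ennreal (ops a + work b) \<partial>measure_pmf (process_run (events (x # us) Rs))) \<le>
      (\<integral>\<^sup>+b. ennreal (ops a) + ennreal (work b) \<partial>measure_pmf (process_run (events (x # us) Rs)))"
      by (intro nn_integral_mono ennreal_add_le)
    also have "\<dots> = ennreal (ops a) + (\<integral>\<^sup>+b. ennreal (work b) \<partial>measure_pmf (process_run (events (x # us) Rs)))"
      by (simp only: nn_integral_pmf_add nn_integral_pmf_const)
    also have "\<dots> \<le> ennreal (ops a) + (of_nat (length (hd Rs)) * ennreal node_cost +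
      ?Y * of_bool (\<not> settled ?c (events (x # us) Rs)))"
      unfolding node_cost_def using work_events_le[OF v p[unfolded Ra]] by (rule add_left_mono)
    finally show "(case p of (Rs, a) \<Rightarrow> \<integral>\<^sup>+b. ennreal (ops a + work b) \<partial>measure_pmf (process_run (events (x # us) Rs))) \<le>
      (case p of (Rs, a) \<Rightarrow> ennreal (ops a) + of_nat (length (hd Rs)) * ennreal node_cost) +
      ?Y * of_bool (\<not> (case p of (Rs, a) \<Rightarrow> settled ?c (events (x # us) Rs)))"
      unfolding Ra by (simp only: prod.case add.assoc)
  qed
  also have "\<dots> = (\<integral>\<^sup>+p. (case p of (Rs, a) \<Rightarrow> ennreal (ops a) + of_nat (length (hd Rs)) * ennreal node_cost) \<partial>?M) +
      ?Y * fail_prob (notify_run (x # us)) (\<lambda>(Rs, a). settled ?c (events (x # us) Rs))"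
    by (simp only: nn_integral_pmf_add nn_integral_pmf_cmult fail_prob_def)
  also have "\<dots> \<le> (\<integral>\<^sup>+(Rs, a). update_cost (Suc (length us)) x a \<partial>measure_pmf (notify_run us)) + ennreal (process_const + 2 * process_factor)"
  proof (rule add_mono)
    show "(\<integral>\<^sup>+p. (case p of (Rs, a) \<Rightarrow> ennreal (ops a) + of_nat (length (hd Rs)) * ennreal node_cost) \<partial>?M)
      \<le> (\<integral>\<^sup>+(Rs, a). update_cost (Suc (length us)) x a \<partial>measure_pmf (notify_run us))"
      unfolding notify_run.simps nn_integral_bind_pmf
      by (intro nn_integral_mono) (auto simp: update_cost_def split_def)
    have "?Y * fail_prob (notify_run (x # us)) (\<lambda>(Rs, a). settled ?c (events (x # us) Rs))
      \<le> ?Y * (of_nat (length (x # us)) * growth_error)"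
      by (intro mult_left_mono settled_run v) simp
    also have "\<dots> \<le> ennreal (process_const + 2 * process_factor)" by (rule growth_error_small[OF v(3)])
    finally show "?Y * fail_prob (notify_run (x # us)) (\<lambda>(Rs, a). settled ?c (events (x # us) Rs))
      \<le> ennreal (process_const + 2 * process_factor)" .
  qed
  finally show ?thesis .
qed

definition insert_bound :: real where
  "insert_bound = resample_cost + real s_size + 1 + real s_size * notify_factor + (1 + real s_size * (1 + real s_size)) * node_cost"

definition delete_bound :: real where
  "delete_bound = real (Suc top_level) * real s_size * (1 + notify_factor) + real (Suc top_level) * (1 + real s_size)
     + real (Suc top_level) * real s_size * (1 + real s_size) * node_cost"

lemma node_cost_nonneg: "0 \<le> node_cost"
  using process_const_nonneg process_factor_nonneg anchor_rate_ge_1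
  by (simp add: node_cost_def anchor_degree_def)

lemma notify_factor_nonneg: "0 \<le> notify_factor"
  using resample_cost_nonneg by (simp add: notify_factor_def)

lemma update_cost_le:
  assumes v: "valid (x # us)" and c: "consistent us a" and b: "0 \<le> r"
    and R: "\<And>R a'. (R, a') \<in> set_pmf (start_notify (Suc (length us)) x a) \<Longrightarrow> real (card R) \<le> r \<and> ops a' \<le> y"
  shows "update_cost (Suc (length us)) x a \<le> ennreal y + ennreal (r * node_cost)"
  unfolding update_cost_def
proof (rule nn_integral_pmf_le_const, clarify)
  fix R a' assume Ra: "(R, a') \<in> set_pmf (start_notify (Suc (length us)) x a)"
  have "finite R" using start_notify_sure(1)[OF v c Ra] finite_verts[OF v] finite_subset by blast
  then have "real (length (enum R)) \<le> r" using R[OF Ra] by simp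
  then have "of_nat (length (enum R)) * ennreal node_cost \<le> ennreal (r * node_cost)"
    unfolding ennreal_of_nat_eq_real_of_nat using node_cost_nonneg
    by (subst ennreal_mult[symmetric]) (auto intro!: ennreal_leI mult_right_mono)
  then show "ennreal (ops a') + of_nat (length (enum R)) * ennreal node_cost \<le> ennreal y + ennreal (r * node_cost)"
    using R[OF Ra] by (intro add_mono ennreal_leI) auto
qed

lemma insert_cost_le:
  assumes v: "valid (Ins S # us)" and c: "consistent us a"
  shows "update_cost (Suc (length us)) (Ins S) a \<le> ennreal insert_bound"
proof -
  let ?r = "1 + real s_size * (1 + real s_size)" let ?y = "resample_cost + real s_size + 1 + real s_size * notify_factor"
  have "update_cost (Suc (length us)) (Ins S) a \<le> ennreal ?y + ennreal (?r * node_cost)"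
    using insert_cost[OF v c] by (intro update_cost_le[OF v c]) auto
  also have "\<dots> = ennreal insert_bound"
    unfolding insert_bound_def using resample_cost_nonneg notify_factor_nonneg node_cost_nonneg
    by (intro ennreal_plus[symmetric]) auto
  finally show ?thesis .
qed

text \<open>The cost is at most linear in \<open>load a u\<close>, and by \<open>sum_load\<close>
  the mean of the load over the present nodes is at most
  \<open>Suc top_level * s_size\<close>.\<close>

lemma delete_cost_le:
  assumes v: "valid us" and c: "consistent us a" and ne: "verts (graph_of us) \<noteq> {}"
  shows "(\<integral>\<^sup>+u. update_cost (Suc (length us)) (Del u) a \<partial>measure_pmf (pmf_of_set (verts (graph_of us)))) \<le> ennreal delete_bound"
proof -
  let ?V = "verts (graph_of us)" let ?t = "real (Suc top_level)" let ?s = "real s_size"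
  define g where "g = 1 + notify_factor + (1 + ?s) * node_cost"
  have g0: "0 \<le> g" using notify_factor_nonneg node_cost_nonneg by (simp add: g_def)
  have fV: "finite ?V" using v by simp
  have cV: "0 < real (card ?V)" using fV ne by (simp add: card_gt_0_iff)
  have "(\<integral>\<^sup>+u. update_cost (Suc (length us)) (Del u) a \<partial>measure_pmf (pmf_of_set ?V)) \<le>
    (\<integral>\<^sup>+u. ennreal (real (load a u) * g + ?t * (1 + ?s)) \<partial>measure_pmf (pmf_of_set ?V))"
  proof (rule nn_integral_pmf_mono)
    fix u assume "u \<in> set_pmf (pmf_of_set ?V)"
    then have u: "valid (Del u # us)" using fV ne v by simp
    have "update_cost (Suc (length us)) (Del u) a \<le>
      ennreal (real (load a u) * (1 + notify_factor) + ?t * (1 + ?s)) + ennreal (real (load a u) * (1 + ?s) * node_cost)"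
      using delete_cost[OF u c] by (intro update_cost_le[OF u c]) auto
    also have "\<dots> = ennreal (real (load a u) * g + ?t * (1 + ?s))"
      using notify_factor_nonneg node_cost_nonneg
      by (subst ennreal_plus[symmetric]) (auto simp: g_def algebra_simps)
    finally show "update_cost (Suc (length us)) (Del u) a \<le> ennreal (real (load a u) * g + ?t * (1 + ?s))" .
  qed
  also have "\<dots> = (\<Sum>u\<in>?V. ennreal (real (load a u) * g + ?t * (1 + ?s))) / of_nat (card ?V)"
    using fV ne by (simp add: nn_integral_pmf_of_set ennreal_of_nat_eq_real_of_nat)
  also have "(\<Sum>u\<in>?V. ennreal (real (load a u) * g + ?t * (1 + ?s))) = ennreal (\<Sum>u\<in>?V. real (load a u) * g + ?t * (1 + ?s))"
    using g0 by (intro sum_ennreal) auto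
  also have "\<dots> / of_nat (card ?V) = ennreal ((\<Sum>u\<in>?V. real (load a u) * g + ?t * (1 + ?s)) / real (card ?V))"
    unfolding ennreal_of_nat_eq_real_of_nat using g0 cV by (intro divide_ennreal sum_nonneg) auto
  also have "\<dots> \<le> ennreal delete_bound"
  proof (rule ennreal_leI)
    have "real (\<Sum>u\<in>?V. load a u) \<le> real (card ?V * (Suc top_level * s_size))"
      using sum_load[OF v c] by (simp only: of_nat_le_iff)
    then have "(\<Sum>u\<in>?V. real (load a u)) \<le> real (card ?V) * (?t * ?s)" by (simp only: of_nat_sum of_nat_mult)
    then have "(\<Sum>u\<in>?V. real (load a u)) * g \<le> real (card ?V) * (?t * ?s) * g"
      using g0 by (rule mult_right_mono)
    moreover have "(\<Sum>u\<in>?V. real (load a u) * g + ?t * (1 + ?s)) = (\<Sum>u\<in>?V. real (load a u)) * g + real (card ?V) * (?t * (1 + ?s))"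
      by (simp only: sum.distrib sum_distrib_right sum_constant)
    moreover have "real (card ?V) * (?t * ?s * g + ?t * (1 + ?s)) = real (card ?V) * (?t * ?s) * g + real (card ?V) * (?t * (1 + ?s))"
      by (simp only: distrib_left mult.assoc)
    ultimately have "(\<Sum>u\<in>?V. real (load a u) * g + ?t * (1 + ?s)) \<le> real (card ?V) * (?t * ?s * g + ?t * (1 + ?s))"
      by linarith
    then have "(\<Sum>u\<in>?V. real (load a u) * g + ?t * (1 + ?s)) / real (card ?V) \<le> ?t * ?s * g + ?t * (1 + ?s)"
      using cV by (simp add: divide_le_eq mult.commute)
    also have "\<dots> = delete_bound" by (simp add: g_def delete_bound_def algebra_simps)
    finally show "(\<Sum>u\<in>?V. real (load a u) * g + ?t * (1 + ?s)) / real (card ?V) \<le> delete_bound" .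
  qed
  finally show ?thesis .
qed

definition amortized_bound :: real where
  "amortized_bound = insert_bound + delete_bound + process_const + 2 * process_factor"

lemma expected_amortized_work_le:
  assumes ns: "node_stream adv n T" and t: "Suc t \<le> T"
  shows "expected_amortized_work adv (Suc t) \<le> ennreal amortized_bound"
proof -
  let ?E = "ennreal (process_const + 2 * process_factor)"
  have ib: "0 \<le> insert_bound" "0 \<le> delete_bound"
    using resample_cost_nonneg notify_factor_nonneg node_cost_nonneg by (auto simp: insert_bound_def delete_bound_def)
  have pn: "0 \<le> process_const + 2 * process_factor" using process_const_nonneg process_factor_nonneg by simp
  have "expected_amortized_work adv (Suc t) = (\<integral>\<^sup>+us. \<integral>\<^sup>+st. ennreal (work st) \<partial>measure_pmf (fixed_run us) \<partial>measure_pmf (updates adv (Suc t)))"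
    unfolding expected_amortized_work_def run_eq by (simp add: work_def)
  also have "\<dots> = (\<integral>\<^sup>+us. \<integral>\<^sup>+x. (\<integral>\<^sup>+st. ennreal (work st) \<partial>measure_pmf (fixed_run (x # us)))
      \<partial>measure_pmf (choose_update adv (graphs_of us)) \<partial>measure_pmf (updates adv t))"
    by (simp del: fixed_run.simps)
  also have "\<dots> \<le> ennreal (insert_bound + delete_bound) + ?E"
  proof (rule nn_integral_pmf_le_const)
    fix us assume us: "us \<in> set_pmf (updates adv t)"
    have v: "valid us" using updates_props(1)[OF ns us] t by simp
    let ?X = "choose_update adv (graphs_of us)"
    have x: "valid (x # us) \<and> all_small (x # us) \<and> length (x # us) \<le> 2 * n" if "x \<in> set_pmf ?X" for x
    proof -
      have "x # us \<in> set_pmf (updates adv (Suc t))" using us that by auto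
      from updates_props[OF ns this t] show ?thesis by blast
    qed
    have "(\<integral>\<^sup>+x. (\<integral>\<^sup>+st. ennreal (work st) \<partial>measure_pmf (fixed_run (x # us))) \<partial>measure_pmf ?X) \<le>
      (\<integral>\<^sup>+x. (\<integral>\<^sup>+p. update_cost (Suc (length us)) x (snd p) \<partial>measure_pmf (notify_run us)) + ?E \<partial>measure_pmf ?X)"
    proof (rule nn_integral_pmf_mono)
      fix x assume "x \<in> set_pmf ?X"
      then show "(\<integral>\<^sup>+st. ennreal (work st) \<partial>measure_pmf (fixed_run (x # us))) \<le>
        (\<integral>\<^sup>+p. update_cost (Suc (length us)) x (snd p) \<partial>measure_pmf (notify_run us)) + ?E"
        using fixed_run_work[of x us] x by (simp add: split_def del: fixed_run.simps valid.simps)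
    qed
    \<comment> \<open>Given \<open>us\<close>, the next update and the earlier notifications are
      independent. After the exchange, a deleted node is uniform while the samples are
      fixed.\<close>
    also have "\<dots> = (\<integral>\<^sup>+p. (\<integral>\<^sup>+x. update_cost (Suc (length us)) x (snd p) \<partial>measure_pmf ?X) \<partial>measure_pmf (notify_run us)) + ?E"
      unfolding nn_integral_pmf_add nn_integral_pmf_const by (subst nn_integral_pmf_swap) (rule refl)
    also have "\<dots> \<le> ennreal (insert_bound + delete_bound) + ?E"
    proof (rule add_right_mono, rule nn_integral_pmf_le_const)
      fix p assume p: "p \<in> set_pmf (notify_run us)"
      have c: "consistent us (snd p)" using notify_run_sure[OF v, of "fst p" "snd p"] p by simp
      show "(\<integral>\<^sup>+x. update_cost (Suc (length us)) x (snd p) \<partial>measure_pmf ?X) \<le> ennreal (insert_bound + delete_bound)"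
      proof (cases "adv (graphs_of us)")
        case (Insert S)
        then have "valid (Ins S # us)" using x by (simp add: choose_update_def)
        from insert_cost_le[OF this c] have "(\<integral>\<^sup>+x. update_cost (Suc (length us)) x (snd p) \<partial>measure_pmf ?X) \<le> ennreal insert_bound"
          using Insert by (simp add: choose_update_def)
        also have "\<dots> \<le> ennreal (insert_bound + delete_bound)" using ib by (intro ennreal_leI) simp
        finally show ?thesis .
      next
        case Delete
        have "history adv (graphs_of us)" "length (graphs_of us) \<le> T"
          using updates_history[OF ns us] length_updates[OF us] t by auto
        then have "case adv (graphs_of us) of Insert S \<Rightarrow> S \<subseteq> verts (hd (graphs_of us)) | Delete \<Rightarrow> verts (hd (graphs_of us)) \<noteq> {}"
          using ns unfolding node_stream_def by blast
        then have ne: "verts (graph_of us) \<noteq> {}" using Delete by simp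
        have "(\<integral>\<^sup>+x. update_cost (Suc (length us)) x (snd p) \<partial>measure_pmf ?X) \<le> ennreal delete_bound"
          using delete_cost_le[OF v c ne] Delete by (simp add: choose_update_def)
        also have "\<dots> \<le> ennreal (insert_bound + delete_bound)" using ib by (intro ennreal_leI) simp
        finally show ?thesis .
      qed
    qed
    finally show "(\<integral>\<^sup>+x. (\<integral>\<^sup>+st. ennreal (work st) \<partial>measure_pmf (fixed_run (x # us))) \<partial>measure_pmf ?X)
      \<le> ennreal (insert_bound + delete_bound) + ?E" .
  qed
  also have "\<dots> = ennreal amortized_bound"
    unfolding amortized_bound_def add.assoc[of "insert_bound + delete_bound"] using ib pn
    by (intro ennreal_plus[symmetric]) auto
  finally show ?thesis .
qed

end

section \<open>Total and amortized work\<close>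

text \<open>Each addition pays for one later removal, and \<open>m\<close> is the size of
  \<open>sol_graph\<close> before the update. It is an inequality because adding an edge that is
  already present counts as an addition.\<close>

definition balanced :: "nat \<Rightarrow> state \<Rightarrow> bool" where
  "balanced m st \<longleftrightarrow> finite (sol_graph st) \<and> card (sol_graph st) + dels st \<le> m + adds st \<and> 0 \<le> ops st"

lemma balanced_tick: "balanced m st \<Longrightarrow> 0 \<le> c \<Longrightarrow> balanced m (tick c st)"
  by (simp add: balanced_def tick_def)

lemma balanced_add_edge: "balanced m st \<Longrightarrow> balanced m (add_edge u v st)"
  by (auto simp: balanced_def add_edge_def card_insert_if)

lemma balanced_remove_edges:
  assumes "balanced m st" shows "balanced m (remove_edges F st)"
proof -
  have f: "finite (sol_graph st)" using assms by (simp add: balanced_def)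
  have "card (sol_graph st) = card (sol_graph st - F) + card (F \<inter> sol_graph st)"
    using card_Diff_Int[OF f, of F] by (simp add: Int_commute)
  then show ?thesis using assms by (simp add: balanced_def remove_edges_def)
qed

lemma balanced_update [simp]:
  "balanced m (st\<lparr>anchors := A\<rparr>) = balanced m st"
  "balanced m (st\<lparr>entry_nbrs := E\<rparr>) = balanced m st"
  "balanced m (st\<lparr>cur_graph := G\<rparr>) = balanced m st"
  "balanced m (st\<lparr>I_sets := I\<rparr>) = balanced m st"
  "balanced m (st\<lparr>B_sets := B\<rparr>) = balanced m st"
  by (simp_all add: balanced_def)

section \<open>The balance is preserved by every operation\<close>

context dynamic_agreement_params
begin

lemma listing_cost_nonneg: "c \<in> set_pmf (listing_cost d) \<Longrightarrow> 0 \<le> c"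
  unfolding listing_cost_def
  by (erule fold_pmf_invariant) (use qcost_nonneg in auto)

lemma balanced_clean: "balanced m st \<Longrightarrow> st' \<in> set_pmf (clean u st) \<Longrightarrow> balanced m st'"
  unfolding clean_def using agreement_cost_nonneg heavy_cost_nonneg
  by (erule_tac fold_pmf_invariant[where P = "balanced m"])
    (auto simp: Let_def balanced_remove_edges balanced_tick split: if_splits)

lemma balanced_anchor:
  assumes "balanced m st" "(X, st') \<in> set_pmf (anchor u st)"
  shows "balanced m st'"
proof -
  let ?G = "cur_graph st"
  define st2 where "st2 = tick (qcost + heavy_cost + 1) (if u \<in> anchors st
       then remove_edges {{u, v} |v. v \<notin> anchors st} (tick (real (card (anchor_nbrs st u))) st) else st)"
  have 2: "balanced m st2"
    using assms(1) agreement_cost_nonneg heavy_cost_nonneg qcost_nonneg by (auto simp: st2_def intro!: balanced_tick balanced_remove_edges)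
  from assms(2) consider "st' = st2" | c where "c \<in> set_pmf (listing_cost (deg ?G u))"
    "st' \<in> set_pmf (fold_pmf (\<lambda>v st. map_pmf (\<lambda>a. (if a then add_edge u v else id)
                 (tick (agreement_cost + 1) st)) (agreement ?G u v)) (enum (N ?G u)) (tick c st2))"
    unfolding anchor_def Let_def st2_def by (auto split: if_splits)
  then show ?thesis
  proof cases
    case 1 then show ?thesis using 2 by simp
  next
    case (2 c)
    have "balanced m (tick c st2)" using \<open>balanced m st2\<close> listing_cost_nonneg[OF 2(1)] by (rule balanced_tick)
    with 2(2) show ?thesis
      by (rule fold_pmf_invariant) (use agreement_cost_nonneg heavy_cost_nonneg in \<open>auto intro!: balanced_add_edge balanced_tick split: if_splits\<close>)
  qed
qed

lemma balanced_connect: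
  assumes "balanced m st" "st' \<in> set_pmf (connect u st)"
  shows "balanced m st'"
proof -
  let ?G = "cur_graph st" let ?k = "samples (10^5)"
  let ?f = "\<lambda>r st. heavy ?G r \<bind> (\<lambda>hv. agreement ?G r u \<bind> (\<lambda>a. let st1 = tick (heavy_cost + agreement_cost + qcost + 1) st
         in return_pmf (if hv \<and> a \<and> r \<in> N ?G u then add_edge r u st1 else st1)))"
  obtain ws where ws: "st' \<in> set_pmf (fold_pmf (\<lambda>w st. fold_pmf ?f (enum (anchor_nbrs st w)) (tick 1 st)) ws (tick (real ?k * qcost + 1) st))"
    using assms(2) unfolding connect_def Let_def by auto
  have inner: "balanced m s'" if "balanced m s" "s' \<in> set_pmf (?f r s)" for r s s'
    using that agreement_cost_nonneg heavy_cost_nonneg qcost_nonneg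
    by (auto simp: Let_def intro!: balanced_add_edge balanced_tick split: if_splits)
  have "balanced m (tick (real ?k * qcost + 1) st)" using assms(1) qcost_nonneg by (intro balanced_tick) auto
  with ws show ?thesis
  proof (rule fold_pmf_invariant)
    fix w s s' assume "balanced m s" and s': "s' \<in> set_pmf (fold_pmf ?f (enum (anchor_nbrs s w)) (tick 1 s))"
    then have "balanced m (tick 1 s)" by (simp add: balanced_tick)
    with s' show "balanced m s'" by (rule fold_pmf_invariant) (rule inner)
  qed
qed

lemma balanced_process: "balanced m st \<Longrightarrow> st' \<in> set_pmf (process u st) \<Longrightarrow> balanced m st'"
proof -
  assume b: "balanced m st" and "st' \<in> set_pmf (process u st)"
  then obtain st1 X st2 st3 where "st1 \<in> set_pmf (clean u (tick 1 st))" "(X, st2) \<in> set_pmf (anchor u st1)"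
    "st3 \<in> set_pmf (connect u st2)"
    "st' = (if X then let E = nbrs (sol_graph st3) u in tick (real (card E) + 1)
            (st3\<lparr>anchors := insert u (anchors st3), entry_nbrs := (entry_nbrs st3)(u := E)\<rparr>)
        else tick 1 (st3\<lparr>anchors := anchors st3 - {u}\<rparr>))"
    unfolding process_def by (auto split: prod.splits)
  moreover from this have "balanced m st3"
    using balanced_tick[OF b, of 1] balanced_clean balanced_anchor balanced_connect by (meson zero_le_one)
  ultimately show ?thesis by (simp add: Let_def balanced_tick)
qed

lemma balanced_resample:
  assumes "balanced m st" "st' \<in> set_pmf (resample w st)"
  shows "balanced m st'"
proof -
  have *: "balanced m (tick c (st\<lparr>I_sets := I, B_sets := B\<rparr>))" if "0 \<le> c" for c I B
    using assms(1) that by (intro balanced_tick) simp_all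
  show ?thesis using assms(2) qcost_nonneg unfolding resample_def Let_def
    by (auto intro!: * add_nonneg_nonneg mult_nonneg_nonneg)
qed

lemma balanced_fold_resample: "balanced m st \<Longrightarrow> st' \<in> set_pmf (fold_pmf resample ws st) \<Longrightarrow> balanced m st'"
  by (erule_tac fold_pmf_invariant[where P = "balanced m"]) (auto intro: balanced_resample)

lemma balanced_notify:
  assumes "balanced m st" "(R, st') \<in> set_pmf (notify R0 st)"
  shows "balanced m st'"
proof -
  from assms(2) obtain c1 c2 R1 R2 st1 st2 where "st1 \<in> set_pmf (fold_pmf resample (enum R0) st)"
    "st2 \<in> set_pmf (fold_pmf resample (enum R1) (tick c1 st1))" "0 \<le> c1"
    "st' \<in> set_pmf (fold_pmf resample (enum R2) (tick c2 st2))" "0 \<le> c2"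
    unfolding notify_def Let_def by (auto simp: sum_nonneg)
  then show ?thesis using assms(1) balanced_fold_resample balanced_tick by meson
qed

lemma balanced_step:
  assumes "finite (sol_graph st)" "st' \<in> set_pmf (step adv h st)"
  shows "balanced (card (sol_graph st)) st'"
proof -
  let ?m = "card (sol_graph st)" let ?st0 = "st\<lparr>ops := 0, adds := 0, dels := 0\<rparr>"
  have 0: "balanced ?m ?st0" using assms(1) by (simp add: balanced_def)
  have arr: "balanced ?m st1" if "(R, st1) \<in> set_pmf (arrive k S ?st0)" for k S R st1
  proof -
    from that obtain st2 R' where "st2 \<in> set_pmf (resample k (?st0\<lparr>cur_graph := insert_node k S (cur_graph ?st0)\<rparr>))"
      "(R', st1) \<in> set_pmf (notify (targets st2 k) (tick (real (card (targets st2 k)) + 1) st2))"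
      unfolding arrive_def Let_def by (auto split: prod.splits)
    moreover have "balanced ?m (?st0\<lparr>cur_graph := insert_node k S (cur_graph ?st0)\<rparr>)" using 0 by (simp only: balanced_update)
    ultimately show ?thesis using balanced_resample balanced_notify balanced_tick
      by (meson add_nonneg_nonneg of_nat_0_le_iff zero_le_one)
  qed
  have dep: "balanced ?m st1" if d: "(R, st1) \<in> set_pmf (depart u ?st0)" for u R st1
  proof -
    have b: "balanced ?m (tick (\<Sum>i\<le>top_level. real (card (B_sets ?st0 u i)) + real (card (I_sets ?st0 u i)) + 1)
      (remove_edges {e. u \<in> e} (?st0\<lparr>
            cur_graph := delete_node u (cur_graph ?st0),
            I_sets := (I_sets ?st0)(u := (\<lambda>_. {})),
            B_sets := (\<lambda>v i. if v = u then {} else B_sets ?st0 v i - {u}),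
            anchors := anchors ?st0 - {u}\<rparr>)))"
      using 0 by (intro balanced_tick balanced_remove_edges sum_nonneg) (simp_all only: balanced_update)
    show ?thesis using balanced_notify[OF b] d unfolding depart_def Let_def by blast
  qed
  from assms(2) obtain R st1 where 1: "(\<exists>k S. (R, st1) \<in> set_pmf (arrive k S ?st0)) \<or> (\<exists>u. (R, st1) \<in> set_pmf (depart u ?st0))"
    and st': "st' \<in> set_pmf (fold_pmf process (enum R) st1)"
    unfolding step_def Let_def by (auto split: request.splits prod.splits) blast
  have "balanced ?m st1" using 1 arr dep by blast
  with st' show ?thesis by (rule fold_pmf_invariant) (rule balanced_process)
qed

lemma finite_sol_run: "(h, st) \<in> set_pmf (run adv t) \<Longrightarrow> finite (sol_graph st)"
proof (induction t arbitrary: h st)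
  case 0
  then show ?case by (simp add: init_state_def)
next
  case (Suc t)
  then obtain h0 st0 where "(h0, st0) \<in> set_pmf (run adv t)" and st: "st \<in> set_pmf (step adv h0 st0)" by auto
  from balanced_step[OF Suc.IH[OF this(1)] st] show ?case by (simp add: balanced_def)
qed

text \<open>Telescoping with the expected size \<open>S\<close> of \<open>sol_graph\<close> as
  potential: the work of an update plus the new size is at most its amortized work plus the old
  size, and the initial size is 0.\<close>

lemma sum_expected_work:
  "(\<Sum>i = 1..t. expected_work adv i) \<le> (\<Sum>i = 1..t. expected_amortized_work adv i)"
proof -
  define S where "S t = (\<integral>\<^sup>+(h, st). ennreal (real (card (sol_graph st))) \<partial>measure_pmf (run adv t))" for t
  have step: "expected_work adv (Suc t) + S (Suc t) \<le> expected_amortized_work adv (Suc t) + S t" for t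
  proof -
    let ?W = "\<lambda>st. ennreal (ops st + real (adds st) + real (dels st))"
    let ?A = "\<lambda>st. ennreal (ops st + 2 * real (adds st))"
    let ?S = "\<lambda>st. ennreal (real (card (sol_graph st)))"
    have run: "(\<integral>\<^sup>+(h, st). f st \<partial>measure_pmf (run adv (Suc t))) =
      (\<integral>\<^sup>+p. (\<integral>\<^sup>+st'. f st' \<partial>measure_pmf (step adv (fst p) (snd p))) \<partial>measure_pmf (run adv t))" for f :: "state \<Rightarrow> ennreal"
      by (simp add: split_def)
    have "expected_work adv (Suc t) + S (Suc t) = (\<integral>\<^sup>+p. (\<integral>\<^sup>+st'. ?W st' + ?S st' \<partial>measure_pmf (step adv (fst p) (snd p))) \<partial>measure_pmf (run adv t))"
      unfolding expected_work_def S_def run nn_integral_pmf_add ..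
    also have "\<dots> \<le> (\<integral>\<^sup>+p. (\<integral>\<^sup>+st'. ?A st' + ?S (snd p) \<partial>measure_pmf (step adv (fst p) (snd p))) \<partial>measure_pmf (run adv t))"
    proof (intro nn_integral_pmf_mono)
      fix p st' assume p: "p \<in> set_pmf (run adv t)" and st': "st' \<in> set_pmf (step adv (fst p) (snd p))"
      have fin: "finite (sol_graph (snd p))" using finite_sol_run[of "fst p" "snd p"] p by simp
      have b: "card (sol_graph st') + dels st' \<le> card (sol_graph (snd p)) + adds st'" "0 \<le> ops st'"
        using balanced_step[OF fin st'] by (auto simp: balanced_def)
      have "?W st' + ?S st' = ennreal (ops st' + real (adds st') + real (dels st') + real (card (sol_graph st')))"
        using b(2) by (intro ennreal_plus[symmetric]) auto
      also have "\<dots> \<le> ennreal (ops st' + 2 * real (adds st') + real (card (sol_graph (snd p))))"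
        using b(1) by (intro ennreal_leI) linarith
      also have "\<dots> = ?A st' + ?S (snd p)" using b(2) by (intro ennreal_plus) auto
      finally show "?W st' + ?S st' \<le> ?A st' + ?S (snd p)" .
    qed
    also have "\<dots> = expected_amortized_work adv (Suc t) + S t"
      unfolding expected_amortized_work_def S_def run nn_integral_pmf_add nn_integral_pmf_const by (simp add: split_def)
    finally show ?thesis .
  qed
  have "(\<Sum>i = 1..t. expected_work adv i) + S t \<le> (\<Sum>i = 1..t. expected_amortized_work adv i)"
  proof (induction t)
    case 0
    then show ?case by (simp add: S_def init_state_def)
  next
    case (Suc t)
    have "(\<Sum>i = 1..Suc t. expected_work adv i) + S (Suc t) = (\<Sum>i = 1..t. expected_work adv i) + (expected_work adv (Suc t) + S (Suc t))"
      by (simp add: add_ac)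
    also have "\<dots> \<le> (\<Sum>i = 1..t. expected_work adv i) + (expected_amortized_work adv (Suc t) + S t)"
      by (intro add_left_mono step)
    also have "\<dots> = ((\<Sum>i = 1..t. expected_work adv i) + S t) + expected_amortized_work adv (Suc t)" by (simp add: add_ac)
    also have "\<dots> \<le> (\<Sum>i = 1..t. expected_amortized_work adv i) + expected_amortized_work adv (Suc t)"
      by (intro add_right_mono Suc.IH)
    finally show ?case by simp
  qed
  moreover have "(\<Sum>i = 1..t. expected_work adv i) \<le> (\<Sum>i = 1..t. expected_work adv i) + S t"
    by (rule add_increasing2) simp_all
  ultimately show ?thesis by (rule order_trans[rotated])
qed

end

section \<open>Polylogarithmic bounds\<close>

text \<open>The constants are uniform in \<open>n\<close>, the query cost and the loop order, for
  fixed \<open>eps\<close> and \<open>A\<close>. Absolute values make the class closed under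
  products without tracking signs.\<close>

definition polylog :: "real \<Rightarrow> real \<Rightarrow> (nat \<Rightarrow> real \<Rightarrow> real) \<Rightarrow> bool" where
  "polylog eps A f \<longleftrightarrow> (\<exists>C k. 0 \<le> C \<and> (\<forall>n q enum. dynamic_agreement_params n eps q enum \<longrightarrow> q \<le> A * log 2 (real n) \<longrightarrow>
     \<bar>f n q\<bar> \<le> C * log 2 (real n) ^ k))"

lemma polylogI:
  assumes "0 \<le> C" "\<And>n q enum. dynamic_agreement_params n eps q enum \<Longrightarrow> q \<le> A * log 2 (real n) \<Longrightarrow> \<bar>f n q\<bar> \<le> C * log 2 (real n) ^ k"
  shows "polylog eps A f"
  unfolding polylog_def using assms by blast

text \<open>Definitions made inside the locale unfold only under its assumptions, so they are
  replaced pointwise for admissible parameters.\<close>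

lemma polylog_cong:
  assumes "\<And>n q enum. dynamic_agreement_params n eps q enum \<Longrightarrow> f n q = g n q" "polylog eps A g"
  shows "polylog eps A f"
proof -
  obtain C k where "0 \<le> C" "\<And>n q enum. dynamic_agreement_params n eps q enum \<Longrightarrow> q \<le> A * log 2 (real n) \<Longrightarrow> \<bar>g n q\<bar> \<le> C * log 2 (real n) ^ k"
    using assms(2) unfolding polylog_def by blast
  then show ?thesis using assms(1) by (intro polylogI[of C _ _ _ k]) auto
qed

lemma polylog_const: "polylog eps A (\<lambda>n q. c)"
  by (rule polylogI[of "\<bar>c\<bar>" _ _ _ 0]) auto

lemma polylog_log: "polylog eps A (\<lambda>n q. log 2 (real n))"
  by (rule polylogI[of 1 _ _ _ 1]) (auto dest: dynamic_agreement_params.log_n)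

lemma polylog_qcost: "polylog eps A (\<lambda>n q. q)"
proof (rule polylogI[of "\<bar>A\<bar>" _ _ _ 1])
  fix n q enum assume d: "dynamic_agreement_params n eps q enum" and q: "q \<le> A * log 2 (real n)"
  have "A * log 2 (real n) \<le> \<bar>A\<bar> * log 2 (real n)"
    using dynamic_agreement_params.log_n[OF d] by (intro mult_right_mono) auto
  then show "\<bar>q\<bar> \<le> \<bar>A\<bar> * log 2 (real n) ^ 1" using q dynamic_agreement_params.qcost_nonneg[OF d] by simp
qed simp

lemma polylog_add:
  assumes "polylog eps A f" "polylog eps A g"
  shows "polylog eps A (\<lambda>n q. f n q + g n q)"
proof -
  obtain C k where f: "0 \<le> C" "\<And>n q enum. dynamic_agreement_params n eps q enum \<Longrightarrow> q \<le> A * log 2 (real n) \<Longrightarrow> \<bar>f n q\<bar> \<le> C * log 2 (real n) ^ k"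
    using assms(1) unfolding polylog_def by blast
  obtain D l where g: "0 \<le> D" "\<And>n q enum. dynamic_agreement_params n eps q enum \<Longrightarrow> q \<le> A * log 2 (real n) \<Longrightarrow> \<bar>g n q\<bar> \<le> D * log 2 (real n) ^ l"
    using assms(2) unfolding polylog_def by blast
  show ?thesis
  proof (rule polylogI[of "C + D" _ _ _ "max k l"])
    fix n q enum assume d: "dynamic_agreement_params n eps q enum" and q: "q \<le> A * log 2 (real n)"
    have L: "1 \<le> log 2 (real n)" by (rule dynamic_agreement_params.log_n[OF d])
    have "C * log 2 (real n) ^ k \<le> C * log 2 (real n) ^ max k l" "D * log 2 (real n) ^ l \<le> D * log 2 (real n) ^ max k l"
      using f(1) g(1) L by (auto intro!: mult_left_mono power_increasing)
    then show "\<bar>f n q + g n q\<bar> \<le> (C + D) * log 2 (real n) ^ max k l"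
      using f(2)[OF d q] g(2)[OF d q] by (simp add: distrib_right)
  qed (use f g in simp)
qed

lemma polylog_mult:
  assumes "polylog eps A f" "polylog eps A g"
  shows "polylog eps A (\<lambda>n q. f n q * g n q)"
proof -
  obtain C k where f: "0 \<le> C" "\<And>n q enum. dynamic_agreement_params n eps q enum \<Longrightarrow> q \<le> A * log 2 (real n) \<Longrightarrow> \<bar>f n q\<bar> \<le> C * log 2 (real n) ^ k"
    using assms(1) unfolding polylog_def by blast
  obtain D l where g: "0 \<le> D" "\<And>n q enum. dynamic_agreement_params n eps q enum \<Longrightarrow> q \<le> A * log 2 (real n) \<Longrightarrow> \<bar>g n q\<bar> \<le> D * log 2 (real n) ^ l"
    using assms(2) unfolding polylog_def by blast
  show ?thesis
  proof (rule polylogI[of "C * D" _ _ _ "k + l"])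
    fix n q enum assume d: "dynamic_agreement_params n eps q enum" and q: "q \<le> A * log 2 (real n)"
    have L: "1 \<le> log 2 (real n)" by (rule dynamic_agreement_params.log_n[OF d])
    have "\<bar>f n q * g n q\<bar> \<le> (C * log 2 (real n) ^ k) * (D * log 2 (real n) ^ l)"
      unfolding abs_mult using f g L by (intro mult_mono f(2)[OF d q] g(2)[OF d q]) auto
    then show "\<bar>f n q * g n q\<bar> \<le> (C * D) * log 2 (real n) ^ (k + l)" by (simp add: power_add mult_ac)
  qed (use f g in simp)
qed

lemma polylog_divide: "polylog eps A f \<Longrightarrow> polylog eps A (\<lambda>n q. f n q / c)"
  unfolding divide_inverse by (intro polylog_mult polylog_const)

lemma polylog_power: "polylog eps A f \<Longrightarrow> polylog eps A (\<lambda>n q. f n q ^ m)"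
  by (induction m) (auto intro: polylog_mult polylog_const)

lemma polylog_samples: "polylog eps A (\<lambda>n q. real (dynamic_agreement.samples n eps c))"
proof (rule polylogI[of "\<bar>c / eps\<bar> + 1" _ _ _ 1])
  fix n q enum assume d: "dynamic_agreement_params n eps q enum"
  have L: "1 \<le> log 2 (real n)" by (rule dynamic_agreement_params.log_n[OF d])
  have "real (dynamic_agreement.samples n eps c) \<le> \<bar>c * log 2 (real n) / eps\<bar> + 1"
    unfolding dynamic_agreement.samples_def by linarith
  also have "\<dots> = \<bar>c / eps\<bar> * log 2 (real n) + 1" using L by (simp add: abs_mult abs_divide)
  also have "\<dots> \<le> (\<bar>c / eps\<bar> + 1) * log 2 (real n)" using L by (simp add: distrib_right)
  finally show "\<bar>real (dynamic_agreement.samples n eps c)\<bar> \<le> (\<bar>c / eps\<bar> + 1) * log 2 (real n) ^ 1" by simp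
qed simp

lemma polylog_top_level: "polylog eps A (\<lambda>n q. real (Suc (dynamic_agreement.top_level n)))"
proof (rule polylogI[of 2 _ _ _ 1])
  fix n q enum assume d: "dynamic_agreement_params n eps q enum"
  have L: "1 \<le> log 2 (real n)" by (rule dynamic_agreement_params.log_n[OF d])
  have "real (dynamic_agreement.top_level n) \<le> log 2 (real n)"
    unfolding dynamic_agreement.top_level_def using L by linarith
  then show "\<bar>real (Suc (dynamic_agreement.top_level n))\<bar> \<le> 2 * log 2 (real n) ^ 1" using L by simp
qed simp

lemmas polylog_intros = polylog_const polylog_log polylog_qcost polylog_add polylog_mult polylog_divide
  polylog_power polylog_samples polylog_top_level

lemma polylog_amortized_bound: "polylog eps A (\<lambda>n q. dynamic_agreement_params.amortized_bound n eps q)"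
proof -
  have ac: "polylog eps A (\<lambda>n q. dynamic_agreement.agreement_cost n eps q)"
    unfolding dynamic_agreement.agreement_cost_def by (intro polylog_intros)
  have hc: "polylog eps A (\<lambda>n q. dynamic_agreement.heavy_cost n eps q)"
    unfolding dynamic_agreement.heavy_cost_def by (intro polylog_intros ac)
  have ar: "polylog eps A (\<lambda>n q. dynamic_agreement_params.anchor_rate n eps)"
    by (rule polylog_cong[OF dynamic_agreement_params.anchor_rate_def]) (assumption, intro polylog_intros)
  have pc: "polylog eps A (\<lambda>n q. dynamic_agreement_params.process_const n eps q)"
    by (rule polylog_cong[OF dynamic_agreement_params.process_const_def]) (assumption, intro polylog_intros ac hc ar)
  have pf: "polylog eps A (\<lambda>n q. dynamic_agreement_params.process_factor n eps q)"
    by (rule polylog_cong[OF dynamic_agreement_params.process_factor_def]) (assumption, intro polylog_intros ac hc)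
  have ad: "polylog eps A (\<lambda>n q. dynamic_agreement_params.anchor_degree n eps)"
    by (rule polylog_cong[OF dynamic_agreement_params.anchor_degree_def]) (assumption, intro polylog_intros ar)
  have nc: "polylog eps A (\<lambda>n q. dynamic_agreement_params.node_cost n eps q)"
    by (rule polylog_cong[OF dynamic_agreement_params.node_cost_def]) (assumption, intro polylog_intros pc pf ad)
  have rc: "polylog eps A (\<lambda>n q. dynamic_agreement_params.resample_cost n eps q)"
    by (rule polylog_cong[OF dynamic_agreement_params.resample_cost_def]) (assumption, intro polylog_intros)
  have nf: "polylog eps A (\<lambda>n q. dynamic_agreement_params.notify_factor n eps q)"
    by (rule polylog_cong[OF dynamic_agreement_params.notify_factor_def]) (assumption, intro polylog_intros rc)
  have ib: "polylog eps A (\<lambda>n q. dynamic_agreement_params.insert_bound n eps q)"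
    by (rule polylog_cong[OF dynamic_agreement_params.insert_bound_def]) (assumption, intro polylog_intros rc nf nc)
  have db: "polylog eps A (\<lambda>n q. dynamic_agreement_params.delete_bound n eps q)"
    by (rule polylog_cong[OF dynamic_agreement_params.delete_bound_def]) (assumption, intro polylog_intros nf nc)
  show ?thesis
    by (rule polylog_cong[OF dynamic_agreement_params.amortized_bound_def]) (assumption, intro polylog_intros ib db pc pf)
qed

theorem mainTheorem2:
  shows "\<exists>eps0 > 0. \<forall>eps A :: real. 0 < eps \<and> eps < eps0 \<and> 0 < A \<longrightarrow>
    (\<exists>(C :: real) (k :: nat). \<forall>(n :: nat) (qcost :: real) enum adv T t.
      2 \<le> n \<longrightarrow> 0 \<le> qcost \<longrightarrow> qcost \<le> A * log 2 (real n) \<longrightarrow> enumerates enum \<longrightarrow>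
      node_stream adv n T \<longrightarrow> 1 \<le> t \<longrightarrow> t \<le> T \<longrightarrow>
        dynamic_agreement.expected_amortized_work n eps qcost enum adv t
          \<le> ennreal (C * log 2 (real n) ^ k) \<and>
        (\<Sum>i = 1..t. dynamic_agreement.expected_work n eps qcost enum adv i)
          \<le> ennreal (real t * (C * log 2 (real n) ^ k)))"
proof (rule exI[of _ "1/100"], intro conjI allI impI)
  \<comment> \<open>The bound 1/100 keeps the test thresholds \<open>0.4 * eps\<close> and
    \<open>1.2 * eps\<close> below 1/80, the constant in \<open>tail_numeric\<close>.\<close>
  fix eps A :: real assume eps: "0 < eps \<and> eps < 1/100 \<and> 0 < A"
  obtain C k where C: "0 \<le> C" and bound: "\<And>n q enum. dynamic_agreement_params n eps q enum \<Longrightarrow> q \<le> A * log 2 (real n) \<Longrightarrow>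
      \<bar>dynamic_agreement_params.amortized_bound n eps q\<bar> \<le> C * log 2 (real n) ^ k"
    using polylog_amortized_bound[of eps A] unfolding polylog_def by blast
  have "dynamic_agreement.expected_amortized_work n eps qcost enum adv t \<le> ennreal (C * log 2 (real n) ^ k) \<and>
        (\<Sum>i = 1..t. dynamic_agreement.expected_work n eps qcost enum adv i)
          \<le> ennreal (real t * (C * log 2 (real n) ^ k))"
    if n: "2 \<le> n" and q: "0 \<le> qcost" "qcost \<le> A * log 2 (real n)" and e: "enumerates enum"
      and ns: "node_stream adv n T" and t: "1 \<le> t" "t \<le> T" for n qcost enum adv T t
  proof -
    interpret dynamic_agreement_params n eps qcost enum
      using n q e eps by unfold_locales auto
    let ?B = "C * log 2 (real n) ^ k"
    have B0: "0 \<le> ?B" using C log_n by simp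
    have B: "amortized_bound \<le> ?B"
      using bound[OF dynamic_agreement_params_axioms q(2)] by simp
    have am: "expected_amortized_work adv i \<le> ennreal ?B" if "1 \<le> i" "i \<le> T" for i
      using expected_amortized_work_le[OF ns, of "i - 1"] that ennreal_leI[OF B] by (simp add: order_trans)
    have "(\<Sum>i = 1..t. expected_work adv i) \<le> (\<Sum>i = 1..t. expected_amortized_work adv i)"
      by (rule sum_expected_work)
    also have "\<dots> \<le> (\<Sum>i = 1..t. ennreal ?B)" using am t by (intro sum_mono) auto
    also have "\<dots> = ennreal (real t * ?B)"
      using B0 by (simp add: ennreal_mult ennreal_of_nat_eq_real_of_nat)
    finally show ?thesis using am[OF t] by blast
  qed
  then show "\<exists>(C :: real) (k :: nat). \<forall>(n :: nat) (qcost :: real) enum adv T t.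
      2 \<le> n \<longrightarrow> 0 \<le> qcost \<longrightarrow> qcost \<le> A * log 2 (real n) \<longrightarrow> enumerates enum \<longrightarrow>
      node_stream adv n T \<longrightarrow> 1 \<le> t \<longrightarrow> t \<le> T \<longrightarrow>
        dynamic_agreement.expected_amortized_work n eps qcost enum adv t
          \<le> ennreal (C * log 2 (real n) ^ k) \<and>
        (\<Sum>i = 1..t. dynamic_agreement.expected_work n eps qcost enum adv i)
          \<le> ennreal (real t * (C * log 2 (real n) ^ k))" by blast
qed simp

end
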